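(* Let an integer $m\ge0$ be fixed, let $h\to+\infty$ and $t=2\sqrt h\cos z$. Let $A_s,B_s,P_s,Q_s$ be the polynomials and $\eta_s$ the constants defined in the context ($A_s,P_s$ even, $B_s,Q_s$ odd). Then there are constants $C_m$ and $S_{m+1}$ (depending on $h$ and $m$) such that for every integer $n\ge1$, as $h\to\infty$ with $z=\frac\pi2+\mathcal O(h^{-1/2})$ (that is, uniformly for $z\in(0,\pi)$ with $|t|\le t_*$, for any fixed $t_*>0$), $$\mathrm{ce}_m(h,z)=C_m\left(D_m(t)\sum_{s=0}^n\frac{A_s(t)}{h^s}+D_m'(t)\sum_{s=0}^n\frac{B_s(t)}{h^s}+\mathcal O(h^{-n-1})\right),$$ $$\frac{\mathrm{se}_{m+1}(h,z)}{\sin z}=S_{m+1}\left(D_m(t)\sum_{s=0}^n\frac{P_s(t)}{h^s}+D_m'(t)\sum_{s=0}^n\frac{Q_s(t)}{h^s}+\mathcal O(h^{-n-1})\right),$$ where $C_m$ and $S_{m+1}$ both have the asymptotic expansion $$C_m,\ S_{m+1}\ \sim\ \left(\frac{\pi h}{2(m!)^2}\right)^{1/4}\left(1+\sum_{s=1}^\infty\frac{\eta_s}{h^s}\right)^{-1/2}.$$ The first terms are $$A_0=P_0=1,\quad B_0=Q_0=0,\quad A_1=\frac{t^2}{2^6},\quad P_1=\frac{9t^2}{2^6},\quad B_1=Q_1=\frac{t^3}{2^5}-(1+2m)\frac t{2^5},\quad\eta_1=\frac{6m+3}{32},$$ $$A_2=\frac{t^8}{2^{13}}-(1+2m)\frac{t^6}{2^{11}}+(9+10m+10m^2)\frac{t^4}{2^{12}}+(5+6m-12m^2-8m^3)\frac{t^2}{2^{12}},$$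 $$B_2=\frac{t^5}{2^8}-(1+2m)\frac{5t^3}{2^{11}}-(11+20m+20m^2)\frac t{2^{11}},$$ $$P_2=\frac{t^8}{2^{13}}-(1+2m)\frac{t^6}{2^{11}}+(113+10m+10m^2)\frac{t^4}{2^{12}}+(5+6m-12m^2-8m^3)\frac{t^2}{2^{12}},$$ $$Q_2=\frac{t^5}{2^7}-(1+2m)\frac{13t^3}{2^{11}}-(11+20m+20m^2)\frac t{2^{11}}.$$
   Context: **Mathieu functions.** Mathieu's equation is $w''(z)+(\lambda-2h^2\cos 2z)w(z)=0$ with real $\lambda$ and $h$. For $m=0,1,2,\dots$, $a_m=a_m(h)$ is the eigenvalue $\lambda$ for which there is a nontrivial solution $\mathrm{ce}_m(h,z)$ with $w'(0)=w'(\pi)=0$ having exactly $m$ zeros in $(0,\pi)$; $b_{m+1}=b_{m+1}(h)$ is the eigenvalue $\lambda$ for which there is a nontrivial solution $\mathrm{se}_{m+1}(h,z)$ with $w(0)=w(\pi)=0$ having exactly $m$ zeros in $(0,\pi)$. They are normalised by $\int_0^\pi\mathrm{ce}_m(h,z)^2dz=\int_0^\pi\mathrm{se}_{m+1}(h,z)^2dz=\frac\pi2$, with signs fixed by continuity in $h$ from $\mathrm{ce}_0(0,z)=1/\sqrt2$, $\mathrm{ce}_m(0,z)=\cos mz$ ($m\geq 1$), $\mathrm{se}_m(0,z)=\sin mz$. $D_m(t)=e^{-t^2/4}\mathrm{He}_m(t)$ is the parabolic cylinder function, a solution of $y''=(\tfrac14t^2-m-\tfrac12)y$. **Coefficients $A_s,B_s$.**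 Put $\tilde t=\tfrac14t^2-m-\tfrac12$. Set $A_0(t)=1$, $B_0(t)=0$. For $s\ge1$, the even polynomial $A_s(t)$ with $A_s(0)=0$, the odd polynomial $B_s(t)$ and the constant $\mu_s$ are determined recursively by the two identities in $t$ $$2A_s'+B_s''-\tfrac t4\big(2tA_{s-1}'+A_{s-1}+tB_{s-1}''+B_{s-1}'+\tilde t\,tB_{s-1}\big)+\sum_{j=1}^s\mu_jB_{s-j}=0,$$ $$A_s''+2\tilde tB_s'+\tfrac t2B_s+\sum_{j=1}^s\mu_jA_{s-j}-\tfrac t4\Big(tA_{s-1}''+A_{s-1}'+\tfrac{t^2}2B_{s-1}+\tilde t\,(tA_{s-1}+2tB_{s-1}'+B_{s-1})\Big)=0.$$ **Coefficients $P_s,Q_s$.** These are determined recursively by $A_s(t)=\sum_{j=0}^s\binom{1/2}{j}\left(-\tfrac{t^2}{4}\right)^jP_{s-j}(t)$ and $B_s(t)=\sum_{j=0}^s\binom{1/2}{j}\left(-\tfrac{t^2}{4}\right)^jQ_{s-j}(t)$. **Constants $\eta_s$.** For $s\ge1$, $$\eta_s=\frac1{m!\sqrt{2\pi}}\int_{-\infty}^\infty\sum_{j=0}^s\binom{-1/2}{j}\left(-\tfrac{t^2}4\right)^j\sum_{i=0}^{s-j}\Big(A_iA_{s-j-i}D_m^2+2A_iB_{s-j-i}D_mD_m'+B_iB_{s-j-i}(D_m')^2\Big)dt,$$ all functions being evaluated at $t$. *)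

theory Defs
  imports "HOL-Analysis.Analysis" "HOL-Computational_Algebra.Computational_Algebra"
begin

section \<open>Mathieu functions\<close>

definition mathieu_solution :: "real \<Rightarrow> real \<Rightarrow> (real \<Rightarrow> real) \<Rightarrow> bool" where
  "mathieu_solution h lam w \<longleftrightarrow>
     (\<forall>z. w differentiable at z) \<and> (\<forall>z. deriv w differentiable at z) \<and>
     (\<forall>z. deriv (deriv w) z + (lam - 2 * h\<^sup>2 * cos (2 * z)) * w z = 0)"

definition exactly_zeros :: "nat \<Rightarrow> (real \<Rightarrow> real) \<Rightarrow> bool" where
  "exactly_zeros m w \<longleftrightarrow>
     finite {z \<in> {0<..<pi}. w z = 0} \<and> card {z \<in> {0<..<pi}. w z = 0} = m"

text \<open>
  The eigenvalue \<open>lam\<close> in the next two definitions is \<open>a_m(h)\<close>, respectively \<open>b_{m+1}(h)\<close>.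
  Nontriviality is implied by the normalisation in the definitions that follow, but is part
  of the notion of eigenfunction.
\<close>

definition ce_eigenfunction :: "nat \<Rightarrow> real \<Rightarrow> real \<Rightarrow> (real \<Rightarrow> real) \<Rightarrow> bool" where
  "ce_eigenfunction m h lam w \<longleftrightarrow>
     mathieu_solution h lam w \<and> (\<exists>z. w z \<noteq> 0) \<and>
     deriv w 0 = 0 \<and> deriv w pi = 0 \<and> exactly_zeros m w"

definition se_eigenfunction :: "nat \<Rightarrow> real \<Rightarrow> real \<Rightarrow> (real \<Rightarrow> real) \<Rightarrow> bool" where
  "se_eigenfunction m h lam w \<longleftrightarrow>
     mathieu_solution h lam w \<and> (\<exists>z. w z \<noteq> 0) \<and>
     w 0 = 0 \<and> w pi = 0 \<and> exactly_zeros (m - 1) w"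

text \<open>
  \<open>is_ce m ce\<close>: the two-variable function \<open>(h, z) \<mapsto> ce h z\<close> is \<open>ce_m(h,z)\<close>.
  Eigenspaces are one-dimensional, so the normalisation leaves one sign free for each \<open>h\<close>;
  continuity in \<open>h\<close> and the value at \<open>h = 0\<close> determine it.
\<close>

definition is_ce :: "nat \<Rightarrow> (real \<Rightarrow> real \<Rightarrow> real) \<Rightarrow> bool" where
  "is_ce m ce \<longleftrightarrow>
     (\<forall>h. \<exists>lam. ce_eigenfunction m h lam (ce h)) \<and>
     (\<forall>h. integral {0..pi} (\<lambda>z. (ce h z)\<^sup>2) = pi / 2) \<and>
     (\<forall>z. continuous_on UNIV (\<lambda>h. ce h z)) \<and>
     (\<forall>z. ce 0 z = (if m = 0 then 1 / sqrt 2 else cos (real m * z)))"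

definition is_se :: "nat \<Rightarrow> (real \<Rightarrow> real \<Rightarrow> real) \<Rightarrow> bool" where
  "is_se m se \<longleftrightarrow> m \<ge> 1 \<and>
     (\<forall>h. \<exists>lam. se_eigenfunction m h lam (se h)) \<and>
     (\<forall>h. integral {0..pi} (\<lambda>z. (se h z)\<^sup>2) = pi / 2) \<and>
     (\<forall>z. continuous_on UNIV (\<lambda>h. se h z)) \<and>
     (\<forall>z. se 0 z = sin (real m * z))"

section \<open>Parabolic cylinder functions\<close>

text \<open>The probabilists' Hermite polynomials, by their three-term recurrence.\<close>

fun hermite_He :: "nat \<Rightarrow> real poly" where
  "hermite_He 0 = 1"
| "hermite_He (Suc 0) = [:0, 1:]"
| "hermite_He (Suc (Suc n)) = [:0, 1:] * hermite_He (Suc n) - of_nat (Suc n) * hermite_He n"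

definition parabolic_D :: "nat \<Rightarrow> real \<Rightarrow> real" where
  "parabolic_D m t = exp (- t\<^sup>2 / 4) * poly (hermite_He m) t"

section \<open>Coefficients of the expansions\<close>

definition even_poly :: "real poly \<Rightarrow> bool" where
  "even_poly p \<longleftrightarrow> (\<forall>t. poly p (- t) = poly p t)"

definition odd_poly :: "real poly \<Rightarrow> bool" where
  "odd_poly p \<longleftrightarrow> (\<forall>t. poly p (- t) = - poly p t)"

definition ttilde :: "nat \<Rightarrow> real poly" where
  "ttilde m = [:- (real m + 1 / 2), 0, 1 / 4:]"

text \<open>The value \<open>\<mu> 0\<close> is not used.\<close>

definition coefficient_system ::
    "nat \<Rightarrow> (nat \<Rightarrow> real poly) \<Rightarrow> (nat \<Rightarrow> real poly) \<Rightarrow> (nat \<Rightarrow> real) \<Rightarrow> bool" where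
  "coefficient_system m A B \<mu> \<longleftrightarrow>
     A 0 = 1 \<and> B 0 = 0 \<and>
     (\<forall>s\<ge>1. even_poly (A s) \<and> poly (A s) 0 = 0 \<and> odd_poly (B s) \<and>
       (let t = [:0, 1:]; tt = ttilde m; A1 = A (s - 1); B1 = B (s - 1) in
          2 * pderiv (A s) + pderiv (pderiv (B s))
            - smult (1/4) t * (2 * t * pderiv A1 + A1 + t * pderiv (pderiv B1) + pderiv B1 + tt * t * B1)
            + (\<Sum>j=1..s. smult (\<mu> j) (B (s - j))) = 0 \<and>
          pderiv (pderiv (A s)) + 2 * tt * pderiv (B s) + smult (1/2) t * B s
            + (\<Sum>j=1..s. smult (\<mu> j) (A (s - j)))
            - smult (1/4) t * (t * pderiv (pderiv A1) + pderiv A1 + smult (1/2) (t ^ 2) * B1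
                + tt * (t * A1 + 2 * t * pderiv B1 + B1)) = 0))"

definition coeff_A :: "nat \<Rightarrow> nat \<Rightarrow> real poly" where
  "coeff_A m = (THE A. \<exists>B \<mu>. coefficient_system m A B \<mu>)"

definition coeff_B :: "nat \<Rightarrow> nat \<Rightarrow> real poly" where
  "coeff_B m = (THE B. \<exists>A \<mu>. coefficient_system m A B \<mu>)"

text \<open>
  The recursion for \<open>P_s\<close> and \<open>Q_s\<close>, solved for the term \<open>j = 0\<close>; the lemma below
  recovers the defining relation.
\<close>

fun sqrt_deconv :: "(nat \<Rightarrow> real poly) \<Rightarrow> nat \<Rightarrow> real poly" where
  "sqrt_deconv A s = A s -
     (\<Sum>j=1..s. smult ((1/2) gchoose j) ([:0, 0, -1/4:] ^ j) * sqrt_deconv A (s - j))"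

declare sqrt_deconv.simps [simp del]

lemma sqrt_deconv_relation:
  "A s = (\<Sum>j=0..s. smult ((1/2) gchoose j) ([:0, 0, -1/4:] ^ j) * sqrt_deconv A (s - j))"
  by (subst sum.atLeast_Suc_atMost) (simp_all add: sqrt_deconv.simps [of A s])

definition coeff_P :: "nat \<Rightarrow> nat \<Rightarrow> real poly" where
  "coeff_P m = sqrt_deconv (coeff_A m)"

definition coeff_Q :: "nat \<Rightarrow> nat \<Rightarrow> real poly" where
  "coeff_Q m = sqrt_deconv (coeff_B m)"

definition coeff_eta :: "nat \<Rightarrow> nat \<Rightarrow> real" where
  "coeff_eta m s = 1 / (fact m * sqrt (2 * pi)) *
     (LINT t|lborel. (\<Sum>j=0..s. ((- 1/2) gchoose j) * (- t\<^sup>2 / 4) ^ j *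
        (\<Sum>i=0..s - j.
            poly (coeff_A m i) t * poly (coeff_A m (s - j - i)) t * (parabolic_D m t)\<^sup>2
          + 2 * poly (coeff_A m i) t * poly (coeff_B m (s - j - i)) t
              * parabolic_D m t * deriv (parabolic_D m) t
          + poly (coeff_B m i) t * poly (coeff_B m (s - j - i)) t * (deriv (parabolic_D m) t)\<^sup>2)))"

section \<open>Asymptotic notions\<close>

text \<open>
  \<open>uniform_expansion m f C U V n\<close>:
  \<open>f(h,z) = C(h) (D_m(t) \<Sum> U_s(t)/h^s + D_m'(t) \<Sum> V_s(t)/h^s + O(h^{-n-1}))\<close> with sums over
  \<open>s \<le> n\<close> and \<open>t = 2 h^{1/2} cos z\<close>, as \<open>h \<rightarrow> \<infinity>\<close>, uniformly for \<open>z \<in> (0, \<pi>)\<close> with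
  \<open>\<bar>t\<bar> \<le> T\<close>, for each fixed \<open>T > 0\<close>.
\<close>

definition uniform_expansion ::
    "nat \<Rightarrow> (real \<Rightarrow> real \<Rightarrow> real) \<Rightarrow> (real \<Rightarrow> real) \<Rightarrow>
     (nat \<Rightarrow> real poly) \<Rightarrow> (nat \<Rightarrow> real poly) \<Rightarrow> nat \<Rightarrow> bool" where
  "uniform_expansion m f C U V n \<longleftrightarrow>
     (\<forall>T>0. \<exists>K. \<forall>\<^sub>F h in at_top. \<forall>z\<in>{0<..<pi}.
        let t = 2 * sqrt h * cos z in \<bar>t\<bar> \<le> T \<longrightarrow>
          (\<exists>R. \<bar>R\<bar> \<le> K / h ^ (n + 1) \<and>
             f h z = C h * (parabolic_D m t * (\<Sum>s=0..n. poly (U s) t / h ^ s)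
                          + deriv (parabolic_D m) t * (\<Sum>s=0..n. poly (V s) t / h ^ s) + R)))"

text \<open>
  \<open>C(h) \<sim> (\<pi> h / (2 (m!)^2))^{1/4} (1 + \<Sum> \<eta>_s / h^s)^{-1/2}\<close>, the series being asymptotic,
  not convergent: it is cut off at an arbitrary order \<open>N\<close> with a remainder \<open>O(h^{-N-1})\<close>.
\<close>

definition constant_expansion :: "nat \<Rightarrow> (real \<Rightarrow> real) \<Rightarrow> bool" where
  "constant_expansion m C \<longleftrightarrow>
     (\<forall>N. \<exists>E \<in> O[at_top](\<lambda>h. 1 / h ^ (N + 1)). \<forall>\<^sub>F h in at_top.
        C h = (pi * h / (2 * (fact m)\<^sup>2)) powr (1/4)
              * (1 + (\<Sum>s=1..N. coeff_eta m s / h ^ s) + E h) powr (- 1/2))"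

end

theory Submission
  imports Defs "HOL-Probability.Distributions"
begin

text \<open>
  In the variable \<open>s = 2 h\<^sup>1\<^sup>/\<^sup>2 (\<pi>/2 - z)\<close> both kinds of eigenfunctions become solutions \<open>f\<close> of
  \<open>f'' = (t\<^sup>2/4 - \<Lambda>) f\<close>, with \<open>t = 2 h\<^sup>1\<^sup>/\<^sup>2 cos z\<close>, that have a parity, exactly \<open>m\<close> zeros and \<open>f f' = 0\<close> at
  the ends, so they can be treated simultaneously. The truncated formal expansion solves the same
  equation for an explicit \<open>\<Lambda>\<close> up to a residual \<open>O(h\<^sup>-\<^sup>n\<^sup>-\<^sup>1)\<close> with Gaussian decay. No spectral theory
  is needed: multiplying \<open>f\<close> by the polynomial in \<open>t\<close> that vanishes at its zeros shows that \<open>f\<close> has an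
  overlap bounded below with some \<open>D_j\<close>, \<open>j \<le> m\<close>; Green's identity then gives \<open>\<Lambda> = j + 1/2 + O(1/h)\<close>,
  and counting zeros forces \<open>j = m\<close>. A second use of Green's identity with the approximation of order
  \<open>n\<close>, followed by a Gronwall estimate, yields \<open>f\<close> up to a factor, which the \<open>L\<^sup>2\<close> norm determines up
  to sign. The constants \<open>C_m\<close> and \<open>S_{m+1}\<close> can be taken equal to one function with the prescribed
  asymptotic series (Borel-Ritt), and the sign is found by following the eigenfunction near \<open>z = 0\<close>
  continuously from \<open>h = 0\<close>. For \<open>se_{m+1}\<close> the division by \<open>sin z = (1 - t\<^sup>2/(4h))\<^sup>1\<^sup>/\<^sup>2\<close> turns
  \<open>A_s, B_s\<close> into \<open>P_s, Q_s\<close>.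
\<close>

section \<open>The polynomial coefficients\<close>

text \<open>The hypotheses provide, for each h, some eigenvalue and a zero count, but nothing about
  the size of the eigenvalue. Both bounds 0 < \<Lambda> < const(m) come from the remaining data: for
  \<Lambda> \<le> 0 the product f f' would be monotone yet vanish at both ends of half the interval,
  and for large \<Lambda> Sturm comparison yields more than m zeros. The bounds fix a turning point
  independent of h, beyond which f decays. This keeps constants uniform although the s-interval has
  length 2 pi sqrt h: Gronwall is used only on fixed intervals, and an energy identity with
  potential \<ge> 1 handles the tail. The index satisfies j \<le> m because the multiplying
  polynomial has degree m, and m \<le> j because the zeros of f are uniformly separated and
  transversal, hence survive in D_j. The recursion for A_s, B_s states that the coefficients of D_m
  and D_m' in the residual vanish, since D_m'' = (t^2/4 - m - 1/2) D_m. The normalisation A_s(0) = 0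
  fixes the free constant factor. The binomial coefficients of -1/2 in eta_s expand ds/dt = (1 -
  t^2/(4h))^(-1/2); as this is singular at the ends, only its truncation is used.\<close>

lemma coeff_pcompose_uminus: "coeff (pcompose p [:0, -1:]) i = (- 1) ^ i * coeff (p :: real poly) i"
proof (induction p arbitrary: i)
  case 0
  then show ?case by simp
next
  case (pCons a p)
  then show ?case by (cases i) (simp_all add: pcompose_pCons coeff_pCons)
qed

text \<open>Real polynomials that agree as functions have equal coefficients, so the pointwise
  definition of parity becomes a condition on coefficients, from which the behaviour under
  \<open>pderiv\<close> is immediate.\<close>

lemma even_poly_iff_coeff: "even_poly p \<longleftrightarrow> (\<forall>i. odd i \<longrightarrow> coeff p i = 0)"
proof -
  have "even_poly p \<longleftrightarrow> poly (pcompose p [:0, -1:]) = poly p"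
    by (auto simp: even_poly_def poly_pcompose fun_eq_iff)
  also have "\<dots> \<longleftrightarrow> (\<forall>i. (- 1) ^ i * coeff p i = coeff p i)"
    by (simp only: poly_eq_poly_eq_iff poly_eq_iff coeff_pcompose_uminus)
  also have "\<dots> \<longleftrightarrow> (\<forall>i. odd i \<longrightarrow> coeff p i = 0)"
    by (auto simp: minus_one_power_iff)
  finally show ?thesis .
qed

lemma odd_poly_iff_coeff: "odd_poly p \<longleftrightarrow> (\<forall>i. even i \<longrightarrow> coeff p i = 0)"
proof -
  have "odd_poly p \<longleftrightarrow> poly (pcompose p [:0, -1:]) = poly (- p)"
    by (auto simp: odd_poly_def poly_pcompose fun_eq_iff)
  also have "\<dots> \<longleftrightarrow> (\<forall>i. (- 1) ^ i * coeff p i = - coeff p i)"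
    by (simp only: poly_eq_poly_eq_iff poly_eq_iff coeff_pcompose_uminus coeff_minus)
  also have "\<dots> \<longleftrightarrow> (\<forall>i. even i \<longrightarrow> coeff p i = 0)"
    by (auto simp: minus_one_power_iff)
  finally show ?thesis .
qed

lemma even_poly_const: "even_poly [:c:]" "even_poly 1" "even_poly 0"
  by (auto simp: even_poly_def)

lemma odd_poly_0: "odd_poly 0"
  by (auto simp: odd_poly_def)

lemma parity_add:
  "even_poly p \<Longrightarrow> even_poly q \<Longrightarrow> even_poly (p + q)"
  "odd_poly p \<Longrightarrow> odd_poly q \<Longrightarrow> odd_poly (p + q)"
  "even_poly p \<Longrightarrow> even_poly q \<Longrightarrow> even_poly (p - q)"
  "odd_poly p \<Longrightarrow> odd_poly q \<Longrightarrow> odd_poly (p - q)"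
  "even_poly p \<Longrightarrow> even_poly (- p)"
  "odd_poly p \<Longrightarrow> odd_poly (- p)"
  by (simp_all add: even_poly_def odd_poly_def)

lemma parity_mult:
  "even_poly p \<Longrightarrow> even_poly q \<Longrightarrow> even_poly (p * q)"
  "odd_poly p \<Longrightarrow> odd_poly q \<Longrightarrow> even_poly (p * q)"
  "even_poly p \<Longrightarrow> odd_poly q \<Longrightarrow> odd_poly (p * q)"
  "odd_poly p \<Longrightarrow> even_poly q \<Longrightarrow> odd_poly (p * q)"
  "even_poly p \<Longrightarrow> even_poly (smult c p)"
  "odd_poly p \<Longrightarrow> odd_poly (smult c p)"
  "even_poly p \<Longrightarrow> even_poly (p ^ k)"
  by (simp_all add: even_poly_def odd_poly_def)

lemma parity_pderiv:
  "even_poly p \<Longrightarrow> odd_poly (pderiv p)"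
  "odd_poly p \<Longrightarrow> even_poly (pderiv p)"
  by (auto simp: even_poly_iff_coeff odd_poly_iff_coeff coeff_pderiv)

lemma parity_sum:
  "(\<And>i. i \<in> I \<Longrightarrow> even_poly (f i)) \<Longrightarrow> even_poly (sum f I)"
  "(\<And>i. i \<in> I \<Longrightarrow> odd_poly (f i)) \<Longrightarrow> odd_poly (sum f I)"
  by (auto simp: even_poly_iff_coeff odd_poly_iff_coeff coeff_sum)

lemma parity_base: "odd_poly [:0, c:]" "even_poly (ttilde m)" "even_poly [:0, 0, c:]"
    "even_poly (numeral k)"
  by (auto simp: even_poly_def odd_poly_def ttilde_def power2_eq_square)

lemmas parity_intros = even_poly_const odd_poly_0 parity_add parity_mult parity_pderiv parity_sum
  parity_base

section \<open>Solvability of one step of the recursion\<close>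

lemma poly_antiderivative:
  fixes p :: "real poly"
  assumes "odd_poly p"
  obtains a where "pderiv a = p" "poly a 0 = 0" "even_poly a"
proof
  define a where "a = (\<Sum>i\<le>degree p. monom (coeff p i / (real i + 1)) (Suc i))"
  have ca: "coeff a (Suc i) = coeff p i / (real i + 1)" for i
    by (auto simp: a_def coeff_sum if_distrib sum.delta coeff_eq_0 not_le cong: if_cong)
  have ca0: "coeff a 0 = 0"
    by (simp add: a_def coeff_sum)
  show "pderiv a = p"
    by (rule poly_eqI) (simp add: coeff_pderiv ca add_ac)
  show "poly a 0 = 0"
    using ca0 by (simp add: poly_0_coeff_0)
  show "even_poly a"
    unfolding even_poly_iff_coeff
  proof (intro allI impI)
    fix i :: nat
    assume "odd i"
    then obtain j where j: "i = Suc j" by (cases i) auto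
    with \<open>odd i\<close> show "coeff a i = 0"
      using assms by (simp add: ca odd_poly_iff_coeff)
  qed
qed

text \<open>The operator acting on B_s once A_s is eliminated: the first identity expresses A_s'
  through -B_s''/2 and earlier terms, so A_s'' contributes -B_s'''/2 to the second.\<close>

definition coeff_op :: "nat \<Rightarrow> real poly \<Rightarrow> real poly" where
  "coeff_op m b = 2 * ttilde m * pderiv b + smult (1/2) [:0, 1:] * b
     - smult (1/2) (pderiv (pderiv (pderiv b)))"

lemma coeff_op_add: "coeff_op m (b + c) = coeff_op m b + coeff_op m c"
  by (simp add: coeff_op_def pderiv_add algebra_simps smult_add_right)

lemma coeff_ttilde_mult:
  "coeff (ttilde m * q) (Suc (Suc i)) = - (real m + 1/2) * coeff q (Suc (Suc i)) + 1/4 * coeff q i"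
  by (simp add: ttilde_def)

lemma coeff_coeff_op:
  "coeff (coeff_op m b) (Suc (Suc i)) =
     2 * (- (real m + 1/2) * coeff (pderiv b) (Suc (Suc i)) + 1/4 * coeff (pderiv b) i)
     + 1/2 * coeff b (Suc i) - 1/2 * coeff (pderiv (pderiv (pderiv b))) (Suc (Suc i))"
proof -
  have "coeff (2 * ttilde m * pderiv b) (Suc (Suc i)) = 2 * coeff (ttilde m * pderiv b) (Suc (Suc i))"
    by (simp add: mult.assoc numeral_poly)
  then show ?thesis
    by (simp only: coeff_op_def coeff_add coeff_diff coeff_ttilde_mult) simp
qed

text \<open>On t^(i+1) the terms that raise the degree are 2 (t^2/4) (i+1) t^i and (t/2) t^(i+1).
  Their sum has the factor (i+2)/2, which never vanishes; existence and uniqueness both rest on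
  this.\<close>

lemma coeff_op_lead:
  assumes "degree b \<le> Suc i"
  shows "coeff (coeff_op m b) (Suc (Suc i)) = (real i + 2) / 2 * coeff b (Suc i)"
  using assms by (simp add: coeff_coeff_op coeff_pderiv coeff_eq_0 field_simps)

lemma coeff_op_high:
  assumes "degree b \<le> d" "i > Suc d"
  shows "coeff (coeff_op m b) i = 0"
proof -
  obtain j where j: "i = Suc (Suc j)" "j \<ge> d"
    using assms(2) by (cases i; cases "i - 1") (auto simp: less_Suc_eq_le)
  show ?thesis
    using assms j by (simp add: coeff_coeff_op coeff_pderiv coeff_eq_0)
qed

lemma coeff_op_even: "odd_poly b \<Longrightarrow> even_poly (coeff_op m b)"
  unfolding coeff_op_def by (intro parity_intros)

text \<open>The operator raises the degree by exactly one, so odd monomials reach every even degree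
  from 2 on and the top coefficient of G can be removed repeatedly. The constant that remains is
  absorbed by \<open>\<nu>\<close>, which becomes \<mu>_s.\<close>

lemma coeff_op_surj:
  assumes "even_poly G" "degree G \<le> 2 * n"
  obtains b \<nu> where "odd_poly b" "coeff_op m b + [:\<nu>:] = G"
proof -
  have "\<exists>b \<nu>. odd_poly b \<and> coeff_op m b + [:\<nu>:] = G"
    using assms
  proof (induction n arbitrary: G)
    case 0
    then obtain c where "G = [:c:]"
      by (auto elim: degree_eq_zeroE)
    then show ?case
      by (intro exI [of _ 0] exI [of _ c]) (simp add: odd_poly_0 coeff_op_def)
  next
    case (Suc n)
    \<comment> \<open>\<open>coeff_op_lead\<close> with i = 2n has the factor (2n+2)/2 = n+1, which
      is divided out here.\<close>
    define c where "c = coeff G (2 * Suc n) / real (Suc n)"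
    define b0 where "b0 = monom c (2 * n + 1)"
    have ob0: "odd_poly b0"
      by (auto simp: odd_poly_iff_coeff b0_def)
    have db0: "degree b0 \<le> Suc (2 * n)"
      by (simp add: b0_def degree_monom_le)
    let ?G = "G - coeff_op m b0"
    have ev: "even_poly ?G"
      by (intro parity_intros Suc.prems coeff_op_even ob0)
    have "coeff ?G i = 0" if "i > 2 * n" for i
    proof -
      consider "odd i" | "i = Suc (Suc (2 * n))" | "i > Suc (Suc (2 * n))"
        using \<open>i > 2 * n\<close> by (metis Suc_lessI dvd_triv_left even_Suc)
      then show ?thesis
      proof cases
        case 1
        then show ?thesis using ev by (simp add: even_poly_iff_coeff)
      next
        case 2
        have "coeff (coeff_op m b0) i = coeff G i"
          unfolding 2 coeff_op_lead [OF db0] by (simp add: b0_def c_def field_simps)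
        then show ?thesis by simp
      next
        case 3
        then show ?thesis
          using Suc.prems(2) coeff_op_high [OF db0, of i] by (simp add: coeff_eq_0)
      qed
    qed
    then have "degree ?G \<le> 2 * n"
      by (intro degree_le) auto
    from Suc.IH [OF ev this] obtain b \<nu> where "odd_poly b" "coeff_op m b + [:\<nu>:] = ?G"
      by blast
    then show ?case
      by (intro exI [of _ "b0 + b"] exI [of _ \<nu>])
        (simp add: coeff_op_add parity_intros ob0 algebra_simps)
  qed
  with that show ?thesis by blast
qed

text \<open>A nonzero b leaves a nonzero top coefficient: (i+2)/2 times the leading coefficient for
  degree i+1, and c/2 at t for a constant c.\<close>

lemma coeff_op_kernel:
  assumes "coeff_op m b + [:\<nu>:] = 0"
  shows "b = 0 \<and> \<nu> = 0"
proof -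
  have "b = 0"
  proof (rule ccontr)
    assume "b \<noteq> 0"
    show False
    proof (cases "degree b")
      case 0
      then obtain c where c: "b = [:c:]" by (auto elim: degree_eq_zeroE)
      have "coeff (coeff_op m b + [:\<nu>:]) 1 = c / 2"
        by (simp add: c coeff_op_def)
      with assms c \<open>b \<noteq> 0\<close> show False by simp
    next
      case (Suc i)
      have "coeff (coeff_op m b + [:\<nu>:]) (Suc (Suc i)) = (real i + 2) / 2 * coeff b (Suc i)"
        using coeff_op_lead [of b i m] Suc by simp
      with assms have "(real i + 2) / 2 * coeff b (degree b) = 0"
        by (simp add: Suc)
      with \<open>b \<noteq> 0\<close> show False by simp
    qed
  qed
  with assms show ?thesis by (simp add: coeff_op_def)
qed

text \<open>The terms at stage s that involve earlier stages only. The sum stops before j = s: that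
  term is \<mu>_s B_0 = 0 here, and \<mu>_s A_0 = \<mu>_s in \<open>source2\<close>, where it
  becomes the unknown constant \<open>\<nu>\<close> of \<open>coefficient_step\<close>.\<close>

definition source1 :: "nat \<Rightarrow> (nat \<Rightarrow> real poly) \<Rightarrow> (nat \<Rightarrow> real poly) \<Rightarrow> (nat \<Rightarrow> real) \<Rightarrow> nat \<Rightarrow> real poly"
  where "source1 m A B \<mu> s = (\<Sum>j=1..<s. smult (\<mu> j) (B (s - j)))
     - smult (1/4) [:0, 1:] * (2 * [:0, 1:] * pderiv (A (s - 1)) + A (s - 1)
         + [:0, 1:] * pderiv (pderiv (B (s - 1))) + pderiv (B (s - 1))
         + ttilde m * [:0, 1:] * B (s - 1))"

definition source2 :: "nat \<Rightarrow> (nat \<Rightarrow> real poly) \<Rightarrow> (nat \<Rightarrow> real poly) \<Rightarrow> (nat \<Rightarrow> real) \<Rightarrow> nat \<Rightarrow> real poly"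
  where "source2 m A B \<mu> s = (\<Sum>j=1..<s. smult (\<mu> j) (A (s - j)))
     - smult (1/4) [:0, 1:] * ([:0, 1:] * pderiv (pderiv (A (s - 1))) + pderiv (A (s - 1))
         + smult (1/2) ([:0, 1:] ^ 2) * B (s - 1)
         + ttilde m * ([:0, 1:] * A (s - 1) + 2 * [:0, 1:] * pderiv (B (s - 1)) + B (s - 1)))"

definition coefficient_step where
  "coefficient_step m A B \<mu> s a b \<nu> \<longleftrightarrow> even_poly a \<and> poly a 0 = 0 \<and> odd_poly b \<and>
     2 * pderiv a + pderiv (pderiv b) + source1 m A B \<mu> s = 0 \<and>
     pderiv (pderiv a) + 2 * ttilde m * pderiv b + smult (1/2) [:0, 1:] * b + [:\<nu>:]
       + source2 m A B \<mu> s = 0"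

lemma coefficient_system_iff:
  "coefficient_system m A B \<mu> \<longleftrightarrow> A 0 = 1 \<and> B 0 = 0 \<and>
     (\<forall>s\<ge>1. coefficient_step m A B \<mu> s (A s) (B s) (\<mu> s))"
proof -
  have *: "(\<Sum>j=1..s. smult (\<mu> j) (X (s - j))) = (\<Sum>j=1..<s. smult (\<mu> j) (X (s - j))) + smult (\<mu> s) (X 0)"
    if "s \<ge> 1" for s and X :: "nat \<Rightarrow> real poly"
    using that by (simp add: sum.last_plus atLeastLessThanSuc_atLeastAtMost [symmetric] add.commute)
  show ?thesis
    unfolding coefficient_system_def coefficient_step_def Let_def
    by (intro conj_cong refl all_cong)
      (simp_all only: * source1_def source2_def, simp_all add: algebra_simps)
qed

lemma source_cong:
  assumes "\<And>y. y < s \<Longrightarrow> A y = A' y" "\<And>y. y < s \<Longrightarrow> B y = B' y"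
    "\<And>y. 1 \<le> y \<Longrightarrow> y < s \<Longrightarrow> \<mu> y = \<mu>' y" "s \<ge> 1"
  shows "source1 m A B \<mu> s = source1 m A' B' \<mu>' s" "source2 m A B \<mu> s = source2 m A' B' \<mu>' s"
proof -
  have "(\<Sum>j=1..<s. smult (\<mu> j) (B (s - j))) = (\<Sum>j=1..<s. smult (\<mu>' j) (B' (s - j)))"
    "(\<Sum>j=1..<s. smult (\<mu> j) (A (s - j))) = (\<Sum>j=1..<s. smult (\<mu>' j) (A' (s - j)))"
    using assms by (auto intro!: sum.cong)
  moreover have "A (s - 1) = A' (s - 1)" "B (s - 1) = B' (s - 1)"
    using assms by auto
  ultimately show "source1 m A B \<mu> s = source1 m A' B' \<mu>' s" "source2 m A B \<mu> s = source2 m A' B' \<mu>' s"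
    by (simp_all only: source1_def source2_def)
qed

lemma source_parity:
  assumes "s \<ge> 1" "\<And>y. y < s \<Longrightarrow> even_poly (A y)" "\<And>y. y < s \<Longrightarrow> odd_poly (B y)"
  shows "odd_poly (source1 m A B \<mu> s)" "even_poly (source2 m A B \<mu> s)"
proof -
  have ev: "even_poly (A (s - 1))" and od: "odd_poly (B (s - 1))"
    using assms by auto
  have ev': "even_poly (A (s - j))" and od': "odd_poly (B (s - j))" if "j \<in> {1..<s}" for j
    using that assms by auto
  have sums: "odd_poly (\<Sum>j=1..<s. smult (\<mu> j) (B (s - j)))" "even_poly (\<Sum>j=1..<s. smult (\<mu> j) (A (s - j)))"
    by (intro parity_sum parity_mult ev' od'; assumption)+
  note rules = ev od ev [THEN parity_pderiv(1)] od [THEN parity_pderiv(2)]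
    ev [THEN parity_pderiv(1), THEN parity_pderiv(2)] od [THEN parity_pderiv(2), THEN parity_pderiv(1)]
  show "odd_poly (source1 m A B \<mu> s)"
    unfolding source1_def
    by (rule parity_add(4) [OF sums(1)]) (use rules in \<open>auto simp: even_poly_def odd_poly_def ttilde_def algebra_simps\<close>)
  show "even_poly (source2 m A B \<mu> s)"
    unfolding source2_def
    by (rule parity_add(3) [OF sums(2)]) (use rules in \<open>auto simp: even_poly_def odd_poly_def ttilde_def algebra_simps\<close>)
qed

text \<open>Differentiating the first identity and substituting A_s'' into the second leaves an
  equation for B_s and \<mu>_s alone, solved by \<open>coeff_op_surj\<close>; the first identity
  then gives A_s by integration. The parity of the earlier stages makes the right-hand side even for
  the former and odd for the latter.\<close>

lemma coefficient_step_exists: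
  assumes "s \<ge> 1" "\<And>y. y < s \<Longrightarrow> even_poly (A y)" "\<And>y. y < s \<Longrightarrow> odd_poly (B y)"
  shows "\<exists>a b \<nu>. coefficient_step m A B \<mu> s a b \<nu>"
proof -
  let ?F = "source1 m A B \<mu> s" and ?G = "source2 m A B \<mu> s"
  note par = source_parity [of s A B m \<mu>, OF assms]
  let ?H = "smult (1/2) (pderiv ?F) - ?G"
  have "even_poly ?H"
    using par by (intro parity_intros)
  then obtain b \<nu> where b: "odd_poly b" "coeff_op m b + [:\<nu>:] = ?H"
    using coeff_op_surj [of ?H "degree ?H" m] by (auto simp: mult_2)
  let ?K = "smult (- 1/2) (?F + pderiv (pderiv b))"
  have "odd_poly ?K"
    using par b by (intro parity_intros)
  then obtain a where a: "pderiv a = ?K" "poly a 0 = 0" "even_poly a"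
    by (rule poly_antiderivative)
  have two: "2 * p = smult 2 p" for p :: "real poly"
    by (simp add: numeral_poly)
  have "2 * pderiv a + pderiv (pderiv b) + ?F = 0"
    by (simp add: a two smult_add_right)
  moreover have "pderiv (pderiv a) + 2 * ttilde m * pderiv b + smult (1/2) [:0, 1:] * b + [:\<nu>:] + ?G = 0"
    using b(2) by (simp add: a coeff_op_def pderiv_smult pderiv_add pderiv_diff pderiv_minus smult_add_right algebra_simps)
  ultimately show ?thesis
    unfolding coefficient_step_def using a(2,3) b(1) by blast
qed

text \<open>The difference of two solutions satisfies the homogeneous identities. Eliminating d puts
  e into the kernel of \<open>coeff_op\<close>; the condition A_s(0) = 0 removes the constant of
  integration left in d.\<close>

lemma coefficient_step_unique:
  assumes "coefficient_step m A B \<mu> s a b \<nu>" "coefficient_step m A B \<mu> s a' b' \<nu>'"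
  shows "a = a' \<and> b = b' \<and> \<nu> = \<nu>'"
proof -
  define d e where "d = a - a'" and "e = b - b'"
  have two: "2 * p = smult 2 p" for p :: "real poly"
    by (simp add: numeral_poly)
  have 1: "2 * pderiv d + pderiv (pderiv e) = 0"
    using assms by (simp add: coefficient_step_def d_def e_def pderiv_diff algebra_simps)
  have 2: "pderiv (pderiv d) + 2 * ttilde m * pderiv e + smult (1/2) [:0, 1:] * e + [:\<nu> - \<nu>':] = 0"
  proof -
    have "[:\<nu> - \<nu>':] = [:\<nu>:] - [:\<nu>':]" by simp
    then have "pderiv (pderiv d) + 2 * ttilde m * pderiv e + smult (1/2) [:0, 1:] * e + [:\<nu> - \<nu>':] =
      (pderiv (pderiv a) + 2 * ttilde m * pderiv b + smult (1/2) [:0, 1:] * b + [:\<nu>:] + source2 m A B \<mu> s)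
      - (pderiv (pderiv a') + 2 * ttilde m * pderiv b' + smult (1/2) [:0, 1:] * b' + [:\<nu>':] + source2 m A B \<mu> s)"
      by (simp add: d_def e_def pderiv_diff algebra_simps smult_diff_right)
    also have "\<dots> = 0"
      using assms unfolding coefficient_step_def by simp
    finally show ?thesis .
  qed
  have d': "pderiv d = smult (- 1/2) (pderiv (pderiv e))"
  proof -
    have "smult 2 (pderiv d) = - pderiv (pderiv e)"
      using 1 by (simp add: two add_eq_0_iff2)
    then have "smult (1/2) (smult 2 (pderiv d)) = smult (1/2) (- pderiv (pderiv e))" by simp
    then show ?thesis by simp
  qed
  have "coeff_op m e + [:\<nu> - \<nu>':] = 0"
    using 2 by (simp add: d' coeff_op_def pderiv_smult pderiv_minus algebra_simps)
  from coeff_op_kernel [OF this] have e: "e = 0" "\<nu> = \<nu>'" by auto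
  then have "pderiv d = 0" using d' by simp
  then obtain c where "d = [:c:]"
    by (metis degree_eq_zeroE pderiv_eq_0_iff)
  moreover have "poly d 0 = 0"
    using assms by (simp add: d_def coefficient_step_def)
  ultimately have "d = 0" by simp
  with e show ?thesis by (simp add: d_def e_def)
qed

section \<open>Existence and uniqueness of the whole coefficient system\<close>

lemma coefficient_system_unique:
  assumes "coefficient_system m A B \<mu>" "coefficient_system m A' B' \<mu>'"
  shows "A s = A' s \<and> B s = B' s \<and> (s \<ge> 1 \<longrightarrow> \<mu> s = \<mu>' s)"
proof (induction s rule: less_induct)
  case (less s)
  show ?case
  proof (cases "s = 0")
    case True
    then show ?thesis using assms by (simp add: coefficient_system_iff)
  next
    case False
    then have "source1 m A B \<mu> s = source1 m A' B' \<mu>' s" "source2 m A B \<mu> s = source2 m A' B' \<mu>' s"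
      using less by (auto intro!: source_cong)
    then have "coefficient_step m A B \<mu> s (A' s) (B' s) (\<mu>' s)"
      using assms(2) False by (simp add: coefficient_system_iff coefficient_step_def)
    moreover have "coefficient_step m A B \<mu> s (A s) (B s) (\<mu> s)"
      using assms(1) False by (simp add: coefficient_system_iff)
    ultimately show ?thesis
      using coefficient_step_unique by blast
  qed
qed

text \<open>Course-of-values recursion by dependent choice on triples (A_s, B_s, \<mu>_s). The step
  lemma asks for the parity of all earlier polynomials, which is read off from the steps that
  produced them.\<close>

lemma coefficient_system_exists: "\<exists>A B \<mu>. coefficient_system m A B \<mu>"
proof -
  define P :: "(nat \<Rightarrow> real poly \<times> real poly \<times> real) \<Rightarrow> nat \<Rightarrow> real poly \<times> real poly \<times> real \<Rightarrow> bool"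
    where "P f s r \<longleftrightarrow> (if s = 0 then fst r = 1 \<and> fst (snd r) = 0 else
      coefficient_step m (\<lambda>i. fst (f i)) (\<lambda>i. fst (snd (f i))) (\<lambda>i. snd (snd (f i))) s
        (fst r) (fst (snd r)) (snd (snd r)))" for f s r
  have "\<exists>f. \<forall>s. P f s (f s)"
  proof (rule dependent_wellorder_choice)
    fix r :: "real poly \<times> real poly \<times> real" and f g :: "nat \<Rightarrow> real poly \<times> real poly \<times> real" and x
    assume *: "\<And>y. y < x \<Longrightarrow> f y = g y"
    then show "P f x r = P g x r"
      using source_cong [of x "\<lambda>i. fst (f i)" "\<lambda>i. fst (g i)" "\<lambda>i. fst (snd (f i))"
        "\<lambda>i. fst (snd (g i))" "\<lambda>i. snd (snd (f i))" "\<lambda>i. snd (snd (g i))" m]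
      by (cases x) (auto simp: P_def coefficient_step_def)
  next
    fix x and f :: "nat \<Rightarrow> real poly \<times> real poly \<times> real"
    assume *: "\<And>y. y < x \<Longrightarrow> P f y (f y)"
    have par: "even_poly (fst (f y))" "odd_poly (fst (snd (f y)))" if "y < x" for y
      using * [OF that] by (auto simp: P_def coefficient_step_def parity_intros split: if_splits)
    show "\<exists>r. P f x r"
    proof (cases "x = 0")
      case True
      then show ?thesis by (intro exI [of _ "(1, 0, 0)"]) (simp add: P_def)
    next
      case False
      then obtain a b \<nu> where "coefficient_step m (\<lambda>i. fst (f i)) (\<lambda>i. fst (snd (f i)))
          (\<lambda>i. snd (snd (f i))) x a b \<nu>"
        using coefficient_step_exists [of x "\<lambda>i. fst (f i)" "\<lambda>i. fst (snd (f i))"] par by fastforce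
      then show ?thesis
        using False by (intro exI [of _ "(a, b, \<nu>)"]) (simp add: P_def)
    qed
  qed
  then obtain f where f: "\<And>s. P f s (f s)" by blast
  have "coefficient_system m (\<lambda>i. fst (f i)) (\<lambda>i. fst (snd (f i))) (\<lambda>i. snd (snd (f i)))"
    unfolding coefficient_system_iff using f by (force simp: P_def split: if_splits)
  then show ?thesis by blast
qed

lemma coeff_A_eq: "coefficient_system m A B \<mu> \<Longrightarrow> coeff_A m = A"
  unfolding coeff_A_def
  by (rule the_equality) (use coefficient_system_unique in blast)+

lemma coeff_B_eq: "coefficient_system m A B \<mu> \<Longrightarrow> coeff_B m = B"
  unfolding coeff_B_def
  by (rule the_equality) (use coefficient_system_unique in blast)+

lemma coefficient_system_coeff: "\<exists>\<mu>. coefficient_system m (coeff_A m) (coeff_B m) \<mu>"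
  using coefficient_system_exists [of m] by (metis coeff_A_eq coeff_B_eq)

text \<open>The value at 0 is arbitrary, so the sequence is selected by \<open>SOME\<close>. For s
  \<ge> 1 its members are the coefficients of h^(-s) in the expansion of \<Lambda>.\<close>

definition coeff_mu :: "nat \<Rightarrow> nat \<Rightarrow> real" where
  "coeff_mu m = (SOME \<mu>. coefficient_system m (coeff_A m) (coeff_B m) \<mu>)"

lemma coefficient_system_mu: "coefficient_system m (coeff_A m) (coeff_B m) (coeff_mu m)"
  unfolding coeff_mu_def by (rule someI_ex [OF coefficient_system_coeff])

lemma coeff_A_0: "coeff_A m 0 = 1" and coeff_B_0: "coeff_B m 0 = 0"
  using coefficient_system_mu [of m] by (simp_all add: coefficient_system_iff)

lemma coefficient_step_coeff:
  "s \<ge> 1 \<Longrightarrow> coefficient_step m (coeff_A m) (coeff_B m) (coeff_mu m) s (coeff_A m s) (coeff_B m s) (coeff_mu m s)"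
  using coefficient_system_mu [of m] by (simp add: coefficient_system_iff)

lemma even_coeff_A: "even_poly (coeff_A m s)"
  using coefficient_step_coeff [of s m] by (cases s) (auto simp: coeff_A_0 parity_intros coefficient_step_def)

lemma odd_coeff_B: "odd_poly (coeff_B m s)"
  using coefficient_step_coeff [of s m] by (cases s) (auto simp: coeff_B_0 parity_intros coefficient_step_def)

lemma parity_sqrt_deconv:
  "(\<And>s. even_poly (A s)) \<Longrightarrow> even_poly (sqrt_deconv A s)"
  "(\<And>s. odd_poly (A s)) \<Longrightarrow> odd_poly (sqrt_deconv A s)"
proof -
  show "even_poly (sqrt_deconv A s)" if "\<And>s. even_poly (A s)"
  proof (induction s rule: less_induct)
    case (less s)
    show ?case
      unfolding sqrt_deconv.simps [of A s]
      by (intro parity_add parity_sum(1) parity_mult that less parity_base) auto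
  qed
  show "odd_poly (sqrt_deconv A s)" if "\<And>s. odd_poly (A s)"
  proof (induction s rule: less_induct)
    case (less s)
    show ?case
      unfolding sqrt_deconv.simps [of A s]
      by (intro parity_add parity_sum(2) parity_mult(3) [OF parity_mult(5) [OF parity_mult(7)]] that less parity_base) auto
  qed
qed

section \<open>Explicit coefficients for s = 1 and s = 2\<close>

lemma coeff_level_1:
  "coeff_A m 1 = [:0, 0, 1/64:]"
  "coeff_B m 1 = [:0, - (1 + 2 * real m) / 32, 0, 1/32:]"
  "coeff_mu m 1 = - (2 * real m ^ 2 + 2 * real m + 1) / 16"
proof -
  let ?a = "[:0, 0, 1/64:] :: real poly" and ?b = "[:0, - (1 + 2 * real m) / 32, 0, 1/32:]"
    and ?\<nu> = "- (2 * real m ^ 2 + 2 * real m + 1) / 16"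
  have "coefficient_step m (coeff_A m) (coeff_B m) (coeff_mu m) 1 ?a ?b ?\<nu>"
    unfolding coefficient_step_def source1_def source2_def
    by (simp add: coeff_A_0 coeff_B_0 even_poly_def odd_poly_def pderiv_pCons ttilde_def numeral_poly
        power2_eq_square field_simps)
  from coefficient_step_unique [OF coefficient_step_coeff this]
  show "coeff_A m 1 = ?a" "coeff_B m 1 = ?b" "coeff_mu m 1 = ?\<nu>"
    by auto
qed

lemma pderiv_pCons9: "pderiv [:a0, a1, a2, a3, a4, a5, a6, a7, a8:] =
    [:a1, 2 * a2, 3 * a3, 4 * a4, 5 * a5, 6 * a6, 7 * a7, 8 * a8 :: real:]"
  by (simp add: pderiv_pCons)

lemma pderiv_pCons6: "pderiv [:a0, a1, a2, a3, a4, a5:] =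
    [:a1, 2 * a2, 3 * a3, 4 * a4, 5 * a5 :: real:]"
  by (simp add: pderiv_pCons)

lemma pderiv_pCons8: "pderiv [:a0, a1, a2, a3, a4, a5, a6, a7:] =
    [:a1, 2 * a2, 3 * a3, 4 * a4, 5 * a5, 6 * a6, 7 * a7 :: real:]"
  by (simp add: pderiv_pCons)

lemma pderiv_pCons5: "pderiv [:a0, a1, a2, a3, a4:] =
    [:a1, 2 * a2, 3 * a3, 4 * a4 :: real:]"
  by (simp add: pderiv_pCons)

lemma pderiv_pCons2: "pderiv [:a0, a1:] = [:a1 :: real:]"
  by (simp add: pderiv_pCons)

lemma pderiv_pCons3: "pderiv [:a0, a1, a2:] = [:a1, 2 * a2 :: real:]"
  by (simp add: pderiv_pCons)

text \<open>By uniqueness of each step it is enough to insert the candidates and compare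
  polynomials. The witness \<open>?\<nu>\<close> is \<mu>_2, the h^(-2) coefficient of \<Lambda>,
  and has to be supplied along with the two polynomials.\<close>

lemma coeff_level_2:
  fixes m :: nat
  defines "M \<equiv> real m"
  shows "coeff_A m 2 = [:0, 0, (5 + 6 * M - 12 * M ^ 2 - 8 * M ^ 3) / 2 ^ 12, 0,
      (9 + 10 * M + 10 * M ^ 2) / 2 ^ 12, 0, - (1 + 2 * M) / 2 ^ 11, 0, 1 / 2 ^ 13:]" (is "_ = ?a")
    and "coeff_B m 2 = [:0, - (11 + 20 * M + 20 * M ^ 2) / 2 ^ 11, 0, - (1 + 2 * M) * 5 / 2 ^ 11, 0,
      1 / 2 ^ 8:]" (is "_ = ?b")
proof -
  let ?\<nu> = "- (2 * M + 1) * (M ^ 2 + M + 1) / 128"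
  have z: "p = 0" if "\<And>t. poly p t = 0" for p :: "real poly"
    using that by (simp add: poly_eq_poly_eq_iff [symmetric] fun_eq_iff)
  have o: "2 - (1::nat) = 1" "{1..<2::nat} = {1}" by auto
  have d1: "pderiv (coeff_A m 1) = [:0, 1/32:]" "pderiv (pderiv (coeff_A m 1)) = [:1/32:]"
    "pderiv (coeff_B m 1) = [:- (1 + 2 * M) / 32, 0, 3/32:]" "pderiv (pderiv (coeff_B m 1)) = [:0, 6/32:]"
    by (simp_all only: coeff_level_1 M_def) (simp_all add: pderiv_pCons)
  have "coefficient_step m (coeff_A m) (coeff_B m) (coeff_mu m) 2 ?a ?b ?\<nu>"
    unfolding coefficient_step_def source1_def source2_def o
  proof (intro conjI)
    show "even_poly ?a" "odd_poly ?b" by (simp_all add: even_poly_def odd_poly_def)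
    show "poly ?a 0 = 0" by simp
  qed (rule z, simp only: d1 pderiv_pCons2 pderiv_pCons3 pderiv_pCons9 pderiv_pCons8 pderiv_pCons6 pderiv_pCons5,
       simp only: coeff_level_1 M_def [symmetric] sum.insert sum.empty finite.emptyI empty_iff not_False_eq_True
         poly_add poly_diff poly_mult poly_smult poly_pCons poly_power poly_numeral poly_0 ttilde_def mult_zero_left mult_zero_right add_0_left add_0_right o,
       simp add: power2_eq_square power3_eq_cube eval_nat_numeral algebra_simps add_divide_distrib diff_divide_distrib)+
  from coefficient_step_unique [OF coefficient_step_coeff this]
  show "coeff_A m 2 = ?a" "coeff_B m 2 = ?b"
    by auto
qed

lemma coeff_PQ_levels:
  "coeff_P m 0 = 1" "coeff_Q m 0 = 0"
  "poly (coeff_P m 1) t = 9 * t^2 / 2^6"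
  "coeff_Q m 1 = coeff_B m 1"
  "poly (coeff_P m 2) t = t^8 / 2^13 - (1 + 2 * real m) * t^6 / 2^11
           + (113 + 10 * real m + 10 * real m ^ 2) * t^4 / 2^12
           + (5 + 6 * real m - 12 * real m ^ 2 - 8 * real m ^ 3) * t^2 / 2^12"
  "poly (coeff_Q m 2) t = t^5 / 2^7 - (1 + 2 * real m) * (13 * t^3) / 2^11
           - (11 + 20 * real m + 20 * real m ^ 2) * t / 2^11"
proof -
  have g: "(1/2 gchoose 1) = (1/2 :: real)" "(1/2 gchoose 2) = (-1/8 :: real)"
    by (simp_all add: gbinomial_prod_rev eval_nat_numeral)
  have a12: "{1..2::nat} = {1, 2}" "{1..1::nat} = {1}" "(2::nat) - 1 = 1" "(1::nat) - 1 = 0" "(2::nat) - 2 = 0"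
    by auto
  have d0: "sqrt_deconv A 0 = A 0" for A
    by (subst sqrt_deconv.simps) simp
  have d1: "sqrt_deconv A 1 = A 1 - smult (1/2) [:0, 0, -1/4:] * A 0" for A
    by (subst sqrt_deconv.simps) (simp only: a12 g d0 sum.insert sum.empty finite.intros empty_iff not_False_eq_True
      add_0_right power_one_right)
  have d2: "sqrt_deconv A 2 = A 2 - (smult (1/2) [:0, 0, -1/4:] * sqrt_deconv A 1
      + smult (-1/8) ([:0, 0, -1/4:] ^ 2) * A 0)" for A
    by (subst sqrt_deconv.simps) (simp only: a12(1), simp add: g d0)
  show 0: "coeff_P m 0 = 1" "coeff_Q m 0 = 0"
    by (simp_all only: coeff_P_def coeff_Q_def d0 coeff_A_0 coeff_B_0)
  have 1: "coeff_P m 1 = coeff_A m 1 - smult (1/2) [:0, 0, -1/4:]"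
    by (simp only: coeff_P_def d1 coeff_A_0 mult_1_right)
  show q1: "coeff_Q m 1 = coeff_B m 1"
    by (simp only: coeff_Q_def d1 coeff_B_0 mult_zero_right diff_zero)
  have 2: "coeff_P m 2 = coeff_A m 2 - (smult (1/2) [:0, 0, -1/4:] * coeff_P m 1
      + smult (-1/8) ([:0, 0, -1/4:] ^ 2))"
    by (simp only: coeff_P_def d2 coeff_A_0 mult_1_right)
  have q2: "coeff_Q m 2 = coeff_B m 2 - smult (1/2) [:0, 0, -1/4:] * coeff_Q m 1"
    by (simp only: coeff_Q_def d2 coeff_B_0 mult_zero_right add_0_right)
  show "poly (coeff_P m 1) t = 9 * t^2 / 2^6"
    unfolding 1 coeff_level_1 by (simp add: power2_eq_square)
  show "poly (coeff_P m 2) t = t^8 / 2^13 - (1 + 2 * real m) * t^6 / 2^11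
           + (113 + 10 * real m + 10 * real m ^ 2) * t^4 / 2^12
           + (5 + 6 * real m - 12 * real m ^ 2 - 8 * real m ^ 3) * t^2 / 2^12"
    unfolding 1 2 coeff_level_1 coeff_level_2 poly_add poly_diff poly_mult poly_smult poly_pCons poly_power poly_0
    by (simp add: power2_eq_square power3_eq_cube eval_nat_numeral algebra_simps add_divide_distrib diff_divide_distrib)
  show "poly (coeff_Q m 2) t = t^5 / 2^7 - (1 + 2 * real m) * (13 * t^3) / 2^11
           - (11 + 20 * real m + 20 * real m ^ 2) * t / 2^11"
    unfolding q1 q2 coeff_level_1 coeff_level_2 poly_add poly_diff poly_mult poly_smult poly_pCons poly_power poly_0
    by (simp add: power2_eq_square power3_eq_cube eval_nat_numeral algebra_simps add_divide_distrib diff_divide_distrib)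
qed

section \<open>Parabolic cylinder functions\<close>

lemma hermite_He_Suc: "hermite_He (Suc n) = [:0, 1:] * hermite_He n - pderiv (hermite_He n)"
  and pderiv_hermite_He_Suc: "pderiv (hermite_He (Suc n)) = of_nat (Suc n) * hermite_He n"
proof (induction n rule: hermite_He.induct)
  case 1
  { case 1 show ?case by simp
  next case 2 show ?case by (simp add: pderiv_pCons) }
next
  case 2
  { case 1 show ?case by (simp add: pderiv_pCons numeral_poly one_pCons)
  next case 2 show ?case by (simp add: pderiv_pCons pderiv_diff pderiv_mult numeral_poly one_pCons) }
next
  case (3 n)
  have *: "pderiv (hermite_He (Suc (Suc n))) = of_nat (Suc (Suc n)) * hermite_He (Suc n)"
    by (rule 3)
  have **: "pderiv (hermite_He (Suc n)) = of_nat (Suc n) * hermite_He n"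
    by (rule 3)
  { case 1
    show ?case
      by (subst hermite_He.simps(3)) (simp only: *)
  next
    case 2
    have x: "pderiv [:0, 1:] = (1 :: real poly)"
      by (simp add: pderiv_pCons)
    have o: "pderiv (of_nat k :: real poly) = 0" for k
      by (simp add: of_nat_poly pderiv_pCons)
    have "pderiv (hermite_He (Suc (Suc (Suc n)))) =
        hermite_He (Suc (Suc n)) + [:0, 1:] * (of_nat (Suc (Suc n)) * hermite_He (Suc n))
          - of_nat (Suc (Suc n)) * (of_nat (Suc n) * hermite_He n)"
      unfolding hermite_He.simps(3) [of "Suc n"] pderiv_diff pderiv_mult x o * **
      by (simp del: of_nat_Suc hermite_He.simps)
    also have "\<dots> = hermite_He (Suc (Suc n)) + of_nat (Suc (Suc n)) * hermite_He (Suc (Suc n))"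
      by (subst (3) hermite_He.simps(3)) (simp only: algebra_simps)
    finally show ?case
      by (simp add: algebra_simps del: hermite_He.simps) }
qed

text \<open>The derivative of the raising relation He_(m+1) = x He_m - He_m', in which He_(m+1)' =
  (m+1) He_m.\<close>

lemma hermite_ODE:
  "pderiv (pderiv (hermite_He m)) = [:0, 1:] * pderiv (hermite_He m) - of_nat m * hermite_He m"
proof -
  have x: "pderiv [:0, 1:] = (1 :: real poly)"
    by (simp add: pderiv_pCons)
  have "pderiv (hermite_He m) = [:0, 1:] * hermite_He m - hermite_He (Suc m)"
    by (simp add: hermite_He_Suc)
  then have "pderiv (pderiv (hermite_He m)) = pderiv ([:0, 1:] * hermite_He m - hermite_He (Suc m))"
    by simp
  also have "\<dots> = [:0, 1:] * pderiv (hermite_He m) - of_nat m * hermite_He m"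
    by (simp add: pderiv_diff pderiv_mult pderiv_hermite_He_Suc pderiv_pCons algebra_simps)
  finally show ?thesis .
qed

lemma degree_hermite_He: "degree (hermite_He n) = n" and lead_coeff_hermite_He: "coeff (hermite_He n) n = 1"
proof -
  have *: "degree (hermite_He n) \<le> n \<and> coeff (hermite_He n) n = 1"
  proof (induction n)
    case 0
    then show ?case by simp
  next
    case (Suc n)
    have "degree (hermite_He (Suc n)) \<le> Suc n"
      unfolding hermite_He_Suc using Suc
      by (intro degree_diff_le) (auto simp: degree_pderiv intro: order_trans [OF degree_pCons_le])
    moreover have "coeff (hermite_He (Suc n)) (Suc n) = 1"
      unfolding hermite_He_Suc using Suc by (simp add: coeff_pderiv coeff_eq_0)
    ultimately show ?case by simp
  qed
  then show "coeff (hermite_He n) n = 1" by simp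
  with * show "degree (hermite_He n) = n"
    by (intro antisym le_degree) auto
qed

lemma hermite_He_minus: "poly (hermite_He n) (- t) = (- 1) ^ n * poly (hermite_He n) t"
  by (induction n rule: hermite_He.induct) (simp_all add: algebra_simps)

text \<open>These nonzero data at 0, the value for even n and the slope for odd n, fix the multiple
  of the approximate solution in the shooting argument.\<close>

lemma hermite_He_0_even: "even n \<Longrightarrow> poly (hermite_He n) 0 \<noteq> 0"
  by (induction n rule: hermite_He.induct) simp_all

lemma hermite_He_0_odd: "odd n \<Longrightarrow> poly (pderiv (hermite_He n)) 0 \<noteq> 0"
  by (cases n) (simp_all add: pderiv_hermite_He_Suc hermite_He_0_even del: of_nat_Suc)

text \<open>The polynomial \<open>gauss_deriv p\<close> satisfies \<open>(exp (-t\<^sup>2/4) p)' = exp (-t\<^sup>2/4) (gauss_deriv p)\<close>.\<close>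

definition gauss_deriv :: "real poly \<Rightarrow> real poly" where
  "gauss_deriv p = pderiv p - smult (1/2) ([:0, 1:] * p)"

lemma gauss_deriv_DERIV:
  "((\<lambda>t. exp (- t\<^sup>2 / 4) * poly p t) has_real_derivative exp (- t\<^sup>2 / 4) * poly (gauss_deriv p) t) (at t)"
  by (auto intro!: derivative_eq_intros simp: gauss_deriv_def algebra_simps)

text \<open>Weber's equation D_m'' = (t^2/4 - m - 1/2) D_m with the Gaussian factor removed.\<close>

lemma gauss_deriv_hermite_He:
  "gauss_deriv (gauss_deriv (hermite_He m)) = ttilde m * hermite_He m"
proof -
  have "poly (gauss_deriv (gauss_deriv (hermite_He m))) t = poly (ttilde m * hermite_He m) t" for t
    by (simp add: gauss_deriv_def pderiv_diff pderiv_smult pderiv_pCons pderiv_mult hermite_ODE ttilde_def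
        field_simps)
  then show ?thesis by (simp add: poly_eq_poly_eq_iff [symmetric] fun_eq_iff)
qed

abbreviation dHe :: "nat \<Rightarrow> real poly" where
  "dHe m \<equiv> gauss_deriv (hermite_He m)"

lemma parabolic_D_eq: "parabolic_D m t = exp (- t\<^sup>2 / 4) * poly (hermite_He m) t"
  by (simp add: parabolic_D_def)

lemma parabolic_D_DERIV:
  "(parabolic_D m has_real_derivative exp (- t\<^sup>2 / 4) * poly (dHe m) t) (at t)"
  using gauss_deriv_DERIV by (simp add: parabolic_D_def [abs_def])

lemma deriv_parabolic_D: "deriv (parabolic_D m) t = exp (- t\<^sup>2 / 4) * poly (dHe m) t"
  by (rule DERIV_imp_deriv) (rule parabolic_D_DERIV)

lemma dHe_0: "poly (dHe m) 0 = poly (pderiv (hermite_He m)) 0"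
  by (simp add: gauss_deriv_def)

lemma dHe_minus: "poly (dHe n) (- t) = - ((- 1) ^ n * poly (dHe n) t)"
proof -
  have "((\<lambda>t. poly (hermite_He n) (- t)) has_real_derivative - poly (pderiv (hermite_He n)) (- t)) (at t)"
    by (rule DERIV_cong, rule DERIV_chain2 [where g = uminus, OF poly_DERIV]) (auto intro!: derivative_eq_intros)
  moreover have "((\<lambda>t. poly (hermite_He n) (- t)) has_real_derivative
      (- 1) ^ n * poly (pderiv (hermite_He n)) t) (at t)"
    unfolding hermite_He_minus by (auto intro!: derivative_eq_intros)
  ultimately have "- poly (pderiv (hermite_He n)) (- t) = (- 1) ^ n * poly (pderiv (hermite_He n)) t"
    by (rule DERIV_unique)
  then show ?thesis
    by (simp add: gauss_deriv_def hermite_He_minus algebra_simps)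
qed

subsection \<open>Gaussian integrals of polynomials\<close>

lemma gauss_moment_integrable: "integrable lborel (\<lambda>t::real. exp (- t\<^sup>2 / 2) * t ^ k)"
proof -
  have "integrable lborel (\<lambda>x. sqrt (2 * pi) * (std_normal_density x * x ^ k))"
    by (intro integrable_mult_right integrable_std_normal_moment)
  then show ?thesis
    by (simp add: std_normal_density_def)
qed

lemma gauss_poly_integrable:
  fixes p :: "real poly"
  shows "integrable lborel (\<lambda>t. exp (- t\<^sup>2 / 2) * poly p t)"
proof -
  have "integrable lborel (\<lambda>t::real. \<Sum>i\<le>degree p. coeff p i * (exp (- t\<^sup>2 / 2) * t ^ i))"
    by (intro Bochner_Integration.integrable_sum integrable_mult_right gauss_moment_integrable)
  then show ?thesis
    by (simp add: poly_altdef sum_distrib_left mult_ac)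
qed

text \<open>The weight is exp(-t^2/2) because the integrands are products of two functions
  exp(-t^2/4) p(t).\<close>

definition gint :: "real poly \<Rightarrow> real" where
  "gint p = (LINT t|lborel. exp (- t\<^sup>2 / 2) * poly p t)"

lemma gint_add: "gint (p + q) = gint p + gint q"
  by (simp only: gint_def distrib_left poly_add Bochner_Integration.integral_add [OF gauss_poly_integrable gauss_poly_integrable])

lemma gint_diff: "gint (p - q) = gint p - gint q"
  by (simp only: gint_def right_diff_distrib poly_diff Bochner_Integration.integral_diff [OF gauss_poly_integrable gauss_poly_integrable])

lemma gint_smult: "gint (smult c p) = c * gint p"
  by (simp add: gint_def mult.left_commute)

lemma gint_0: "gint 0 = 0"
  by (simp add: gint_def)

lemma gint_sum: "gint (sum f I) = (\<Sum>i\<in>I. gint (f i))"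
  by (induction I rule: infinite_finite_induct) (simp_all add: gint_add gint_0)

lemma gint_monom: "gint (monom 1 k) = sqrt (2 * pi) * (LINT x|lborel. std_normal_density x * x ^ k)"
proof -
  have "sqrt (2 * pi) * (LINT x|lborel. std_normal_density x * x ^ k)
      = (LINT x|lborel. sqrt (2 * pi) * (std_normal_density x * x ^ k))"
    by simp
  also have "\<dots> = gint (monom 1 k)"
    by (simp add: gint_def poly_monom std_normal_density_def)
  finally show ?thesis by simp
qed

lemma gint_1: "gint 1 = sqrt (2 * pi)"
  using gint_monom [of 0] integral_std_normal_moment_even [of 0] by simp

lemma gint_monom_Suc: "gint (monom 1 (Suc (Suc k))) = real (Suc k) * gint (monom 1 k)"
proof (cases "even k")
  case True
  then obtain j where j: "k = 2 * j" by blast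
  have "fact (2 * Suc j) / (2 ^ Suc j * fact (Suc j)) = real (Suc k) * (fact (2 * j) / (2 ^ j * fact j))"
    by (simp add: j field_simps del: of_nat_Suc) (simp add: algebra_simps)
  then show ?thesis
    using integral_std_normal_moment_even [of "Suc j"] integral_std_normal_moment_even [of j]
    by (simp add: gint_monom j)
next
  case False
  then obtain j where j: "k = 2 * j + 1" by (metis oddE)
  show ?thesis
    using integral_std_normal_moment_odd [of "Suc j"] integral_std_normal_moment_odd [of j]
    by (simp add: gint_monom j)
qed

lemma pderiv_sum: "pderiv (sum f I) = (\<Sum>i\<in>I. pderiv (f i))"
  by (induction I rule: infinite_finite_induct) (simp_all add: pderiv_add)

text \<open>Gaussian integration by parts. On monomials it is the recursion of the moments, so no
  boundary terms have to be discussed.\<close>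

lemma gint_by_parts: "gint ([:0, 1:] * p) = gint (pderiv p)"
proof -
  have m: "monom c i = smult c (monom 1 i)" for c :: real and i
    by (simp add: smult_monom)
  have *: "gint ([:0, 1:] * monom 1 i) = gint (pderiv (monom 1 i))" for i
  proof (cases i)
    case 0
    then show ?thesis
      using integral_std_normal_moment_odd [of 0] gint_monom [of 1]
      by (simp add: pderiv_monom gint_0 monom_Suc one_pCons)
  next
    case (Suc j)
    have "[:0, 1:] * monom 1 i = monom (1::real) (Suc (Suc j))"
      by (simp add: Suc monom_Suc)
    then show ?thesis
      using gint_monom_Suc [of j] m [of "real (Suc j)" j]
      by (simp add: Suc pderiv_monom gint_smult del: of_nat_Suc)
  qed
  have p: "p = (\<Sum>i\<le>degree p. smult (coeff p i) (monom 1 i))"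
    by (simp add: smult_monom poly_as_sum_of_monoms)
  have "gint ([:0, 1:] * p) = (\<Sum>i\<le>degree p. coeff p i * gint ([:0, 1:] * monom 1 i))"
    by (subst p) (simp only: sum_distrib_left mult_smult_right gint_sum gint_smult)
  also have "\<dots> = gint (\<Sum>i\<le>degree p. smult (coeff p i) (pderiv (monom 1 i)))"
    by (simp only: * gint_sum gint_smult)
  also have "(\<Sum>i\<le>degree p. smult (coeff p i) (pderiv (monom 1 i))) = pderiv p"
    by (subst (3) p) (simp only: pderiv_sum pderiv_smult)
  finally show ?thesis .
qed

text \<open>One factor He_(m+1) is written as x He_m - He_m'. Integration by parts turns x into a
  derivative, and the product rule leaves only He_m He_(m+1)' = (m+1) He_m^2.\<close>

lemma gint_hermite_square: "gint (hermite_He m * hermite_He m) = fact m * sqrt (2 * pi)"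
proof (induction m)
  case 0
  then show ?case by (simp add: gint_1)
next
  case (Suc m)
  let ?H = "hermite_He m" and ?G = "hermite_He (Suc m)"
  have "?G * ?G = [:0, 1:] * (?H * ?G) - pderiv ?H * ?G"
    by (subst (1) hermite_He_Suc) (simp only: algebra_simps)
  then have "gint (?G * ?G) = gint (pderiv (?H * ?G)) - gint (pderiv ?H * ?G)"
    by (simp only: gint_diff gint_by_parts)
  also have "\<dots> = gint (pderiv (?H * ?G) - pderiv ?H * ?G)"
    by (simp only: gint_diff)
  also have "pderiv (?H * ?G) - pderiv ?H * ?G = smult (real (Suc m)) (?H * ?H)"
    by (simp add: pderiv_mult pderiv_hermite_He_Suc of_nat_poly del: of_nat_Suc)
  finally show ?case
    using Suc by (simp add: gint_smult)
qed

text \<open>The virial identity: both \<open>D D'\<close> and \<open>t (D'\<^sup>2 - (t\<^sup>2/4 - m - 1/2) D\<^sup>2)\<close> vanish at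
  infinity, so the integrals of their derivatives vanish.\<close>

lemma gint_hermite_virial:
  "gint ([:0, 0, 1:] * (hermite_He m * hermite_He m)) = (2 * real m + 1) * gint (hermite_He m * hermite_He m)"
proof -
  let ?H = "hermite_He m" and ?E = "dHe m" and ?x = "[:0, 1:] :: real poly"
  have ibp: "gint (pderiv p - ?x * p) = 0" for p
    by (simp add: gint_diff gint_by_parts del: mult_pCons_left)
  have H': "pderiv ?H = ?E + smult (1/2) (?x * ?H)"
    by (simp add: gauss_deriv_def)
  have E': "pderiv ?E = ttilde m * ?H + smult (1/2) (?x * ?E)"
    using gauss_deriv_hermite_He [of m] by (simp add: gauss_deriv_def algebra_simps)
  have 1: "pderiv (?H * ?E) - ?x * (?H * ?E) = ?E * ?E + ttilde m * (?H * ?H)"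
  proof -
    have "poly (pderiv (?H * ?E) - ?x * (?H * ?E)) t = poly (?E * ?E + ttilde m * (?H * ?H)) t" for t
      by (simp add: pderiv_mult H' E' field_simps)
    then show ?thesis by (simp add: poly_eq_poly_eq_iff [symmetric] fun_eq_iff)
  qed
  have 2: "pderiv (?x * (?E * ?E - ttilde m * (?H * ?H))) - ?x * (?x * (?E * ?E - ttilde m * (?H * ?H)))
     = ?E * ?E - ttilde m * (?H * ?H) - smult (1/2) ([:0, 0, 1:] * (?H * ?H))"
  proof -
    have x: "pderiv ?x = 1" "pderiv (ttilde m) = smult (1/2) ?x"
      by (simp_all add: pderiv_pCons ttilde_def)
    have "poly (pderiv (?x * (?E * ?E - ttilde m * (?H * ?H))) - ?x * (?x * (?E * ?E - ttilde m * (?H * ?H)))) t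
      = poly (?E * ?E - ttilde m * (?H * ?H) - smult (1/2) ([:0, 0, 1:] * (?H * ?H))) t" for t
      by (simp only: pderiv_mult pderiv_diff x H' E') (simp add: ttilde_def field_simps)
    then show ?thesis by (simp add: poly_eq_poly_eq_iff [symmetric] fun_eq_iff)
  qed
  have a: "gint (?E * ?E) + gint (ttilde m * (?H * ?H)) = 0"
    using ibp [of "?H * ?E"] unfolding 1 by (simp only: gint_add)
  have b: "gint (?E * ?E) - gint (ttilde m * (?H * ?H)) - 1/2 * gint ([:0, 0, 1:] * (?H * ?H)) = 0"
    using ibp [of "?x * (?E * ?E - ttilde m * (?H * ?H))"] unfolding 2 by (simp only: gint_diff gint_smult)
  have c: "ttilde m * (?H * ?H) = smult (1/4) ([:0, 0, 1:] * (?H * ?H)) - smult (real m + 1/2) (?H * ?H)"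
    by (simp add: poly_eq_poly_eq_iff [symmetric] fun_eq_iff ttilde_def field_simps)
  have d: "gint (ttilde m * (?H * ?H)) = 1/4 * gint ([:0, 0, 1:] * (?H * ?H)) - (real m + 1/2) * gint (?H * ?H)"
    by (simp only: c gint_diff gint_smult)
  show ?thesis using a b d by (simp add: field_simps)
qed

text \<open>The factor of exp(-t^2/4) in A_s D_m + B_s D_m'.\<close>

definition amplitude :: "nat \<Rightarrow> nat \<Rightarrow> real poly" where
  "amplitude m s = coeff_A m s * hermite_He m + coeff_B m s * dHe m"

text \<open>Coefficient of h^(-s) in (1 - t^2/(4h))^(-1/2) times the square of the amplitude series;
  the square-root factor is ds/dt.\<close>

definition norm_density :: "nat \<Rightarrow> nat \<Rightarrow> real poly" where
  "norm_density m s = (\<Sum>j\<le>s. smult ((-1/2) gchoose j) ([:0, 0, -1/4:] ^ j)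
     * (\<Sum>i\<le>s - j. amplitude m i * amplitude m (s - j - i)))"

lemma coeff_eta_gint: "coeff_eta m s = gint (norm_density m s) / (fact m * sqrt (2 * pi))"
proof -
  \<comment> \<open>The definition of \<open>coeff_eta\<close> has the mixed term 2 A_i B_(n-i),
    whereas squaring the amplitudes gives A_i B_(n-i) + B_i A_(n-i). They agree only after summation
    over i.\<close>
  have cross: "(\<Sum>i\<le>n. poly (coeff_B m i) t * poly (coeff_A m (n - i)) t)
      = (\<Sum>i\<le>n. poly (coeff_A m i) t * poly (coeff_B m (n - i)) t)" for n t
    by (rule sum.reindex_bij_witness [of _ "\<lambda>i. n - i" "\<lambda>i. n - i"]) auto
  have e: "exp (- t\<^sup>2 / 4) * exp (- t\<^sup>2 / 4) = exp (- t\<^sup>2 / 2)" for t :: real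
    by (simp add: exp_add [symmetric])
  have inner: "(\<Sum>i=0..n. poly (coeff_A m i) t * poly (coeff_A m (n - i)) t * (parabolic_D m t)\<^sup>2
          + 2 * poly (coeff_A m i) t * poly (coeff_B m (n - i)) t
              * parabolic_D m t * deriv (parabolic_D m) t
          + poly (coeff_B m i) t * poly (coeff_B m (n - i)) t * (deriv (parabolic_D m) t)\<^sup>2)
      = exp (- t\<^sup>2 / 2) * poly (\<Sum>i\<le>n. amplitude m i * amplitude m (n - i)) t" (is "?l = ?r") for n t
  proof -
    let ?H = "poly (hermite_He m) t" and ?E = "poly (dHe m) t"
    let ?a = "\<lambda>i. poly (coeff_A m i) t" and ?b = "\<lambda>i. poly (coeff_B m i) t"
    have "?l = (exp (- t\<^sup>2 / 4) * exp (- t\<^sup>2 / 4)) * (\<Sum>i\<le>n. ?a i * ?a (n - i) * ?H\<^sup>2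
        + 2 * ?a i * ?b (n - i) * ?H * ?E + ?b i * ?b (n - i) * ?E\<^sup>2)"
      unfolding sum_distrib_left atLeast0AtMost parabolic_D_eq deriv_parabolic_D
      by (intro sum.cong refl) (simp add: power2_eq_square algebra_simps)
    also have "\<dots> = exp (- t\<^sup>2 / 2) * (\<Sum>i\<le>n. ?a i * ?a (n - i) * ?H\<^sup>2
        + 2 * ?a i * ?b (n - i) * ?H * ?E + ?b i * ?b (n - i) * ?E\<^sup>2)"
      by (simp only: e)
    also have "(\<Sum>i\<le>n. ?a i * ?a (n - i) * ?H\<^sup>2 + 2 * ?a i * ?b (n - i) * ?H * ?E
        + ?b i * ?b (n - i) * ?E\<^sup>2) = (\<Sum>i\<le>n. ?a i * ?a (n - i)) * ?H\<^sup>2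
        + (\<Sum>i\<le>n. ?a i * ?b (n - i)) * (?H * ?E) + (\<Sum>i\<le>n. ?a i * ?b (n - i)) * (?H * ?E)
        + (\<Sum>i\<le>n. ?b i * ?b (n - i)) * ?E\<^sup>2"
      unfolding sum_distrib_right sum.distrib [symmetric]
      by (intro sum.cong refl) (simp add: algebra_simps)
    also have "\<dots> = (\<Sum>i\<le>n. ?a i * ?a (n - i)) * ?H\<^sup>2
        + (\<Sum>i\<le>n. ?a i * ?b (n - i)) * (?H * ?E) + (\<Sum>i\<le>n. ?b i * ?a (n - i)) * (?H * ?E)
        + (\<Sum>i\<le>n. ?b i * ?b (n - i)) * ?E\<^sup>2"
      by (simp only: cross)
    also have "\<dots> = poly (\<Sum>i\<le>n. amplitude m i * amplitude m (n - i)) t"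
      unfolding poly_sum sum_distrib_right sum.distrib [symmetric]
      by (intro sum.cong refl) (simp add: amplitude_def power2_eq_square algebra_simps)
    finally show ?thesis .
  qed
  have "(\<Sum>j=0..s. ((- 1/2) gchoose j) * (- t\<^sup>2 / 4) ^ j * (exp (- t\<^sup>2 / 2) *
      poly (\<Sum>i\<le>s - j. amplitude m i * amplitude m (s - j - i)) t))
      = exp (- t\<^sup>2 / 2) * poly (norm_density m s) t" for t
    unfolding norm_density_def poly_sum atLeast0AtMost sum_distrib_left
    by (intro sum.cong refl) (simp add: poly_sum power2_eq_square algebra_simps)
  then show ?thesis
    by (simp only: coeff_eta_def inner gint_def) simp
qed

lemma coeff_eta_0: "coeff_eta m 0 = 1"
  by (simp add: coeff_eta_gint norm_density_def amplitude_def coeff_A_0 coeff_B_0 gint_hermite_square)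

text \<open>With q = B_1 the mixed term 2 q D D' equals (q D^2)' - q' D^2 and may be replaced by -q'
  D^2 under the integral; the virial identity evaluates the remaining t^2 D^2. The factor 5/32 is
  2/64 from A_1 plus 1/8 from the square-root factor.\<close>

lemma coeff_eta_1: "coeff_eta m 1 = (6 * real m + 3) / 32"
proof -
  let ?H = "hermite_He m" and ?E = "dHe m" and ?x = "[:0, 1:] :: real poly"
  let ?q = "[:0, - (1 + 2 * real m) / 32, 0, 1/32:]"
  have g: "((-1/2) gchoose 1) = (-1/2 :: real)"
    by (simp add: gbinomial_1)
  have nd: "norm_density m 1 = smult (5/32) ([:0, 0, 1:] * (?H * ?H)) + 2 * ?q * ?H * ?E"
  proof -
    have "poly (norm_density m 1) t = poly (smult (5/32) ([:0, 0, 1:] * (?H * ?H)) + 2 * ?q * ?H * ?E) t" for t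
      using g by (simp add: norm_density_def amplitude_def coeff_A_0 coeff_B_0 coeff_level_1 [unfolded One_nat_def]
        field_simps)
    then show ?thesis by (simp add: poly_eq_poly_eq_iff [symmetric] fun_eq_iff)
  qed
  have dq: "pderiv ?q = [:- (1 + 2 * real m) / 32, 0, 3/32:]"
    by (simp add: pderiv_pCons)
  have "pderiv (?q * (?H * ?H)) - ?x * (?q * (?H * ?H)) = pderiv ?q * (?H * ?H) + 2 * ?q * ?H * ?E"
  proof -
    have "poly (pderiv (?q * (?H * ?H)) - ?x * (?q * (?H * ?H))) t
        = poly (pderiv ?q * (?H * ?H) + 2 * ?q * ?H * ?E) t" for t
      by (simp only: pderiv_mult dq) (simp add: gauss_deriv_def field_simps)
    then show ?thesis by (simp add: poly_eq_poly_eq_iff [symmetric] fun_eq_iff)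
  qed
  moreover have "gint (pderiv (?q * (?H * ?H)) - ?x * (?q * (?H * ?H))) = 0"
    by (simp only: gint_diff gint_by_parts, simp?)
  ultimately have "gint (2 * ?q * ?H * ?E) = - gint (pderiv ?q * (?H * ?H))"
    by (simp only: gint_add, simp?)
  also have "pderiv ?q * (?H * ?H) = smult (3/32) ([:0, 0, 1:] * (?H * ?H)) - smult ((1 + 2 * real m) / 32) (?H * ?H)"
    by (simp only: dq) (simp add: poly_eq_poly_eq_iff [symmetric] fun_eq_iff field_simps)
  also have "- gint \<dots> = - 3/32 * gint ([:0, 0, 1:] * (?H * ?H)) + (1 + 2 * real m) / 32 * gint (?H * ?H)"
    by (simp only: gint_diff gint_smult, simp?)
  finally have "gint (norm_density m 1) = 5/32 * gint ([:0, 0, 1:] * (?H * ?H)) - 3/32 * gint ([:0, 0, 1:] * (?H * ?H))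
      + (1 + 2 * real m) / 32 * gint (?H * ?H)"
    by (simp only: nd gint_add gint_smult, simp?)
  then have "gint (norm_density m 1) = (6 * real m + 3) / 32 * (fact m * sqrt (2 * pi))"
    by (simp only: gint_hermite_virial gint_hermite_square) (simp add: field_simps)
  then show ?thesis
    by (simp add: coeff_eta_gint)
qed

section \<open>Expansions in powers of a small parameter with polynomial coefficients\<close>

text \<open>Here e stands for 1/h. The bound is uniform in e and polynomial in t; a Gaussian factor
  or a bounded range of t absorbs the growth later.\<close>

definition poly_bounded :: "(real \<Rightarrow> real \<Rightarrow> real) \<Rightarrow> bool" where
  "poly_bounded F \<longleftrightarrow> (\<exists>K\<ge>0. \<exists>N. \<forall>e t. 0 < e \<longrightarrow> e \<le> 1 \<longrightarrow> \<bar>F e t\<bar> \<le> K * (1 + t\<^sup>2) ^ N)"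

lemma poly_boundedI:
  assumes "\<And>e t. 0 < e \<Longrightarrow> e \<le> 1 \<Longrightarrow> \<bar>F e t\<bar> \<le> K * (1 + t\<^sup>2) ^ N"
  shows "poly_bounded F"
proof -
  have "0 \<le> K * (1 + (0::real)\<^sup>2) ^ N"
    using assms [of 1 0] by (metis abs_ge_zero order_trans zero_less_one order_refl)
  then have "K \<ge> 0" by simp
  then show ?thesis unfolding poly_bounded_def using assms by blast
qed

lemma poly_bounded_add:
  assumes "poly_bounded F" "poly_bounded G"
  shows "poly_bounded (\<lambda>e t. F e t + G e t)"
proof -
  obtain K N L M where K: "K \<ge> 0" "\<And>e t. 0 < e \<Longrightarrow> e \<le> 1 \<Longrightarrow> \<bar>F e t\<bar> \<le> K * (1 + t\<^sup>2) ^ N"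
    and L: "L \<ge> 0" "\<And>e t. 0 < e \<Longrightarrow> e \<le> 1 \<Longrightarrow> \<bar>G e t\<bar> \<le> L * (1 + t\<^sup>2) ^ M"
    using assms unfolding poly_bounded_def by metis
  show ?thesis
  proof (rule poly_boundedI)
    fix e t :: real
    assume e: "0 < e" "e \<le> 1"
    have "(1 + t\<^sup>2) ^ N \<le> (1 + t\<^sup>2) ^ (N + M)" "(1 + t\<^sup>2) ^ M \<le> (1 + t\<^sup>2) ^ (N + M)"
      by (rule power_increasing; simp)+
    then have "K * (1 + t\<^sup>2) ^ N \<le> K * (1 + t\<^sup>2) ^ (N + M)" "L * (1 + t\<^sup>2) ^ M \<le> L * (1 + t\<^sup>2) ^ (N + M)"
      using K(1) L(1) by (auto intro: mult_left_mono)
    with K(2) [OF e, of t] L(2) [OF e, of t] show "\<bar>F e t + G e t\<bar> \<le> (K + L) * (1 + t\<^sup>2) ^ (N + M)"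
      unfolding distrib_right by linarith
  qed
qed

lemma poly_bounded_mult:
  assumes "poly_bounded F" "poly_bounded G"
  shows "poly_bounded (\<lambda>e t. F e t * G e t)"
proof -
  obtain K N L M where K: "K \<ge> 0" "\<And>e t. 0 < e \<Longrightarrow> e \<le> 1 \<Longrightarrow> \<bar>F e t\<bar> \<le> K * (1 + t\<^sup>2) ^ N"
    and L: "L \<ge> 0" "\<And>e t. 0 < e \<Longrightarrow> e \<le> 1 \<Longrightarrow> \<bar>G e t\<bar> \<le> L * (1 + t\<^sup>2) ^ M"
    using assms unfolding poly_bounded_def by metis
  show ?thesis
  proof (rule poly_boundedI)
    fix e t :: real
    assume e: "0 < e" "e \<le> 1"
    have "\<bar>F e t * G e t\<bar> \<le> (K * (1 + t\<^sup>2) ^ N) * (L * (1 + t\<^sup>2) ^ M)"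
      unfolding abs_mult using K L e by (intro mult_mono) auto
    then show "\<bar>F e t * G e t\<bar> \<le> (K * L) * (1 + t\<^sup>2) ^ (N + M)"
      by (simp add: power_add mult_ac)
  qed
qed

lemma poly_bounded_const: "poly_bounded (\<lambda>e t. c)"
  by (rule poly_boundedI [of _ "\<bar>c\<bar>" 0]) simp

lemma poly_bounded_id: "poly_bounded (\<lambda>e t. t)"
proof (rule poly_boundedI [of _ 1 1])
  fix t :: real
  have "0 \<le> (\<bar>t\<bar> - 1)\<^sup>2" by simp
  then have "2 * \<bar>t\<bar> \<le> 1 + t\<^sup>2"
    by (simp add: power2_diff)
  then show "\<bar>t\<bar> \<le> 1 * (1 + t\<^sup>2) ^ 1" by simp
qed

lemma poly_bounded_power: "poly_bounded (\<lambda>e t. e ^ k)"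
  by (rule poly_boundedI [of _ 1 0]) (auto intro: power_le_one)

lemma poly_bounded_param: "poly_bounded (\<lambda>e t. e)"
  using poly_bounded_power [of 1] by simp

lemma poly_bounded_poly: "poly_bounded (\<lambda>e t. poly p t)"
  by (induction p) (auto intro!: poly_bounded_add poly_bounded_mult poly_bounded_const poly_bounded_id)

lemma poly_bounded_uminus: "poly_bounded F \<Longrightarrow> poly_bounded (\<lambda>e t. - F e t)"
  unfolding poly_bounded_def by simp

lemma poly_bounded_diff:
  "poly_bounded F \<Longrightarrow> poly_bounded G \<Longrightarrow> poly_bounded (\<lambda>e t. F e t - G e t)"
  using poly_bounded_add [OF _ poly_bounded_uminus] by simp

lemma poly_bounded_sum:
  "(\<And>i. i \<in> I \<Longrightarrow> poly_bounded (F i)) \<Longrightarrow> poly_bounded (\<lambda>e t. \<Sum>i\<in>I. F i e t)"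
  by (induction I rule: infinite_finite_induct) (auto intro: poly_bounded_const poly_bounded_add)

lemmas poly_bounded_intros = poly_bounded_add poly_bounded_mult poly_bounded_const poly_bounded_id
  poly_bounded_power poly_bounded_param poly_bounded_poly poly_bounded_uminus poly_bounded_diff
  poly_bounded_sum

text \<open>A power series in e up to order n, realised by a function. The identity is required for
  every e, while the bound on the remainder concerns 0 < e \<le> 1 only.\<close>

definition expansion :: "nat \<Rightarrow> (real \<Rightarrow> real \<Rightarrow> real) \<Rightarrow> (nat \<Rightarrow> real poly) \<Rightarrow> bool" where
  "expansion n F X \<longleftrightarrow> (\<exists>R. poly_bounded R \<and>
     (\<forall>e t. F e t = (\<Sum>s\<le>n. e ^ s * poly (X s) t) + e ^ (n + 1) * R e t))"

definition truncation :: "nat \<Rightarrow> (nat \<Rightarrow> real poly) \<Rightarrow> real \<Rightarrow> real \<Rightarrow> real" where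
  "truncation n X e t = (\<Sum>s\<le>n. e ^ s * poly (X s) t)"

lemma expansionI:
  assumes "poly_bounded R" "\<And>e t. F e t = truncation n X e t + e ^ (n + 1) * R e t"
  shows "expansion n F X"
  using assms by (auto simp: expansion_def truncation_def)

lemma expansionE:
  assumes "expansion n F X"
  obtains R where "poly_bounded R" "\<And>e t. F e t = truncation n X e t + e ^ (n + 1) * R e t"
  using assms by (auto simp: expansion_def truncation_def)

lemma poly_bounded_truncation: "poly_bounded (truncation n X)"
  unfolding truncation_def [abs_def] by (intro poly_bounded_intros)

lemma expansion_truncation: "expansion n (truncation n X) X"
  by (rule expansionI [of "\<lambda>e t. 0"]) (auto intro: poly_bounded_const)

lemma expansion_add:
  assumes "expansion n F X" "expansion n G Y"
  shows "expansion n (\<lambda>e t. F e t + G e t) (\<lambda>s. X s + Y s)"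
proof -
  obtain R S where R: "poly_bounded R" "\<And>e t. F e t = truncation n X e t + e ^ (n + 1) * R e t"
    and S: "poly_bounded S" "\<And>e t. G e t = truncation n Y e t + e ^ (n + 1) * S e t"
    using assms by (metis expansionE)
  show ?thesis
    by (rule expansionI [of "\<lambda>e t. R e t + S e t"])
      (auto simp: R S truncation_def sum.distrib distrib_left intro!: poly_bounded_intros R S)
qed

lemma expansion_mult:
  assumes "expansion n F X" "expansion n G Y"
  shows "expansion n (\<lambda>e t. F e t * G e t) (\<lambda>s. \<Sum>i\<le>s. X i * Y (s - i))"
proof -
  obtain R S where R: "poly_bounded R" "\<And>e t. F e t = truncation n X e t + e ^ (n + 1) * R e t"
    and S: "poly_bounded S" "\<And>e t. G e t = truncation n Y e t + e ^ (n + 1) * S e t"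
    using assms by (metis expansionE)
  \<comment> \<open>The pairs with i, j \<le> n but i + j > n. Each carries at least e^(n+1), which
    is divided out, so only nonnegative powers of e remain.\<close>
  define T where "T e t = (\<Sum>(i, j) \<in> {p \<in> {..n} \<times> {..n}. fst p + snd p > n}.
      e ^ (i + j - (n + 1)) * (poly (X i) t * poly (Y j) t))" for e t
  have T: "poly_bounded T"
    unfolding T_def [abs_def] case_prod_unfold by (intro poly_bounded_intros)
  have prod: "truncation n X e t * truncation n Y e t
      = truncation n (\<lambda>s. \<Sum>i\<le>s. X i * Y (s - i)) e t + e ^ (n + 1) * T e t" for e t
  proof -
    let ?f = "\<lambda>(i, j). e ^ (i + j) * (poly (X i) t * poly (Y j) t)"
    have "truncation n X e t * truncation n Y e t = sum ?f ({..n} \<times> {..n})"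
      by (simp add: truncation_def sum_product sum.cartesian_product power_add mult_ac)
    also have "{..n} \<times> {..n} = {p \<in> {..n} \<times> {..n}. fst p + snd p \<le> n} \<union> {p \<in> {..n} \<times> {..n}. fst p + snd p > n}"
      by auto
    also have "sum ?f \<dots> = sum ?f {p \<in> {..n} \<times> {..n}. fst p + snd p \<le> n}
        + sum ?f {p \<in> {..n} \<times> {..n}. fst p + snd p > n}"
      by (rule sum.union_disjoint) auto
    also have "sum ?f {p \<in> {..n} \<times> {..n}. fst p + snd p > n} = e ^ (n + 1) * T e t"
      unfolding T_def sum_distrib_left
    proof (intro sum.cong refl, clarify)
      fix i j
      assume "n < fst (i, j) + snd (i, j)"
      then have "i + j = (n + 1) + (i + j - (n + 1))"
        by simp
      then have "e ^ (i + j) = e ^ (n + 1) * e ^ (i + j - (n + 1))"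
        by (metis power_add)
      then show "e ^ (i + j) * (poly (X i) t * poly (Y j) t)
          = e ^ (n + 1) * (e ^ (i + j - (n + 1)) * (poly (X i) t * poly (Y j) t))"
        by (simp only: mult.assoc)
    qed
    also have "sum ?f {p \<in> {..n} \<times> {..n}. fst p + snd p \<le> n} = (\<Sum>s\<le>n. \<Sum>i\<le>s. ?f (i, s - i))"
    proof -
      have "(\<Sum>s\<le>n. \<Sum>i\<le>s. ?f (i, s - i)) = sum (\<lambda>(s, i). ?f (i, s - i)) (Sigma {..n} (\<lambda>s. {..s}))"
        by (rule sum.Sigma) auto
      also have "\<dots> = sum ?f {p \<in> {..n} \<times> {..n}. fst p + snd p \<le> n}"
        by (rule sum.reindex_bij_witness [of _ "\<lambda>(i, j). (i + j, i)" "\<lambda>(s, i). (i, s - i)"]) auto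
      finally show ?thesis by simp
    qed
    also have "\<dots> = truncation n (\<lambda>s. \<Sum>i\<le>s. X i * Y (s - i)) e t"
      by (simp add: truncation_def poly_sum sum_distrib_left)
    finally show ?thesis .
  qed
  show ?thesis
  proof (rule expansionI [of "\<lambda>e t. T e t + truncation n X e t * S e t + R e t * G e t"])
    have "poly_bounded G"
      unfolding S(2) [abs_def] by (intro poly_bounded_intros poly_bounded_truncation S)
    then show "poly_bounded (\<lambda>e t. T e t + truncation n X e t * S e t + R e t * G e t)"
      by (intro poly_bounded_intros poly_bounded_truncation T S R)
  next
    fix e t
    have "F e t * G e t = truncation n X e t * truncation n Y e t
        + e ^ (n + 1) * (truncation n X e t * S e t + R e t * G e t)"
      by (simp only: R(2) [of e t]) (simp only: S(2) [of e t] algebra_simps)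
    then show "F e t * G e t = truncation n (\<lambda>s. \<Sum>i\<le>s. X i * Y (s - i)) e t
        + e ^ (n + 1) * (T e t + truncation n X e t * S e t + R e t * G e t)"
      by (simp only: prod distrib_left add.assoc)
  qed
qed

lemma expansion_poly_mult:
  assumes "expansion n F X"
  shows "expansion n (\<lambda>e t. poly p t * F e t) (\<lambda>s. p * X s)"
proof -
  obtain R where R: "poly_bounded R" "\<And>e t. F e t = truncation n X e t + e ^ (n + 1) * R e t"
    using assms by (metis expansionE)
  show ?thesis
    by (rule expansionI [of "\<lambda>e t. poly p t * R e t"])
      (auto simp: R truncation_def distrib_left sum_distrib_left mult_ac intro!: poly_bounded_intros R)
qed

text \<open>The coefficient of order n moves to order n + 1 and joins the remainder.\<close>

lemma expansion_shift:
  assumes "expansion n F X"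
  shows "expansion n (\<lambda>e t. e * F e t) (\<lambda>s. if s = 0 then 0 else X (s - 1))"
proof -
  obtain R where R: "poly_bounded R" "\<And>e t. F e t = truncation n X e t + e ^ (n + 1) * R e t"
    using assms by (metis expansionE)
  show ?thesis
  proof (rule expansionI [of "\<lambda>e t. poly (X n) t + e * R e t"])
    show "poly_bounded (\<lambda>e t. poly (X n) t + e * R e t)"
      by (intro poly_bounded_intros R)
  next
    fix e t
    have "truncation n (\<lambda>s. if s = 0 then 0 else X (s - 1)) e t = (\<Sum>s<n. e ^ Suc s * poly (X s) t)"
    proof (cases n)
      case 0
      then show ?thesis by (simp add: truncation_def)
    next
      case (Suc k)
      show ?thesis
        unfolding truncation_def Suc sum.atMost_Suc_shift lessThan_Suc_atMost by simp
    qed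
    moreover have "truncation n X e t = (\<Sum>s<n. e ^ s * poly (X s) t) + e ^ n * poly (X n) t"
      by (simp add: truncation_def flip: lessThan_Suc_atMost)
    ultimately show "e * F e t = truncation n (\<lambda>s. if s = 0 then 0 else X (s - 1)) e t
        + e ^ (n + 1) * (poly (X n) t + e * R e t)"
      by (simp add: R(2) algebra_simps sum_distrib_left)
  qed
qed

lemma expansion_vanishing:
  assumes "expansion n F X" "\<And>s. s \<le> n \<Longrightarrow> X s = 0"
  obtains R where "poly_bounded R" "\<And>e t. F e t = e ^ (n + 1) * R e t"
proof -
  obtain R where R: "poly_bounded R" "\<And>e t. F e t = truncation n X e t + e ^ (n + 1) * R e t"
    using assms(1) by (metis expansionE)
  moreover have "truncation n X e t = 0" for e t
    using assms(2) by (simp add: truncation_def)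
  ultimately show ?thesis using that by simp
qed

section \<open>The approximate solutions\<close>

abbreviation expansion_A :: "nat \<Rightarrow> nat \<Rightarrow> real \<Rightarrow> real \<Rightarrow> real" where
  "expansion_A m n \<equiv> truncation n (coeff_A m)"

definition approx :: "nat \<Rightarrow> nat \<Rightarrow> real \<Rightarrow> real \<Rightarrow> real" where
  "approx m n e t = exp (- t\<^sup>2 / 4) * truncation n (amplitude m) e t"

definition dapprox :: "nat \<Rightarrow> nat \<Rightarrow> real \<Rightarrow> real \<Rightarrow> real" where
  "dapprox m n e t = exp (- t\<^sup>2 / 4) * truncation n (\<lambda>s. gauss_deriv (amplitude m s)) e t"

definition ddapprox :: "nat \<Rightarrow> nat \<Rightarrow> real \<Rightarrow> real \<Rightarrow> real" where
  "ddapprox m n e t = exp (- t\<^sup>2 / 4) * truncation n (\<lambda>s. gauss_deriv (gauss_deriv (amplitude m s))) e t"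

lemma truncation_gauss_DERIV:
  "((\<lambda>t. exp (- t\<^sup>2 / 4) * truncation n X e t) has_real_derivative
     exp (- t\<^sup>2 / 4) * truncation n (\<lambda>s. gauss_deriv (X s)) e t) (at t)"
proof -
  have "((\<lambda>t. \<Sum>s\<le>n. e ^ s * (exp (- t\<^sup>2 / 4) * poly (X s) t)) has_real_derivative
      (\<Sum>s\<le>n. e ^ s * (exp (- t\<^sup>2 / 4) * poly (gauss_deriv (X s)) t))) (at t)"
    by (intro DERIV_sum DERIV_cmult gauss_deriv_DERIV)
  then show ?thesis
    by (simp add: truncation_def sum_distrib_left mult.left_commute)
qed

lemma approx_DERIV: "(approx m n e has_real_derivative dapprox m n e t) (at t)"
  using truncation_gauss_DERIV by (simp add: approx_def [abs_def] dapprox_def)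

lemma dapprox_DERIV: "(dapprox m n e has_real_derivative ddapprox m n e t) (at t)"
  using truncation_gauss_DERIV by (simp add: dapprox_def [abs_def] ddapprox_def)

lemma approx_parabolic:
  "approx m n e t = parabolic_D m t * (\<Sum>s\<le>n. e ^ s * poly (coeff_A m s) t)
     + deriv (parabolic_D m) t * (\<Sum>s\<le>n. e ^ s * poly (coeff_B m s) t)"
  by (simp add: approx_def truncation_def amplitude_def parabolic_D_eq deriv_parabolic_D
      algebra_simps sum.distrib sum_distrib_left)

text \<open>The formal expansion of \<Lambda>; its leading term m + 1/2 is the harmonic oscillator
  level belonging to D_m.\<close>

definition approx_eigenvalue :: "nat \<Rightarrow> nat \<Rightarrow> real \<Rightarrow> real" where
  "approx_eigenvalue m n e = real m + 1/2 + (\<Sum>s=1..n. e ^ s * coeff_mu m s)"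

text \<open>The residual of the approximate solution in
  \<open>(1 - e t\<^sup>2/4) u'' - (e t/4) u' - (t\<^sup>2/4 - \<Lambda>) u = 0\<close>, where \<open>e = 1/h\<close>: this is Mathieu's
  equation in the variable \<open>t = 2 h\<^sup>1\<^sup>/\<^sup>2 cos z\<close>.\<close>

definition residual :: "nat \<Rightarrow> nat \<Rightarrow> real \<Rightarrow> real \<Rightarrow> real" where
  "residual m n e t = (1 - e * t\<^sup>2 / 4) * ddapprox m n e t - e * t / 4 * dapprox m n e t
     - (t\<^sup>2 / 4 - approx_eigenvalue m n e) * approx m n e t"

lemma gauss_deriv_mult: "gauss_deriv (p * q) = pderiv p * q + p * gauss_deriv q"
  by (simp add: poly_eq_poly_eq_iff [symmetric] fun_eq_iff gauss_deriv_def pderiv_mult algebra_simps)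

lemma gauss_deriv_add: "gauss_deriv (p + q) = gauss_deriv p + gauss_deriv q"
  by (simp add: gauss_deriv_def pderiv_add algebra_simps smult_add_right)

lemma gauss_deriv_D: "gauss_deriv (a * hermite_He m + b * dHe m)
    = (pderiv a + ttilde m * b) * hermite_He m + (a + pderiv b) * dHe m"
  by (simp add: gauss_deriv_mult gauss_deriv_add gauss_deriv_hermite_He algebra_simps)

lemma pderiv_ttilde: "pderiv (ttilde m) = smult (1/2) [:0, 1:]"
  by (simp add: ttilde_def pderiv_pCons)

text \<open>Coefficient of e^s in \<open>residual\<close>, the Gaussian removed. The terms with
  index s - 1 come from e t^2/4 and e t/4.\<close>

definition residual_coeff :: "nat \<Rightarrow> nat \<Rightarrow> real poly" where
  "residual_coeff m s = gauss_deriv (gauss_deriv (amplitude m s)) - ttilde m * amplitude m s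
     + (\<Sum>j=1..s. smult (coeff_mu m j) (amplitude m (s - j)))
     - (if s = 0 then 0 else smult (1/4) ([:0, 0, 1:] * gauss_deriv (gauss_deriv (amplitude m (s - 1)))
          + [:0, 1:] * gauss_deriv (amplitude m (s - 1))))"

text \<open>Combinations a He_m + b dHe_m are mapped to such combinations by
  \<open>gauss_deriv\<close>. Collecting the two factors in the residual reproduces exactly the two
  identities that define A_s and B_s.\<close>

lemma residual_coeff_0: "residual_coeff m s = 0"
proof (cases "s = 0")
  case True
  have "amplitude m 0 = hermite_He m"
    by (simp add: amplitude_def coeff_A_0 coeff_B_0)
  then show ?thesis
    using True by (simp add: residual_coeff_def gauss_deriv_hermite_He)
next
  case False
  let ?x = "[:0, 1:] :: real poly" and ?T = "ttilde m" and ?H = "hermite_He m" and ?E = "dHe m"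
  define a b a1 b1 where "a = coeff_A m s" and "b = coeff_B m s" and "a1 = coeff_A m (s - 1)"
    and "b1 = coeff_B m (s - 1)"
  define sA sB where "sA = (\<Sum>j=1..s. smult (coeff_mu m j) (coeff_A m (s - j)))"
    and "sB = (\<Sum>j=1..s. smult (coeff_mu m j) (coeff_B m (s - j)))"
  have sum: "(\<Sum>j=1..s. smult (coeff_mu m j) (amplitude m (s - j))) = sA * ?H + sB * ?E"
    by (simp add: amplitude_def sA_def sB_def smult_add_right sum.distrib sum_distrib_right)
  have eq1: "2 * pderiv a + pderiv (pderiv b) - smult (1/4) ?x * (2 * ?x * pderiv a1 + a1
       + ?x * pderiv (pderiv b1) + pderiv b1 + ?T * ?x * b1) + sB = 0"
    and eq2: "pderiv (pderiv a) + 2 * ?T * pderiv b + smult (1/2) ?x * b + sA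
        - smult (1/4) ?x * (?x * pderiv (pderiv a1) + pderiv a1 + smult (1/2) (?x ^ 2) * b1
                + ?T * (?x * a1 + 2 * ?x * pderiv b1 + b1)) = 0"
    using coefficient_system_mu [of m] False
    unfolding coefficient_system_def Let_def a_def b_def a1_def b1_def sA_def sB_def
    by auto
  have xx: "[:0, 0, 1:] = ?x * ?x" by simp
  have dd: "gauss_deriv (gauss_deriv (a * ?H + b * ?E))
      = (pderiv (pderiv a) + 2 * ?T * pderiv b + smult (1/2) ?x * b + ?T * a) * ?H
        + (2 * pderiv a + pderiv (pderiv b) + ?T * b) * ?E" for a b
    by (simp only: gauss_deriv_D pderiv_add pderiv_mult pderiv_ttilde) (simp add: algebra_simps)
  have "residual_coeff m s =
    (pderiv (pderiv a) + 2 * ?T * pderiv b + smult (1/2) ?x * b + sA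
        - smult (1/4) ?x * (?x * pderiv (pderiv a1) + pderiv a1 + smult (1/2) (?x ^ 2) * b1
                + ?T * (?x * a1 + 2 * ?x * pderiv b1 + b1))) * ?H
    + (2 * pderiv a + pderiv (pderiv b) - smult (1/4) ?x * (2 * ?x * pderiv a1 + a1
       + ?x * pderiv (pderiv b1) + pderiv b1 + ?T * ?x * b1) + sB) * ?E" (is "?l = ?r")
  proof -
    have "poly ?l t = poly ?r t" for t
      unfolding residual_coeff_def sum unfolding amplitude_def a_def [symmetric] b_def [symmetric]
        a1_def [symmetric] b1_def [symmetric] dd xx using False
      by (simp only: False gauss_deriv_D if_False poly_add poly_diff poly_mult poly_smult poly_power power2_eq_square,
          simp only: algebra_simps, simp?)
    then show ?thesis by (simp add: poly_eq_poly_eq_iff [symmetric] fun_eq_iff)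
  qed
  also have "\<dots> = 0" by (simp only: eq1 eq2, simp?)
  finally show ?thesis .
qed

text \<open>The operator is assembled from truncations by the expansion calculus. Its coefficients
  up to e^n vanish, and whatever the products of truncated series create beyond order n is collected
  in R.\<close>

lemma residual_bound:
  obtains R where "poly_bounded R" "\<And>e t. residual m n e t = e ^ (n + 1) * (exp (- t\<^sup>2 / 4) * R e t)"
proof -
  let ?a = "amplitude m"
  \<comment> \<open>The entry at 0 vanishes because the leading term m + 1/2 is already contained in
    \<open>ttilde\<close>.\<close>
  let ?mu = "\<lambda>s. if s = 0 then 0 else [:coeff_mu m s:]"
  define U U' U'' where "U = truncation n ?a" and "U' = truncation n (\<lambda>s. gauss_deriv (?a s))"
    and "U'' = truncation n (\<lambda>s. gauss_deriv (gauss_deriv (?a s)))"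
  have exps: "expansion n U ?a" "expansion n U' (\<lambda>s. gauss_deriv (?a s))"
    "expansion n U'' (\<lambda>s. gauss_deriv (gauss_deriv (?a s)))"
    by (simp_all only: U_def U'_def U''_def expansion_truncation)
  note E = expansion_add [OF
      expansion_add [OF expansion_add [OF exps(3) expansion_poly_mult [OF exps(1), of "- ttilde m"]]
        expansion_mult [OF expansion_truncation [of n ?mu] exps(1)]]
      expansion_shift [OF expansion_add [OF expansion_poly_mult [OF exps(3), of "[:0, 0, -1/4:]"]
        expansion_poly_mult [OF exps(2), of "[:0, -1/4:]"]]]]
  have "(gauss_deriv (gauss_deriv (?a s)) + - ttilde m * ?a s + (\<Sum>i\<le>s. ?mu i * ?a (s - i)))
      + (if s = 0 then 0 else [:0, 0, -1/4:] * gauss_deriv (gauss_deriv (?a (s - 1)))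
           + [:0, -1/4:] * gauss_deriv (?a (s - 1))) = 0" (is "?l = 0") for s
  proof -
    have mu: "(\<Sum>i\<le>s. ?mu i * ?a (s - i)) = (\<Sum>j=1..s. smult (coeff_mu m j) (?a (s - j)))"
      unfolding atLeast0AtMost [symmetric] by (subst sum.atLeast_Suc_atMost) auto
    have pq: "[:0, 0, -1/4:] * p + [:0, -1/4:] * q = - smult (1/4) ([:0, 0, 1:] * p + [:0, 1:] * q)"
      for p q :: "real poly"
      by (simp add: poly_eq_poly_eq_iff [symmetric] fun_eq_iff field_simps)
    have "?l = residual_coeff m s"
      unfolding residual_coeff_def mu pq
      by (cases "s = 0") (simp_all only: if_True if_False refl diff_conv_add_uminus mult_minus_left simp_thms minus_zero)
    then show ?thesis
      by (simp only: residual_coeff_0)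
  qed
  note van = this
  obtain R where R: "poly_bounded R"
    "\<And>e t. (U'' e t + poly (- ttilde m) t * U e t + truncation n ?mu e t * U e t)
      + e * (poly [:0, 0, -1/4:] t * U'' e t + poly [:0, -1/4:] t * U' e t) = e ^ (n + 1) * R e t"
    by (rule expansion_vanishing [OF E, OF van]) (rule that)
  show ?thesis
  proof (rule that [OF R(1)])
    fix e t
    have "truncation n ?mu e t = (\<Sum>s=1..n. e ^ s * coeff_mu m s)"
      unfolding truncation_def atLeast0AtMost [symmetric] by (subst sum.atLeast_Suc_atMost) auto
    then have ev: "approx_eigenvalue m n e = real m + 1/2 + truncation n ?mu e t"
      by (simp add: approx_eigenvalue_def)
    have u: "ddapprox m n e t = exp (- t\<^sup>2 / 4) * U'' e t" "dapprox m n e t = exp (- t\<^sup>2 / 4) * U' e t"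
      "approx m n e t = exp (- t\<^sup>2 / 4) * U e t"
      by (simp_all only: U_def U'_def U''_def approx_def dapprox_def ddapprox_def)
    have ring: "(1 - e * x / 4) * (w * a2) - e * t / 4 * (w * a1) - (x / 4 - (p + q)) * (w * a0)
        = w * ((a2 + (p - x / 4) * a0 + q * a0) + e * (- (x / 4) * a2 + - (t / 4) * a1))"
      for x w a0 a1 a2 p q :: real
      by (simp add: field_simps)
    have p: "poly (- ttilde m) t = real m + 1/2 - t\<^sup>2 / 4" "poly [:0, 0, -1/4:] t = - (t\<^sup>2 / 4)" "poly [:0, -1/4:] t = - (t / 4)"
      by (simp_all add: ttilde_def power2_eq_square)
    have "residual m n e t = exp (- t\<^sup>2 / 4) * ((U'' e t + poly (- ttilde m) t * U e t + truncation n ?mu e t * U e t)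
      + e * (poly [:0, 0, -1/4:] t * U'' e t + poly [:0, -1/4:] t * U' e t))"
      unfolding residual_def ev u p by (rule ring)
    then show "residual m n e t = e ^ (n + 1) * (exp (- t\<^sup>2 / 4) * R e t)"
      by (simp only: R(2)) simp
  qed
qed

lemma approx_minus: "approx m n e (- t) = (- 1) ^ m * approx m n e t"
proof -
  have "poly (amplitude m s) (- t) = (- 1) ^ m * poly (amplitude m s) t" for s
    using even_coeff_A [of m s] odd_coeff_B [of m s]
    by (simp add: amplitude_def even_poly_def odd_poly_def hermite_He_minus dHe_minus algebra_simps)
  then show ?thesis
    by (simp add: approx_def truncation_def sum_distrib_left mult_ac)
qed

lemma truncation_split:
  "truncation n X e t = poly (X 0) t + e * (\<Sum>s=1..n. e ^ (s - 1) * poly (X s) t)"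
proof -
  have "(\<Sum>s=Suc 0..n. e ^ s * poly (X s) t) = (\<Sum>s=Suc 0..n. e * (e ^ (s - 1) * poly (X s) t))"
  proof (rule sum.cong [OF refl])
    fix s assume "s \<in> {Suc 0..n}"
    then show "e ^ s * poly (X s) t = e * (e ^ (s - 1) * poly (X s) t)"
      by (cases s) auto
  qed
  then show ?thesis
    unfolding truncation_def atLeast0AtMost [symmetric] sum_distrib_left
    by (subst sum.atLeast_Suc_atMost) auto
qed

lemma approx_first_order:
  obtains R where "poly_bounded R" "\<And>e t. approx m n e t = parabolic_D m t + e * (exp (- t\<^sup>2 / 4) * R e t)"
proof -
  have "truncation n (amplitude m) e t = poly (hermite_He m) t + e * (\<Sum>s=1..n. e ^ (s - 1) * poly (amplitude m s) t)" for e t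
    by (subst truncation_split) (simp add: amplitude_def coeff_A_0 coeff_B_0)
  then have "approx m n e t = parabolic_D m t
      + e * (exp (- t\<^sup>2 / 4) * (\<Sum>s=1..n. e ^ (s - 1) * poly (amplitude m s) t))" for e t
    by (simp add: approx_def parabolic_D_eq algebra_simps)
  moreover have "poly_bounded (\<lambda>e t. \<Sum>s=1..n. e ^ (s - 1) * poly (amplitude m s) t)"
    by (intro poly_bounded_intros)
  ultimately show ?thesis using that by blast
qed

lemma dapprox_first_order:
  obtains R where "poly_bounded R" "\<And>e t. dapprox m n e t = deriv (parabolic_D m) t + e * (exp (- t\<^sup>2 / 4) * R e t)"
proof -
  have "truncation n (\<lambda>s. gauss_deriv (amplitude m s)) e t = poly (dHe m) t
      + e * (\<Sum>s=1..n. e ^ (s - 1) * poly (gauss_deriv (amplitude m s)) t)" for e t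
    by (subst truncation_split) (simp add: amplitude_def coeff_A_0 coeff_B_0)
  then have "dapprox m n e t = deriv (parabolic_D m) t
      + e * (exp (- t\<^sup>2 / 4) * (\<Sum>s=1..n. e ^ (s - 1) * poly (gauss_deriv (amplitude m s)) t))" for e t
    by (simp add: dapprox_def deriv_parabolic_D algebra_simps)
  moreover have "poly_bounded (\<lambda>e t. \<Sum>s=1..n. e ^ (s - 1) * poly (gauss_deriv (amplitude m s)) t)"
    by (intro poly_bounded_intros)
  ultimately show ?thesis using that by blast
qed

section \<open>Gaussian decay against polynomial growth\<close>

lemma power_le_fact_exp:
  assumes "(y::real) \<ge> 0"
  shows "y ^ N \<le> fact N * exp y"
proof -
  define f where "f i = y ^ i /\<^sub>R fact i" for i
  have f: "f sums exp y"
    unfolding f_def [abs_def] by (rule exp_converges)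
  have "f i \<ge> 0" for i
    using assms by (simp add: f_def)
  then have "sum f {N} \<le> suminf f"
    using f by (intro sum_le_suminf) (auto intro: sums_summable)
  then have "f N \<le> exp y"
    using f by (simp add: sums_unique [symmetric])
  then show ?thesis
    by (simp add: f_def field_simps)
qed

lemma growth_exp_bounded: "\<exists>K\<ge>0. \<forall>t::real. (1 + t\<^sup>2) ^ N * exp (- t\<^sup>2 / 4) \<le> K"
proof (intro exI conjI allI)
  fix t :: real
  \<comment> \<open>In terms of y the Gaussian is exp(1/4 - y), so the bound y^N \<le> N! exp(y)
    cancels it exactly.\<close>
  define y where "y = (1 + t\<^sup>2) / 4"
  have y: "y \<ge> 0" by (simp add: y_def)
  have t: "1 + t\<^sup>2 = 4 * y" "- t\<^sup>2 / 4 = 1/4 - y" by (simp_all add: y_def field_simps)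
  have "(1 + t\<^sup>2) ^ N * exp (- t\<^sup>2 / 4) = 4 ^ N * (y ^ N * exp (1/4 - y))"
    unfolding t power_mult_distrib by (rule mult.assoc)
  also have "\<dots> \<le> 4 ^ N * ((fact N * exp y) * exp (1/4 - y))"
    by (intro mult_left_mono mult_right_mono power_le_fact_exp y) auto
  also have "\<dots> = 4 ^ N * (fact N * exp (1/4))"
    by (simp only: mult.assoc exp_add [symmetric]) simp
  finally show "(1 + t\<^sup>2) ^ N * exp (- t\<^sup>2 / 4) \<le> 4 ^ N * (fact N * exp (1/4))" .
qed simp

text \<open>The exponent j is free: 0 serves for plain boundedness, 1 gives integrability over the
  growing interval uniformly in h, and larger values make boundary terms smaller than any prescribed
  power of 1/h.\<close>

lemma poly_bounded_gauss:
  assumes "poly_bounded R"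
  shows "\<exists>K\<ge>0. \<forall>e t. 0 < e \<longrightarrow> e \<le> 1 \<longrightarrow> \<bar>exp (- t\<^sup>2 / 4) * R e t\<bar> \<le> K / (1 + t\<^sup>2) ^ j"
proof -
  obtain K N where K: "K \<ge> 0" "\<And>e t. 0 < e \<Longrightarrow> e \<le> 1 \<Longrightarrow> \<bar>R e t\<bar> \<le> K * (1 + t\<^sup>2) ^ N"
    using assms unfolding poly_bounded_def by metis
  obtain L where L: "L \<ge> 0" "\<And>t::real. (1 + t\<^sup>2) ^ (N + j) * exp (- t\<^sup>2 / 4) \<le> L"
    using growth_exp_bounded by metis
  show ?thesis
  proof (intro exI [of _ "K * L"] conjI allI impI)
    show "0 \<le> K * L" using K L by simp
    fix e t :: real
    assume e: "0 < e" "e \<le> 1"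
    have p: "0 < (1 + t\<^sup>2) ^ j"
      by (intro zero_less_power) (metis add_pos_nonneg zero_le_power2 zero_less_one)
    have "\<bar>exp (- t\<^sup>2 / 4) * R e t\<bar> * (1 + t\<^sup>2) ^ j \<le> exp (- t\<^sup>2 / 4) * (K * (1 + t\<^sup>2) ^ N) * (1 + t\<^sup>2) ^ j"
      unfolding abs_mult using K(2) [OF e, of t] by (intro mult_right_mono) auto
    also have "\<dots> = K * ((1 + t\<^sup>2) ^ (N + j) * exp (- t\<^sup>2 / 4))"
      by (simp add: power_add mult_ac)
    also have "\<dots> \<le> K * L"
      using K L by (intro mult_left_mono) auto
    finally show "\<bar>exp (- t\<^sup>2 / 4) * R e t\<bar> \<le> K * L / (1 + t\<^sup>2) ^ j"
      using p by (simp add: pos_le_divide_eq)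
  qed
qed

section \<open>Comparison arguments for second-order equations\<close>

text \<open>(f f')' = f'^2 + V f^2.\<close>

lemma product_nondecreasing:
  fixes f f' V :: "real \<Rightarrow> real"
  assumes "\<And>s. s \<in> {a..b} \<Longrightarrow> (f has_real_derivative f' s) (at s)"
    and "\<And>s. s \<in> {a..b} \<Longrightarrow> (f' has_real_derivative V s * f s) (at s)"
    and "\<And>s. s \<in> {a..b} \<Longrightarrow> V s \<ge> 0"
    and "a \<le> x" "x \<le> y" "y \<le> b"
  shows "f x * f' x \<le> f y * f' y"
proof (rule DERIV_nonneg_imp_nondecreasing [OF \<open>x \<le> y\<close>])
  fix s
  assume "x \<le> s" "s \<le> y"
  then have s: "s \<in> {a..b}" using assms by auto
  have "((\<lambda>s. f s * f' s) has_real_derivative f' s * f' s + V s * f s * f s) (at s)"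
    by (rule DERIV_mult [OF assms(1,2) [OF s]])
  moreover have "f' s * f' s + V s * f s * f s \<ge> 0"
    using assms(3) [OF s] by (simp add: mult.assoc)
  ultimately show "\<exists>D. ((\<lambda>s. f s * f' s) has_real_derivative D) (at s) \<and> 0 \<le> D"
    by blast
qed

text \<open>f f' is nondecreasing, yet runs from a nonnegative to a nonpositive value, so it
  vanishes identically. Its derivative f'^2 + V f^2 is then 0 at the midpoint, where V > 0. For a
  nontrivial solution the conclusion is a contradiction.\<close>

lemma double_zero_of_boundary_signs:
  fixes f f' V :: "real \<Rightarrow> real"
  assumes d: "\<And>s. s \<in> {a..b} \<Longrightarrow> (f has_real_derivative f' s) (at s)"
      "\<And>s. s \<in> {a..b} \<Longrightarrow> (f' has_real_derivative V s * f s) (at s)"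
    and V: "\<And>s. s \<in> {a..b} \<Longrightarrow> V s \<ge> 0" "\<And>s. s \<in> {a<..<b} \<Longrightarrow> V s > 0"
    and "a < b" "f a * f' a \<ge> 0" "f b * f' b \<le> 0"
  shows "\<exists>s\<in>{a<..<b}. f s = 0 \<and> f' s = 0"
proof -
  have zero: "f s * f' s = 0" if "s \<in> {a..b}" for s
  proof -
    have "f a * f' a \<le> f s * f' s"
      by (rule product_nondecreasing [OF d V(1), of a b]) (use that \<open>a < b\<close> in simp_all)
    moreover have "f s * f' s \<le> f b * f' b"
      by (rule product_nondecreasing [OF d V(1), of a b]) (use that \<open>a < b\<close> in simp_all)
    ultimately show ?thesis using assms(6,7) by linarith
  qed
  let ?c = "(a + b) / 2"
  have c: "?c \<in> {a<..<b}" "?c \<in> {a..b}" using \<open>a < b\<close> by auto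
  have "((\<lambda>s. f s * f' s) has_real_derivative f' ?c * f' ?c + V ?c * f ?c * f ?c) (at ?c)"
    by (rule DERIV_mult [OF d [OF c(2)]])
  moreover have "((\<lambda>s. f s * f' s) has_real_derivative 0) (at ?c)"
  proof -
    have "eventually (\<lambda>s. s \<in> {a<..<b}) (nhds ?c)"
      using c(1) by (intro eventually_nhds_in_open) auto
    then have "eventually (\<lambda>s. f s * f' s = 0) (nhds ?c)"
      by eventually_elim (rule zero, simp)
    from DERIV_cong_ev [OF refl this refl, of 0] show ?thesis by simp
  qed
  ultimately have "f' ?c * f' ?c + V ?c * f ?c * f ?c = 0"
    by (rule DERIV_unique)
  moreover have "V ?c * f ?c * f ?c \<ge> 0"
    using V(1) [OF c(2)] by (simp add: mult.assoc)
  moreover have "f' ?c * f' ?c \<ge> 0" by simp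
  ultimately have "f' ?c * f' ?c = 0" "V ?c * f ?c * f ?c = 0"
    by linarith+
  with V(2) [OF c(1)] have "f ?c = 0 \<and> f' ?c = 0" by simp
  with c(1) show ?thesis by blast
qed

text \<open>Gronwall for E = f^2 + f'^2. The constant 2 + M collects 2 f f' \<le> E, 2 V f f' \<le>
  M E and the part f'^2 of 2 f' r \<le> f'^2 + r^2.\<close>

lemma energy_growth:
  fixes f f' V r :: "real \<Rightarrow> real"
  assumes d: "\<And>s. s \<in> {a..b} \<Longrightarrow> (f has_real_derivative f' s) (at s)"
      "\<And>s. s \<in> {a..b} \<Longrightarrow> (f' has_real_derivative V s * f s + r s) (at s)"
    and V: "\<And>s. s \<in> {a..b} \<Longrightarrow> \<bar>V s\<bar> \<le> M" and r: "\<And>s. s \<in> {a..b} \<Longrightarrow> \<bar>r s\<bar> \<le> \<rho>"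
    and "a \<le> b"
  shows "(f b)\<^sup>2 + (f' b)\<^sup>2 \<le> ((f a)\<^sup>2 + (f' a)\<^sup>2 + \<rho>\<^sup>2 * (b - a)) * exp ((2 + M) * (b - a))"
proof -
  let ?E = "\<lambda>s. (f s)\<^sup>2 + (f' s)\<^sup>2" and ?c = "2 + M"
  define G where "G s = ?E s * exp (- ?c * (s - a)) - \<rho>\<^sup>2 * (s - a)" for s
  have M: "M \<ge> 0" using V [of a] \<open>a \<le> b\<close> by fastforce
  have "G b \<le> G a"
  proof (rule DERIV_nonpos_imp_nonincreasing [OF \<open>a \<le> b\<close>])
    fix s
    assume "a \<le> s" "s \<le> b"
    then have s: "s \<in> {a..b}" by auto
    let ?E' = "2 * f s * f' s + 2 * f' s * (V s * f s + r s)"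
    let ?x = "exp (- ?c * (s - a))"
    have "(G has_real_derivative (?E' - ?c * ?E s) * ?x - \<rho>\<^sup>2) (at s)"
      unfolding G_def using d [OF s]
      by (auto intro!: derivative_eq_intros simp: algebra_simps)
    moreover have "(?E' - ?c * ?E s) * ?x - \<rho>\<^sup>2 \<le> 0"
    proof -
      have "2 * f s * f' s \<le> ?E s"
        using sum_squares_bound [of "f s" "f' s"] by simp
      moreover have "2 * f' s * (V s * f s) \<le> M * ?E s"
      proof -
        have "2 * f' s * (V s * f s) \<le> \<bar>V s\<bar> * (2 * \<bar>f s\<bar> * \<bar>f' s\<bar>)"
          using abs_ge_self [of "2 * f' s * (V s * f s)"] by (simp add: abs_mult mult_ac)
        also have "\<dots> \<le> M * ?E s"
          using V [OF s] sum_squares_bound [of "\<bar>f s\<bar>" "\<bar>f' s\<bar>"] by (intro mult_mono) auto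
        finally show ?thesis .
      qed
      moreover have "2 * f' s * r s \<le> (f' s)\<^sup>2 + (r s)\<^sup>2"
        using sum_squares_bound [of "f' s" "r s"] by simp
      moreover have "(r s)\<^sup>2 \<le> \<rho>\<^sup>2"
        using r [OF s] by (metis abs_ge_zero power2_abs power_mono)
      ultimately have "?E' - ?c * ?E s \<le> \<rho>\<^sup>2"
        using zero_le_power2 [of "f s"] unfolding distrib_left distrib_right by linarith
      then have "(?E' - ?c * ?E s) * ?x \<le> \<rho>\<^sup>2 * ?x"
        by (rule mult_right_mono) simp
      also have "\<dots> \<le> \<rho>\<^sup>2 * 1"
        using s M by (intro mult_left_mono) (auto intro!: mult_nonpos_nonneg)
      finally show ?thesis by simp
    qed
    ultimately show "\<exists>D. (G has_real_derivative D) (at s) \<and> D \<le> 0" by blast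
  qed
  then have "?E b * exp (- ?c * (b - a)) \<le> ?E a + \<rho>\<^sup>2 * (b - a)"
    by (simp add: G_def)
  then have "?E b * exp (- ?c * (b - a)) * exp (?c * (b - a)) \<le> (?E a + \<rho>\<^sup>2 * (b - a)) * exp (?c * (b - a))"
    by (rule mult_right_mono) simp
  moreover have "exp (- ?c * (b - a)) * exp (?c * (b - a)) = 1"
    by (simp only: exp_add [symmetric]) (simp add: algebra_simps)
  ultimately show ?thesis
    by (simp only: mult.assoc mult_1_right)
qed

text \<open>\<open>energy_growth\<close> without forcing, applied to the reflected solution f(a + b
  - s).\<close>

lemma energy_lower:
  fixes f f' V :: "real \<Rightarrow> real"
  assumes d: "\<And>s. s \<in> {a..b} \<Longrightarrow> (f has_real_derivative f' s) (at s)"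
      "\<And>s. s \<in> {a..b} \<Longrightarrow> (f' has_real_derivative V s * f s) (at s)"
    and V: "\<And>s. s \<in> {a..b} \<Longrightarrow> \<bar>V s\<bar> \<le> M" and "a \<le> b"
  shows "(f a)\<^sup>2 + (f' a)\<^sup>2 \<le> ((f b)\<^sup>2 + (f' b)\<^sup>2) * exp ((2 + M) * (b - a))"
proof -
  define g where "g s = f (a + b - s)" for s
  define g' where "g' s = - f' (a + b - s)" for s
  have "(g b)\<^sup>2 + (g' b)\<^sup>2 \<le> ((g a)\<^sup>2 + (g' a)\<^sup>2 + 0\<^sup>2 * (b - a)) * exp ((2 + M) * (b - a))"
  proof (rule energy_growth [where V = "\<lambda>s. V (a + b - s)" and r = "\<lambda>s. 0"])
    fix s assume s: "s \<in> {a..b}"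
    then have s': "a + b - s \<in> {a..b}" by auto
    have l: "((\<lambda>s. a + b - s) has_real_derivative -1) (at s)"
      by (auto intro!: derivative_eq_intros)
    show "(g has_real_derivative g' s) (at s)"
      unfolding g_def [abs_def] g'_def
      using DERIV_chain2 [OF d(1) [OF s'] l] by simp
    show "(g' has_real_derivative V (a + b - s) * g s + 0) (at s)"
      unfolding g_def g'_def [abs_def]
      using DERIV_minus [OF DERIV_chain2 [OF d(2) [OF s'] l]] by simp
    show "\<bar>V (a + b - s)\<bar> \<le> M" by (rule V [OF s'])
  qed (use \<open>a \<le> b\<close> in auto)
  then show ?thesis by (simp add: g_def g'_def)
qed

lemma nonzero_imp_same_sign:
  fixes f :: "real \<Rightarrow> real"
  assumes "continuous_on {a..b} f" "\<And>s. s \<in> {a..b} \<Longrightarrow> f s \<noteq> 0" "x \<in> {a..b}" "y \<in> {a..b}"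
  shows "f x * f y > 0"
proof (rule ccontr)
  assume "\<not> f x * f y > 0"
  moreover have "f x * f y \<noteq> 0" using assms by auto
  ultimately have neg: "f x * f y < 0" by linarith
  have conn: "connected (f ` {a..b})"
    by (intro connected_continuous_image assms connected_Icc)
  have ivt: "0 \<in> f ` {a..b}" if "p \<in> {a..b}" "q \<in> {a..b}" "f p < 0" "f q > 0" for p q
    by (rule connectedD_interval [OF conn, of "f p" "f q"]) (use that in auto)
  from neg have "0 \<in> f ` {a..b}"
    using ivt [of x y] ivt [of y x] assms(3,4) by (auto simp only: mult_less_0_iff)
  with assms(2) show False by auto
qed

text \<open>Comparison with sin(N(s - a)), which is positive between a and b = a + pi/N. If f had no
  zero, the Wronskian, multiplied by f(a) to fix its sign, would be nondecreasing, while it goes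
  from N f(a)^2 > 0 to -N f(a) f(b) < 0.\<close>

lemma sturm_zero:
  fixes f f' V :: "real \<Rightarrow> real"
  assumes d: "\<And>s. s \<in> {a..a + pi / N} \<Longrightarrow> (f has_real_derivative f' s) (at s)"
      "\<And>s. s \<in> {a..a + pi / N} \<Longrightarrow> (f' has_real_derivative V s * f s) (at s)"
    and V: "\<And>s. s \<in> {a..a + pi / N} \<Longrightarrow> V s \<le> - N\<^sup>2" and "N > 0"
  shows "\<exists>s\<in>{a..a + pi / N}. f s = 0"
proof (rule ccontr)
  let ?b = "a + pi / N"
  assume "\<not> (\<exists>s\<in>{a..?b}. f s = 0)"
  then have nz: "f s \<noteq> 0" if "s \<in> {a..?b}" for s using that by blast
  have ab: "a \<le> ?b" using \<open>N > 0\<close> by simp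
  have cont: "continuous_on {a..?b} f"
    by (intro DERIV_atLeastAtMost_imp_continuous_on) (use d(1) in force)
  have sgn: "f a * f s > 0" if "s \<in> {a..?b}" for s
    using nonzero_imp_same_sign [OF cont nz, of a s] that ab by auto
  define W where "W s = f a * (f s * (N * cos (N * (s - a))) - f' s * sin (N * (s - a)))" for s
  have "W a \<le> W ?b"
  proof (rule DERIV_nonneg_imp_nondecreasing [OF ab])
    fix s assume "a \<le> s" "s \<le> ?b"
    then have s: "s \<in> {a..?b}" by auto
    have "(W has_real_derivative f a * ((- N\<^sup>2 - V s) * f s * sin (N * (s - a)))) (at s)"
      unfolding W_def using d [OF s]
      by (auto intro!: derivative_eq_intros simp: algebra_simps power2_eq_square)
    moreover have "f a * ((- N\<^sup>2 - V s) * f s * sin (N * (s - a))) \<ge> 0"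
    proof -
      have "0 \<le> N * (s - a)" "N * (s - a) \<le> pi"
        using s \<open>N > 0\<close> by (auto simp: field_simps)
      then have sin: "sin (N * (s - a)) \<ge> 0" by (rule sin_ge_zero)
      have "(f a * f s) * ((- N\<^sup>2 - V s) * sin (N * (s - a))) \<ge> 0"
        by (rule mult_nonneg_nonneg [OF less_imp_le [OF sgn [OF s]] mult_nonneg_nonneg [OF _ sin]])
          (use V [OF s] in auto)
      then show ?thesis by (simp add: mult_ac)
    qed
    ultimately show "\<exists>D. (W has_real_derivative D) (at s) \<and> 0 \<le> D" by blast
  qed
  moreover have "W a = N * (f a * f a)" "W ?b = - N * (f a * f ?b)"
    using \<open>N > 0\<close> by (simp_all add: W_def)
  moreover have "N * (f a * f a) > 0" "N * (f a * f ?b) > 0"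
    using sgn [of a] sgn [of ?b] ab \<open>N > 0\<close> by auto
  ultimately show False by linarith
qed

section \<open>Mathieu's equation in the scaled variable\<close>

text \<open>With \<open>s = 2 h\<^sup>1\<^sup>/\<^sup>2 (\<pi>/2 - z)\<close> the variable \<open>t = 2 h\<^sup>1\<^sup>/\<^sup>2 cos z\<close> is \<open>tvar h s\<close>, and Mathieu's
  equation becomes \<open>f'' = (t\<^sup>2/4 - \<Lambda>) f\<close> on \<open>\<bar>s\<bar> \<le> \<pi> h\<^sup>1\<^sup>/\<^sup>2\<close>, where \<open>\<Lambda> = (\<lambda> + 2h\<^sup>2) / (4h)\<close>.\<close>

definition tvar :: "real \<Rightarrow> real \<Rightarrow> real" where
  "tvar h s = 2 * sqrt h * sin (s / (2 * sqrt h))"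

lemma tvar_0 [simp]: "tvar h 0 = 0"
  by (simp add: tvar_def)

lemma tvar_minus: "tvar h (- s) = - tvar h s"
  by (simp add: tvar_def)

lemma tvar_DERIV:
  assumes "h > 0"
  shows "(tvar h has_real_derivative cos (s / (2 * sqrt h))) (at s)"
  unfolding tvar_def [abs_def] using assms
  by (auto intro!: derivative_eq_intros simp: field_simps)

lemma continuous_on_tvar: "continuous_on A (tvar h)"
  unfolding tvar_def [abs_def] divide_inverse
  by (intro continuous_on_mult continuous_on_const continuous_on_sin continuous_on_id)

lemma tvar_cos:
  assumes "h > 0"
  shows "(cos (s / (2 * sqrt h)))\<^sup>2 = 1 - (tvar h s)\<^sup>2 / (4 * h)"
  using assms by (simp add: tvar_def cos_squared_eq power_mult_distrib field_simps)

lemma abs_tvar_le: "h > 0 \<Longrightarrow> \<bar>tvar h s\<bar> \<le> \<bar>s\<bar>"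
proof -
  assume h: "h > 0"
  have "\<bar>sin (s / (2 * sqrt h))\<bar> \<le> \<bar>s / (2 * sqrt h)\<bar>"
    by (rule abs_sin_x_le_abs_x)
  then have "2 * sqrt h * \<bar>sin (s / (2 * sqrt h))\<bar> \<le> 2 * sqrt h * \<bar>s / (2 * sqrt h)\<bar>"
    using h by (intro mult_left_mono) auto
  then show ?thesis using h by (simp add: tvar_def abs_mult abs_divide)
qed

text \<open>Up to pi/3 the derivative cos x - 1/2 is nonnegative. From there to pi/2 the sine is at
  least sqrt 3 / 2 \<ge> 0.85, while x/2 \<le> pi/4 < 0.8.\<close>

lemma half_le_sin:
  assumes "0 \<le> x" "x \<le> pi / 2"
  shows "x / 2 \<le> sin x"
proof (cases "x \<le> pi / 3")
  case True
  have "sin 0 - 0 / 2 \<le> sin x - x / 2"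
  proof (rule DERIV_nonneg_imp_nondecreasing [OF assms(1)])
    fix y :: real assume y: "0 \<le> y" "y \<le> x"
    have "cos (pi / 3) \<le> cos y"
      using y True by (intro cos_monotone_0_pi_le) auto
    then have "0 \<le> cos y - 1 / 2" by (simp add: cos_60)
    moreover have "((\<lambda>x. sin x - x / 2) has_real_derivative cos y - 1 / 2) (at y)"
      by (auto intro!: derivative_eq_intros)
    ultimately show "\<exists>D. ((\<lambda>x. sin x - x / 2) has_real_derivative D) (at y) \<and> 0 \<le> D" by blast
  qed
  then show ?thesis by simp
next
  case False
  have "sin (pi / 3) \<le> sin x"
    using False assms by (intro sin_monotone_2pi_le) auto
  moreover have "sin (pi / 3) = sqrt 3 / 2" by (rule sin_60)
  moreover have "sqrt 3 \<ge> 17 / 10"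
    by (rule real_le_rsqrt) (simp add: power2_eq_square)
  moreover have "pi < 32 / 10" using pi_approx by simp
  ultimately show ?thesis using assms by linarith
qed

text \<open>Allows decay in t to be read as decay in s up to the ends of the interval, where t is no
  longer close to s.\<close>

lemma abs_tvar_ge:
  assumes "h > 0" "\<bar>s\<bar> \<le> pi * sqrt h"
  shows "\<bar>s\<bar> / 2 \<le> \<bar>tvar h s\<bar>"
proof -
  have *: "s / 2 \<le> tvar h s" if "0 \<le> s" "s \<le> pi * sqrt h" for s
  proof -
    have "(s / (2 * sqrt h)) / 2 \<le> sin (s / (2 * sqrt h))"
      using that assms by (intro half_le_sin) (auto simp: field_simps)
    then show ?thesis using assms by (simp add: tvar_def field_simps)
  qed
  show ?thesis
    using * [of s] * [of "- s"] assms by (cases "s \<ge> 0") (auto simp: tvar_minus)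
qed

lemma tvar_ge: "h > 0 \<Longrightarrow> 0 \<le> s \<Longrightarrow> s \<le> pi * sqrt h \<Longrightarrow> s / 2 \<le> tvar h s"
proof -
  assume a: "h > 0" "0 \<le> s" "s \<le> pi * sqrt h"
  then have "0 \<le> s / (2 * sqrt h)" "s / (2 * sqrt h) \<le> pi"
    by (auto simp: field_simps mult_left_mono)
  then have "tvar h s \<ge> 0" using a by (simp add: tvar_def sin_ge_zero)
  then show ?thesis using abs_tvar_ge [of h s] a by auto
qed

lemma tvar_strict_mono:
  assumes "h > 0" "- (pi * sqrt h) \<le> x" "x < y" "y \<le> pi * sqrt h"
  shows "tvar h x < tvar h y"
proof -
  have "sin (x / (2 * sqrt h)) < sin (y / (2 * sqrt h))"
    using assms by (intro sin_monotone_2pi) (auto simp: field_simps)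
  then show ?thesis using assms by (simp add: tvar_def)
qed

lemma tvar_end: "h > 0 \<Longrightarrow> tvar h (pi * sqrt h) = 2 * sqrt h" "h > 0 \<Longrightarrow> cos (pi * sqrt h / (2 * sqrt h)) = 0"
  by (simp_all add: tvar_def)

text \<open>64 (m+1)^2 is N^2 for N = 8 (m+1), a frequency high enough to force m + 1 zeros in
  [0, 1]. The additional 1 covers t^2/4 for |s| \<le> 1.\<close>

definition lam_bound :: "nat \<Rightarrow> real" where
  "lam_bound m = 64 * (real m + 1)\<^sup>2 + 1"

text \<open>Since t \<ge> s/2, beyond this point t^2/4 is at least the square of
  \<open>lam_bound m + 1\<close>, so t^2/4 - \<Lambda> \<ge> 1.\<close>

definition turn :: "nat \<Rightarrow> real" where
  "turn m = 4 * (lam_bound m + 1)"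

lemma turn_pos: "turn m > 0" "lam_bound m \<ge> 1"
  by (auto simp: turn_def lam_bound_def intro: add_nonneg_pos)

text \<open>The common form of both kinds of eigenfunction. The product in \<open>boundary\<close>
  covers f = 0 as well as f' = 0; the Cauchy data at 0 are normalised, rather than the L^2 norm, to
  suit Gronwall estimates started at 0; \<open>wide\<close> keeps \<open>turn m + 2\<close> within
  the inner half of the interval.\<close>

locale mathieu_mode =
  fixes m :: nat and h \<Lambda> :: real and f f' :: "real \<Rightarrow> real"
  assumes h: "h \<ge> 1" and wide: "2 * turn m + 4 \<le> pi * sqrt h"
    and DERIV_f: "\<And>s. (f has_real_derivative f' s) (at s)"
    and DERIV_f': "\<And>s. (f' has_real_derivative ((tvar h s)\<^sup>2 / 4 - \<Lambda>) * f s) (at s)"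
    and parity: "(\<forall>s. f (- s) = f s) \<or> (\<forall>s. f (- s) = - f s)"
    and boundary: "f (pi * sqrt h) * f' (pi * sqrt h) = 0"
    and normalized: "(f 0)\<^sup>2 + (f' 0)\<^sup>2 = 1"
    and zeros: "finite {s. \<bar>s\<bar> < pi * sqrt h \<and> f s = 0}" "card {s. \<bar>s\<bar> < pi * sqrt h \<and> f s = 0} = m"
begin

abbreviation b :: real where "b \<equiv> pi * sqrt h"
abbreviation V :: "real \<Rightarrow> real" where "V s \<equiv> (tvar h s)\<^sup>2 / 4 - \<Lambda>"

lemma h_pos: "h > 0" using h by simp

lemma b_pos: "b > 2" "b > turn m"
  using wide turn_pos(1) [of m] by auto

lemma parity_f': "((\<forall>s. f (- s) = f s) \<and> (\<forall>s. f' (- s) = - f' s)) \<or>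
    ((\<forall>s. f (- s) = - f s) \<and> (\<forall>s. f' (- s) = f' s))"
proof -
  have d: "((\<lambda>s. f (- s)) has_real_derivative - f' (- s)) (at s)" for s
    using DERIV_chain2 [where f = f and g = uminus, OF DERIV_f DERIV_minus [OF DERIV_ident]] by simp
  from parity show ?thesis
  proof
    assume ev: "\<forall>s. f (- s) = f s"
    have "- f' (- s) = f' s" for s
      using DERIV_unique [OF d [of s]] DERIV_f [of s] ev by simp
    then have "f' (- s) = - f' s" for s by (metis minus_minus)
    with ev show ?thesis by simp
  next
    assume od: "\<forall>s. f (- s) = - f s"
    have "((\<lambda>s. f (- s)) has_real_derivative - f' s) (at s)" for s
      using DERIV_minus [OF DERIV_f [of s]] od by simp
    then have "f' (- s) = f' s" for s
      using DERIV_unique [OF d [of s]] by (metis minus_minus)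
    with od show ?thesis by simp
  qed
qed

lemma product_0: "f 0 * f' 0 = 0"
proof -
  from parity_f' have "f' (- 0) = - f' 0 \<or> f (- 0) = - f 0" by blast
  then show ?thesis by auto
qed

lemma energy_even: "(f (- s))\<^sup>2 + (f' (- s))\<^sup>2 = (f s)\<^sup>2 + (f' s)\<^sup>2" "\<bar>f (- s)\<bar> = \<bar>f s\<bar>" "\<bar>f' (- s)\<bar> = \<bar>f' s\<bar>"
    "f (- s) * f' (- s) = - (f s * f' s)"
  using parity_f' by auto

lemma abs_V: "\<bar>s\<bar> \<le> T \<Longrightarrow> \<bar>V s\<bar> \<le> T\<^sup>2 / 4 + \<bar>\<Lambda>\<bar>"
proof -
  assume "\<bar>s\<bar> \<le> T"
  then have "\<bar>tvar h s\<bar> \<le> T" using abs_tvar_le [OF h_pos, of s] by linarith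
  then have "(tvar h s)\<^sup>2 \<le> T\<^sup>2"
    by (metis abs_ge_zero power2_abs power_mono)
  then show ?thesis
    using abs_triangle_ineq4 [of "(tvar h s)\<^sup>2 / 4" \<Lambda>] by simp
qed

section \<open>Bounds on \<Lambda> and monotone decay beyond the turning point\<close>

lemma not_double_zero: "\<not> (f s = 0 \<and> f' s = 0)"
proof
  assume *: "f s = 0 \<and> f' s = 0"
  have "f \<bar>s\<bar> = 0 \<and> f' \<bar>s\<bar> = 0"
    using * energy_even(2,3) [of s] by (cases "s \<ge> 0") auto
  moreover have "(f 0)\<^sup>2 + (f' 0)\<^sup>2 \<le> ((f \<bar>s\<bar>)\<^sup>2 + (f' \<bar>s\<bar>)\<^sup>2) * exp ((2 + (s\<^sup>2 / 4 + \<bar>\<Lambda>\<bar>)) * (\<bar>s\<bar> - 0))"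
    by (rule energy_lower [OF DERIV_f DERIV_f']) (use abs_V [of _ "\<bar>s\<bar>"] in auto)
  ultimately show False using normalized by simp
qed

text \<open>For \<Lambda> \<le> 0 the potential is positive on (0, b), while f f' vanishes at 0 by
  parity and at b by the boundary condition. This forces a double zero.\<close>

lemma Lam_pos: "\<Lambda> > 0"
proof (rule ccontr)
  assume "\<not> \<Lambda> > 0"
  then have L: "\<Lambda> \<le> 0" by simp
  have "\<exists>s\<in>{0<..<b}. f s = 0 \<and> f' s = 0"
  proof (rule double_zero_of_boundary_signs [OF DERIV_f DERIV_f'])
    fix s assume s: "s \<in> {0<..<b}"
    then have "tvar h s > 0" using tvar_ge [OF h_pos, of s] by auto
    then have "(tvar h s)\<^sup>2 > 0" by simp
    then show "V s > 0" using L by linarith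
  next
    fix s show "V s \<ge> 0" using L zero_le_power2 [of "tvar h s"] by linarith
  qed (use b_pos product_0 boundary in auto)
  then show False using not_double_zero by blast
qed

text \<open>Otherwise Sturm comparison applies on m + 1 disjoint intervals of length pi/N, spaced by
  2 pi/N inside [0, 1], and produces m + 1 distinct zeros.\<close>

lemma Lam_less: "\<Lambda> < lam_bound m"
proof (rule ccontr)
  assume "\<not> \<Lambda> < lam_bound m"
  then have L: "\<Lambda> \<ge> lam_bound m" by simp
  define N :: real where "N = 8 * (real m + 1)"
  have N: "N > 0" by (simp add: N_def)
  define a where "a i = real i * (2 * pi / N)" for i :: nat
  have up: "a i + pi / N \<le> 1" if "i \<le> m" for i
  proof -
    have "a i + pi / N = (2 * real i + 1) * pi / N"
      by (simp add: a_def add_divide_distrib algebra_simps)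
    also have "\<dots> \<le> (2 * (real m + 1)) * 4 / N"
      using that N pi_less_4 by (intro divide_right_mono mult_mono) auto
    also have "\<dots> = 1" by (simp add: N_def field_simps)
    finally show ?thesis .
  qed
  have a0: "a i \<ge> 0" for i using N by (simp add: a_def)
  have "\<exists>s\<in>{a i..a i + pi / N}. f s = 0" if "i \<le> m" for i
  proof (rule sturm_zero [OF DERIV_f DERIV_f' _ N])
    fix s assume "s \<in> {a i..a i + pi / N}"
    then have "\<bar>s\<bar> \<le> 1" using up [OF that] a0 [of i] by auto
    then have "\<bar>tvar h s\<bar> \<le> 1" using abs_tvar_le [OF h_pos, of s] by linarith
    then have "(tvar h s)\<^sup>2 \<le> 1" by (simp add: abs_square_le_1)
    moreover have "N\<^sup>2 = 64 * (real m + 1)\<^sup>2"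
      unfolding N_def power_mult_distrib by simp
    ultimately show "V s \<le> - N\<^sup>2"
      using L unfolding lam_bound_def by linarith
  qed
  then have "\<forall>i. \<exists>s. i \<le> m \<longrightarrow> a i \<le> s \<and> s \<le> a i + pi / N \<and> f s = 0"
    by fastforce
  from choice [OF this] obtain z where z: "\<And>i. i \<le> m \<Longrightarrow> a i \<le> z i \<and> z i \<le> a i + pi / N \<and> f (z i) = 0"
    by blast
  have inj: "inj_on z {..m}"
  proof (rule linorder_inj_onI)
    fix i j assume ij: "i < j" "i \<in> {..m}" "j \<in> {..m}"
    have "a i + pi / N < a i + 2 * pi / N" using N by (simp add: field_simps)
    also have "\<dots> = (real i + 1) * (2 * pi / N)"
      by (simp add: a_def add_divide_distrib algebra_simps)
    also have "\<dots> \<le> a j"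
      unfolding a_def using ij N by (intro mult_right_mono) auto
    finally show "z i \<noteq> z j" using z [of i] z [of j] ij by auto
  qed auto
  have "z ` {..m} \<subseteq> {s. \<bar>s\<bar> < b \<and> f s = 0}"
  proof (rule image_subsetI)
    fix i assume "i \<in> {..m}"
    then have "0 \<le> z i" "z i \<le> 1" "f (z i) = 0"
      using z [of i] a0 [of i] up [of i] by auto
    then show "z i \<in> {s. \<bar>s\<bar> < b \<and> f s = 0}" using b_pos by simp
  qed
  then have "card (z ` {..m}) \<le> m"
    using card_mono [OF zeros(1)] zeros(2) by metis
  then show False using card_image [OF inj] by simp
qed

lemma V_ge_1: "turn m \<le> s \<Longrightarrow> s \<le> b \<Longrightarrow> V s \<ge> 1"
proof -
  assume s: "turn m \<le> s" "s \<le> b"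
  then have "turn m / 2 \<le> tvar h s"
    using tvar_ge [OF h_pos, of s] turn_pos [of m] by linarith
  then have "(turn m / 2)\<^sup>2 \<le> (tvar h s)\<^sup>2"
    using turn_pos [of m] by (intro power_mono) auto
  moreover have "(turn m / 2)\<^sup>2 / 4 = (lam_bound m + 1)\<^sup>2"
    by (simp add: turn_def power2_eq_square algebra_simps)
  moreover have "lam_bound m + 1 \<le> (lam_bound m + 1)\<^sup>2"
    using turn_pos(2) [of m] by (simp add: power2_eq_square)
  ultimately show ?thesis using Lam_less by linarith
qed

text \<open>Where V \<ge> 0 the product f f' is nondecreasing, and it ends with the value 0 at
  b.\<close>

lemma tail_product: "turn m \<le> s \<Longrightarrow> s \<le> b \<Longrightarrow> f s * f' s \<le> 0"
proof -
  assume s: "turn m \<le> s" "s \<le> b"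
  have "f s * f' s \<le> f b * f' b"
  proof (rule product_nondecreasing [OF DERIV_f DERIV_f'])
    show "V x \<ge> 0" if "x \<in> {s..b}" for x using V_ge_1 [of x] that s by simp
  qed (use s in auto)
  then show ?thesis using boundary by simp
qed

lemma tail_nonzero: "turn m \<le> s \<Longrightarrow> s < b \<Longrightarrow> f s \<noteq> 0"
proof
  assume s: "turn m \<le> s" "s < b" and z: "f s = 0"
  have V: "V x \<ge> 1" if "s \<le> x" "x \<le> b" for x
    using V_ge_1 [of x] that s by linarith
  have "\<exists>s\<in>{s<..<b}. f s = 0 \<and> f' s = 0"
  proof (rule double_zero_of_boundary_signs [OF DERIV_f DERIV_f'])
    show "V x \<ge> 0" if "x \<in> {s..b}" for x using V [of x] that by simp
    show "V x > 0" if "x \<in> {s<..<b}" for x using V [of x] that by simp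
  qed (use s z boundary in auto)
  then show False using not_double_zero by blast
qed

text \<open>(f^2)' = 2 f f' and (f'^2)' = 2 V f f' are both nonpositive in the tail.\<close>

lemma tail_decreasing:
  assumes "turn m \<le> x" "x \<le> y" "y \<le> b"
  shows "(f y)\<^sup>2 \<le> (f x)\<^sup>2" "(f' y)\<^sup>2 \<le> (f' x)\<^sup>2"
proof -
  have p: "f s * f' s \<le> 0" "V s \<ge> 0" if "x \<le> s" "s \<le> y" for s
    using tail_product [of s] V_ge_1 [of s] that assms by auto
  show "(f y)\<^sup>2 \<le> (f x)\<^sup>2"
  proof (rule DERIV_nonpos_imp_nonincreasing [OF assms(2)])
    fix s assume s: "x \<le> s" "s \<le> y"
    have "((\<lambda>s. (f s)\<^sup>2) has_real_derivative 2 * (f s * f' s)) (at s)"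
      using DERIV_f by (auto intro!: derivative_eq_intros)
    with p(1) [OF s] show "\<exists>D. ((\<lambda>s. (f s)\<^sup>2) has_real_derivative D) (at s) \<and> D \<le> 0"
      by (metis mult_le_0_iff zero_le_numeral)
  qed
  show "(f' y)\<^sup>2 \<le> (f' x)\<^sup>2"
  proof (rule DERIV_nonpos_imp_nonincreasing [OF assms(2)])
    fix s assume s: "x \<le> s" "s \<le> y"
    have "((\<lambda>s. (f' s)\<^sup>2) has_real_derivative 2 * (V s * (f s * f' s))) (at s)"
      using DERIV_f' [of s] by (auto intro!: derivative_eq_intros)
    moreover have "2 * (V s * (f s * f' s)) \<le> 0"
      using p [OF s] by (simp add: mult_nonneg_nonpos)
    ultimately show "\<exists>D. ((\<lambda>s. (f' s)\<^sup>2) has_real_derivative D) (at s) \<and> D \<le> 0"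
      by blast
  qed
qed

lemma abs_V_le: "\<bar>s\<bar> \<le> T \<Longrightarrow> \<bar>V s\<bar> \<le> T\<^sup>2 / 4 + lam_bound m"
  using abs_V [of s T] Lam_pos Lam_less by simp

end

text \<open>The Gronwall factor of \<open>energy_growth\<close> over a length T, where |V| \<le>
  T^2/4 + \<open>lam_bound m\<close>.\<close>

definition growth :: "nat \<Rightarrow> real \<Rightarrow> real" where
  "growth m T = exp ((2 + (T\<^sup>2 / 4 + lam_bound m)) * T)"

lemma growth_ge_1: "T \<ge> 0 \<Longrightarrow> growth m T \<ge> 1"
  unfolding growth_def using turn_pos(2) [of m] by (auto intro!: mult_nonneg_nonneg add_nonneg_nonneg)

context mathieu_mode
begin

lemma energy_bounds:
  assumes "\<bar>s\<bar> \<le> T"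
  shows "(f s)\<^sup>2 + (f' s)\<^sup>2 \<le> growth m T" "1 \<le> ((f s)\<^sup>2 + (f' s)\<^sup>2) * growth m T"
proof -
  have 1: "(f \<bar>s\<bar>)\<^sup>2 + (f' \<bar>s\<bar>)\<^sup>2 = (f s)\<^sup>2 + (f' s)\<^sup>2"
    using energy_even(1) [of s] by (cases "s \<ge> 0") auto
  have "(f \<bar>s\<bar>)\<^sup>2 + (f' \<bar>s\<bar>)\<^sup>2 \<le> ((f 0)\<^sup>2 + (f' 0)\<^sup>2 + 0\<^sup>2 * (\<bar>s\<bar> - 0)) * exp ((2 + (T\<^sup>2 / 4 + lam_bound m)) * (\<bar>s\<bar> - 0))"
    by (rule energy_growth [where r = "\<lambda>s. 0" and V = V]) (use DERIV_f DERIV_f' assms abs_V_le in auto)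
  also have "\<dots> \<le> growth m T"
    unfolding normalized growth_def using assms turn_pos(2) [of m]
    by (auto intro!: mult_left_mono add_nonneg_nonneg)
  finally show "(f s)\<^sup>2 + (f' s)\<^sup>2 \<le> growth m T" by (simp only: 1)
  have "(f 0)\<^sup>2 + (f' 0)\<^sup>2 \<le> ((f \<bar>s\<bar>)\<^sup>2 + (f' \<bar>s\<bar>)\<^sup>2) * exp ((2 + (T\<^sup>2 / 4 + lam_bound m)) * (\<bar>s\<bar> - 0))"
    by (rule energy_lower [where V = V]) (use DERIV_f DERIV_f' assms abs_V_le in auto)
  also have "\<dots> \<le> ((f \<bar>s\<bar>)\<^sup>2 + (f' \<bar>s\<bar>)\<^sup>2) * growth m T"
    unfolding growth_def using assms turn_pos(2) [of m]
    by (intro mult_left_mono) (auto intro!: mult_left_mono add_nonneg_nonneg)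
  finally show "1 \<le> ((f s)\<^sup>2 + (f' s)\<^sup>2) * growth m T" by (simp only: 1 normalized)
qed

lemma f_bounds:
  assumes "\<bar>s\<bar> \<le> b"
  shows "(f s)\<^sup>2 \<le> growth m (turn m)" "(f' s)\<^sup>2 \<le> growth m (turn m)"
proof -
  have "(f \<bar>s\<bar>)\<^sup>2 \<le> growth m (turn m) \<and> (f' \<bar>s\<bar>)\<^sup>2 \<le> growth m (turn m)"
  proof (cases "\<bar>s\<bar> \<le> turn m")
    case True
    have "(f \<bar>s\<bar>)\<^sup>2 + (f' \<bar>s\<bar>)\<^sup>2 \<le> growth m (turn m)"
      by (rule energy_bounds) (use True in auto)
    then show ?thesis using zero_le_power2 [of "f \<bar>s\<bar>"] zero_le_power2 [of "f' \<bar>s\<bar>"] by linarith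
  next
    case False
    have "(f (turn m))\<^sup>2 + (f' (turn m))\<^sup>2 \<le> growth m (turn m)"
      by (rule energy_bounds) (use turn_pos(1) [of m] in auto)
    moreover have "(f \<bar>s\<bar>)\<^sup>2 \<le> (f (turn m))\<^sup>2" "(f' \<bar>s\<bar>)\<^sup>2 \<le> (f' (turn m))\<^sup>2"
      using tail_decreasing [of "turn m" "\<bar>s\<bar>"] False assms by auto
    ultimately show ?thesis using zero_le_power2 [of "f (turn m)"] zero_le_power2 [of "f' (turn m)"] by linarith
  qed
  moreover have "(f \<bar>s\<bar>)\<^sup>2 = (f s)\<^sup>2" "(f' \<bar>s\<bar>)\<^sup>2 = (f' s)\<^sup>2"
    using energy_even(2,3) [of s] by (metis abs_if power2_abs)+
  ultimately show "(f s)\<^sup>2 \<le> growth m (turn m)" "(f' s)\<^sup>2 \<le> growth m (turn m)" by auto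
qed

lemma zeros_inside: "\<bar>s\<bar> < b \<Longrightarrow> f s = 0 \<Longrightarrow> \<bar>s\<bar> < turn m"
proof (rule ccontr)
  assume s: "\<bar>s\<bar> < b" "f s = 0" "\<not> \<bar>s\<bar> < turn m"
  then have "f \<bar>s\<bar> \<noteq> 0" by (intro tail_nonzero) auto
  moreover have "\<bar>f \<bar>s\<bar>\<bar> = \<bar>f s\<bar>"
    using energy_even(2) [of s] by (cases "s \<ge> 0") auto
  ultimately show False using s(2) by simp
qed

text \<open>The energy at \<open>turn m + 2\<close> is bounded below but might sit in f'. As |f'|
  decreases, the mean value theorem on the half unit before that point bounds f' by values of f: its
  square is at most 16 f(s)^2, and the energy at most 32 f(s)^2.\<close>

lemma tail_lower:
  assumes "turn m \<le> s" "s \<le> turn m + 3/2"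
  shows "1 \<le> 32 * growth m (turn m + 2) * (f s)\<^sup>2"
proof -
  let ?T = "turn m" and ?g = "growth m (turn m + 2)"
  have g: "?g \<ge> 1" using turn_pos(1) [of m] by (intro growth_ge_1) simp
  have E: "1 \<le> ((f (?T + 2))\<^sup>2 + (f' (?T + 2))\<^sup>2) * ?g"
    by (rule energy_bounds) (use turn_pos(1) [of m] in auto)
  have dec: "(f (?T + 3/2))\<^sup>2 \<le> (f s)\<^sup>2" "(f (?T + 2))\<^sup>2 \<le> (f (?T + 3/2))\<^sup>2"
    using tail_decreasing(1) [of s "?T + 3/2"] tail_decreasing(1) [of "?T + 3/2" "?T + 2"] assms wide turn_pos(1) [of m] by auto
  obtain \<xi> where \<xi>: "?T + 3/2 < \<xi>" "\<xi> < ?T + 2" "f (?T + 2) - f (?T + 3/2) = (?T + 2 - (?T + 3/2)) * f' \<xi>"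
    using MVT2 [of "?T + 3/2" "?T + 2" f f'] DERIV_f by auto
  have f': "(f' (?T + 2))\<^sup>2 \<le> (f' \<xi>)\<^sup>2"
    using tail_decreasing(2) [of \<xi> "?T + 2"] \<xi> wide turn_pos(1) [of m] by auto
  have "f' \<xi> = 2 * (f (?T + 2) - f (?T + 3/2))" using \<xi>(3) by simp
  then have "(f' \<xi>)\<^sup>2 = 4 * (f (?T + 2) - f (?T + 3/2))\<^sup>2"
    by (simp only: power_mult_distrib) simp
  also have "\<dots> \<le> 4 * (2 * (f (?T + 2))\<^sup>2 + 2 * (f (?T + 3/2))\<^sup>2)"
    using zero_le_power2 [of "f (?T + 2) + f (?T + 3/2)"] by (simp add: power2_sum power2_diff)
  also have "\<dots> = 8 * (f (?T + 2))\<^sup>2 + 8 * (f (?T + 3/2))\<^sup>2" by simp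
  finally have "(f' (?T + 2))\<^sup>2 \<le> 16 * (f s)\<^sup>2"
    using f' dec(1) dec(2) by linarith
  then have "(f (?T + 2))\<^sup>2 + (f' (?T + 2))\<^sup>2 \<le> 32 * (f s)\<^sup>2"
    using dec zero_le_power2 [of "f s"] by linarith
  then have "((f (?T + 2))\<^sup>2 + (f' (?T + 2))\<^sup>2) * ?g \<le> 32 * (f s)\<^sup>2 * ?g"
    using g by (intro mult_right_mono) auto
  with E show ?thesis by (simp add: mult_ac)
qed

end

section \<open>Approximate modes\<close>

definition amode :: "nat \<Rightarrow> nat \<Rightarrow> real \<Rightarrow> real \<Rightarrow> real" where
  "amode j n h s = approx j n (1 / h) (tvar h s)"

definition damode :: "nat \<Rightarrow> nat \<Rightarrow> real \<Rightarrow> real \<Rightarrow> real" where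
  "damode j n h s = dapprox j n (1 / h) (tvar h s) * cos (s / (2 * sqrt h))"

lemma amode_DERIV: "h > 0 \<Longrightarrow> (amode j n h has_real_derivative damode j n h s) (at s)"
  unfolding amode_def [abs_def] damode_def
  by (rule DERIV_chain2 [OF approx_DERIV tvar_DERIV])

text \<open>The chain rule brings in the square of dt/ds, which is 1 - t^2/(4h), and the second
  derivative of t, which is -t/(4h). These are the coefficients in \<open>residual\<close>, so the
  residual in t is also the residual in s.\<close>

lemma damode_DERIV:
  assumes "h > 0"
  shows "(damode j n h has_real_derivative
     ((tvar h s)\<^sup>2 / 4 - approx_eigenvalue j n (1 / h)) * amode j n h s + residual j n (1 / h) (tvar h s)) (at s)"
proof -
  let ?t = "tvar h s" and ?c = "cos (s / (2 * sqrt h))"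
  have c: "((\<lambda>s. cos (s / (2 * sqrt h))) has_real_derivative - (?t / (4 * h))) (at s)"
    using assms by (auto intro!: derivative_eq_intros simp: tvar_def field_simps)
  have "(damode j n h has_real_derivative
      (ddapprox j n (1 / h) ?t * ?c) * ?c + - (?t / (4 * h)) * dapprox j n (1 / h) ?t) (at s)"
    unfolding damode_def [abs_def]
    by (rule DERIV_mult [OF DERIV_chain2 [OF dapprox_DERIV tvar_DERIV [OF assms]] c])
  also have "(ddapprox j n (1 / h) ?t * ?c) * ?c = (1 - ?t\<^sup>2 / (4 * h)) * ddapprox j n (1 / h) ?t"
    using tvar_cos [OF assms, of s] by (simp add: power2_eq_square mult_ac)
  finally show ?thesis
    by (rule DERIV_cong) (use assms in \<open>simp add: residual_def amode_def field_simps\<close>)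
qed

lemma continuous_on_DERIV: "(\<And>s::real. (f has_real_derivative f' s) (at s)) \<Longrightarrow> continuous_on A f"
  by (meson DERIV_isCont continuous_at_imp_continuous_on)

text \<open>|t| \<ge> |s|/2 gives 1/(1+t^2) \<le> 4/(1+s^2), whose integral over the whole line is 4
  pi. Hence the bound does not see the length of the interval.\<close>

lemma weighted_integral_bound:
  assumes h: "h > 0" and K: "K \<ge> 0" and cont: "continuous_on {- (pi * sqrt h)..pi * sqrt h} \<phi>"
    and le: "\<And>s. \<bar>s\<bar> \<le> pi * sqrt h \<Longrightarrow> \<bar>\<phi> s\<bar> \<le> K / (1 + (tvar h s)\<^sup>2)"
  shows "\<bar>integral {- (pi * sqrt h)..pi * sqrt h} \<phi>\<bar> \<le> 4 * pi * K"
proof -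
  let ?b = "pi * sqrt h"
  have b: "- ?b \<le> ?b" using h by simp
  have "((\<lambda>s. 4 * K * inverse (1 + s\<^sup>2)) has_integral 4 * K * arctan ?b - 4 * K * arctan (- ?b)) {- ?b..?b}"
    by (rule fundamental_theorem_of_calculus [OF b])
      (auto intro!: derivative_eq_intros simp: has_real_derivative_iff_has_vector_derivative [symmetric])
  then have *: "((\<lambda>s. 4 * K * inverse (1 + s\<^sup>2)) has_integral 8 * (K * arctan ?b)) {- ?b..?b}"
    by (simp add: arctan_minus)
  note int = has_integral_integrable [OF *] integral_unique [OF *]
  have "norm (integral {- ?b..?b} \<phi>) \<le> integral {- ?b..?b} (\<lambda>s. 4 * K * inverse (1 + s\<^sup>2))"
  proof (rule integral_norm_bound_integral [OF integrable_continuous_real [OF cont] int(1)])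
    fix s assume "s \<in> {- ?b..?b}"
    then have s: "\<bar>s\<bar> \<le> ?b" by auto
    have "\<bar>s\<bar> / 2 \<le> \<bar>tvar h s\<bar>" by (rule abs_tvar_ge [OF h s])
    then have "(\<bar>s\<bar> / 2)\<^sup>2 \<le> (\<bar>tvar h s\<bar>)\<^sup>2" by (rule power_mono) simp
    then have "(1 + s\<^sup>2) / 4 \<le> 1 + (tvar h s)\<^sup>2" by (simp add: power_divide)
    then have "K / (1 + (tvar h s)\<^sup>2) \<le> K / ((1 + s\<^sup>2) / 4)"
      using K by (intro divide_left_mono) (auto intro!: mult_pos_pos add_pos_nonneg)
    also have "\<dots> = 4 * K * inverse (1 + s\<^sup>2)" by (simp add: field_simps)
    finally show "norm (\<phi> s) \<le> 4 * K * inverse (1 + s\<^sup>2)"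
      using le [OF s] by simp
  qed
  also have "\<dots> \<le> 8 * (K * (pi / 2))"
    unfolding int(2) using arctan_ubound [of ?b] K by (intro mult_left_mono) auto
  finally show ?thesis by (simp add: mult_ac)
qed

section \<open>Decay of residual and approximate solutions, uniformly in h\<close>

lemma residual_decay: "\<exists>K\<ge>0. \<forall>h t. h \<ge> 1 \<longrightarrow> \<bar>residual j n (1 / h) t\<bar> \<le> K / h ^ (n + 1) / (1 + t\<^sup>2) ^ q"
proof -
  obtain R where R: "poly_bounded R" "\<And>e t. residual j n e t = e ^ (n + 1) * (exp (- t\<^sup>2 / 4) * R e t)"
    using residual_bound by blast
  obtain K where K: "K \<ge> 0" "\<And>e t. 0 < e \<Longrightarrow> e \<le> 1 \<Longrightarrow> \<bar>exp (- t\<^sup>2 / 4) * R e t\<bar> \<le> K / (1 + t\<^sup>2) ^ q"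
    using poly_bounded_gauss [OF R(1)] by blast
  show ?thesis
  proof (intro exI [of _ K] conjI allI impI K(1))
    fix h t :: real
    assume "h \<ge> 1"
    then have "(1 / h) ^ (n + 1) * \<bar>exp (- t\<^sup>2 / 4) * R (1 / h) t\<bar> \<le> (1 / h) ^ (n + 1) * (K / (1 + t\<^sup>2) ^ q)"
      by (intro mult_left_mono K(2)) auto
    then show "\<bar>residual j n (1 / h) t\<bar> \<le> K / h ^ (n + 1) / (1 + t\<^sup>2) ^ q"
      using \<open>h \<ge> 1\<close> by (simp add: R(2) abs_mult power_divide)
  qed
qed

lemma approx_decay: "\<exists>K\<ge>0. \<forall>h t. h \<ge> 1 \<longrightarrow> \<bar>approx j n (1 / h) t\<bar> \<le> K / (1 + t\<^sup>2) ^ q \<and>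
    \<bar>dapprox j n (1 / h) t\<bar> \<le> K / (1 + t\<^sup>2) ^ q"
proof -
  obtain K where K: "K \<ge> 0" "\<And>e t. 0 < e \<Longrightarrow> e \<le> 1 \<Longrightarrow> \<bar>approx j n e t\<bar> \<le> K / (1 + t\<^sup>2) ^ q"
    using poly_bounded_gauss [OF poly_bounded_truncation, of n "amplitude j" q] unfolding approx_def by blast
  obtain L where L: "L \<ge> 0" "\<And>e t. 0 < e \<Longrightarrow> e \<le> 1 \<Longrightarrow> \<bar>dapprox j n e t\<bar> \<le> L / (1 + t\<^sup>2) ^ q"
    using poly_bounded_gauss [OF poly_bounded_truncation, of n "\<lambda>s. gauss_deriv (amplitude j s)" q]
    unfolding dapprox_def by blast
  have "K / (1 + t\<^sup>2) ^ q \<le> (K + L) / (1 + t\<^sup>2) ^ q" "L / (1 + t\<^sup>2) ^ q \<le> (K + L) / (1 + t\<^sup>2) ^ q" for t :: real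
    using K(1) L(1) by (auto intro!: divide_right_mono)
  note le = this
  have "\<bar>approx j n (1 / h) t\<bar> \<le> (K + L) / (1 + t\<^sup>2) ^ q \<and> \<bar>dapprox j n (1 / h) t\<bar> \<le> (K + L) / (1 + t\<^sup>2) ^ q"
    if "h \<ge> 1" for h t :: real
  proof -
    have "0 < 1 / h" "1 / h \<le> 1" using that by auto
    then show ?thesis
      using order_trans [OF K(2) le(1)] order_trans [OF L(2) le(2)] by blast
  qed
  then show ?thesis
    using K(1) L(1) by (intro exI [of _ "K + L"]) auto
qed

lemma approx_order_difference:
  "\<exists>K\<ge>0. \<forall>h t. h \<ge> 1 \<longrightarrow> \<bar>approx j n (1 / h) t - parabolic_D j t\<bar> \<le> K / h / (1 + t\<^sup>2) ^ q \<and>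
     \<bar>dapprox j n (1 / h) t - deriv (parabolic_D j) t\<bar> \<le> K / h / (1 + t\<^sup>2) ^ q"
proof -
  obtain R where R: "poly_bounded R" "\<And>e t. approx j n e t = parabolic_D j t + e * (exp (- t\<^sup>2 / 4) * R e t)"
    using approx_first_order by blast
  obtain S where S: "poly_bounded S" "\<And>e t. dapprox j n e t = deriv (parabolic_D j) t + e * (exp (- t\<^sup>2 / 4) * S e t)"
    using dapprox_first_order by blast
  obtain K where K: "K \<ge> 0" "\<And>e t. 0 < e \<Longrightarrow> e \<le> 1 \<Longrightarrow> \<bar>exp (- t\<^sup>2 / 4) * R e t\<bar> \<le> K / (1 + t\<^sup>2) ^ q"
    using poly_bounded_gauss [OF R(1)] by blast
  obtain L where L: "L \<ge> 0" "\<And>e t. 0 < e \<Longrightarrow> e \<le> 1 \<Longrightarrow> \<bar>exp (- t\<^sup>2 / 4) * S e t\<bar> \<le> L / (1 + t\<^sup>2) ^ q"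
    using poly_bounded_gauss [OF S(1)] by blast
  show ?thesis
  proof (intro exI [of _ "K + L"] conjI allI impI)
    fix h t :: real
    assume h: "h \<ge> 1"
    have "K / (1 + t\<^sup>2) ^ q \<le> (K + L) / (1 + t\<^sup>2) ^ q" "L / (1 + t\<^sup>2) ^ q \<le> (K + L) / (1 + t\<^sup>2) ^ q"
      using K(1) L(1) by (auto intro!: divide_right_mono)
    then have "\<bar>exp (- t\<^sup>2 / 4) * R (1 / h) t\<bar> \<le> (K + L) / (1 + t\<^sup>2) ^ q"
      "\<bar>exp (- t\<^sup>2 / 4) * S (1 / h) t\<bar> \<le> (K + L) / (1 + t\<^sup>2) ^ q"
      using K(2) [of "1 / h" t] L(2) [of "1 / h" t] h by auto
    then have "(1 / h) * \<bar>exp (- t\<^sup>2 / 4) * R (1 / h) t\<bar> \<le> (1 / h) * ((K + L) / (1 + t\<^sup>2) ^ q)"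
      "(1 / h) * \<bar>exp (- t\<^sup>2 / 4) * S (1 / h) t\<bar> \<le> (1 / h) * ((K + L) / (1 + t\<^sup>2) ^ q)"
      using h by (auto intro!: mult_left_mono simp del: times_divide_eq_left times_divide_eq_right)
    then show "\<bar>approx j n (1 / h) t - parabolic_D j t\<bar> \<le> (K + L) / h / (1 + t\<^sup>2) ^ q"
      "\<bar>dapprox j n (1 / h) t - deriv (parabolic_D j) t\<bar> \<le> (K + L) / h / (1 + t\<^sup>2) ^ q"
      using h unfolding R(2) S(2) by (simp_all add: abs_mult)
  qed (use K L in auto)
qed

lemma continuous_on_residual: "continuous_on A (\<lambda>s. residual j n e (tvar h s))"
proof -
  have "continuous_on A (\<lambda>s. truncation n X e (tvar h s))" for X
    unfolding truncation_def by (intro continuous_intros continuous_on_tvar)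
  then show ?thesis
    unfolding residual_def approx_def dapprox_def ddapprox_def
    by (intro continuous_intros continuous_on_tvar) auto
qed

text \<open>At the ends |t| = 2 sqrt h, so 1 + t^2 \<ge> h and decay in t is decay in h. The
  derivative vanishes exactly because dt/ds does.\<close>

lemma amode_end:
  assumes "h \<ge> 1" "K \<ge> 0" "\<bar>s\<bar> = pi * sqrt h"
    and "\<And>t. \<bar>approx j n (1 / h) t\<bar> \<le> K / (1 + t\<^sup>2) ^ q"
  shows "\<bar>amode j n h s\<bar> \<le> K / h ^ q" "damode j n h s = 0"
proof -
  have s: "s = pi * sqrt h \<or> s = - (pi * sqrt h)"
    using assms(3) by (auto simp: abs_if split: if_splits)
  then have t: "(tvar h s)\<^sup>2 = 4 * h"
    using assms(1) tvar_end(1) [of h] tvar_minus [of h "pi * sqrt h"]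
    by (auto simp: power_mult_distrib)
  have "h ^ q \<le> (1 + (tvar h s)\<^sup>2) ^ q"
    unfolding t using assms by (intro power_mono) auto
  then have "K / (1 + (tvar h s)\<^sup>2) ^ q \<le> K / h ^ q"
    using assms by (intro divide_left_mono mult_pos_pos zero_less_power) (auto simp: t add_pos_nonneg)
  with assms(4) [of "tvar h s"] show "\<bar>amode j n h s\<bar> \<le> K / h ^ q"
    unfolding amode_def by linarith
  have "s / (2 * sqrt h) = pi / 2 \<or> s / (2 * sqrt h) = - (pi / 2)"
    using s assms(1) by auto
  then have "cos (s / (2 * sqrt h)) = 0" by (metis cos_minus cos_pi_half)
  then show "damode j n h s = 0" by (simp add: damode_def)
qed

section \<open>Green's identity for a mode and an approximate mode\<close>

context mathieu_mode
begin

lemma continuous_f: "continuous_on A f" "continuous_on A f'"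
  by (rule continuous_on_DERIV [OF DERIV_f], rule continuous_on_DERIV [OF DERIV_f'])

lemma continuous_amode: "continuous_on A (amode j n h)" "continuous_on A (damode j n h)"
  by (rule continuous_on_DERIV [OF amode_DERIV [OF h_pos]], rule continuous_on_DERIV [OF damode_DERIV [OF h_pos]])

abbreviation overlap :: "nat \<Rightarrow> nat \<Rightarrow> real" where
  "overlap j n \<equiv> integral {- b..b} (\<lambda>s. amode j n h s * f s)"

lemma green:
  "(\<Lambda> - approx_eigenvalue j n (1 / h)) * overlap j n + integral {- b..b} (\<lambda>s. residual j n (1 / h) (tvar h s) * f s)
     = amode j n h (- b) * f' (- b) - amode j n h b * f' b"
proof -
  let ?W = "\<lambda>s. damode j n h s * f s - amode j n h s * f' s"
  let ?g = "\<lambda>s. (\<Lambda> - approx_eigenvalue j n (1 / h)) * (amode j n h s * f s)"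
  let ?r = "\<lambda>s. residual j n (1 / h) (tvar h s) * f s"
  have "((\<lambda>s. ?g s + ?r s) has_integral ?W b - ?W (- b)) {- b..b}"
  proof (rule fundamental_theorem_of_calculus)
    show "- b \<le> b" using b_pos by simp
    fix s
    have "(?W has_real_derivative ?g s + ?r s) (at s)"
      using amode_DERIV [OF h_pos, of j n s] damode_DERIV [OF h_pos, of j n s] DERIV_f [of s] DERIV_f' [of s]
      by (auto intro!: derivative_eq_intros simp: algebra_simps)
    then show "(?W has_vector_derivative ?g s + ?r s) (at s within {- b..b})"
      by (simp add: has_real_derivative_iff_has_vector_derivative has_vector_derivative_at_within)
  qed
  then have "integral {- b..b} (\<lambda>s. ?g s + ?r s) = ?W b - ?W (- b)"
    by (rule integral_unique)
  moreover have "integral {- b..b} (\<lambda>s. ?g s + ?r s) = integral {- b..b} ?g + integral {- b..b} ?r"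
    by (intro Henstock_Kurzweil_Integration.integral_add integrable_continuous_real continuous_intros
        continuous_f continuous_amode continuous_on_residual)
  moreover have "integral {- b..b} ?g = (\<Lambda> - approx_eigenvalue j n (1 / h)) * overlap j n"
    by simp
  moreover have "damode j n h b = 0" "damode j n h (- b) = 0"
    using h_pos by (simp_all add: damode_def)
  ultimately show ?thesis by simp
qed

lemma f_abs_bounds: "\<bar>s\<bar> \<le> b \<Longrightarrow> \<bar>f s\<bar> \<le> growth m (turn m)" "\<bar>s\<bar> \<le> b \<Longrightarrow> \<bar>f' s\<bar> \<le> growth m (turn m)"
proof -
  have g: "growth m (turn m) \<ge> 1" using turn_pos(1) [of m] by (intro growth_ge_1) simp
  have sq: "\<bar>x\<bar> \<le> K" if "x\<^sup>2 \<le> K" "K \<ge> 1" for x K :: real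
  proof -
    have "K \<le> K\<^sup>2" using that by (simp add: power2_eq_square)
    with that have "x\<^sup>2 \<le> K\<^sup>2" by linarith
    then show ?thesis using that abs_le_square_iff [of x K] by simp
  qed
  show "\<bar>s\<bar> \<le> b \<Longrightarrow> \<bar>f s\<bar> \<le> growth m (turn m)" "\<bar>s\<bar> \<le> b \<Longrightarrow> \<bar>f' s\<bar> \<le> growth m (turn m)"
    using f_bounds g sq by blast+
qed

end

text \<open>In Green's identity the residual integral and the boundary terms are both O(h^(-n-1)),
  the latter by decay of \<open>amode\<close> with exponent n + 1. The estimate holds for every j
  and becomes informative once the overlap is bounded below.\<close>

lemma eigenvalue_close:
  "\<exists>K\<ge>0. \<forall>h \<Lambda> f f'. mathieu_mode m h \<Lambda> f f' \<longrightarrow>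
     \<bar>\<Lambda> - approx_eigenvalue j n (1 / h)\<bar> * \<bar>integral {- (pi * sqrt h)..pi * sqrt h} (\<lambda>s. amode j n h s * f s)\<bar> \<le> K / h ^ (n + 1)"
proof -
  obtain K where K: "K \<ge> 0" "\<And>h t. h \<ge> 1 \<Longrightarrow> \<bar>residual j n (1 / h) t\<bar> \<le> K / h ^ (n + 1) / (1 + t\<^sup>2) ^ 1"
    using residual_decay by blast
  obtain L where L: "L \<ge> 0" "\<And>h t. h \<ge> 1 \<Longrightarrow> \<bar>approx j n (1 / h) t\<bar> \<le> L / (1 + t\<^sup>2) ^ (n + 1)"
    using approx_decay by blast
  define G where "G = growth m (turn m)"
  have G: "G \<ge> 1" unfolding G_def using turn_pos(1) [of m] by (intro growth_ge_1) simp
  show ?thesis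
  proof (intro exI [of _ "2 * L * G + 4 * pi * (K * G)"] conjI allI impI)
    show "0 \<le> 2 * L * G + 4 * pi * (K * G)" using K L G by simp
    fix h \<Lambda> f f'
    assume "mathieu_mode m h \<Lambda> f f'"
    then interpret mathieu_mode m h \<Lambda> f f' .
    let ?I = "integral {- b..b} (\<lambda>s. residual j n (1 / h) (tvar h s) * f s)"
    have "\<bar>?I\<bar> \<le> 4 * pi * (K / h ^ (n + 1) * G)"
    proof (rule weighted_integral_bound [OF h_pos])
      show "0 \<le> K / h ^ (n + 1) * G" using K G h_pos by simp
      show "continuous_on {- b..b} (\<lambda>s. residual j n (1 / h) (tvar h s) * f s)"
        by (intro continuous_intros continuous_f continuous_on_residual)
      fix s assume s: "\<bar>s\<bar> \<le> b"
      have "\<bar>residual j n (1 / h) (tvar h s)\<bar> * \<bar>f s\<bar> \<le> (K / h ^ (n + 1) / (1 + (tvar h s)\<^sup>2) ^ 1) * G"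
        using K(2) [OF h] f_abs_bounds(1) [OF s] K(1) h_pos unfolding G_def by (intro mult_mono) auto
      then show "\<bar>residual j n (1 / h) (tvar h s) * f s\<bar> \<le> K / h ^ (n + 1) * G / (1 + (tvar h s)\<^sup>2)"
        by (simp add: abs_mult)
    qed
    moreover have "\<bar>amode j n h s * f' s\<bar> \<le> L / h ^ (n + 1) * G" if "\<bar>s\<bar> = b" for s
      unfolding abs_mult using amode_end(1) [OF h L(1) that L(2) [OF h]] f_abs_bounds(2) [of s] that L(1) h_pos
      unfolding G_def by (intro mult_mono) auto
    from this [of b] this [of "- b"] b_pos
    have "\<bar>amode j n h b * f' b\<bar> \<le> L / h ^ (n + 1) * G" "\<bar>amode j n h (- b) * f' (- b)\<bar> \<le> L / h ^ (n + 1) * G"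
      by auto
    ultimately have "\<bar>(\<Lambda> - approx_eigenvalue j n (1 / h)) * overlap j n\<bar>
        \<le> 2 * (L / h ^ (n + 1) * G) + 4 * pi * (K / h ^ (n + 1) * G)"
      using green [of j n] by linarith
    then show "\<bar>\<Lambda> - approx_eigenvalue j n (1 / h)\<bar> * \<bar>overlap j n\<bar> \<le> (2 * L * G + 4 * pi * (K * G)) / h ^ (n + 1)"
      by (simp add: abs_mult add_divide_distrib)
  qed
qed

section \<open>Overlap with a low mode\<close>

text \<open>The quotient f/g, extended by f'/g' at the common zeros, is continuous and nowhere zero,
  hence of one sign.\<close>

lemma common_simple_zeros_sign:
  fixes f g :: "real \<Rightarrow> real"
  assumes d: "\<And>x. x \<in> {a<..<b} \<Longrightarrow> (f has_real_derivative f' x) (at x)"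
      "\<And>x. x \<in> {a<..<b} \<Longrightarrow> (g has_real_derivative g' x) (at x)"
    and z: "\<And>x. x \<in> {a<..<b} \<Longrightarrow> f x = 0 \<longleftrightarrow> g x = 0"
      "\<And>x. x \<in> {a<..<b} \<Longrightarrow> f x = 0 \<Longrightarrow> f' x \<noteq> 0 \<and> g' x \<noteq> 0"
  shows "(\<forall>x\<in>{a<..<b}. f x * g x \<ge> 0) \<or> (\<forall>x\<in>{a<..<b}. f x * g x \<le> 0)"
proof -
  define q where "q x = (if f x = 0 then f' x / g' x else f x / g x)" for x
  have cont: "isCont q x" if x: "x \<in> {a<..<b}" for x
  proof (cases "f x = 0")
    case False
    have cf: "isCont f x" "isCont g x" using d [OF x] by (auto intro: DERIV_isCont)
    have "eventually (\<lambda>y. f y \<noteq> 0) (nhds x)"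
      using cf(1) False by (simp add: continuous_at_avoid isCont_def tendsto_imp_eventually_ne eventually_nhds_conv_at)
    then have "eventually (\<lambda>y. q y = f y / g y) (nhds x)"
      by eventually_elim (simp add: q_def)
    moreover have "isCont (\<lambda>y. f y / g y) x"
      using cf z(1) [OF x] False by (intro continuous_intros) auto
    ultimately show ?thesis
      by (simp only: isCont_cong)
  next
    case True
    then have g0: "g x = 0" "g' x \<noteq> 0" using z x by auto
    have l: "(\<lambda>y. ((f y - f x) / (y - x)) / ((g y - g x) / (y - x))) \<midarrow>x\<rightarrow> f' x / g' x"
      using d [OF x] g0(2) unfolding has_field_derivative_iff by (intro tendsto_divide) auto
    have gne: "eventually (\<lambda>y. (g y - g x) / (y - x) \<noteq> 0) (at x)"
      using d(2) [OF x] g0(2) unfolding has_field_derivative_iff by (rule tendsto_imp_eventually_ne)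
    have "eventually (\<lambda>y. y \<in> {a<..<b} \<and> y \<noteq> x) (at x)"
      using eventually_at_in_open' [of "{a<..<b}" x] x by (auto simp: eventually_at_filter elim: eventually_mono)
    with gne have "eventually (\<lambda>y. ((f y - f x) / (y - x)) / ((g y - g x) / (y - x)) = q y) (at x)"
      by eventually_elim (use True g0 z(1) in \<open>auto simp: q_def\<close>)
    with l have "q \<midarrow>x\<rightarrow> f' x / g' x" by (rule Lim_transform_eventually)
    then show ?thesis using True by (simp add: isCont_def q_def)
  qed
  have nz: "q x \<noteq> 0" if "x \<in> {a<..<b}" for x
    using z [OF that] by (auto simp: q_def)
  have "continuous_on {a<..<b} q" by (intro continuous_at_imp_continuous_on ballI cont)
  then have conn: "connected (q ` {a<..<b})" by (rule connected_continuous_image) auto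
  have no: False if "x \<in> {a<..<b}" "y \<in> {a<..<b}" "q x < 0" "q y > 0" for x y
  proof -
    have "0 \<in> q ` {a<..<b}"
      by (rule connectedD_interval [OF conn, of "q x" "q y"]) (use that in auto)
    then show False using nz by auto
  qed
  have fg: "f x * g x = q x * (g x)\<^sup>2" if "x \<in> {a<..<b}" for x
    using z(1) [OF that] by (auto simp: q_def power2_eq_square)
  show ?thesis
  proof (cases "\<exists>x\<in>{a<..<b}. q x < 0")
    case True
    then have "q y \<le> 0" if "y \<in> {a<..<b}" for y
      using no that by (meson not_le)
    then show ?thesis by (auto simp: fg mult_nonpos_nonneg)
  next
    case False
    then have "q y \<ge> 0" if "y \<in> {a<..<b}" for y
      using that by (meson not_le)
    then show ?thesis by (auto simp: fg)
  qed
qed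

lemma hermite_recurrence:
  "x * poly (hermite_He j) x = poly (hermite_He (Suc j)) x + real j * poly (hermite_He (j - 1)) x"
  by (cases j) (simp_all add: algebra_simps)

text \<open>Multiplication by x - r acts on Hermite coefficients through x He_j = He_(j+1) + j
  He_(j-1). A factor enlarges the bound by at most 1 (shift up) + M (shift down) + T (the
  root).\<close>

lemma hermite_expansion_of_product:
  assumes "finite Z" "card Z \<le> M" "\<And>z. z \<in> Z \<Longrightarrow> \<bar>r z\<bar> \<le> T" "T \<ge> 0"
  shows "\<exists>c. (\<forall>j. \<bar>c j\<bar> \<le> (T + real M + 1) ^ card Z) \<and> (\<forall>j>card Z. c j = 0) \<and>
    (\<forall>x. (\<Prod>z\<in>Z. x - r z) = (\<Sum>j\<le>card Z. c j * poly (hermite_He j) x))"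
  using assms
proof (induction Z rule: finite_induct)
  case empty
  show ?case by (rule exI [of _ "\<lambda>j. if j = 0 then 1 else 0"]) auto
next
  case (insert w Z)
  let ?k = "card Z" and ?B = "T + real M + 1" and ?H = "\<lambda>j x. poly (hermite_He j) x"
  obtain c where c: "\<And>j. \<bar>c j\<bar> \<le> ?B ^ ?k" "\<And>j. j > ?k \<Longrightarrow> c j = 0"
    "\<And>x. (\<Prod>z\<in>Z. x - r z) = (\<Sum>j\<le>?k. c j * ?H j x)"
    using insert by auto
  define c' where "c' j = (if j = 0 then 0 else c (j - 1)) + (real j + 1) * c (Suc j) - r w * c j" for j
  have k: "card (insert w Z) = Suc ?k" using insert by simp
  have kM: "Suc ?k \<le> M" using insert by simp
  have rw: "\<bar>r w\<bar> \<le> T" using insert by simp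
  show ?case
  proof (intro exI [of _ c'] conjI allI impI)
    fix j
    have "\<bar>c' j\<bar> \<le> \<bar>if j = 0 then 0 else c (j - 1)\<bar> + \<bar>(real j + 1) * c (Suc j)\<bar> + \<bar>r w * c j\<bar>"
      unfolding c'_def by linarith
    also have "\<bar>if j = 0 then 0 else c (j - 1)\<bar> \<le> ?B ^ ?k"
      using c(1) [of "j - 1"] insert by auto
    also have "\<bar>(real j + 1) * c (Suc j)\<bar> \<le> real M * ?B ^ ?k"
    proof (cases "Suc j > ?k")
      case True
      then show ?thesis using c(2) insert by simp
    next
      case False
      then show ?thesis
        unfolding abs_mult using kM c(1) [of "Suc j"] by (intro mult_mono) auto
    qed
    also have "\<bar>r w * c j\<bar> \<le> T * ?B ^ ?k"
      unfolding abs_mult using rw c(1) [of j] insert by (intro mult_mono) auto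
    finally show "\<bar>c' j\<bar> \<le> ?B ^ card (insert w Z)"
      unfolding k by (simp add: algebra_simps)
  next
    fix j assume "j > card (insert w Z)"
    then show "c' j = 0" using c(2) unfolding k c'_def by auto
  next
    fix x
    have 1: "(\<Sum>j\<le>?k. c j * ?H (Suc j) x) = (\<Sum>j\<le>Suc ?k. (if j = 0 then 0 else c (j - 1)) * ?H j x)"
      by (subst sum.atMost_Suc_shift) simp
    have "(\<Sum>j\<le>?k. c j * (real j * ?H (j - 1) x)) = (\<Sum>j\<le>Suc (Suc ?k). c j * (real j * ?H (j - 1) x))"
      using c(2) by simp
    also have "\<dots> = (\<Sum>j\<le>Suc ?k. (real j + 1) * c (Suc j) * ?H j x)"
      by (subst sum.atMost_Suc_shift) (simp add: mult_ac add_ac)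
    finally have 2: "(\<Sum>j\<le>?k. c j * (real j * ?H (j - 1) x)) = (\<Sum>j\<le>Suc ?k. (real j + 1) * c (Suc j) * ?H j x)" .
    have 3: "(\<Sum>j\<le>?k. c j * ?H j x) = (\<Sum>j\<le>Suc ?k. c j * ?H j x)"
      using c(2) by simp
    have "(\<Prod>z\<in>insert w Z. x - r z) = (x - r w) * (\<Sum>j\<le>?k. c j * ?H j x)"
      using insert by (simp add: c(3))
    also have "\<dots> = (\<Sum>j\<le>?k. c j * (x * ?H j x)) - r w * (\<Sum>j\<le>?k. c j * ?H j x)"
      unfolding left_diff_distrib sum_distrib_left by (simp add: mult_ac sum_subtractf)
    also have "(\<Sum>j\<le>?k. c j * (x * ?H j x)) = (\<Sum>j\<le>?k. c j * ?H (Suc j) x) + (\<Sum>j\<le>?k. c j * (real j * ?H (j - 1) x))"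
      unfolding hermite_recurrence distrib_left sum.distrib by simp
    also have "\<dots> - r w * (\<Sum>j\<le>?k. c j * ?H j x) = (\<Sum>j\<le>Suc ?k. c' j * ?H j x)"
      unfolding 1 2 3 sum_distrib_left sum.distrib [symmetric] sum_subtractf [symmetric]
      by (intro sum.cong refl) (simp only: c'_def left_diff_distrib distrib_right mult.assoc)
    finally show "(\<Prod>z\<in>insert w Z. x - r z) = (\<Sum>j\<le>card (insert w Z). c' j * ?H j x)"
      by (simp only: k)
  qed
qed

lemma parity_derivative:
  fixes F F' :: "real \<Rightarrow> real"
  assumes d: "\<And>s. (F has_real_derivative F' s) (at s)" and p: "\<And>s. F (- s) = \<sigma> * F s"
  shows "F' (- s) = - (\<sigma> * F' s)"
proof -
  have "((\<lambda>s. F (- s)) has_real_derivative - F' (- s)) (at s)"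
    using DERIV_chain2 [where f = F and g = uminus, OF d DERIV_minus [OF DERIV_ident]] by simp
  moreover have "((\<lambda>s. F (- s)) has_real_derivative \<sigma> * F' s) (at s)"
    unfolding p by (rule DERIV_cmult [OF d])
  ultimately have "- F' (- s) = \<sigma> * F' s" by (rule DERIV_unique)
  then show ?thesis by simp
qed

lemma amode_minus: "amode j n h (- s) = (- 1) ^ j * amode j n h s"
  by (simp add: amode_def tvar_minus approx_minus)

lemma damode_minus: "h > 0 \<Longrightarrow> damode j n h (- s) = - ((- 1) ^ j * damode j n h s)"
  by (rule parity_derivative [OF amode_DERIV amode_minus])

lemma amode_order_0: "amode j 0 h s = parabolic_D j (tvar h s)"
  by (simp add: amode_def approx_parabolic coeff_A_0 coeff_B_0)

lemma cos_scaled_pos: "h > 0 \<Longrightarrow> \<bar>s\<bar> < pi * sqrt h \<Longrightarrow> cos (s / (2 * sqrt h)) > 0"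
  by (rule cos_gt_zero_pi) (auto simp: field_simps abs_if split: if_splits)

lemma tvar_inj: "h > 0 \<Longrightarrow> \<bar>x\<bar> \<le> pi * sqrt h \<Longrightarrow> \<bar>y\<bar> \<le> pi * sqrt h \<Longrightarrow> tvar h x = tvar h y \<Longrightarrow> x = y"
  using tvar_strict_mono [of h x y] tvar_strict_mono [of h y x] by (cases x y rule: linorder_cases) (auto simp: abs_le_iff)

text \<open>The zeros of f are simple because double zeros are excluded, and those of the polynomial
  are simple because t is strictly increasing in s. The sign extends to the end points by
  continuity.\<close>

lemma (in mathieu_mode) product_sign:
  defines "Z \<equiv> {s. \<bar>s\<bar> < b \<and> f s = 0}"
  shows "(\<forall>s\<in>{- b..b}. f s * (\<Prod>z\<in>Z. tvar h s - tvar h z) \<ge> 0) \<or>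
    (\<forall>s\<in>{- b..b}. f s * (\<Prod>z\<in>Z. tvar h s - tvar h z) \<le> 0)"
proof -
  have fin: "finite Z" using zeros(1) by (simp add: Z_def)
  define P where "P = (\<Prod>z\<in>Z. [:- tvar h z, 1:])"
  define g where "g s = poly P (tvar h s)" for s
  have P: "poly P x = (\<Prod>z\<in>Z. x - tvar h z)" for x
    by (simp add: P_def poly_prod)
  have dg: "(g has_real_derivative poly (pderiv P) (tvar h s) * cos (s / (2 * sqrt h))) (at s)" for s
    unfolding g_def [abs_def] by (rule DERIV_chain2 [OF poly_DERIV tvar_DERIV [OF h_pos]])
  have zero: "g s = 0 \<longleftrightarrow> s \<in> Z" if "\<bar>s\<bar> < b" for s
  proof
    assume "g s = 0"
    then obtain z where "z \<in> Z" "tvar h s = tvar h z"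
      unfolding g_def P using fin by auto
    then show "s \<in> Z" using tvar_inj [OF h_pos, of s z] that by (auto simp: Z_def)
  qed (auto simp: g_def P fin prod_zero_iff)
  have simple: "poly (pderiv P) (tvar h z) \<noteq> 0" if "z \<in> Z" for z
  proof -
    define Q where "Q = (\<Prod>w\<in>Z - {z}. [:- tvar h w, 1:])"
    have PQ: "P = [:- tvar h z, 1:] * Q"
      unfolding P_def Q_def by (rule prod.remove [OF fin that])
    have "poly (pderiv P) (tvar h z) = poly Q (tvar h z)"
      unfolding PQ pderiv_mult by (simp add: pderiv_pCons)
    also have "\<dots> \<noteq> 0"
    proof
      assume "poly Q (tvar h z) = 0"
      then obtain w where "w \<in> Z - {z}" "tvar h z = tvar h w"
        unfolding Q_def poly_prod using fin by auto
      then show False using tvar_inj [OF h_pos, of z w] that by (auto simp: Z_def)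
    qed
    finally show ?thesis .
  qed
  have "(\<forall>s\<in>{- b<..<b}. f s * g s \<ge> 0) \<or> (\<forall>s\<in>{- b<..<b}. f s * g s \<le> 0)"
  proof (rule common_simple_zeros_sign [OF DERIV_f dg])
    fix s assume "s \<in> {- b<..<b}"
    then have s: "\<bar>s\<bar> < b" by auto
    show "f s = 0 \<longleftrightarrow> g s = 0" using zero [OF s] s by (simp add: Z_def)
    show "f' s \<noteq> 0 \<and> poly (pderiv P) (tvar h s) * cos (s / (2 * sqrt h)) \<noteq> 0" if "f s = 0"
      using simple [of s] cos_scaled_pos [OF h_pos s] not_double_zero [of s] that s by (auto simp: Z_def)
  qed
  moreover have cont: "continuous_on (closure {- b<..<b}) (\<lambda>s. f s * g s)"
    by (intro continuous_intros continuous_f continuous_on_DERIV [OF dg])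
  have cl: "closure {- b<..<b} = {- b..b}"
    using b_pos by (intro closure_greaterThanLessThan) auto
  ultimately have "(\<forall>s\<in>{- b..b}. f s * g s \<ge> 0) \<or> (\<forall>s\<in>{- b..b}. f s * g s \<le> 0)"
  proof (elim disjE)
    assume *: "\<forall>s\<in>{- b<..<b}. f s * g s \<ge> 0"
    have "f s * g s \<ge> 0" if "s \<in> {- b..b}" for s
      by (rule continuous_ge_on_closure [OF cont]) (use * that cl in simp_all)
    then show ?thesis by blast
  next
    assume *: "\<forall>s\<in>{- b<..<b}. f s * g s \<le> 0"
    have "f s * g s \<le> 0" if "s \<in> {- b..b}" for s
      by (rule continuous_le_on_closure [OF cont]) (use * that cl in simp_all)
    then show ?thesis by blast
  qed
  then show ?thesis by (simp only: g_def P)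
qed

text \<open>The integrand of constant sign is bounded below on an interval of length 1/2. Expanding
  the polynomial in He_0, ..., He_m with coefficients at most B makes the integral a combination of
  m + 1 overlaps, so they cannot all be small.\<close>

lemma overlap_lower:
  "\<exists>c>0. \<forall>h \<Lambda> f f'. mathieu_mode m h \<Lambda> f f' \<longrightarrow>
     (\<exists>j\<le>m. c \<le> \<bar>integral {- (pi * sqrt h)..pi * sqrt h} (\<lambda>s. amode j 0 h s * f s)\<bar>)"
proof -
  let ?T = "turn m"
  define G g where "G = growth m ?T" and "g = growth m (?T + 2)"
  have Gg: "G \<ge> 1" "g \<ge> 1" unfolding G_def g_def using turn_pos(1) [of m] by (auto intro!: growth_ge_1)
  define B where "B = (?T + real m + 1) ^ m"
  have B: "B \<ge> 1" unfolding B_def using turn_pos(1) [of m] by (intro one_le_power) simp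
  \<comment> \<open>The length 1/2 of the interval \<open>?I\<close> below times lower bounds for
    |f|, for the Gaussian, and for the m linear factors.\<close>
  define c0 where "c0 = 1/2 * (1 / (32 * g * G) * (exp (- (?T + 2)\<^sup>2 / 4) * (1/2) ^ m))"
  have c0: "c0 > 0" unfolding c0_def using Gg by simp
  show ?thesis
  proof (intro exI [of _ "c0 / (B * (real m + 1))"] conjI allI impI)
    show "0 < c0 / (B * (real m + 1))" using c0 B by simp
    fix h \<Lambda> f f'
    assume "mathieu_mode m h \<Lambda> f f'"
    then interpret mathieu_mode m h \<Lambda> f f' .
    define Z where "Z = {s. \<bar>s\<bar> < b \<and> f s = 0}"
    have Z: "finite Z" "card Z = m" using zeros by (simp_all add: Z_def)
    have ZT: "\<bar>z\<bar> < ?T" if "z \<in> Z" for z using zeros_inside that by (simp add: Z_def)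
    define p where "p x = (\<Prod>z\<in>Z. x - tvar h z)" for x
    define F where "F s = f s * p (tvar h s) * exp (- (tvar h s)\<^sup>2 / 4)" for s
    have contp: "continuous_on A (\<lambda>s. p (tvar h s))" for A
      unfolding p_def by (intro continuous_intros continuous_on_tvar)
    have contF: "continuous_on A F" for A
      unfolding F_def [abs_def] by (intro continuous_intros continuous_f contp continuous_on_tvar) auto
    obtain \<sigma> :: real where \<sigma>: "\<bar>\<sigma>\<bar> = 1" "\<And>s. \<bar>s\<bar> \<le> b \<Longrightarrow> \<sigma> * F s \<ge> 0"
    proof -
      from product_sign have "(\<forall>s\<in>{- b..b}. f s * p (tvar h s) \<ge> 0) \<or> (\<forall>s\<in>{- b..b}. f s * p (tvar h s) \<le> 0)"
        unfolding p_def Z_def .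
      then show ?thesis
      proof
        assume *: "\<forall>s\<in>{- b..b}. f s * p (tvar h s) \<ge> 0"
        have "f s * p (tvar h s) * exp (- (tvar h s)\<^sup>2 / 4) \<ge> 0" if "\<bar>s\<bar> \<le> b" for s
          by (rule mult_nonneg_nonneg [OF bspec [OF *]]) (use that in auto)
        then show ?thesis by (intro that [of 1]) (auto simp: F_def)
      next
        assume *: "\<forall>s\<in>{- b..b}. f s * p (tvar h s) \<le> 0"
        have "f s * p (tvar h s) * exp (- (tvar h s)\<^sup>2 / 4) \<le> 0" if "\<bar>s\<bar> \<le> b" for s
          by (rule mult_nonpos_nonneg [OF bspec [OF *]]) (use that in auto)
        then show ?thesis by (intro that [of "-1"]) (auto simp: F_def)
      qed
    qed
    have int: "(\<lambda>s. \<sigma> * F s) integrable_on {u..v}" for u v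
      by (intro integrable_continuous_real continuous_intros contF)
    let ?I = "{?T + 1..?T + 3/2}"
    have sub: "?I \<subseteq> {- b..b}" using wide turn_pos(1) [of m] by auto
    have low: "2 * c0 \<le> \<sigma> * F s" if s: "s \<in> ?I" for s
    proof -
      have sb: "\<bar>s\<bar> \<le> b" "\<bar>s\<bar> \<le> ?T + 2" using s sub turn_pos(1) [of m] by auto
      have "1 \<le> 32 * g * (f s)\<^sup>2"
        unfolding g_def using s by (intro tail_lower) auto
      \<comment> \<open>f^2 \<le> |f| G turns the lower bound for f^2 into one for |f|.\<close>
      also have "\<dots> \<le> 32 * g * (\<bar>f s\<bar> * G)"
      proof (intro mult_left_mono)
        have "\<bar>f s\<bar> * \<bar>f s\<bar> \<le> \<bar>f s\<bar> * G"
          using f_abs_bounds(1) [OF sb(1)] unfolding G_def by (intro mult_left_mono) auto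
        then show "(f s)\<^sup>2 \<le> \<bar>f s\<bar> * G" by (simp add: power2_eq_square)
      qed (use Gg in auto)
      finally have f: "1 / (32 * g * G) \<le> \<bar>f s\<bar>"
        using Gg by (simp add: field_simps)
      \<comment> \<open>All zeros lie below \<open>?T\<close>, and t grows by at least 1/2 from
        \<open>?T\<close> to s: the distance is at least 1, and \<open>wide\<close> keeps dt/ds
        \<ge> 1/2 there.\<close>
      have fac: "1/2 \<le> tvar h s - tvar h z" if z: "z \<in> Z" for z
      proof -
        have "tvar h z < tvar h ?T"
          using ZT [OF z] b_pos turn_pos(1) [of m] by (intro tvar_strict_mono [OF h_pos]) auto
        moreover have "1/2 \<le> tvar h s - tvar h ?T"
        proof -
          obtain \<xi> where \<xi>: "?T < \<xi>" "\<xi> < s" "tvar h s - tvar h ?T = (s - ?T) * cos (\<xi> / (2 * sqrt h))"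
            using MVT2 [of ?T s "tvar h" "\<lambda>x. cos (x / (2 * sqrt h))"] tvar_DERIV [OF h_pos] s by auto
          have "2 * \<xi> \<le> pi * sqrt h" using \<xi> s wide by auto
          then have "\<xi> / (2 * sqrt h) \<le> pi / 4" using h_pos by (simp add: field_simps)
          then have "\<xi> / (2 * sqrt h) \<le> pi / 3" using pi_gt_zero by linarith
          moreover have "0 \<le> \<xi> / (2 * sqrt h)" using \<xi> turn_pos(1) [of m] h_pos by simp
          ultimately have "cos (pi / 3) \<le> cos (\<xi> / (2 * sqrt h))"
            by (intro cos_monotone_0_pi_le) auto
          then have "1 * (1/2) \<le> (s - ?T) * cos (\<xi> / (2 * sqrt h))"
            using s by (intro mult_mono) (auto simp: cos_60)
          then show ?thesis using \<xi>(3) by simp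
        qed
        ultimately show ?thesis by linarith
      qed
      have "(1/2) ^ m \<le> p (tvar h s)"
      proof -
        have "(\<Prod>z\<in>Z. 1/2) \<le> p (tvar h s)"
          unfolding p_def by (rule prod_mono) (use fac in auto)
        then show ?thesis using Z by simp
      qed
      moreover have "exp (- (?T + 2)\<^sup>2 / 4) \<le> exp (- (tvar h s)\<^sup>2 / 4)"
      proof -
        have "\<bar>tvar h s\<bar> \<le> ?T + 2" using abs_tvar_le [OF h_pos, of s] sb(2) by linarith
        then have "(tvar h s)\<^sup>2 \<le> (?T + 2)\<^sup>2" by (metis abs_ge_zero power2_abs power_mono)
        then show ?thesis by simp
      qed
      ultimately have "exp (- (?T + 2)\<^sup>2 / 4) * (1/2) ^ m \<le> exp (- (tvar h s)\<^sup>2 / 4) * \<bar>p (tvar h s)\<bar>"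
        by (intro mult_mono) auto
      then have "1 / (32 * g * G) * (exp (- (?T + 2)\<^sup>2 / 4) * (1/2) ^ m)
          \<le> \<bar>f s\<bar> * (exp (- (tvar h s)\<^sup>2 / 4) * \<bar>p (tvar h s)\<bar>)"
        using f Gg by (intro mult_mono [OF f]) auto
      also have "\<dots> = \<bar>\<sigma> * F s\<bar>" using \<sigma>(1) by (simp add: F_def abs_mult mult_ac)
      also have "\<dots> = \<sigma> * F s" using \<sigma>(2) [OF sb(1)] by simp
      finally show ?thesis by (simp add: c0_def mult_ac)
    qed
    have "c0 = integral ?I (\<lambda>s. 2 * c0)" by simp
    also have "\<dots> \<le> integral ?I (\<lambda>s. \<sigma> * F s)"
      by (rule integral_le [OF _ int low]) auto
    also have "\<dots> \<le> integral {- b..b} (\<lambda>s. \<sigma> * F s)"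
      by (rule integral_subset_le [OF sub int int]) (use \<sigma>(2) in auto)
    also have "\<dots> = \<sigma> * integral {- b..b} F" by simp
    also have "\<dots> \<le> \<bar>integral {- b..b} F\<bar>"
      using abs_ge_self [of "\<sigma> * integral {- b..b} F"] \<sigma>(1) by (simp add: abs_mult)
    finally have 1: "c0 \<le> \<bar>integral {- b..b} F\<bar>" .
    have r: "\<bar>tvar h z\<bar> \<le> ?T" if "z \<in> Z" for z
      using abs_tvar_le [OF h_pos, of z] ZT [OF that] by linarith
    obtain c where c: "\<And>j. \<bar>c j\<bar> \<le> B" "\<And>x. p x = (\<Sum>j\<le>m. c j * poly (hermite_He j) x)"
      using hermite_expansion_of_product [OF Z(1), of m "tvar h" ?T] r turn_pos(1) [of m] Z(2)
      unfolding B_def p_def by auto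
    have "F = (\<lambda>s. \<Sum>j\<le>m. c j * (amode j 0 h s * f s))"
      by (simp add: F_def fun_eq_iff c(2) amode_order_0 parabolic_D_eq sum_distrib_left sum_distrib_right mult_ac)
    then have "integral {- b..b} F = (\<Sum>j\<le>m. c j * overlap j 0)"
      by (simp add: integral_sum integrable_continuous_real continuous_intros continuous_f continuous_amode)
    then have "\<bar>integral {- b..b} F\<bar> \<le> (\<Sum>j\<le>m. \<bar>c j\<bar> * \<bar>overlap j 0\<bar>)"
      using sum_abs [of "\<lambda>j. c j * overlap j 0" "{..m}"] by (simp add: abs_mult)
    also have "\<dots> \<le> (\<Sum>j\<le>m. B * \<bar>overlap j 0\<bar>)"
      using c(1) by (intro sum_mono mult_right_mono) auto
    finally have 2: "c0 \<le> B * (\<Sum>j\<le>m. \<bar>overlap j 0\<bar>)"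
      using 1 by (simp add: sum_distrib_left)
    show "\<exists>j\<le>m. c0 / (B * (real m + 1)) \<le> \<bar>overlap j 0\<bar>"
    proof (rule ccontr)
      assume "\<not> ?thesis"
      then have "(\<Sum>j\<le>m. \<bar>overlap j 0\<bar>) < (\<Sum>j\<le>m. c0 / (B * (real m + 1)))"
        by (intro sum_strict_mono) auto
      also have "\<dots> = (real m + 1) * (c0 / (B * (real m + 1)))" by (simp add: add.commute)
      also have "\<dots> = c0 / B"
      proof -
        have "x * (c0 / (B * x)) = c0 / B" if "x > 0" for x
          using that B by (simp add: field_simps)
        then show ?thesis by simp
      qed
      finally show False using 2 B by (simp add: field_simps)
    qed
  qed
qed

text \<open>An odd integrand integrates to 0 over [-b, b], so a nonzero overlap forces f to have the
  parity of D_j.\<close>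

lemma (in mathieu_mode) overlap_parity:
  assumes "overlap j n \<noteq> 0"
  shows "f (- s) = (- 1) ^ j * f s"
proof -
  obtain \<sigma> :: real where \<sigma>: "\<sigma> = 1 \<or> \<sigma> = -1" "\<And>s. f (- s) = \<sigma> * f s"
    using parity by (metis mult_1 mult_minus1)
  have "overlap j n = integral {- b..b} (\<lambda>s. amode j n h (- s) * f (- s))"
    using Henstock_Kurzweil_Integration.integral_reflect_real [of b "- b" "\<lambda>s. amode j n h s * f s"] by simp
  also have "\<dots> = integral {- b..b} (\<lambda>s. ((- 1) ^ j * \<sigma>) * (amode j n h s * f s))"
    by (simp add: amode_minus \<sigma>(2) mult_ac)
  also have "\<dots> = ((- 1) ^ j * \<sigma>) * overlap j n" by simp
  finally have "(- 1) ^ j * \<sigma> = 1" using assms by simp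
  then have "\<sigma> = (- 1) ^ j" using \<sigma>(1) by (cases "even j") auto
  then show ?thesis using \<sigma>(2) by simp
qed

text \<open>As f and the approximate mode have the same parity, one multiple \<kappa> matches both
  Cauchy data at 0. The difference starts from zero data and is driven by the eigenvalue error and
  the residual, which Gronwall controls on [0, T].\<close>

lemma shooting:
  assumes "T \<ge> 0"
  shows "\<exists>K h0. K > 0 \<and> (\<forall>h \<Lambda> f f' \<delta>. mathieu_mode m h \<Lambda> f f' \<longrightarrow> h \<ge> h0 \<longrightarrow>
     \<bar>\<Lambda> - approx_eigenvalue j n (1 / h)\<bar> \<le> \<delta> \<longrightarrow> (\<forall>s. f (- s) = (- 1) ^ j * f s) \<longrightarrow>
     (\<exists>\<kappa>. 1 / K \<le> \<bar>\<kappa>\<bar> \<and> \<bar>\<kappa>\<bar> \<le> K \<and> (\<forall>s. \<bar>s\<bar> \<le> T \<longrightarrow>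
        \<bar>f s - \<kappa> * amode j n h s\<bar> \<le> K * (\<delta> + 1 / h ^ (n + 1)) \<and>
        \<bar>f' s - \<kappa> * damode j n h s\<bar> \<le> K * (\<delta> + 1 / h ^ (n + 1)))))"
proof -
  define w where "w = (if even j then parabolic_D j 0 else deriv (parabolic_D j) 0)"
  have w: "w \<noteq> 0"
    unfolding w_def by (simp add: parabolic_D_eq deriv_parabolic_D dHe_0 hermite_He_0_even hermite_He_0_odd)
  obtain K1 where K1: "K1 \<ge> 0" "\<And>h t. h \<ge> 1 \<Longrightarrow> \<bar>approx j n (1 / h) t - parabolic_D j t\<bar> \<le> K1 / h / (1 + t\<^sup>2) ^ 0"
    "\<And>h t. h \<ge> 1 \<Longrightarrow> \<bar>dapprox j n (1 / h) t - deriv (parabolic_D j) t\<bar> \<le> K1 / h / (1 + t\<^sup>2) ^ 0"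
    using approx_order_difference by blast
  obtain K2 where K2: "K2 \<ge> 0" "\<And>h t. h \<ge> 1 \<Longrightarrow> \<bar>approx j n (1 / h) t\<bar> \<le> K2 / (1 + t\<^sup>2) ^ 0"
    using approx_decay by blast
  obtain K3 where K3: "K3 \<ge> 0" "\<And>h t. h \<ge> 1 \<Longrightarrow> \<bar>residual j n (1 / h) t\<bar> \<le> K3 / h ^ (n + 1) / (1 + t\<^sup>2) ^ 0"
    using residual_decay by blast
  define k where "k = 2 / \<bar>w\<bar>"
  have k: "k > 0" using w by (simp add: k_def)
  define X where "X = T * growth m T"
  have X: "X \<ge> 0" using assms growth_ge_1 [of T m] by (simp add: X_def)
  define K where "K = k + 2 * \<bar>w\<bar> + k * (K2 + K3) * (X + 1) + 1"
  have K: "K > 0" "k \<le> K" "2 * \<bar>w\<bar> \<le> K" "k * (K2 + K3) * (X + 1) \<le> K"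
    using k K2 K3 X by (auto simp: K_def add_nonneg_pos)
  show ?thesis
  proof (rule exI [of _ K], rule exI [of _ "max 1 (2 * K1 / \<bar>w\<bar>)"], intro conjI allI impI K(1))
    fix h \<Lambda> f f' \<delta>
    assume mode: "mathieu_mode m h \<Lambda> f f'" and hh: "max 1 (2 * K1 / \<bar>w\<bar>) \<le> h"
      and \<delta>: "\<bar>\<Lambda> - approx_eigenvalue j n (1 / h)\<bar> \<le> \<delta>" and par: "\<forall>s. f (- s) = (- 1) ^ j * f s"
    interpret mathieu_mode m h \<Lambda> f f' by (rule mode)
    have par': "f' (- s) = - ((- 1) ^ j * f' s)" for s
      using parity_derivative [OF DERIV_f] par by blast
    define u v where "u = (if even j then f 0 else f' 0)"
      and "v = (if even j then amode j n h 0 else damode j n h 0)"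
    have zeros: "even j \<Longrightarrow> f' 0 = 0 \<and> damode j n h 0 = 0" "odd j \<Longrightarrow> f 0 = 0 \<and> amode j n h 0 = 0"
      using par' [of 0] damode_minus [OF h_pos, of j n 0] par [rule_format, of 0] amode_minus [of j n h 0] by auto
    have u: "\<bar>u\<bar> = 1"
    proof -
      have "u\<^sup>2 = 1" using normalized zeros by (auto simp: u_def)
      then show ?thesis using abs_square_eq_1 by blast
    qed
    \<comment> \<open>For large h the nonzero datum v of the approximate mode is within |w|/2 of
      that of D_j, which bounds \<kappa> from both sides.\<close>
    have "\<bar>v - w\<bar> \<le> K1 / h"
      using K1(2,3) [OF h, of 0] by (auto simp: v_def w_def amode_def damode_def)
    also have "\<dots> \<le> \<bar>w\<bar> / 2"
      using hh w h_pos by (simp add: field_simps)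
    finally have v: "\<bar>w\<bar> / 2 \<le> \<bar>v\<bar>" "\<bar>v\<bar> \<le> 2 * \<bar>w\<bar>" by linarith+
    have v0: "v \<noteq> 0" using v w by auto
    define \<kappa> where "\<kappa> = u / v"
    have \<kappa>: "\<bar>\<kappa>\<bar> = 1 / \<bar>v\<bar>" using u by (simp add: \<kappa>_def)
    have \<kappa>k: "\<bar>\<kappa>\<bar> \<le> k"
    proof -
      have "1 / \<bar>v\<bar> \<le> 1 / (\<bar>w\<bar> / 2)" using v w by (intro divide_left_mono) auto
      then show ?thesis by (simp add: \<kappa> k_def)
    qed
    have "1 / K \<le> \<bar>\<kappa>\<bar>"
      unfolding \<kappa> using v v0 K by (intro divide_left_mono) auto
    moreover have "\<bar>\<kappa>\<bar> \<le> K" using \<kappa>k K by linarith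
    moreover have "\<bar>f s - \<kappa> * amode j n h s\<bar> \<le> K * (\<delta> + 1 / h ^ (n + 1)) \<and>
        \<bar>f' s - \<kappa> * damode j n h s\<bar> \<le> K * (\<delta> + 1 / h ^ (n + 1))" if s: "\<bar>s\<bar> \<le> T" for s
    proof -
      define d d' where "d x = f x - \<kappa> * amode j n h x" and "d' x = f' x - \<kappa> * damode j n h x" for x
      let ?\<epsilon> = "\<delta> + 1 / h ^ (n + 1)"
      define r where "r x = - \<kappa> * ((\<Lambda> - approx_eigenvalue j n (1 / h)) * amode j n h x + residual j n (1 / h) (tvar h x))" for x
      define \<rho> where "\<rho> = k * ((K2 + K3) * ?\<epsilon>)"
      have \<delta>0: "\<delta> \<ge> 0" using \<delta> abs_ge_zero order_trans by blast
      have \<epsilon>: "?\<epsilon> \<ge> 0" "\<delta> \<le> ?\<epsilon>" "1 / h ^ (n + 1) \<le> ?\<epsilon>" using \<delta>0 h_pos by auto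
      have \<rho>: "\<rho> \<ge> 0" unfolding \<rho>_def using k K2 K3 \<epsilon> by (intro mult_nonneg_nonneg) auto
      have r: "\<bar>r x\<bar> \<le> \<rho>" for x
      proof -
        have "\<bar>(\<Lambda> - approx_eigenvalue j n (1 / h)) * amode j n h x\<bar> \<le> ?\<epsilon> * K2"
          unfolding abs_mult using order_trans [OF \<delta> \<epsilon>(2)] \<epsilon>(1) K2(2) [OF h, of "tvar h x"]
          by (intro mult_mono) (simp_all add: amode_def)
        moreover have "\<bar>residual j n (1 / h) (tvar h x)\<bar> \<le> K3 * ?\<epsilon>"
        proof -
          have "K3 * (1 / h ^ (n + 1)) \<le> K3 * ?\<epsilon>" using \<epsilon>(3) K3(1) by (rule mult_left_mono)
          then show ?thesis using K3(2) [OF h, of "tvar h x"] by simp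
        qed
        ultimately have "\<bar>(\<Lambda> - approx_eigenvalue j n (1 / h)) * amode j n h x + residual j n (1 / h) (tvar h x)\<bar>
            \<le> (K2 + K3) * ?\<epsilon>"
          using abs_triangle_ineq [of "(\<Lambda> - approx_eigenvalue j n (1 / h)) * amode j n h x" "residual j n (1 / h) (tvar h x)"]
          by (simp only: distrib_right mult.commute [of K2])
        then show ?thesis
          unfolding r_def \<rho>_def abs_mult abs_minus_cancel using \<kappa>k k by (intro mult_mono) auto
      qed
      have "(d \<bar>s\<bar>)\<^sup>2 + (d' \<bar>s\<bar>)\<^sup>2 \<le> ((d 0)\<^sup>2 + (d' 0)\<^sup>2 + \<rho>\<^sup>2 * (\<bar>s\<bar> - 0)) * exp ((2 + (T\<^sup>2 / 4 + lam_bound m)) * (\<bar>s\<bar> - 0))"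
      proof (rule energy_growth [where V = V and r = r])
        fix x assume x: "x \<in> {0..\<bar>s\<bar>}"
        show "(d has_real_derivative d' x) (at x)"
          unfolding d_def [abs_def] d'_def
          by (intro DERIV_diff DERIV_cmult DERIV_f amode_DERIV h_pos)
        show "(d' has_real_derivative V x * d x + r x) (at x)"
          unfolding d'_def [abs_def]
          by (rule DERIV_cong [OF DERIV_diff [OF DERIV_f' DERIV_cmult [OF damode_DERIV [OF h_pos]]]])
            (simp add: d_def r_def field_simps)
        show "\<bar>V x\<bar> \<le> T\<^sup>2 / 4 + lam_bound m" using x s by (intro abs_V_le) auto
      qed (use r in auto)
      also have "((d 0)\<^sup>2 + (d' 0)\<^sup>2 + \<rho>\<^sup>2 * (\<bar>s\<bar> - 0)) = (0\<^sup>2 + 0\<^sup>2 + \<rho>\<^sup>2 * (\<bar>s\<bar> - 0))"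
        using zeros v0 by (auto simp: d_def d'_def \<kappa>_def u_def v_def)
      also have "(0\<^sup>2 + 0\<^sup>2 + \<rho>\<^sup>2 * (\<bar>s\<bar> - 0)) * exp ((2 + (T\<^sup>2 / 4 + lam_bound m)) * (\<bar>s\<bar> - 0)) \<le> \<rho>\<^sup>2 * T * growth m T"
        unfolding growth_def using s turn_pos(2) [of m] assms
        by (intro mult_mono) (auto intro!: mult_left_mono add_nonneg_nonneg)
      also have "\<dots> \<le> (\<rho> * (X + 1))\<^sup>2"
      proof -
        have "X \<le> (X + 1)\<^sup>2" using X by (simp add: power2_eq_square algebra_simps)
        then have "\<rho>\<^sup>2 * X \<le> \<rho>\<^sup>2 * (X + 1)\<^sup>2" by (intro mult_left_mono) auto
        then show ?thesis by (simp add: X_def power_mult_distrib mult_ac)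
      qed
      finally have E: "(d \<bar>s\<bar>)\<^sup>2 + (d' \<bar>s\<bar>)\<^sup>2 \<le> (\<rho> * (X + 1))\<^sup>2" .
      have "(d \<bar>s\<bar>)\<^sup>2 \<le> (\<rho> * (X + 1))\<^sup>2" "(d' \<bar>s\<bar>)\<^sup>2 \<le> (\<rho> * (X + 1))\<^sup>2"
        using E zero_le_power2 [of "d \<bar>s\<bar>"] zero_le_power2 [of "d' \<bar>s\<bar>"] by linarith+
      moreover have "\<rho> * (X + 1) \<ge> 0" using \<rho> X by simp
      ultimately have "\<bar>d \<bar>s\<bar>\<bar> \<le> \<rho> * (X + 1)" "\<bar>d' \<bar>s\<bar>\<bar> \<le> \<rho> * (X + 1)"
        using abs_le_square_iff [of "d \<bar>s\<bar>" "\<rho> * (X + 1)"] abs_le_square_iff [of "d' \<bar>s\<bar>" "\<rho> * (X + 1)"] by auto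
      moreover have "\<bar>d \<bar>s\<bar>\<bar> = \<bar>d s\<bar>" "\<bar>d' \<bar>s\<bar>\<bar> = \<bar>d' s\<bar>"
      proof -
        have "d (- s) = (- 1) ^ j * d s" "d' (- s) = - ((- 1) ^ j * d' s)"
          using par par' amode_minus damode_minus [OF h_pos] by (simp_all add: d_def d'_def algebra_simps)
        then have "\<bar>d (- s)\<bar> = \<bar>d s\<bar>" "\<bar>d' (- s)\<bar> = \<bar>d' s\<bar>" by (simp_all add: abs_mult power_abs)
        then show "\<bar>d \<bar>s\<bar>\<bar> = \<bar>d s\<bar>" "\<bar>d' \<bar>s\<bar>\<bar> = \<bar>d' s\<bar>" by (auto simp: abs_if)
      qed
      moreover have "\<rho> * (X + 1) \<le> K * ?\<epsilon>"
      proof -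
        have "\<rho> * (X + 1) = (k * (K2 + K3) * (X + 1)) * ?\<epsilon>" by (simp only: \<rho>_def mult_ac)
        also have "\<dots> \<le> K * ?\<epsilon>" by (rule mult_right_mono [OF K(4) \<epsilon>(1)])
        finally show ?thesis .
      qed
      ultimately show ?thesis unfolding d_def d'_def by linarith
    qed
    ultimately show "\<exists>\<kappa>. 1 / K \<le> \<bar>\<kappa>\<bar> \<and> \<bar>\<kappa>\<bar> \<le> K \<and> (\<forall>s. \<bar>s\<bar> \<le> T \<longrightarrow>
        \<bar>f s - \<kappa> * amode j n h s\<bar> \<le> K * (\<delta> + 1 / h ^ (n + 1)) \<and>
        \<bar>f' s - \<kappa> * damode j n h s\<bar> \<le> K * (\<delta> + 1 / h ^ (n + 1)))"
      by blast
  qed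
qed

section \<open>Identification of the mode and its expansion\<close>

lemma MVT_abs:
  fixes F F' :: "real \<Rightarrow> real"
  assumes d: "\<And>x. (F has_real_derivative F' x) (at x)"
  shows "\<exists>\<xi>. \<bar>\<xi> - z\<bar> \<le> \<bar>s - z\<bar> \<and> F s - F z = (s - z) * F' \<xi>"
proof (cases s z rule: linorder_cases)
  case less
  from MVT2 [OF less d] obtain \<xi> where "s < \<xi>" "\<xi> < z" "F z - F s = (z - s) * F' \<xi>" by blast
  then show ?thesis by (intro exI [of _ \<xi>]) (auto simp: algebra_simps)
next
  case greater
  from MVT2 [OF greater d] obtain \<xi> where "z < \<xi>" "\<xi> < s" "F s - F z = (s - z) * F' \<xi>" by blast
  then show ?thesis by (intro exI [of _ \<xi>]) auto
qed auto

text \<open>A lower bound for |f'| at a zero z: with G = \<open>growth m (turn m)\<close> one has 1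
  \<le> G f'(z)^2 and |f'(z)| \<le> G.\<close>

definition slope :: "nat \<Rightarrow> real" where
  "slope m = 1 / (growth m (turn m))\<^sup>2"

text \<open>\<open>slope m\<close> divided by twice a bound for |f''| = |V f| on |s| \<le>
  \<open>turn m + 1\<close>. Within this distance of a zero, f' changes by at most half of
  \<open>slope m\<close>.\<close>

definition zero_radius :: "nat \<Rightarrow> real" where
  "zero_radius m = slope m / (2 * (((turn m + 1)\<^sup>2 / 4 + lam_bound m) * growth m (turn m)))"

lemma slope_bounds: "0 < slope m" "slope m \<le> 1" "0 < zero_radius m" "zero_radius m \<le> 1"
proof -
  have g: "growth m (turn m) \<ge> 1" using turn_pos(1) [of m] by (intro growth_ge_1) simp
  then have "(growth m (turn m))\<^sup>2 \<ge> 1" by simp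
  then have "0 < (growth m (turn m))\<^sup>2" "(growth m (turn m))\<^sup>2 \<ge> 1" by linarith+
  then show s: "0 < slope m" "slope m \<le> 1" by (simp_all add: slope_def pos_divide_le_eq)
  have M: "1 * 1 \<le> ((turn m + 1)\<^sup>2 / 4 + lam_bound m) * growth m (turn m)"
    using g turn_pos(2) [of m] by (intro mult_mono) (auto simp: add_nonneg_nonneg intro: order_trans)
  then show "0 < zero_radius m" "zero_radius m \<le> 1"
    using s by (auto simp: zero_radius_def)
qed

context mathieu_mode
begin

text \<open>Throughout the radius f' keeps the sign of f'(z) and at least half the guaranteed slope;
  the mean value theorem carries this to f. It yields both a sign change of known size and the
  separation of zeros.\<close>

lemma zero_isolated:
  assumes z: "\<bar>z\<bar> < b" "f z = 0" and s: "\<bar>s - z\<bar> \<le> zero_radius m"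
  shows "sgn (f' z) * f s * (s - z) \<ge> slope m / 2 * (s - z)\<^sup>2"
proof -
  define G where "G = growth m (turn m)"
  define M where "M = ((turn m + 1)\<^sup>2 / 4 + lam_bound m) * G"
  have G: "G \<ge> 1" unfolding G_def using turn_pos(1) [of m] by (intro growth_ge_1) simp
  have zT: "\<bar>z\<bar> < turn m" using zeros_inside z by blast
  have "1 \<le> ((f z)\<^sup>2 + (f' z)\<^sup>2) * G"
    unfolding G_def using zT by (intro energy_bounds) simp
  then have "1 \<le> \<bar>f' z\<bar> * \<bar>f' z\<bar> * G" using z by (simp add: power2_eq_square)
  also have "\<dots> \<le> \<bar>f' z\<bar> * G * G"
    using f_abs_bounds(2) [of z] z G by (intro mult_right_mono mult_left_mono) (auto simp: G_def)
  finally have slope: "slope m \<le> \<bar>f' z\<bar>"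
    using G by (simp add: slope_def G_def [symmetric] field_simps power2_eq_square)
  have near: "sgn (f' z) * f' x \<ge> slope m / 2" if x: "\<bar>x - z\<bar> \<le> zero_radius m" for x
  proof -
    obtain \<xi> where \<xi>: "\<bar>\<xi> - z\<bar> \<le> \<bar>x - z\<bar>" "f' x - f' z = (x - z) * (V \<xi> * f \<xi>)"
      using MVT_abs [of f' "\<lambda>x. V x * f x" z x] DERIV_f' by blast
    have \<xi>T: "\<bar>\<xi>\<bar> \<le> turn m + 1" using \<xi>(1) x zT slope_bounds(4) [of m] by linarith
    have \<xi>b: "\<bar>\<xi>\<bar> \<le> b" using \<xi>T wide turn_pos(1) [of m] by linarith
    have "\<bar>V \<xi> * f \<xi>\<bar> \<le> M"
      unfolding abs_mult M_def using abs_V_le [OF \<xi>T] f_abs_bounds(1) [OF \<xi>b]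
      by (intro mult_mono) (auto simp: G_def)
    then have "\<bar>x - z\<bar> * \<bar>V \<xi> * f \<xi>\<bar> \<le> zero_radius m * M"
      using x slope_bounds(3) [of m] by (intro mult_mono) auto
    moreover have "zero_radius m * M = slope m / 2"
    proof -
      have "M > 0" unfolding M_def using G turn_pos(2) [of m] by (intro mult_pos_pos) (auto intro: add_nonneg_pos)
      moreover have "zero_radius m = slope m / (2 * M)" by (simp add: zero_radius_def M_def G_def)
      ultimately show ?thesis by simp
    qed
    ultimately have "\<bar>f' x - f' z\<bar> \<le> slope m / 2" unfolding \<xi>(2) abs_mult by linarith
    then show ?thesis
      using slope slope_bounds(1) [of m] by (auto simp: sgn_if abs_if split: if_splits)
  qed
  obtain \<xi> where \<xi>: "\<bar>\<xi> - z\<bar> \<le> \<bar>s - z\<bar>" "f s - f z = (s - z) * f' \<xi>"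
    using MVT_abs [of f f' z s] DERIV_f by blast
  have "slope m / 2 * (s - z)\<^sup>2 \<le> (sgn (f' z) * f' \<xi>) * (s - z)\<^sup>2"
    using \<xi>(1) s by (intro mult_right_mono near) auto
  also have "\<dots> = sgn (f' z) * f s * (s - z)"
    using \<xi>(2) z(2) by (simp add: power2_eq_square)
  finally show ?thesis .
qed

text \<open>On either side of a zero of f, at distance \<rho>, f has opposite signs and a modulus
  exceeding the approximation error, so D_j(t) vanishes in between. Distinct zeros of f give
  distinct real roots of He_j, of which there are at most j.\<close>

lemma index_le:
  assumes \<kappa>: "\<kappa> \<noteq> 0" and \<eta>: "6 * \<eta> < slope m * zero_radius m"
    and approx: "\<And>s. \<bar>s\<bar> \<le> turn m + 1 \<Longrightarrow> \<bar>f s - \<kappa> * amode j 0 h s\<bar> \<le> \<eta>"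
  shows "m \<le> j"
proof -
  define Z where "Z = {s. \<bar>s\<bar> < b \<and> f s = 0}"
  \<comment> \<open>With a third of the radius, two zeros of f served by the same zero of D_j are
    within 2 \<rho> and coincide by \<open>zero_isolated\<close>; and the hypothesis on \<eta> reads
    \<eta> < \<open>slope m / 2 * \<rho>\<close>.\<close>
  define \<rho> where "\<rho> = zero_radius m / 3"
  have \<rho>: "0 < \<rho>" "\<rho> \<le> zero_radius m" "3 * \<rho> = zero_radius m" "\<rho> \<le> 1"
    using slope_bounds [of m] by (auto simp: \<rho>_def)
  have Z: "\<bar>z\<bar> < b" "f z = 0" "\<bar>z\<bar> < turn m" if "z \<in> Z" for z
    using that zeros_inside by (auto simp: Z_def)
  have "\<exists>w. \<bar>w - z\<bar> \<le> \<rho> \<and> amode j 0 h w = 0" if z: "z \<in> Z" for z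
  proof -
    have "slope m / 2 * \<rho> = slope m * zero_radius m / 6" by (simp add: \<rho>_def)
    then have \<eta>': "\<eta> < slope m / 2 * \<rho>" using \<eta> by linarith
    have plus: "sgn (f' z) * f (z + \<rho>) \<ge> slope m / 2 * \<rho>"
      using zero_isolated [OF Z(1,2) [OF z], of "z + \<rho>"] \<rho> by (simp add: power2_eq_square mult.assoc [symmetric])
    have minus: "sgn (f' z) * f (z - \<rho>) \<le> - (slope m / 2 * \<rho>)"
    proof -
      have "slope m / 2 * \<rho> * \<rho> \<le> - (sgn (f' z) * f (z - \<rho>)) * \<rho>"
        using zero_isolated [OF Z(1,2) [OF z], of "z - \<rho>"] \<rho> by (simp add: power2_eq_square mult.assoc)
      then have "slope m / 2 * \<rho> \<le> - (sgn (f' z) * f (z - \<rho>))"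
        using \<rho>(1) by (rule mult_right_le_imp_le)
      then show ?thesis by linarith
    qed
    have close: "\<bar>sgn (f' z) * f s - sgn (f' z) * (\<kappa> * amode j 0 h s)\<bar> \<le> \<eta>" if "\<bar>s - z\<bar> \<le> \<rho>" for s
    proof -
      have "\<bar>sgn (f' z) * f s - sgn (f' z) * (\<kappa> * amode j 0 h s)\<bar> = \<bar>sgn (f' z)\<bar> * \<bar>f s - \<kappa> * amode j 0 h s\<bar>"
        unfolding abs_mult [symmetric] right_diff_distrib by simp
      also have "\<dots> \<le> 1 * \<eta>"
        using approx [of s] that Z(3) [OF z] \<rho>(4) by (intro mult_mono) (auto simp: abs_sgn_eq)
      finally show ?thesis by simp
    qed
    have "sgn (f' z) * (\<kappa> * amode j 0 h (z + \<rho>)) > 0" "sgn (f' z) * (\<kappa> * amode j 0 h (z - \<rho>)) < 0"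
      using close [of "z + \<rho>"] close [of "z - \<rho>"] plus minus \<eta>' \<rho>(1) by (auto simp: abs_le_iff)
    then have neg: "(sgn (f' z) * (\<kappa> * amode j 0 h (z - \<rho>))) * (sgn (f' z) * (\<kappa> * amode j 0 h (z + \<rho>))) < 0"
      by (rule mult_neg_pos [rotated])
    have "\<exists>w\<in>{z - \<rho>..z + \<rho>}. sgn (f' z) * (\<kappa> * amode j 0 h w) = 0"
    proof (rule ccontr)
      assume "\<not> ?thesis"
      then have "(sgn (f' z) * (\<kappa> * amode j 0 h (z - \<rho>))) * (sgn (f' z) * (\<kappa> * amode j 0 h (z + \<rho>))) > 0"
        using \<rho>(1) by (intro nonzero_imp_same_sign [of "z - \<rho>" "z + \<rho>" "\<lambda>w. sgn (f' z) * (\<kappa> * amode j 0 h w)"]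
            continuous_intros continuous_amode) auto
      with neg show False by simp
    qed
    then obtain w where w: "w \<in> {z - \<rho>..z + \<rho>}" "sgn (f' z) * (\<kappa> * amode j 0 h w) = 0" by blast
    have "f' z \<noteq> 0" using not_double_zero Z(2) [OF z] by blast
    then have "amode j 0 h w = 0" using w(2) \<kappa> by (simp add: sgn_zero_iff)
    then show ?thesis using w(1) by (intro exI [of _ w]) auto
  qed
  then have "\<forall>z. \<exists>w. z \<in> Z \<longrightarrow> \<bar>w - z\<bar> \<le> \<rho> \<and> amode j 0 h w = 0" by blast
  from choice [OF this] obtain w where w: "\<And>z. z \<in> Z \<Longrightarrow> \<bar>w z - z\<bar> \<le> \<rho> \<and> amode j 0 h (w z) = 0"
    by blast
  have inj: "inj_on (\<lambda>z. tvar h (w z)) Z"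
  proof (rule inj_onI)
    fix x y assume xy: "x \<in> Z" "y \<in> Z" "tvar h (w x) = tvar h (w y)"
    have "\<bar>w x\<bar> \<le> b" "\<bar>w y\<bar> \<le> b"
      using w [OF xy(1)] w [OF xy(2)] Z(3) [OF xy(1)] Z(3) [OF xy(2)] \<rho>(4) wide turn_pos(1) [of m] by linarith+
    then have "w x = w y" using tvar_inj [OF h_pos] xy(3) by blast
    then have "\<bar>y - x\<bar> \<le> zero_radius m"
      using w [OF xy(1)] w [OF xy(2)] \<rho> by linarith
    from zero_isolated [OF Z(1,2) [OF xy(1)] this] Z(2) [OF xy(2)] have "slope m / 2 * (y - x)\<^sup>2 \<le> 0" by simp
    then have "(y - x)\<^sup>2 \<le> 0" using slope_bounds(1) [of m] by (simp add: mult_le_0_iff)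
    then show "x = y" by simp
  qed
  have "(\<lambda>z. tvar h (w z)) ` Z \<subseteq> {x. poly (hermite_He j) x = 0}"
    using w by (auto simp: amode_order_0 parabolic_D_eq)
  moreover have ne: "hermite_He j \<noteq> 0" using lead_coeff_hermite_He [of j] by auto
  ultimately have "card ((\<lambda>z. tvar h (w z)) ` Z) \<le> card {x. poly (hermite_He j) x = 0}"
    by (intro card_mono poly_roots_finite)
  also have "\<dots> \<le> j"
    using card_poly_roots_bound [OF ne] by (simp add: degree_hermite_He)
  finally show ?thesis
    using card_image [OF inj] zeros(2) by (simp add: Z_def)
qed

end

text \<open>An order-0 overlap bounded below puts \<Lambda> within O(1/h) of j + 1/2; shooting then
  brings f close to a multiple of D_j on a range containing all zeros, so \<open>index_le\<close>
  applies. Since j may vary with h and f, thresholds are taken for all j \<le> m at once.\<close>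

lemma mode_index:
  "\<exists>c h0. c > 0 \<and> (\<forall>h \<Lambda> f f'. mathieu_mode m h \<Lambda> f f' \<longrightarrow> h \<ge> h0 \<longrightarrow>
     c \<le> \<bar>integral {- (pi * sqrt h)..pi * sqrt h} (\<lambda>s. amode m 0 h s * f s)\<bar>)"
proof -
  obtain c where c: "c > 0" "\<And>h \<Lambda> f f'. mathieu_mode m h \<Lambda> f f' \<Longrightarrow>
     \<exists>j\<le>m. c \<le> \<bar>integral {- (pi * sqrt h)..pi * sqrt h} (\<lambda>s. amode j 0 h s * f s)\<bar>"
    using overlap_lower [of m] by blast
  have "\<forall>j. \<exists>K. 0 \<le> K \<and> (\<forall>h \<Lambda> f f'. mathieu_mode m h \<Lambda> f f' \<longrightarrow>
     \<bar>\<Lambda> - approx_eigenvalue j 0 (1 / h)\<bar> * \<bar>integral {- (pi * sqrt h)..pi * sqrt h} (\<lambda>s. amode j 0 h s * f s)\<bar> \<le> K / h ^ (0 + 1))"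
    using eigenvalue_close by blast
  from choice [OF this] obtain K where K: "\<And>j. 0 \<le> K j" "\<And>j h \<Lambda> f f'. mathieu_mode m h \<Lambda> f f' \<Longrightarrow>
     \<bar>\<Lambda> - approx_eigenvalue j 0 (1 / h)\<bar> * \<bar>integral {- (pi * sqrt h)..pi * sqrt h} (\<lambda>s. amode j 0 h s * f s)\<bar> \<le> K j / h ^ (0 + 1)"
    by blast
  have T: "turn m + 1 \<ge> 0" using turn_pos(1) [of m] by simp
  have "\<forall>j. \<exists>p. fst p > 0 \<and> (\<forall>h \<Lambda> f f' \<delta>. mathieu_mode m h \<Lambda> f f' \<longrightarrow> h \<ge> snd p \<longrightarrow>
     \<bar>\<Lambda> - approx_eigenvalue j 0 (1 / h)\<bar> \<le> \<delta> \<longrightarrow> (\<forall>s. f (- s) = (- 1) ^ j * f s) \<longrightarrow>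
     (\<exists>\<kappa>. 1 / fst p \<le> \<bar>\<kappa>\<bar> \<and> \<bar>\<kappa>\<bar> \<le> fst p \<and> (\<forall>s. \<bar>s\<bar> \<le> turn m + 1 \<longrightarrow>
        \<bar>f s - \<kappa> * amode j 0 h s\<bar> \<le> fst p * (\<delta> + 1 / h ^ (0 + 1)) \<and>
        \<bar>f' s - \<kappa> * damode j 0 h s\<bar> \<le> fst p * (\<delta> + 1 / h ^ (0 + 1)))))"
  proof
    fix j
    from shooting [OF T, of m j 0] obtain K' h0 where "K' > 0 \<and> (\<forall>h \<Lambda> f f' \<delta>. mathieu_mode m h \<Lambda> f f' \<longrightarrow> h \<ge> h0 \<longrightarrow>
     \<bar>\<Lambda> - approx_eigenvalue j 0 (1 / h)\<bar> \<le> \<delta> \<longrightarrow> (\<forall>s. f (- s) = (- 1) ^ j * f s) \<longrightarrow>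
     (\<exists>\<kappa>. 1 / K' \<le> \<bar>\<kappa>\<bar> \<and> \<bar>\<kappa>\<bar> \<le> K' \<and> (\<forall>s. \<bar>s\<bar> \<le> turn m + 1 \<longrightarrow>
        \<bar>f s - \<kappa> * amode j 0 h s\<bar> \<le> K' * (\<delta> + 1 / h ^ (0 + 1)) \<and>
        \<bar>f' s - \<kappa> * damode j 0 h s\<bar> \<le> K' * (\<delta> + 1 / h ^ (0 + 1)))))"
      by blast
    then show "\<exists>p. fst p > 0 \<and> (\<forall>h \<Lambda> f f' \<delta>. mathieu_mode m h \<Lambda> f f' \<longrightarrow> h \<ge> snd p \<longrightarrow>
     \<bar>\<Lambda> - approx_eigenvalue j 0 (1 / h)\<bar> \<le> \<delta> \<longrightarrow> (\<forall>s. f (- s) = (- 1) ^ j * f s) \<longrightarrow>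
     (\<exists>\<kappa>. 1 / fst p \<le> \<bar>\<kappa>\<bar> \<and> \<bar>\<kappa>\<bar> \<le> fst p \<and> (\<forall>s. \<bar>s\<bar> \<le> turn m + 1 \<longrightarrow>
        \<bar>f s - \<kappa> * amode j 0 h s\<bar> \<le> fst p * (\<delta> + 1 / h ^ (0 + 1)) \<and>
        \<bar>f' s - \<kappa> * damode j 0 h s\<bar> \<le> fst p * (\<delta> + 1 / h ^ (0 + 1)))))"
      by - (rule exI [of _ "(K', h0)"], unfold fst_conv snd_conv)
  qed
  from choice [OF this] obtain p where p: "\<And>j. fst (p j) > 0"
    "\<And>j h \<Lambda> f f' \<delta>. mathieu_mode m h \<Lambda> f f' \<Longrightarrow> h \<ge> snd (p j) \<Longrightarrow>
     \<bar>\<Lambda> - approx_eigenvalue j 0 (1 / h)\<bar> \<le> \<delta> \<Longrightarrow> (\<forall>s. f (- s) = (- 1) ^ j * f s) \<Longrightarrow>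
     (\<exists>\<kappa>. 1 / fst (p j) \<le> \<bar>\<kappa>\<bar> \<and> \<bar>\<kappa>\<bar> \<le> fst (p j) \<and> (\<forall>s. \<bar>s\<bar> \<le> turn m + 1 \<longrightarrow>
        \<bar>f s - \<kappa> * amode j 0 h s\<bar> \<le> fst (p j) * (\<delta> + 1 / h ^ (0 + 1)) \<and>
        \<bar>f' s - \<kappa> * damode j 0 h s\<bar> \<le> fst (p j) * (\<delta> + 1 / h ^ (0 + 1))))"
    by blast
  \<comment> \<open>For h > E j the shooting error, of size 1/h, satisfies the smallness condition
    of \<open>index_le\<close>.\<close>
  define E where "E j = 6 * (fst (p j) * (K j / c + 1)) / (slope m * zero_radius m)" for j
  define h0 where "h0 = 1 + (\<Sum>j\<le>m. \<bar>snd (p j)\<bar> + E j)"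
  have sz: "slope m * zero_radius m > 0" using slope_bounds [of m] by simp
  have E: "E j \<ge> 0" for j
    unfolding E_def using sz K(1) [of j] p(1) [of j] c(1) by (intro divide_nonneg_pos mult_nonneg_nonneg add_nonneg_nonneg) auto
  have h0: "\<bar>snd (p j)\<bar> \<le> h0" "E j < h0" if "j \<le> m" for j
  proof -
    have "\<bar>snd (p j)\<bar> + E j \<le> (\<Sum>j\<le>m. \<bar>snd (p j)\<bar> + E j)"
      using that E by (intro member_le_sum [of j "{..m}" "\<lambda>j. \<bar>snd (p j)\<bar> + E j"]) auto
    then show "\<bar>snd (p j)\<bar> \<le> h0" "E j < h0" using E [of j] unfolding h0_def by linarith+
  qed
  show ?thesis
  proof (rule exI [of _ c], rule exI [of _ h0], intro conjI allI impI c(1))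
    fix h \<Lambda> f f'
    assume mode: "mathieu_mode m h \<Lambda> f f'" and hh: "h0 \<le> h"
    interpret mathieu_mode m h \<Lambda> f f' by (rule mode)
    obtain j where j: "j \<le> m" "c \<le> \<bar>overlap j 0\<bar>"
      using c(2) [OF mode] by blast
    define \<delta> where "\<delta> = K j / c / h"
    have "\<bar>\<Lambda> - approx_eigenvalue j 0 (1 / h)\<bar> * c \<le> K j / h"
      using K(2) [OF mode, of j] mult_left_mono [OF j(2), of "\<bar>\<Lambda> - approx_eigenvalue j 0 (1 / h)\<bar>"] by simp
    then have \<delta>: "\<bar>\<Lambda> - approx_eigenvalue j 0 (1 / h)\<bar> \<le> \<delta>"
      using c(1) h_pos by (simp add: \<delta>_def field_simps)
    have "\<forall>s. f (- s) = (- 1) ^ j * f s"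
      using overlap_parity [of j 0] j(2) c(1) by force
    moreover have "h \<ge> snd (p j)" using h0(1) [OF j(1)] hh by linarith
    ultimately obtain \<kappa> where \<kappa>: "1 / fst (p j) \<le> \<bar>\<kappa>\<bar>" "\<And>s. \<bar>s\<bar> \<le> turn m + 1 \<Longrightarrow>
        \<bar>f s - \<kappa> * amode j 0 h s\<bar> \<le> fst (p j) * (\<delta> + 1 / h ^ (0 + 1))"
      using p(2) [OF mode _ \<delta>] by blast
    have "\<kappa> \<noteq> 0" using \<kappa>(1) p(1) [of j] by (metis abs_zero divide_pos_pos not_le zero_less_one)
    moreover have "6 * (fst (p j) * (\<delta> + 1 / h ^ (0 + 1))) < slope m * zero_radius m"
    proof -
      have "E j < h" using h0(2) [OF j(1)] hh by linarith
      then have "6 * (fst (p j) * (K j / c + 1)) < h * (slope m * zero_radius m)"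
        using sz unfolding E_def by (simp add: pos_divide_less_eq)
      then have "6 * (fst (p j) * (K j / c + 1)) / h < slope m * zero_radius m"
        using h_pos by (simp add: pos_divide_less_eq mult.commute)
      moreover have "6 * (fst (p j) * (K j / c + 1)) / h = 6 * (fst (p j) * (\<delta> + 1 / h ^ (0 + 1)))"
        using h_pos c(1) by (simp add: \<delta>_def field_simps)
      ultimately show ?thesis by simp
    qed
    ultimately have "m \<le> j" using \<kappa>(2) by (rule index_le)
    with j show "c \<le> \<bar>overlap m 0\<bar>" by simp
  qed
qed

text \<open>The overlaps of order n and of order 0 differ by O(1/h), so the lower bound survives
  with c/2 and can be divided out of \<open>eigenvalue_close\<close>.\<close>

lemma eigenvalue_expansion:
  "\<exists>K h0. K \<ge> 0 \<and> (\<forall>h \<Lambda> f f'. mathieu_mode m h \<Lambda> f f' \<longrightarrow> h \<ge> h0 \<longrightarrow>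
     \<bar>\<Lambda> - approx_eigenvalue m n (1 / h)\<bar> \<le> K / h ^ (n + 1) \<and> (\<forall>s. f (- s) = (- 1) ^ m * f s))"
proof -
  obtain c h1 where c: "c > 0" "\<And>h \<Lambda> f f'. mathieu_mode m h \<Lambda> f f' \<Longrightarrow> h \<ge> h1 \<Longrightarrow>
     c \<le> \<bar>integral {- (pi * sqrt h)..pi * sqrt h} (\<lambda>s. amode m 0 h s * f s)\<bar>"
    using mode_index [of m] by blast
  obtain K where K: "K \<ge> 0" "\<And>h \<Lambda> f f'. mathieu_mode m h \<Lambda> f f' \<Longrightarrow>
     \<bar>\<Lambda> - approx_eigenvalue m n (1 / h)\<bar> * \<bar>integral {- (pi * sqrt h)..pi * sqrt h} (\<lambda>s. amode m n h s * f s)\<bar> \<le> K / h ^ (n + 1)"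
    using eigenvalue_close [of m m n] by blast
  obtain L where L: "L \<ge> 0" "\<And>h t. h \<ge> 1 \<Longrightarrow> \<bar>approx m n (1 / h) t - parabolic_D m t\<bar> \<le> L / h / (1 + t\<^sup>2) ^ 1"
    using approx_order_difference by blast
  define G where "G = growth m (turn m)"
  have G: "G \<ge> 1" unfolding G_def using turn_pos(1) [of m] by (intro growth_ge_1) simp
  show ?thesis
  proof (rule exI [of _ "2 * K / c"], rule exI [of _ "max h1 (8 * pi * (L * G) / c)"], intro conjI allI impI)
    show "2 * K / c \<ge> 0" using K c by simp
    fix h \<Lambda> f f'
    assume mode: "mathieu_mode m h \<Lambda> f f'" and hh: "max h1 (8 * pi * (L * G) / c) \<le> h"
    interpret mathieu_mode m h \<Lambda> f f' by (rule mode)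
    have "\<bar>integral {- b..b} (\<lambda>s. (amode m n h s - amode m 0 h s) * f s)\<bar> \<le> 4 * pi * (L / h * G)"
    proof (rule weighted_integral_bound [OF h_pos])
      show "0 \<le> L / h * G" using L G h_pos by simp
      show "continuous_on {- b..b} (\<lambda>s. (amode m n h s - amode m 0 h s) * f s)"
        by (intro continuous_intros continuous_f continuous_amode)
      fix s assume s: "\<bar>s\<bar> \<le> b"
      have "\<bar>amode m n h s - amode m 0 h s\<bar> * \<bar>f s\<bar> \<le> (L / h / (1 + (tvar h s)\<^sup>2) ^ 1) * G"
        unfolding amode_order_0 unfolding amode_def using L(2) [OF h] f_abs_bounds(1) [OF s] L(1) h_pos
        unfolding G_def by (intro mult_mono) auto
      then show "\<bar>(amode m n h s - amode m 0 h s) * f s\<bar> \<le> L / h * G / (1 + (tvar h s)\<^sup>2)"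
        by (simp add: abs_mult)
    qed
    moreover have "integral {- b..b} (\<lambda>s. (amode m n h s - amode m 0 h s) * f s) = overlap m n - overlap m 0"
      unfolding left_diff_distrib
      by (intro Henstock_Kurzweil_Integration.integral_diff integrable_continuous_real continuous_intros continuous_f continuous_amode)
    moreover have "4 * pi * (L / h * G) \<le> c / 2"
    proof -
      have "8 * pi * (L * G) / c \<le> h" using hh by simp
      then have "8 * pi * (L * G) \<le> h * c" using c(1) by (simp add: pos_divide_le_eq)
      then show ?thesis using h_pos by (simp add: field_simps)
    qed
    moreover have "c \<le> \<bar>overlap m 0\<bar>" using c(2) [OF mode] hh by simp
    ultimately have ov: "c / 2 \<le> \<bar>overlap m n\<bar>" by linarith
    have "\<bar>\<Lambda> - approx_eigenvalue m n (1 / h)\<bar> * (c / 2) \<le> K / h ^ (n + 1)"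
      by (rule order_trans [OF mult_left_mono [OF ov] K(2) [OF mode]]) simp
    then have "\<bar>\<Lambda> - approx_eigenvalue m n (1 / h)\<bar> \<le> K / h ^ (n + 1) / (c / 2)"
      using c(1) by (subst pos_le_divide_eq) auto
    also have "\<dots> = 2 * K / c / h ^ (n + 1)" by (simp add: mult_ac)
    finally show "\<bar>\<Lambda> - approx_eigenvalue m n (1 / h)\<bar> \<le> 2 * K / c / h ^ (n + 1)" .
    show "f (- s) = (- 1) ^ m * f s" for s
      using overlap_parity [of m n] ov c(1) by force
  qed
qed

text \<open>Gronwall would cost a factor exponential in the length of the interval, which is of
  order sqrt h. With V \<ge> 1, instead, (d d')' = d'^2 + V d^2 + r d \<ge> d^2/2 - r^2/2, and
  integration controls d in L^2.\<close>

lemma tail_energy: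
  fixes d d' V r :: "real \<Rightarrow> real"
  assumes dd: "\<And>s. (d has_real_derivative d' s) (at s)"
      "\<And>s. (d' has_real_derivative V s * d s + r s) (at s)"
    and V: "\<And>s. s \<in> {a..b} \<Longrightarrow> V s \<ge> 1" and "a \<le> b"
    and cont: "continuous_on {a..b} V" "continuous_on {a..b} r"
  shows "integral {a..b} (\<lambda>s. (d s)\<^sup>2) \<le> 2 * (d b * d' b - d a * d' a) + integral {a..b} (\<lambda>s. (r s)\<^sup>2)"
proof -
  have contd: "continuous_on {a..b} d" "continuous_on {a..b} d'"
    by (rule continuous_on_DERIV [OF dd(1)], rule continuous_on_DERIV [OF dd(2)])
  have "((\<lambda>s. d' s * d' s + (V s * d s + r s) * d s) has_integral d b * d' b - d a * d' a) {a..b}"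
  proof (rule fundamental_theorem_of_calculus [OF \<open>a \<le> b\<close>])
    fix s
    have "((\<lambda>s. d s * d' s) has_real_derivative d' s * d' s + (V s * d s + r s) * d s) (at s)"
      using DERIV_mult [OF dd(1) [of s] dd(2) [of s]] by (simp add: algebra_simps)
    then show "((\<lambda>s. d s * d' s) has_vector_derivative d' s * d' s + (V s * d s + r s) * d s) (at s within {a..b})"
      by (simp add: has_real_derivative_iff_has_vector_derivative has_vector_derivative_at_within)
  qed
  then have I: "integral {a..b} (\<lambda>s. d' s * d' s + (V s * d s + r s) * d s) = d b * d' b - d a * d' a"
    by (rule integral_unique)
  have "integral {a..b} (\<lambda>s. (d s)\<^sup>2 / 2 - (r s)\<^sup>2 / 2) \<le> integral {a..b} (\<lambda>s. d' s * d' s + (V s * d s + r s) * d s)"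
  proof (rule integral_le)
    fix s assume s: "s \<in> {a..b}"
    have "1 * (d s)\<^sup>2 \<le> V s * (d s)\<^sup>2"
      by (rule mult_right_mono [OF V [OF s]]) simp
    moreover have "0 \<le> (d s + r s)\<^sup>2" "0 \<le> (d' s)\<^sup>2" by simp_all
    moreover have "d' s * d' s + (V s * d s + r s) * d s - ((d s)\<^sup>2 / 2 - (r s)\<^sup>2 / 2)
        = (d' s)\<^sup>2 + (V s * (d s)\<^sup>2 - 1 * (d s)\<^sup>2) + (d s + r s)\<^sup>2 / 2"
      by (simp add: power2_eq_square field_simps)
    ultimately show "(d s)\<^sup>2 / 2 - (r s)\<^sup>2 / 2 \<le> d' s * d' s + (V s * d s + r s) * d s"
      by linarith
  qed (intro integrable_continuous_real continuous_intros contd cont; simp)+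
  also have "integral {a..b} (\<lambda>s. (d s)\<^sup>2 / 2 - (r s)\<^sup>2 / 2)
      = integral {a..b} (\<lambda>s. (d s)\<^sup>2 / 2) - integral {a..b} (\<lambda>s. (r s)\<^sup>2 / 2)"
    by (intro Henstock_Kurzweil_Integration.integral_diff integrable_continuous_real continuous_intros contd cont; simp)
  also have "\<dots> = integral {a..b} (\<lambda>s. (d s)\<^sup>2) / 2 - integral {a..b} (\<lambda>s. (r s)\<^sup>2) / 2"
    by simp
  finally show ?thesis unfolding I by simp
qed

lemma even_integral:
  fixes F :: "real \<Rightarrow> real"
  assumes "continuous_on {- b..b} F" "\<And>s. F (- s) = F s" "b \<ge> 0"
  shows "integral {- b..b} F = 2 * integral {0..b} F"
proof -
  have "integral {- b..0} F + integral {0..b} F = integral {- b..b} F"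
    using assms by (intro Henstock_Kurzweil_Integration.integral_combine integrable_continuous_real) auto
  moreover have "integral {- b..0} F = integral {0..b} F"
    using Henstock_Kurzweil_Integration.integral_reflect_real [of b 0 F] assms(2) by simp
  ultimately show ?thesis by simp
qed

text \<open>Shooting controls the difference d on the fixed core and \<open>tail_energy\<close>
  controls it beyond, so the integral of d^2 is O(h^(-2n-2)). This also compares the L^2
  norms.\<close>

lemma mode_expansion:
  assumes "T \<ge> 0"
  shows "\<exists>K h0. K > 0 \<and> (\<forall>h \<Lambda> f f'. mathieu_mode m h \<Lambda> f f' \<longrightarrow> h \<ge> h0 \<longrightarrow>
    (\<exists>\<kappa>. 1 / K \<le> \<bar>\<kappa>\<bar> \<and> \<bar>\<kappa>\<bar> \<le> K \<and> (\<forall>s. \<bar>s\<bar> \<le> T \<longrightarrow> \<bar>f s - \<kappa> * amode m n h s\<bar> \<le> K / h ^ (n + 1)) \<and>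
      \<bar>integral {- (pi * sqrt h)..pi * sqrt h} (\<lambda>s. (f s)\<^sup>2)
        - \<kappa>\<^sup>2 * integral {- (pi * sqrt h)..pi * sqrt h} (\<lambda>s. (amode m n h s)\<^sup>2)\<bar> \<le> K / h ^ (n + 1)))"
proof -
  define T' where "T' = max T (turn m)"
  have T': "T' \<ge> 0" "T \<le> T'" "turn m \<le> T'" using assms by (auto simp: T'_def)
  obtain K1 h1 where K1: "K1 > 0" "\<And>h \<Lambda> f f' \<delta>. mathieu_mode m h \<Lambda> f f' \<Longrightarrow> h \<ge> h1 \<Longrightarrow>
     \<bar>\<Lambda> - approx_eigenvalue m n (1 / h)\<bar> \<le> \<delta> \<Longrightarrow> (\<forall>s. f (- s) = (- 1) ^ m * f s) \<Longrightarrow>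
     (\<exists>\<kappa>. 1 / K1 \<le> \<bar>\<kappa>\<bar> \<and> \<bar>\<kappa>\<bar> \<le> K1 \<and> (\<forall>s. \<bar>s\<bar> \<le> T' \<longrightarrow>
        \<bar>f s - \<kappa> * amode m n h s\<bar> \<le> K1 * (\<delta> + 1 / h ^ (n + 1)) \<and>
        \<bar>f' s - \<kappa> * damode m n h s\<bar> \<le> K1 * (\<delta> + 1 / h ^ (n + 1))))"
    using shooting [OF T'(1), of m m n] by blast
  obtain K2 h2 where K2: "K2 \<ge> 0" "\<And>h \<Lambda> f f'. mathieu_mode m h \<Lambda> f f' \<Longrightarrow> h \<ge> h2 \<Longrightarrow>
     \<bar>\<Lambda> - approx_eigenvalue m n (1 / h)\<bar> \<le> K2 / h ^ (n + 1) \<and> (\<forall>s. f (- s) = (- 1) ^ m * f s)"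
    using eigenvalue_expansion [of m n] by blast
  \<comment> \<open>The exponent 2 (n+1) makes the boundary term d(b) d'(b) as small as the square
    of the error.\<close>
  obtain K3 where K3: "K3 \<ge> 0" "\<And>h t. h \<ge> 1 \<Longrightarrow> \<bar>approx m n (1 / h) t\<bar> \<le> K3 / (1 + t\<^sup>2) ^ (2 * (n + 1))"
    using approx_decay by blast
  obtain K4 where K4: "K4 \<ge> 0" "\<And>h t. h \<ge> 1 \<Longrightarrow> \<bar>approx m n (1 / h) t\<bar> \<le> K4 / (1 + t\<^sup>2) ^ 1"
    using approx_decay by blast
  obtain K5 where K5: "K5 \<ge> 0" "\<And>h t. h \<ge> 1 \<Longrightarrow> \<bar>residual m n (1 / h) t\<bar> \<le> K5 / h ^ (n + 1) / (1 + t\<^sup>2) ^ 1"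
    using residual_decay by blast
  define G where "G = growth m (turn m)"
  have G: "G \<ge> 1" unfolding G_def using turn_pos(1) [of m] by (intro growth_ge_1) simp
  define D where "D = K1 * (K2 + 1)"
  have D: "D \<ge> 0" using K1(1) K2(1) by (simp add: D_def)
  define R where "R = K1 * (K2 * K4 + K5)"
  have R: "R \<ge> 0" unfolding R_def using K1(1) K2(1) K4(1) K5(1) by (intro mult_nonneg_nonneg add_nonneg_nonneg) auto
  define M where "M = 2 * (turn m * D\<^sup>2 + (2 * (K1 * K3 * G + D\<^sup>2) + 4 * pi * R\<^sup>2))"
  have M: "M \<ge> 0" unfolding M_def using K1(1) K3(1) G turn_pos(1) [of m] by (intro mult_nonneg_nonneg add_nonneg_nonneg) auto
  define K where "K = K1 + D + (M + K1 * (M + 4 * pi * K4\<^sup>2)) + 1"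
  have Kb: "K > 0" "K1 \<le> K" "D \<le> K" "M + K1 * (M + 4 * pi * K4\<^sup>2) \<le> K"
  proof -
    have "0 \<le> K1 * (M + 4 * pi * K4\<^sup>2)" using K1(1) M by simp
    then show "K > 0" "K1 \<le> K" "D \<le> K" "M + K1 * (M + 4 * pi * K4\<^sup>2) \<le> K"
      unfolding K_def using K1(1) D M by linarith+
  qed
  show ?thesis
  proof (rule exI [of _ K], rule exI [of _ "max h1 h2"], intro conjI allI impI Kb(1))
    fix h \<Lambda> f f'
    assume mode: "mathieu_mode m h \<Lambda> f f'" and hh: "max h1 h2 \<le> h"
    interpret mathieu_mode m h \<Lambda> f f' by (rule mode)
    let ?e = "1 / h ^ (n + 1)"
    have e: "0 < ?e" "?e \<le> 1" using one_le_power [OF h, of "n + 1"] h_pos by (simp_all del: power_Suc)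
    have Lam: "\<bar>\<Lambda> - approx_eigenvalue m n (1 / h)\<bar> \<le> K2 / h ^ (n + 1)" and par: "\<forall>s. f (- s) = (- 1) ^ m * f s"
      using K2(2) [OF mode] hh by auto
    have D_e: "K1 * (K2 / h ^ (n + 1) + 1 / h ^ (n + 1)) = D * ?e"
      by (simp add: D_def ring_distribs add_divide_distrib)
    obtain \<kappa> where \<kappa>: "1 / K1 \<le> \<bar>\<kappa>\<bar>" "\<bar>\<kappa>\<bar> \<le> K1" "\<And>s. \<bar>s\<bar> \<le> T' \<Longrightarrow> \<bar>f s - \<kappa> * amode m n h s\<bar> \<le> D * ?e"
        "\<And>s. \<bar>s\<bar> \<le> T' \<Longrightarrow> \<bar>f' s - \<kappa> * damode m n h s\<bar> \<le> D * ?e"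
      using K1(2) [OF mode _ Lam par] hh unfolding D_e by auto
    define d d' where "d x = f x - \<kappa> * amode m n h x" and "d' x = f' x - \<kappa> * damode m n h x" for x
    define r where "r x = - \<kappa> * ((\<Lambda> - approx_eigenvalue m n (1 / h)) * amode m n h x + residual m n (1 / h) (tvar h x))" for x
    have contr: "continuous_on A r" for A
      unfolding r_def [abs_def] by (intro continuous_intros continuous_amode continuous_on_residual)
    have contd: "continuous_on A d" for A
      unfolding d_def [abs_def] by (intro continuous_intros continuous_amode continuous_f)
    have contV: "continuous_on A V" for A
      by (intro continuous_intros continuous_on_tvar) auto
    have r: "\<bar>r x\<bar> \<le> R * ?e / (1 + (tvar h x)\<^sup>2)" for x
    proof -
      let ?q = "1 + (tvar h x)\<^sup>2"
      have q: "?q > 0" by (simp add: add_pos_nonneg)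
      have "\<bar>(\<Lambda> - approx_eigenvalue m n (1 / h)) * amode m n h x\<bar> \<le> (K2 / h ^ (n + 1)) * (K4 / ?q ^ 1)"
        unfolding abs_mult amode_def using Lam K4(2) [OF h, of "tvar h x"] K2(1) h_pos by (intro mult_mono) auto
      moreover have "\<bar>residual m n (1 / h) (tvar h x)\<bar> \<le> K5 / h ^ (n + 1) / ?q ^ 1"
        by (rule K5(2) [OF h])
      ultimately have "\<bar>(\<Lambda> - approx_eigenvalue m n (1 / h)) * amode m n h x + residual m n (1 / h) (tvar h x)\<bar>
          \<le> (K2 / h ^ (n + 1)) * (K4 / ?q ^ 1) + K5 / h ^ (n + 1) / ?q ^ 1"
        by linarith
      also have "\<dots> = (K2 * K4 + K5) * ?e / ?q"
        by (simp add: add_divide_distrib)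
      finally have "\<bar>\<kappa>\<bar> * \<bar>(\<Lambda> - approx_eigenvalue m n (1 / h)) * amode m n h x + residual m n (1 / h) (tvar h x)\<bar>
          \<le> K1 * ((K2 * K4 + K5) * ?e / ?q)"
        using \<kappa>(2) K1(1) by (intro mult_mono) auto
      then show ?thesis by (simp add: r_def R_def abs_mult mult.assoc)
    qed
    have r2: "(r x)\<^sup>2 \<le> (R * ?e)\<^sup>2 / (1 + (tvar h x)\<^sup>2)" for x
    proof -
      let ?q = "1 + (tvar h x)\<^sup>2"
      have q: "?q \<ge> 1" by simp
      have "\<bar>r x\<bar>\<^sup>2 \<le> (R * ?e / ?q)\<^sup>2" by (rule power_mono [OF r]) simp
      also have "\<dots> = (R * ?e)\<^sup>2 / ?q\<^sup>2" by (rule power_divide)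
      also have "\<dots> \<le> (R * ?e)\<^sup>2 / ?q"
      proof -
        have "?q * 1 \<le> ?q * ?q" using q by (intro mult_left_mono) auto
        then have "?q \<le> ?q\<^sup>2" by (simp add: power2_eq_square)
        moreover have "0 < ?q" using q by linarith
        ultimately show ?thesis
          by (intro divide_left_mono mult_pos_pos zero_less_power zero_le_power2)
      qed
      finally show ?thesis by simp
    qed
    have tb: "turn m \<le> b" using b_pos by simp
    have int_r: "integral {turn m..b} (\<lambda>s. (r s)\<^sup>2) \<le> 4 * pi * (R * ?e)\<^sup>2"
    proof -
      have "integral {turn m..b} (\<lambda>s. (r s)\<^sup>2) \<le> integral {- b..b} (\<lambda>s. (r s)\<^sup>2)"
        using turn_pos(1) [of m] tb
        by (intro integral_subset_le integrable_continuous_real continuous_intros contr) auto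
      also have "\<dots> \<le> \<bar>integral {- b..b} (\<lambda>s. (r s)\<^sup>2)\<bar>" by simp
      also have "\<dots> \<le> 4 * pi * (R * ?e)\<^sup>2"
        using r2 by (intro weighted_integral_bound [OF h_pos] continuous_intros contr) auto
      finally show ?thesis .
    qed
    have te: "integral {turn m..b} (\<lambda>s. (d s)\<^sup>2) \<le> 2 * (d b * d' b - d (turn m) * d' (turn m)) + integral {turn m..b} (\<lambda>s. (r s)\<^sup>2)"
    proof (rule tail_energy [where V = V])
      fix x
      show "(d has_real_derivative d' x) (at x)"
        unfolding d_def [abs_def] d'_def
        by (intro DERIV_diff DERIV_cmult DERIV_f amode_DERIV h_pos)
      show "(d' has_real_derivative V x * d x + r x) (at x)"
        unfolding d'_def [abs_def]
        by (rule DERIV_cong [OF DERIV_diff [OF DERIV_f' DERIV_cmult [OF damode_DERIV [OF h_pos]]]])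
          (simp add: d_def r_def field_simps)
    qed (use V_ge_1 tb contV contr in auto)
    have dbd: "d b * d' b \<le> K1 * K3 * G * ?e\<^sup>2"
    proof -
      have am: "\<bar>amode m n h b\<bar> \<le> K3 / h ^ (2 * (n + 1))" "damode m n h b = 0"
      proof -
        have "\<bar>b\<bar> = pi * sqrt h" using b_pos by simp
        from amode_end [OF h K3(1) this K3(2) [OF h]]
        show "\<bar>amode m n h b\<bar> \<le> K3 / h ^ (2 * (n + 1))" "damode m n h b = 0" .
      qed
      \<comment> \<open>The boundary condition removes f f' and \<open>damode\<close> vanishes at b,
        so only one mixed term is left.\<close>
      have "d b * d' b = - (\<kappa> * amode m n h b * f' b)"
        using boundary am(2) by (auto simp: d_def d'_def algebra_simps)
      also have "\<dots> \<le> \<bar>\<kappa>\<bar> * \<bar>amode m n h b\<bar> * \<bar>f' b\<bar>"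
        using abs_ge_minus_self [of "\<kappa> * amode m n h b * f' b"] by (simp add: abs_mult)
      also have "\<dots> \<le> K1 * (K3 / h ^ (2 * (n + 1))) * G"
        using \<kappa>(2) am(1) f_abs_bounds(2) [of b] b_pos K1(1) K3(1) h_pos
        by (intro mult_mono mult_nonneg_nonneg) (auto simp: G_def)
      also have "\<dots> = K1 * K3 * G * ?e\<^sup>2"
        by (simp only: power_divide power_mult [symmetric] power_one mult.commute [of 2]) simp
      finally show ?thesis .
    qed
    have dtd: "- (d (turn m) * d' (turn m)) \<le> D\<^sup>2 * ?e\<^sup>2"
    proof -
      have "\<bar>d (turn m)\<bar> * \<bar>d' (turn m)\<bar> \<le> (D * ?e) * (D * ?e)"
        using \<kappa>(3,4) [of "turn m"] T'(3) turn_pos(1) [of m] D e unfolding d_def d'_def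
        by (intro mult_mono) auto
      then show ?thesis
        using abs_ge_minus_self [of "d (turn m) * d' (turn m)"] by (simp add: abs_mult power2_eq_square mult_ac)
    qed
    have tail: "integral {turn m..b} (\<lambda>s. (d s)\<^sup>2) \<le> (2 * (K1 * K3 * G + D\<^sup>2) + 4 * pi * R\<^sup>2) * ?e\<^sup>2"
    proof -
      have "(2 * (K1 * K3 * G + D\<^sup>2) + 4 * pi * R\<^sup>2) * x\<^sup>2
          = 2 * (K1 * K3 * G * x\<^sup>2) + 2 * (D\<^sup>2 * x\<^sup>2) + 4 * pi * (R * x)\<^sup>2" for x
        by (simp add: power_mult_distrib algebra_simps)
      from this [of ?e] show ?thesis using int_r te dbd dtd unfolding right_diff_distrib by linarith
    qed
    have core: "integral {0..turn m} (\<lambda>s. (d s)\<^sup>2) \<le> turn m * D\<^sup>2 * ?e\<^sup>2"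
    proof -
      have "integral {0..turn m} (\<lambda>s. (d s)\<^sup>2) \<le> integral {0..turn m} (\<lambda>s. (D * ?e)\<^sup>2)"
      proof (rule integral_le)
        fix s assume s: "s \<in> {0..turn m}"
        then have "\<bar>d s\<bar> \<le> D * ?e" using \<kappa>(3) [of s] T'(3) by (simp add: d_def)
        then show "(d s)\<^sup>2 \<le> (D * ?e)\<^sup>2" by (metis abs_ge_zero power2_abs power_mono)
      qed (auto intro!: integrable_continuous_real continuous_intros contd)
      also have "\<dots> = turn m * D\<^sup>2 * ?e\<^sup>2"
        using turn_pos(1) [of m] by (simp only: power_mult_distrib) simp
      finally show ?thesis .
    qed
    have int_d: "integral {- b..b} (\<lambda>s. (d s)\<^sup>2) \<le> M * ?e\<^sup>2"
    proof -
      have dpar: "(d (- s))\<^sup>2 = (d s)\<^sup>2" for s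
      proof -
        have "d (- s) = (- 1) ^ m * d s"
          using par amode_minus by (simp add: d_def algebra_simps)
        then show ?thesis by (simp add: power_mult_distrib flip: power_mult)
      qed
      have "integral {- b..b} (\<lambda>s. (d s)\<^sup>2) = 2 * integral {0..b} (\<lambda>s. (d s)\<^sup>2)"
        using b_pos dpar by (intro even_integral continuous_intros contd) auto
      also have "integral {0..b} (\<lambda>s. (d s)\<^sup>2) = integral {0..turn m} (\<lambda>s. (d s)\<^sup>2) + integral {turn m..b} (\<lambda>s. (d s)\<^sup>2)"
        using turn_pos(1) [of m] tb
        by (intro Henstock_Kurzweil_Integration.integral_combine [symmetric] integrable_continuous_real continuous_intros contd) auto
      also have "2 * \<dots> \<le> 2 * (turn m * D\<^sup>2 * ?e\<^sup>2 + (2 * (K1 * K3 * G + D\<^sup>2) + 4 * pi * R\<^sup>2) * ?e\<^sup>2)"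
        using tail core by simp
      also have "\<dots> = M * ?e\<^sup>2" by (simp only: M_def distrib_right mult.assoc)
      finally show ?thesis .
    qed
    let ?g = "amode m n h"
    have int_g: "integral {- b..b} (\<lambda>s. (?g s)\<^sup>2) \<le> 4 * pi * K4\<^sup>2"
    proof -
      have "\<bar>integral {- b..b} (\<lambda>s. (?g s)\<^sup>2)\<bar> \<le> 4 * pi * K4\<^sup>2"
      proof (rule weighted_integral_bound [OF h_pos])
        fix s
        let ?q = "1 + (tvar h s)\<^sup>2"
        have q: "?q \<ge> 1" by simp
        have "\<bar>?g s\<bar> * \<bar>?g s\<bar> \<le> (K4 / ?q) * K4"
        proof (intro mult_mono)
          show a: "\<bar>?g s\<bar> \<le> K4 / ?q" using K4(2) [OF h, of "tvar h s"] by (simp add: amode_def)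
          have "0 < ?q" using q by linarith
          then have "0 < ?q * 1" by (simp only: mult_1_right)
          then have "K4 / ?q \<le> K4 / 1" using q K4(1) by (intro divide_left_mono)
          then show "\<bar>?g s\<bar> \<le> K4" using a by simp
        qed (use K4(1) in auto)
        then show "\<bar>(?g s)\<^sup>2\<bar> \<le> K4\<^sup>2 / ?q" by (simp add: power2_eq_square)
      qed (auto intro!: continuous_intros continuous_amode)
      then show ?thesis by linarith
    qed
    have split: "integral {- b..b} (\<lambda>s. (f s)\<^sup>2) - \<kappa>\<^sup>2 * integral {- b..b} (\<lambda>s. (?g s)\<^sup>2)
        = integral {- b..b} (\<lambda>s. (d s)\<^sup>2) + \<kappa> * integral {- b..b} (\<lambda>s. 2 * (d s * ?g s))"
    proof -
      have "integral {- b..b} (\<lambda>s. (f s)\<^sup>2) = integral {- b..b} (\<lambda>s. (d s)\<^sup>2 + (\<kappa> * (2 * (d s * ?g s)) + \<kappa>\<^sup>2 * (?g s)\<^sup>2))"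
        by (intro integral_cong) (simp add: d_def power2_eq_square algebra_simps)
      also have "\<dots> = integral {- b..b} (\<lambda>s. (d s)\<^sup>2) + (integral {- b..b} (\<lambda>s. \<kappa> * (2 * (d s * ?g s)))
          + integral {- b..b} (\<lambda>s. \<kappa>\<^sup>2 * (?g s)\<^sup>2))"
        by (subst Henstock_Kurzweil_Integration.integral_add; (subst Henstock_Kurzweil_Integration.integral_add)?)
          (intro integrable_continuous_real continuous_intros contd continuous_amode refl)+
      finally show ?thesis by simp
    qed
    have cross: "\<bar>integral {- b..b} (\<lambda>s. 2 * (d s * ?g s))\<bar> \<le> (M + 4 * pi * K4\<^sup>2) * ?e"
    proof -
      \<comment> \<open>2 |d g| \<le> d^2/e + e g^2 with e = h^(-n-1): the integral of d^2 being
        O(e^2), both terms contribute O(e).\<close>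
      have "norm (integral {- b..b} (\<lambda>s. 2 * (d s * ?g s))) \<le> integral {- b..b} (\<lambda>s. (1 / ?e) * (d s)\<^sup>2 + ?e * (?g s)\<^sup>2)"
      proof (rule integral_norm_bound_integral)
        fix s
        have "0 \<le> (\<bar>d s\<bar> - ?e * \<bar>?g s\<bar>)\<^sup>2 / ?e" using e by simp
        also have "\<dots> = (1 / ?e) * (d s)\<^sup>2 - 2 * \<bar>d s\<bar> * \<bar>?g s\<bar> + ?e * (?g s)\<^sup>2"
        proof -
          have "(x - y * z)\<^sup>2 / y = (1 / y) * x\<^sup>2 - 2 * x * z + y * z\<^sup>2" if "y > 0" for x y z :: real
            using that by (simp add: field_simps power2_eq_square)
          from this [OF e(1), of "\<bar>d s\<bar>" "\<bar>?g s\<bar>"] show ?thesis by simp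
        qed
        finally show "norm (2 * (d s * ?g s)) \<le> (1 / ?e) * (d s)\<^sup>2 + ?e * (?g s)\<^sup>2"
          by (simp add: abs_mult)
      qed (intro integrable_continuous_real continuous_intros contd continuous_amode)+
      also have "\<dots> = (1 / ?e) * integral {- b..b} (\<lambda>s. (d s)\<^sup>2) + ?e * integral {- b..b} (\<lambda>s. (?g s)\<^sup>2)"
        by (subst Henstock_Kurzweil_Integration.integral_add)
          (intro integrable_continuous_real continuous_intros contd continuous_amode, intro integrable_continuous_real continuous_intros contd continuous_amode, simp)
      also have "\<dots> \<le> (1 / ?e) * (M * ?e\<^sup>2) + ?e * (4 * pi * K4\<^sup>2)"
        using e int_d int_g by (intro add_mono mult_left_mono) auto
      also have "\<dots> = (M + 4 * pi * K4\<^sup>2) * ?e"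
        using e(1) by (simp add: power2_eq_square field_simps)
      finally show ?thesis by simp
    qed
    have fin: "\<bar>integral {- b..b} (\<lambda>s. (f s)\<^sup>2) - \<kappa>\<^sup>2 * integral {- b..b} (\<lambda>s. (?g s)\<^sup>2)\<bar> \<le> K / h ^ (n + 1)"
    proof -
      have "\<bar>integral {- b..b} (\<lambda>s. (d s)\<^sup>2)\<bar> \<le> M * ?e"
      proof -
        have "integral {- b..b} (\<lambda>s. (d s)\<^sup>2) \<ge> 0"
          by (intro integral_nonneg integrable_continuous_real continuous_intros contd) auto
        moreover have "M * ?e\<^sup>2 \<le> M * ?e"
        proof (rule mult_left_mono [OF _ M])
          have "?e * ?e \<le> ?e * 1" using e by (intro mult_left_mono) auto
          then show "?e\<^sup>2 \<le> ?e" by (simp only: power2_eq_square mult_1_right)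
        qed
        ultimately show ?thesis using int_d by linarith
      qed
      moreover have "\<bar>\<kappa> * integral {- b..b} (\<lambda>s. 2 * (d s * ?g s))\<bar> \<le> K1 * ((M + 4 * pi * K4\<^sup>2) * ?e)"
        unfolding abs_mult [of \<kappa>] using \<kappa>(2) cross K1(1) by (intro mult_mono) auto
      ultimately have "\<bar>integral {- b..b} (\<lambda>s. (f s)\<^sup>2) - \<kappa>\<^sup>2 * integral {- b..b} (\<lambda>s. (?g s)\<^sup>2)\<bar>
          \<le> M * ?e + K1 * ((M + 4 * pi * K4\<^sup>2) * ?e)"
        unfolding split by linarith
      also have "\<dots> = (M + K1 * (M + 4 * pi * K4\<^sup>2)) * ?e"
        by (simp only: distrib_right mult.assoc)
      also have "\<dots> \<le> K * ?e" using Kb(4) e by (intro mult_right_mono) auto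
      finally show ?thesis by simp
    qed
    have k1: "1 / K \<le> \<bar>\<kappa>\<bar>"
    proof -
      have "1 / K \<le> 1 / K1" using Kb K1(1) by (intro divide_left_mono) auto
      then show ?thesis using \<kappa>(1) by linarith
    qed
    have near: "\<bar>f s - \<kappa> * amode m n h s\<bar> \<le> K / h ^ (n + 1)" if "\<bar>s\<bar> \<le> T" for s
    proof -
      have "D * ?e \<le> K * ?e" using Kb(3) e by (intro mult_right_mono) auto
      then show ?thesis using \<kappa>(3) [of s] that T'(2) by simp
    qed
    show "\<exists>\<kappa>. 1 / K \<le> \<bar>\<kappa>\<bar> \<and> \<bar>\<kappa>\<bar> \<le> K \<and> (\<forall>s. \<bar>s\<bar> \<le> T \<longrightarrow> \<bar>f s - \<kappa> * amode m n h s\<bar> \<le> K / h ^ (n + 1)) \<and>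
      \<bar>integral {- b..b} (\<lambda>s. (f s)\<^sup>2) - \<kappa>\<^sup>2 * integral {- b..b} (\<lambda>s. (amode m n h s)\<^sup>2)\<bar> \<le> K / h ^ (n + 1)"
      using k1 \<kappa>(2) Kb(2) near fin by (intro exI [of _ \<kappa>]) auto
  qed
qed

section \<open>Norm of the approximate solutions\<close>

lemma gchoose_neg_half_Suc:
  "(2 * real n + 2) * ((- 1) ^ Suc n * ((-1/2) gchoose Suc n)) = (2 * real n + 1) * ((- 1) ^ n * ((-1/2) gchoose n))"
proof -
  have e: "(2 * real n + 2) * ((-1/2) gchoose Suc n) = - ((2 * real n + 1) * ((-1/2 :: real) gchoose n))"
    using gbinomial_mult_1 [of "-1/2 :: real" n] by (simp add: field_simps)
  have "(2 * real n + 2) * ((- 1) ^ Suc n * ((-1/2) gchoose Suc n)) = - ((- 1) ^ n * ((2 * real n + 2) * ((-1/2) gchoose Suc n)))"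
    by simp
  then show ?thesis unfolding e by (simp only: mult_minus_right minus_minus mult.left_commute)
qed

lemma gchoose_half_Suc:
  "(2 * real n + 2) * ((- 1) ^ Suc n * ((1/2) gchoose Suc n)) = (2 * real n - 1) * ((- 1) ^ n * ((1/2) gchoose n))"
proof -
  have e: "(2 * real n + 2) * ((1/2) gchoose Suc n) = - ((2 * real n - 1) * ((1/2 :: real) gchoose n))"
    using gbinomial_mult_1 [of "1/2 :: real" n] by (simp add: field_simps)
  have "(2 * real n + 2) * ((- 1) ^ Suc n * ((1/2) gchoose Suc n)) = - ((- 1) ^ n * ((2 * real n + 2) * ((1/2) gchoose Suc n)))"
    by simp
  then show ?thesis unfolding e by (simp only: mult_minus_right minus_minus mult.left_commute)
qed

text \<open>The sum is a partial binomial series of (1 - sin^2 x)^(-1/2). The recursion of its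
  coefficients makes the derivative telescope to the last term, so no convergence question
  arises.\<close>

lemma cos_partial_sum_DERIV:
  fixes n :: nat
  defines "a \<equiv> \<lambda>j. (- 1) ^ j * ((-1/2) gchoose j) :: real"
  shows "((\<lambda>x. cos x * (\<Sum>j\<le>n. a j * sin x ^ (2 * j))) has_real_derivative
    - ((2 * real n + 1) * a n * sin x ^ (2 * n + 1))) (at x)"
proof (induction n)
  case 0
  show ?case by (auto intro!: derivative_eq_intros simp: a_def)
next
  case (Suc n)
  have "((\<lambda>x. sin x ^ (2 * Suc n)) has_real_derivative (2 * real n + 2) * sin x ^ (2 * n + 1) * cos x) (at x)"
    by (rule DERIV_cong [OF DERIV_power [OF DERIV_sin, where n = "2 * Suc n"]]) simp
  from DERIV_cmult [OF DERIV_mult [OF DERIV_cos this], of "a (Suc n)"]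
  have "((\<lambda>x. a (Suc n) * (cos x * sin x ^ (2 * Suc n))) has_real_derivative
      a (Suc n) * (- sin x * sin x ^ (2 * Suc n) + cos x * ((2 * real n + 2) * sin x ^ (2 * n + 1) * cos x))) (at x)"
    by (rule DERIV_cong) (simp add: algebra_simps)
  then have D: "((\<lambda>x. a (Suc n) * (cos x * sin x ^ (2 * Suc n))) has_real_derivative
      ((2 * real n + 2) * a (Suc n)) * sin x ^ (2 * n + 1) - (2 * real n + 3) * a (Suc n) * sin x ^ (2 * n + 3)) (at x)"
  proof (rule DERIV_cong)
    have cc: "cos x * cos x = 1 - sin x * sin x"
      using sin_cos_squared_add3 [of x] by linarith
    have cp: "cos x * ((2 * real n + 2) * sin x ^ (2 * n + 1) * cos x) = (2 * real n + 2) * sin x ^ (2 * n + 1) * (1 - sin x * sin x)"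
      unfolding cc [symmetric] by simp
    show "a (Suc n) * (- sin x * sin x ^ (2 * Suc n) + cos x * ((2 * real n + 2) * sin x ^ (2 * n + 1) * cos x))
        = ((2 * real n + 2) * a (Suc n)) * sin x ^ (2 * n + 1) - (2 * real n + 3) * a (Suc n) * sin x ^ (2 * n + 3)"
      unfolding cp by (simp add: power_add power3_eq_cube algebra_simps)
  qed
  have rec: "(2 * real n + 2) * a (Suc n) = (2 * real n + 1) * a n"
    unfolding a_def by (rule gchoose_neg_half_Suc)
  have "((\<lambda>x. cos x * (\<Sum>j\<le>n. a j * sin x ^ (2 * j)) + a (Suc n) * (cos x * sin x ^ (2 * Suc n))) has_real_derivative
      - ((2 * real n + 1) * a n * sin x ^ (2 * n + 1))
      + ((2 * real n + 1) * a n * sin x ^ (2 * n + 1) - (2 * real n + 3) * a (Suc n) * sin x ^ (2 * n + 3))) (at x)"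
    using DERIV_add [OF Suc D] unfolding rec .
  moreover have "(\<lambda>x. cos x * (\<Sum>j\<le>Suc n. a j * sin x ^ (2 * j)))
      = (\<lambda>x. cos x * (\<Sum>j\<le>n. a j * sin x ^ (2 * j)) + a (Suc n) * (cos x * sin x ^ (2 * Suc n)))"
    by (simp add: fun_eq_iff distrib_left mult.left_commute)
  moreover have "- ((2 * real n + 1) * a n * sin x ^ (2 * n + 1))
      + ((2 * real n + 1) * a n * sin x ^ (2 * n + 1) - (2 * real n + 3) * a (Suc n) * sin x ^ (2 * n + 3))
      = - ((2 * real (Suc n) + 1) * a (Suc n) * sin x ^ (2 * Suc n + 1))"
  proof -
    have "2 * n + 3 = 2 * Suc n + 1" "2 * real n + 3 = 2 * real (Suc n) + 1" by simp_all
    then show ?thesis by (simp only:, simp?)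
  qed
  ultimately show ?case by (simp only:)
qed

lemma power_abs_le_MVT:
  fixes F F' :: "real \<Rightarrow> real"
  assumes "\<And>x. (F has_real_derivative F' x) (at x)" "\<And>x. \<bar>F' x\<bar> \<le> C * \<bar>x\<bar> ^ k" "C \<ge> 0"
  shows "\<bar>F x - F 0\<bar> \<le> C * \<bar>x\<bar> ^ Suc k"
proof -
  obtain \<xi> where \<xi>: "\<bar>\<xi> - 0\<bar> \<le> \<bar>x - 0\<bar>" "F x - F 0 = (x - 0) * F' \<xi>"
    using MVT_abs [OF assms(1), of 0 x] by blast
  have "\<bar>F x - F 0\<bar> = \<bar>x\<bar> * \<bar>F' \<xi>\<bar>" using \<xi>(2) by (simp add: abs_mult)
  also have "\<dots> \<le> \<bar>x\<bar> * (C * \<bar>x\<bar> ^ k)"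
  proof (rule mult_left_mono)
    have "\<bar>\<xi>\<bar> ^ k \<le> \<bar>x\<bar> ^ k" using \<xi>(1) by (intro power_mono) auto
    then have "C * \<bar>\<xi>\<bar> ^ k \<le> C * \<bar>x\<bar> ^ k" using assms(3) by (rule mult_left_mono)
    then show "\<bar>F' \<xi>\<bar> \<le> C * \<bar>x\<bar> ^ k" using assms(2) [of \<xi>] by linarith
  qed simp
  finally show ?thesis by (simp add: mult_ac)
qed

text \<open>Valid for all x, including |x| = pi/2 where cos vanishes and the series for 1/cos
  diverges. The whole interval of integration is thereby covered.\<close>

lemma cos_partial_sum_bound:
  "\<exists>C\<ge>0. \<forall>x::real. \<bar>1 - cos x * (\<Sum>j\<le>n. ((-1/2) gchoose j) * (- ((sin x)\<^sup>2)) ^ j)\<bar> \<le> C * \<bar>x\<bar> ^ (2 * n + 2)"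
proof -
  define a :: "nat \<Rightarrow> real" where "a j = (- 1) ^ j * ((-1/2) gchoose j)" for j
  let ?F = "\<lambda>x. cos x * (\<Sum>j\<le>n. a j * sin x ^ (2 * j))"
  have F: "?F x = cos x * (\<Sum>j\<le>n. ((-1/2) gchoose j) * (- ((sin x)\<^sup>2)) ^ j)" for x
  proof -
    have "(- ((sin x)\<^sup>2)) ^ j = (- 1) ^ j * sin x ^ (2 * j)" for j
      by (subst power_minus) (simp add: power_mult)
    then show ?thesis by (simp add: a_def mult_ac)
  qed
  have "\<bar>?F x - ?F 0\<bar> \<le> ((2 * real n + 1) * \<bar>a n\<bar>) * \<bar>x\<bar> ^ Suc (2 * n + 1)" for x
  proof (rule power_abs_le_MVT [where F = ?F and k = "2 * n + 1"])
    fix x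
    show "(?F has_real_derivative - ((2 * real n + 1) * a n * sin x ^ (2 * n + 1))) (at x)"
      unfolding a_def by (rule cos_partial_sum_DERIV)
    have "\<bar>sin x\<bar> ^ (2 * n + 1) \<le> \<bar>x\<bar> ^ (2 * n + 1)"
      by (intro power_mono abs_sin_x_le_abs_x) auto
    then have "(2 * real n + 1) * \<bar>a n\<bar> * \<bar>sin x\<bar> ^ (2 * n + 1) \<le> (2 * real n + 1) * \<bar>a n\<bar> * \<bar>x\<bar> ^ (2 * n + 1)"
      by (intro mult_left_mono) auto
    then show "\<bar>- ((2 * real n + 1) * a n * sin x ^ (2 * n + 1))\<bar> \<le> ((2 * real n + 1) * \<bar>a n\<bar>) * \<bar>x\<bar> ^ (2 * n + 1)"
      by (simp only: abs_minus_cancel abs_mult power_abs, simp?)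
  qed auto
  moreover have "?F 0 = 1"
  proof -
    have "(\<Sum>j\<le>n. a j * sin 0 ^ (2 * j)) = (\<Sum>j\<le>n. if j = 0 then a 0 else 0)"
      by (intro sum.cong) auto
    then show ?thesis by (simp add: a_def)
  qed
  ultimately have "\<bar>1 - ?F x\<bar> \<le> ((2 * real n + 1) * \<bar>a n\<bar>) * \<bar>x\<bar> ^ (2 * n + 2)" for x
    by (simp add: abs_minus_commute)
  then show ?thesis
    by (intro exI [of _ "(2 * real n + 1) * \<bar>a n\<bar>"]) (simp add: F)
qed

text \<open>For |t| > 2 sqrt h one has 1 \<le> t^2/(4h), so the tail is at most h^(-N) times an
  absolute Gaussian moment.\<close>

lemma gauss_truncated_integral:
  "\<exists>C\<ge>0. \<forall>h\<ge>1. \<bar>integral {- (2 * sqrt h)..2 * sqrt h} (\<lambda>t. exp (- t\<^sup>2 / 2) * poly p t) - gint p\<bar> \<le> C / h ^ N"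
proof -
  let ?\<phi> = "\<lambda>t. exp (- t\<^sup>2 / 2) * poly p t"
  let ?\<psi> = "\<lambda>t. \<bar>exp (- t\<^sup>2 / 2) * poly ([:0, 0, 1/4:] ^ N * p) t\<bar>"
  define C where "C = (LINT t|lborel. ?\<psi> t)"
  have C: "C \<ge> 0" unfolding C_def by (rule Bochner_Integration.integral_nonneg) simp
  show ?thesis
  proof (intro exI [of _ C] conjI allI impI C)
    fix h :: real
    assume h: "h \<ge> 1"
    let ?I = "{- (2 * sqrt h)..2 * sqrt h}"
    have si: "set_integrable lborel ?I ?\<phi>"
      unfolding set_integrable_def by (rule integrable_mult_indicator [OF _ gauss_poly_integrable]) simp
    have I: "integral ?I ?\<phi> = (LINT t|lborel. indicator ?I t * ?\<phi> t)"
      using set_borel_integral_eq_integral(2) [OF si] unfolding set_lebesgue_integral_def real_scaleR_def by (rule sym)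
    have i1: "integrable lborel (\<lambda>t. indicator ?I t * ?\<phi> t)"
      using si unfolding set_integrable_def real_scaleR_def .
    have eq: "integral ?I ?\<phi> - gint p = (LINT t|lborel. indicator ?I t * ?\<phi> t - ?\<phi> t)"
      unfolding I gint_def by (rule Bochner_Integration.integral_diff [OF i1 gauss_poly_integrable, symmetric])
    have "\<bar>LINT t|lborel. indicator ?I t * ?\<phi> t - ?\<phi> t\<bar> \<le> (LINT t|lborel. ?\<psi> t / h ^ N)"
    proof -
      have "norm (LINT t|lborel. indicator ?I t * ?\<phi> t - ?\<phi> t) \<le> (LINT t|lborel. ?\<psi> t / h ^ N)"
      proof (rule Bochner_Integration.integral_norm_bound_integral)
        show "integrable lborel (\<lambda>t. indicator ?I t * ?\<phi> t - ?\<phi> t)"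
          by (intro Bochner_Integration.integrable_diff i1 gauss_poly_integrable)
        show "integrable lborel (\<lambda>t. ?\<psi> t / h ^ N)"
          by (intro integrable_divide integrable_abs gauss_poly_integrable)
        fix t :: real
        show "norm (indicator ?I t * ?\<phi> t - ?\<phi> t) \<le> ?\<psi> t / h ^ N"
        proof (cases "t \<in> ?I")
          case True
          then show ?thesis using h by simp
        next
          case False
          then have "2 * sqrt h < \<bar>t\<bar>" by auto
          then have "(2 * sqrt h)\<^sup>2 \<le> \<bar>t\<bar>\<^sup>2" using h by (intro power_mono) auto
          moreover have "(2 * sqrt h)\<^sup>2 = 4 * h" using h by (simp add: power_mult_distrib)
          ultimately have "1 \<le> t\<^sup>2 / 4 / h" using h by (simp add: pos_le_divide_eq)
          then have "1 \<le> (t\<^sup>2 / 4 / h) ^ N" by (rule one_le_power)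
          then have "\<bar>?\<phi> t\<bar> * 1 \<le> \<bar>?\<phi> t\<bar> * (t\<^sup>2 / 4 / h) ^ N" by (intro mult_left_mono) auto
          also have "\<dots> = ?\<psi> t / h ^ N"
          proof -
            have "poly ([:0, 0, 1/4:] ^ N * p) t = (t\<^sup>2 / 4) ^ N * poly p t"
              by (simp add: poly_power power2_eq_square)
            moreover have "(t\<^sup>2 / 4 / h) ^ N = (t\<^sup>2 / 4) ^ N / h ^ N" by (rule power_divide)
            moreover have "\<bar>(t\<^sup>2 / 4) ^ N\<bar> = (t\<^sup>2 / 4) ^ N" by simp
            ultimately show ?thesis by (simp only: abs_mult times_divide_eq_right mult.assoc mult.commute [of "\<bar>poly p t\<bar>"])
          qed
          finally show ?thesis using False by simp
        qed
      qed
      then show ?thesis unfolding real_norm_def .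
    qed
    also have "\<dots> = C / h ^ N" unfolding C_def by (rule Bochner_Integration.integral_divide_zero)
    finally show "\<bar>integral ?I ?\<phi> - gint p\<bar> \<le> C / h ^ N" unfolding eq .
  qed
qed

lemma integral_cauchy_bound:
  fixes \<phi> :: "real \<Rightarrow> real"
  assumes "k \<ge> 0" "K \<ge> 0" "continuous_on {- k..k} \<phi>" "\<And>t. \<bar>t\<bar> \<le> k \<Longrightarrow> \<bar>\<phi> t\<bar> \<le> K / (1 + t\<^sup>2)"
  shows "\<bar>integral {- k..k} \<phi>\<bar> \<le> pi * K"
proof -
  have "((\<lambda>s. K * inverse (1 + s\<^sup>2)) has_integral K * arctan k - K * arctan (- k)) {- k..k}"
    by (rule fundamental_theorem_of_calculus)
      (use assms in \<open>auto intro!: derivative_eq_intros simp: has_real_derivative_iff_has_vector_derivative [symmetric]\<close>)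
  then have *: "((\<lambda>s. K * inverse (1 + s\<^sup>2)) has_integral 2 * (K * arctan k)) {- k..k}"
    by (simp add: arctan_minus)
  have "norm (integral {- k..k} \<phi>) \<le> integral {- k..k} (\<lambda>s. K * inverse (1 + s\<^sup>2))"
    by (rule integral_norm_bound_integral [OF integrable_continuous_real [OF assms(3)] has_integral_integrable [OF *]])
      (use assms(4) in \<open>auto simp: divide_inverse\<close>)
  also have "\<dots> = 2 * (K * arctan k)" by (rule integral_unique [OF *])
  also have "\<dots> \<le> 2 * (K * (pi / 2))"
    using arctan_ubound [of k] assms(2) by (intro mult_left_mono) auto
  finally show ?thesis by (simp add: mult_ac)
qed

text \<open>The factor ds/dt = 1/cos is singular at the ends. Therefore its truncated series J is
  inserted: the substitution is exact for cos J \<open>amode\<close>^2, and |1 - cos J| is at most a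
  constant times h^(-n-1) (1+t^2)^(n+1), which the decay of \<open>amode\<close> absorbs.\<close>

lemma amode_norm:
  "\<exists>K\<ge>0. \<forall>h\<ge>1. \<bar>integral {- (pi * sqrt h)..pi * sqrt h} (\<lambda>s. (amode m n h s)\<^sup>2)
     - fact m * sqrt (2 * pi) * (\<Sum>s\<le>n. coeff_eta m s / h ^ s)\<bar> \<le> K / h ^ (n + 1)"
proof -
  define X :: "nat \<Rightarrow> real poly" where "X j = smult ((-1/2) gchoose j) ([:0, 0, -1/4:] ^ j)" for j
  define J where "J = truncation n X"
  define E where "E e t = J e t * (truncation n (amplitude m) e t * truncation n (amplitude m) e t)" for e t
  have "expansion n E (\<lambda>s. \<Sum>i\<le>s. X i * (\<Sum>i'\<le>s - i. amplitude m i' * amplitude m (s - i - i')))"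
    using expansion_mult [OF expansion_truncation [of n X]
        expansion_mult [OF expansion_truncation [of n "amplitude m"] expansion_truncation [of n "amplitude m"]]]
    unfolding E_def [abs_def] J_def .
  moreover have "norm_density m = (\<lambda>s. \<Sum>i\<le>s. X i * (\<Sum>i'\<le>s - i. amplitude m i' * amplitude m (s - i - i')))"
    by (rule ext) (simp only: norm_density_def X_def)
  ultimately have "expansion n E (norm_density m)"
    by (simp only:)
  then obtain R where R: "poly_bounded R" "\<And>e t. E e t = truncation n (norm_density m) e t + e ^ (n + 1) * R e t"
    by (rule expansionE) (rule that)
  obtain K1 where K1: "K1 \<ge> 0" "\<And>e t. 0 < e \<Longrightarrow> e \<le> 1 \<Longrightarrow> \<bar>exp (- t\<^sup>2 / 4) * R e t\<bar> \<le> K1 / (1 + t\<^sup>2) ^ 1"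
    using poly_bounded_gauss [OF R(1)] by blast
  have "\<forall>s. \<exists>C. C \<ge> 0 \<and> (\<forall>h\<ge>1. \<bar>integral {- (2 * sqrt h)..2 * sqrt h} (\<lambda>t. exp (- t\<^sup>2 / 2) * poly (norm_density m s) t)
      - gint (norm_density m s)\<bar> \<le> C / h ^ (n + 1))"
  proof
    fix s
    show "\<exists>C. C \<ge> 0 \<and> (\<forall>h\<ge>1. \<bar>integral {- (2 * sqrt h)..2 * sqrt h} (\<lambda>t. exp (- t\<^sup>2 / 2) * poly (norm_density m s) t)
        - gint (norm_density m s)\<bar> \<le> C / h ^ (n + 1))"
      by (rule gauss_truncated_integral)
  qed
  from choice [OF this] obtain C where "\<forall>s. C s \<ge> 0 \<and> (\<forall>h\<ge>1.
      \<bar>integral {- (2 * sqrt h)..2 * sqrt h} (\<lambda>t. exp (- t\<^sup>2 / 2) * poly (norm_density m s) t)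
      - gint (norm_density m s)\<bar> \<le> C s / h ^ (n + 1))"
    by (rule exE)
  note CC = spec [OF this]
  have C: "C s \<ge> 0" "h \<ge> 1 \<Longrightarrow>
      \<bar>integral {- (2 * sqrt h)..2 * sqrt h} (\<lambda>t. exp (- t\<^sup>2 / 2) * poly (norm_density m s) t)
      - gint (norm_density m s)\<bar> \<le> C s / h ^ (n + 1)" for s h
    using CC [of s] by (simp_all only:)
  obtain K2 :: real where K2: "K2 \<ge> 0" "\<And>x. \<bar>1 - cos x * (\<Sum>j\<le>n. ((-1/2) gchoose j) * (- ((sin x)\<^sup>2)) ^ j)\<bar> \<le> K2 * \<bar>x\<bar> ^ (2 * n + 2)"
    using cos_partial_sum_bound [of n] by blast
  \<comment> \<open>The exponent n + 2 offsets the growth (1+t^2)^(n+1) of 1 - cos J and leaves one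
    factor 1/(1+t^2) for integrability.\<close>
  obtain K3 where K3: "K3 \<ge> 0" "\<And>h t. h \<ge> 1 \<Longrightarrow> \<bar>approx m n (1 / h) t\<bar> \<le> K3 / (1 + t\<^sup>2) ^ (n + 2)"
  proof -
    obtain K3 where K3: "K3 \<ge> 0 \<and> (\<forall>h t. h \<ge> 1 \<longrightarrow> \<bar>approx m n (1 / h) t\<bar> \<le> K3 / (1 + t\<^sup>2) ^ (n + 2) \<and>
        \<bar>dapprox m n (1 / h) t\<bar> \<le> K3 / (1 + t\<^sup>2) ^ (n + 2))"
      using approx_decay [of m n "n + 2"] by (rule exE)
    show ?thesis
      by (rule that [of K3]) (simp_all only: K3)
  qed
  define K where "K = 4 * pi * (K3\<^sup>2 * K2) + ((\<Sum>s\<le>n. C s) + pi * K1)"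
  have K0: "K \<ge> 0"
    unfolding K_def using K1(1) K2(1) C(1) by (intro add_nonneg_nonneg mult_nonneg_nonneg sum_nonneg) auto
  show ?thesis
  proof (intro exI [of _ K] conjI allI impI K0)
    fix h :: real
    assume h: "h \<ge> 1"
    let ?e = "1 / h" and ?b = "pi * sqrt h" and ?k = "2 * sqrt h"
    have hp: "h > 0" and e: "0 < ?e" "?e \<le> 1" using h by auto
    define \<Phi> where "\<Phi> t = exp (- t\<^sup>2 / 2) * E ?e t" for t
    have cont_tr: "continuous_on A (truncation n Y ?e)" for A Y
      unfolding truncation_def [abs_def] by (intro continuous_intros)
    have contE: "continuous_on A (E ?e)" for A
      unfolding E_def [abs_def] J_def by (intro continuous_intros cont_tr)
    have cont\<Phi>: "continuous_on A \<Phi>" for A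
      unfolding \<Phi>_def [abs_def] by (intro continuous_intros contE) auto
    \<comment> \<open>t^2/(4h) is the square of sin(s/(2 sqrt h)), so J is the partial binomial
      series for 1/cos.\<close>
    have J: "J ?e (tvar h s) = (\<Sum>j\<le>n. ((-1/2) gchoose j) * (- ((sin (s / (2 * sqrt h)))\<^sup>2)) ^ j)" for s
    proof -
      have "tvar h s * tvar h s = 4 * h * (sin (s / (2 * sqrt h)))\<^sup>2"
        using hp by (simp add: tvar_def power_mult_distrib flip: power2_eq_square)
      then have "?e * (- (tvar h s * tvar h s / 4)) = - ((sin (s / (2 * sqrt h)))\<^sup>2)"
        using hp by simp
      then have "?e ^ j * (- (tvar h s * tvar h s / 4)) ^ j = (- ((sin (s / (2 * sqrt h)))\<^sup>2)) ^ j" for j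
        by (simp only: power_mult_distrib [symmetric])
      moreover have "poly (X j) (tvar h s) = ((-1/2) gchoose j) * (- (tvar h s * tvar h s / 4)) ^ j" for j
        by (simp add: X_def poly_power)
      ultimately have "?e ^ j * poly (X j) (tvar h s) = ((-1/2) gchoose j) * (- ((sin (s / (2 * sqrt h)))\<^sup>2)) ^ j" for j
        by (metis mult.left_commute)
      then show ?thesis
        by (simp only: J_def truncation_def)
    qed
    have am: "\<Phi> (tvar h s) = (amode m n h s)\<^sup>2 * J ?e (tvar h s)" for s
    proof -
      have "exp (- (tvar h s)\<^sup>2 / 4) * exp (- (tvar h s)\<^sup>2 / 4) = exp (- (tvar h s)\<^sup>2 / 2)"
        by (simp add: exp_add [symmetric])
      then show ?thesis
        by (simp add: \<Phi>_def E_def amode_def approx_def power2_eq_square mult_ac)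
    qed
    let ?c = "\<lambda>s. cos (s / (2 * sqrt h))"
    have sub: "((\<lambda>s. ?c s *\<^sub>R \<Phi> (tvar h s)) has_integral integral {tvar h (- ?b)..tvar h ?b} \<Phi>) {- ?b..?b}"
    proof (rule has_integral_substitution [where c = "- ?k" and d = ?k])
      show "- ?b \<le> ?b" using hp by simp
      show "tvar h (- ?b) \<le> tvar h ?b" using hp by (simp add: tvar_minus tvar_end)
      show "tvar h ` {- ?b..?b} \<subseteq> {- ?k..?k}"
      proof (rule image_subsetI)
        fix s
        have "\<bar>sin (s / (2 * sqrt h))\<bar> \<le> 1" by (rule abs_sin_le_one)
        then have "?k * \<bar>sin (s / (2 * sqrt h))\<bar> \<le> ?k * 1" using hp by (intro mult_left_mono) auto
        then have "\<bar>tvar h s\<bar> \<le> ?k" using hp by (simp add: tvar_def abs_mult)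
        then show "tvar h s \<in> {- ?k..?k}" by auto
      qed
      show "continuous_on {- ?k..?k} \<Phi>" by (rule cont\<Phi>)
      show "(tvar h has_real_derivative ?c s) (at s within {- ?b..?b})" for s
        by (rule has_field_derivative_at_within [OF tvar_DERIV [OF hp]])
    qed
    have sub': "integral {- ?b..?b} (\<lambda>s. ?c s * \<Phi> (tvar h s)) = integral {- ?k..?k} \<Phi>"
      using integral_unique [OF sub] hp by (simp add: tvar_minus tvar_end)
    have cont_am: "continuous_on A (amode m n h)" for A
      by (rule continuous_on_DERIV [OF amode_DERIV [OF hp]])
    have contc: "continuous_on A ?c" for A
      unfolding divide_inverse by (intro continuous_intros)
    have cont\<Phi>t: "continuous_on A (\<lambda>s. \<Phi> (tvar h s))" for A
      by (rule continuous_on_compose2 [OF cont\<Phi> [of UNIV] continuous_on_tvar]) auto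
    let ?\<Delta> = "\<lambda>s. (amode m n h s)\<^sup>2 * (1 - ?c s * J ?e (tvar h s))"
    have \<Delta>: "?\<Delta> s = (amode m n h s)\<^sup>2 - ?c s * \<Phi> (tvar h s)" for s
      unfolding am by (simp add: algebra_simps)
    have cont\<Delta>: "continuous_on A ?\<Delta>" for A
      unfolding \<Delta> by (intro continuous_intros cont_am contc cont\<Phi>t)
    have 1: "integral {- ?b..?b} (\<lambda>s. (amode m n h s)\<^sup>2) - integral {- ?k..?k} \<Phi> = integral {- ?b..?b} ?\<Delta>"
      unfolding \<Delta> sub' [symmetric]
      by (rule Henstock_Kurzweil_Integration.integral_diff [symmetric])
        (intro integrable_continuous_real continuous_intros cont_am contc cont\<Phi>t)+
    have 2: "\<bar>integral {- ?b..?b} ?\<Delta>\<bar> \<le> 4 * pi * (K3\<^sup>2 * K2 / h ^ (n + 1))"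
    proof (rule weighted_integral_bound [OF hp _ cont\<Delta>])
      show "0 \<le> K3\<^sup>2 * K2 / h ^ (n + 1)" using K2(1) hp by simp
      fix s assume s: "\<bar>s\<bar> \<le> ?b"
      let ?t = "tvar h s" and ?q = "1 + (tvar h s)\<^sup>2"
      have q: "?q \<ge> 1" by simp
      have "\<bar>s\<bar> / 2 \<le> \<bar>?t\<bar>" by (rule abs_tvar_ge [OF hp s])
      then have "(\<bar>s\<bar> / 2) ^ (2 * n + 2) \<le> \<bar>?t\<bar> ^ (2 * n + 2)" by (intro power_mono) auto
      also have "\<dots> = (?t\<^sup>2) ^ (n + 1)"
        using power_mult [of "\<bar>?t\<bar>" 2 "n + 1"] by simp
      also have "\<dots> \<le> ?q ^ (n + 1)" by (intro power_mono) auto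
      finally have sq: "(\<bar>s\<bar> / 2) ^ (2 * n + 2) \<le> ?q ^ (n + 1)" .
      have "\<bar>s / (2 * sqrt h)\<bar> ^ (2 * n + 2) = (\<bar>s\<bar> / 2) ^ (2 * n + 2) / sqrt h ^ (2 * n + 2)"
        using hp by (simp add: abs_mult power_divide power_mult_distrib)
      also have "sqrt h ^ (2 * n + 2) = h ^ (n + 1)"
        using power_mult [of "sqrt h" 2 "n + 1"] hp by simp
      finally have th: "\<bar>s / (2 * sqrt h)\<bar> ^ (2 * n + 2) \<le> ?q ^ (n + 1) / h ^ (n + 1)"
        using divide_right_mono [OF sq, of "h ^ (n + 1)"] hp by simp
      have "\<bar>1 - ?c s * J ?e ?t\<bar> \<le> K2 * \<bar>s / (2 * sqrt h)\<bar> ^ (2 * n + 2)"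
        unfolding J by (rule K2(2))
      also have "\<dots> \<le> K2 * (?q ^ (n + 1) / h ^ (n + 1))"
        using th K2(1) by (rule mult_left_mono)
      finally have j: "\<bar>1 - ?c s * J ?e ?t\<bar> \<le> K2 * (?q ^ (n + 1) / h ^ (n + 1))" .
      have a1: "\<bar>amode m n h s\<bar> \<le> K3 / ?q ^ (n + 2)" using K3(2) [OF h] by (simp add: amode_def)
      have "K3 / ?q ^ (n + 2) \<le> K3 / 1"
        using K3(1) one_le_power [OF q, of "n + 2"] by (intro divide_left_mono; simp only: mult_1_right; linarith)
      then have a2: "\<bar>amode m n h s\<bar> \<le> K3" using a1 by simp
      have "\<bar>amode m n h s\<bar> * \<bar>amode m n h s\<bar> * \<bar>1 - ?c s * J ?e ?t\<bar>
          \<le> (K3 / ?q ^ (n + 2)) * K3 * (K2 * (?q ^ (n + 1) / h ^ (n + 1)))"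
        using a1 a2 j K3(1) q by (intro mult_mono mult_nonneg_nonneg divide_nonneg_nonneg zero_le_power) auto
      also have "\<dots> = K3\<^sup>2 * K2 / h ^ (n + 1) / ?q"
      proof -
        have "(K3 / q ^ (n + 2)) * K3 * (K2 * (q ^ (n + 1) / y)) = K3\<^sup>2 * K2 / y / q" if "q \<ge> 1" for q y :: real
          using that by (simp add: power_add power2_eq_square field_simps)
        from this [OF q] show ?thesis .
      qed
      finally show "\<bar>?\<Delta> s\<bar> \<le> K3\<^sup>2 * K2 / h ^ (n + 1) / ?q"
        by (simp add: abs_mult power2_eq_square)
    qed
    have split: "integral {- ?k..?k} \<Phi> = (\<Sum>s\<le>n. ?e ^ s * integral {- ?k..?k} (\<lambda>t. exp (- t\<^sup>2 / 2) * poly (norm_density m s) t))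
        + ?e ^ (n + 1) * integral {- ?k..?k} (\<lambda>t. exp (- t\<^sup>2 / 2) * R ?e t)"
      and contR: "continuous_on {- ?k..?k} (\<lambda>t. exp (- t\<^sup>2 / 2) * R ?e t)"
    proof -
      have "R ?e t = (E ?e t - truncation n (norm_density m) ?e t) / ?e ^ (n + 1)" for t
        using R(2) [of ?e t] e by simp
      then have "continuous_on A (R ?e)" for A
        using hp by (auto intro!: continuous_intros contE cont_tr simp: fun_eq_iff)
      then show c: "continuous_on {- ?k..?k} (\<lambda>t. exp (- t\<^sup>2 / 2) * R ?e t)"
        by (intro continuous_intros) auto
      have "\<Phi> = (\<lambda>t. (\<Sum>s\<le>n. ?e ^ s * (exp (- t\<^sup>2 / 2) * poly (norm_density m s) t)) + ?e ^ (n + 1) * (exp (- t\<^sup>2 / 2) * R ?e t))"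
        unfolding \<Phi>_def [abs_def] R(2) truncation_def
        by (simp add: fun_eq_iff distrib_left sum_distrib_left mult_ac)
      then have "integral {- ?k..?k} \<Phi> = integral {- ?k..?k} (\<lambda>t. (\<Sum>s\<le>n. ?e ^ s * (exp (- t\<^sup>2 / 2) * poly (norm_density m s) t)) + ?e ^ (n + 1) * (exp (- t\<^sup>2 / 2) * R ?e t))"
        by simp
      also have "\<dots> = integral {- ?k..?k} (\<lambda>t. \<Sum>s\<le>n. ?e ^ s * (exp (- t\<^sup>2 / 2) * poly (norm_density m s) t))
          + integral {- ?k..?k} (\<lambda>t. ?e ^ (n + 1) * (exp (- t\<^sup>2 / 2) * R ?e t))"
        by (rule Henstock_Kurzweil_Integration.integral_add)
          ((intro integrable_continuous_real continuous_intros c; simp)+)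
      also have "integral {- ?k..?k} (\<lambda>t. \<Sum>s\<le>n. ?e ^ s * (exp (- t\<^sup>2 / 2) * poly (norm_density m s) t))
          = (\<Sum>s\<le>n. integral {- ?k..?k} (\<lambda>t. ?e ^ s * (exp (- t\<^sup>2 / 2) * poly (norm_density m s) t)))"
        by (rule Henstock_Kurzweil_Integration.integral_sum) (auto intro!: integrable_continuous_real continuous_intros)
      finally show "integral {- ?k..?k} \<Phi> = (\<Sum>s\<le>n. ?e ^ s * integral {- ?k..?k} (\<lambda>t. exp (- t\<^sup>2 / 2) * poly (norm_density m s) t))
        + ?e ^ (n + 1) * integral {- ?k..?k} (\<lambda>t. exp (- t\<^sup>2 / 2) * R ?e t)"
        by simp
    qed
    have R_int: "\<bar>integral {- ?k..?k} (\<lambda>t. exp (- t\<^sup>2 / 2) * R ?e t)\<bar> \<le> pi * K1"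
    proof (rule integral_cauchy_bound [OF _ K1(1) contR])
      show "0 \<le> ?k" using hp by simp
      fix t :: real
      have "exp (- t\<^sup>2 / 2) * \<bar>R ?e t\<bar> \<le> exp (- t\<^sup>2 / 4) * \<bar>R ?e t\<bar>"
        by (intro mult_right_mono) auto
      then show "\<bar>exp (- t\<^sup>2 / 2) * R ?e t\<bar> \<le> K1 / (1 + t\<^sup>2)"
        using K1(2) [OF e, of t] by (simp add: abs_mult)
    qed
    have 3: "\<bar>integral {- ?k..?k} \<Phi> - (\<Sum>s\<le>n. ?e ^ s * gint (norm_density m s))\<bar> \<le> ((\<Sum>s\<le>n. C s) + pi * K1) / h ^ (n + 1)"
    proof -
      have "integral {- ?k..?k} \<Phi> - (\<Sum>s\<le>n. ?e ^ s * gint (norm_density m s))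
        = (\<Sum>s\<le>n. ?e ^ s * (integral {- ?k..?k} (\<lambda>t. exp (- t\<^sup>2 / 2) * poly (norm_density m s) t) - gint (norm_density m s)))
          + ?e ^ (n + 1) * integral {- ?k..?k} (\<lambda>t. exp (- t\<^sup>2 / 2) * R ?e t)"
        unfolding split by (simp add: right_diff_distrib sum_subtractf)
      moreover have "\<bar>\<Sum>s\<le>n. ?e ^ s * (integral {- ?k..?k} (\<lambda>t. exp (- t\<^sup>2 / 2) * poly (norm_density m s) t) - gint (norm_density m s))\<bar>
          \<le> (\<Sum>s\<le>n. C s / h ^ (n + 1))"
      proof (rule order_trans [OF sum_abs], rule sum_mono)
        fix s
        have "?e ^ s \<le> 1" using e by (intro power_le_one) auto
        then have "\<bar>?e ^ s\<bar> * \<bar>integral {- ?k..?k} (\<lambda>t. exp (- t\<^sup>2 / 2) * poly (norm_density m s) t) - gint (norm_density m s)\<bar>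
            \<le> 1 * (C s / h ^ (n + 1))"
          using e C(2) [OF h, of s] by (intro mult_mono) auto
        then show "\<bar>?e ^ s * (integral {- ?k..?k} (\<lambda>t. exp (- t\<^sup>2 / 2) * poly (norm_density m s) t) - gint (norm_density m s))\<bar> \<le> C s / h ^ (n + 1)"
          by (simp add: abs_mult)
      qed
      moreover have "\<bar>?e ^ (n + 1) * integral {- ?k..?k} (\<lambda>t. exp (- t\<^sup>2 / 2) * R ?e t)\<bar> \<le> ?e ^ (n + 1) * (pi * K1)"
        unfolding abs_mult using R_int e by (intro mult_mono) auto
      ultimately have "\<bar>integral {- ?k..?k} \<Phi> - (\<Sum>s\<le>n. ?e ^ s * gint (norm_density m s))\<bar>
          \<le> (\<Sum>s\<le>n. C s / h ^ (n + 1)) + ?e ^ (n + 1) * (pi * K1)"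
        by linarith
      also have "\<dots> = ((\<Sum>s\<le>n. C s) + pi * K1) / h ^ (n + 1)"
        by (simp only: add_divide_distrib sum_divide_distrib power_divide power_one) simp
      finally show ?thesis .
    qed
    have "(\<Sum>s\<le>n. ?e ^ s * gint (norm_density m s)) = fact m * sqrt (2 * pi) * (\<Sum>s\<le>n. coeff_eta m s / h ^ s)"
      unfolding sum_distrib_left by (intro sum.cong refl) (simp add: coeff_eta_gint power_divide)
    with 1 2 3 have "\<bar>integral {- ?b..?b} (\<lambda>s. (amode m n h s)\<^sup>2) - fact m * sqrt (2 * pi) * (\<Sum>s\<le>n. coeff_eta m s / h ^ s)\<bar>
        \<le> 4 * pi * (K3\<^sup>2 * K2 / h ^ (n + 1)) + ((\<Sum>s\<le>n. C s) + pi * K1) / h ^ (n + 1)"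
      by linarith
    also have "\<dots> = K / h ^ (n + 1)" by (simp add: K_def add_divide_distrib)
    finally show "\<bar>integral {- ?b..?b} (\<lambda>s. (amode m n h s)\<^sup>2) - fact m * sqrt (2 * pi) * (\<Sum>s\<le>n. coeff_eta m s / h ^ s)\<bar> \<le> K / h ^ (n + 1)" .
  qed
qed

section \<open>Division by the square root factor\<close>

text \<open>Here the sum S is a partial series of (1 - sin^2 x)^(1/2). The second claim is that the
  numerator S' cos + S sin of the derivative of S/cos telescopes to one term.\<close>

lemma sqrt_partial_sum_DERIV:
  defines "a \<equiv> \<lambda>j. (- 1) ^ j * ((1/2) gchoose j) :: real"
  assumes that: "q = (\<lambda>n. \<Sum>j\<le>n. a j * (2 * real j * sin x ^ (2 * j - 1) * cos x))"
  shows "((\<lambda>x. \<Sum>j\<le>n. a j * sin x ^ (2 * j)) has_real_derivative q n) (at x) \<and>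
      cos x * q n + sin x * (\<Sum>j\<le>n. a j * sin x ^ (2 * j)) = (1 - 2 * real n) * a n * sin x ^ (2 * n + 1)"
proof
  have d: "((\<lambda>x. a j * sin x ^ (2 * j)) has_real_derivative a j * (2 * real j * sin x ^ (2 * j - 1) * cos x)) (at x)" for j
    by (rule DERIV_cong [OF DERIV_cmult [OF DERIV_power [OF DERIV_sin, where n = "2 * j"]]]) simp
  show "((\<lambda>x. \<Sum>j\<le>n. a j * sin x ^ (2 * j)) has_real_derivative q n) (at x)"
    unfolding that by (rule DERIV_sum) (rule d)
  show "cos x * q n + sin x * (\<Sum>j\<le>n. a j * sin x ^ (2 * j)) = (1 - 2 * real n) * a n * sin x ^ (2 * n + 1)"
  proof (induction n)
    case 0
    show ?case by (simp add: that)
  next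
    case (Suc n)
    define y where "y = sin x ^ (2 * n + 1)"
    have p: "2 * Suc n - 1 = 2 * n + 1" "sin x ^ (2 * Suc n) = y * sin x" "sin x ^ (2 * Suc n + 1) = y * sin x * sin x"
      by (simp_all add: y_def)
    have rec: "(2 * real n + 2) * a (Suc n) = - ((1 - 2 * real n) * a n)"
      using gchoose_half_Suc [of n] unfolding a_def by (simp add: algebra_simps)
    have cc: "cos x * cos x = 1 - sin x * sin x"
      using sin_cos_squared_add3 [of x] by linarith
    have "cos x * q (Suc n) + sin x * (\<Sum>j\<le>Suc n. a j * sin x ^ (2 * j))
        = (cos x * q n + sin x * (\<Sum>j\<le>n. a j * sin x ^ (2 * j)))
          + a (Suc n) * (2 * real (Suc n) * y * (cos x * cos x) + sin x * (y * sin x))"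
      unfolding that sum.atMost_Suc p y_def [symmetric] by (simp add: algebra_simps)
    also have "\<dots> = (1 - 2 * real n) * a n * y + ((2 * real n + 2) * a (Suc n)) * y
        - (2 * real n + 1) * a (Suc n) * (y * sin x * sin x)"
      unfolding Suc y_def [symmetric] cc by (simp add: algebra_simps)
    also have "\<dots> = (1 - 2 * real (Suc n)) * a (Suc n) * sin x ^ (2 * Suc n + 1)"
      unfolding rec p by (simp add: algebra_simps)
    finally show ?case .
  qed
qed

lemma cos_ge_half:
  assumes "\<bar>x\<bar> \<le> (1::real)"
  shows "1/2 \<le> cos x"
proof -
  have "\<bar>x\<bar> \<le> pi / 3" using assms pi_gt3 by linarith
  then have "cos (pi / 3) \<le> cos \<bar>x\<bar>" by (intro cos_monotone_0_pi_le) auto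
  then show ?thesis by (simp add: cos_60)
qed

text \<open>The cosine is now in the denominator, so x is restricted to a range where cos x \<ge>
  1/2. For bounded t and large h this is enough.\<close>

lemma sqrt_partial_sum_bound:
  "\<exists>C\<ge>0. \<forall>x::real. \<bar>x\<bar> \<le> 1 \<longrightarrow> \<bar>(\<Sum>j\<le>n. ((1/2) gchoose j) * (- ((sin x)\<^sup>2)) ^ j) / cos x - 1\<bar> \<le> C * \<bar>x\<bar> ^ (2 * n + 2)"
proof -
  define a :: "nat \<Rightarrow> real" where "a j = (- 1) ^ j * ((1/2) gchoose j)" for j
  define S where "S x = (\<Sum>j\<le>n. a j * sin x ^ (2 * j))" for x
  define C where "C = 4 * (\<bar>1 - 2 * real n\<bar> * \<bar>a n\<bar>)"
  have S: "S x = (\<Sum>j\<le>n. ((1/2) gchoose j) * (- ((sin x)\<^sup>2)) ^ j)" for x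
  proof -
    have "(- ((sin x)\<^sup>2)) ^ j = (- 1) ^ j * sin x ^ (2 * j)" for j
      by (subst power_minus) (simp add: power_mult)
    then show ?thesis by (simp add: S_def a_def mult_ac)
  qed
  have S0: "S 0 = 1"
  proof -
    have "(\<Sum>j\<le>n. a j * sin 0 ^ (2 * j)) = (\<Sum>j\<le>n. if j = 0 then a 0 else 0)"
      by (intro sum.cong) auto
    then show ?thesis by (simp add: S_def a_def)
  qed
  have D: "((\<lambda>x. S x / cos x) has_real_derivative (1 - 2 * real n) * a n * sin x ^ (2 * n + 1) / (cos x * cos x)) (at x)"
    if "\<bar>x\<bar> \<le> 1" for x
  proof -
    have c: "cos x \<noteq> 0" using cos_ge_half [OF that] by auto
    define q where "q = (\<lambda>n. \<Sum>j\<le>n. a j * (2 * real j * sin x ^ (2 * j - 1) * cos x))"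
    note * = sqrt_partial_sum_DERIV [of q x n, folded a_def, OF q_def]
    have "((\<lambda>x. S x / cos x) has_real_derivative (q n * cos x - S x * - sin x) / (cos x * cos x)) (at x)"
      unfolding S_def [abs_def] by (rule DERIV_divide [OF conjunct1 [OF *] DERIV_cos c])
    moreover have "q n * cos x - S x * - sin x = (1 - 2 * real n) * a n * sin x ^ (2 * n + 1)"
      using conjunct2 [OF *] by (simp add: S_def mult.commute)
    ultimately show ?thesis by simp
  qed
  have "\<bar>S x / cos x - 1\<bar> \<le> C * \<bar>x\<bar> ^ (2 * n + 2)" if x: "\<bar>x\<bar> \<le> 1" for x
  proof -
    have bound: "\<bar>(1 - 2 * real n) * a n * sin \<xi> ^ (2 * n + 1) / (cos \<xi> * cos \<xi>)\<bar> \<le> C * \<bar>x\<bar> ^ (2 * n + 1)"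
      if "\<bar>\<xi>\<bar> \<le> \<bar>x\<bar>" for \<xi>
    proof -
      have c: "1/2 \<le> cos \<xi>" using that x by (intro cos_ge_half) simp
      have "1/2 * (1/2) \<le> cos \<xi> * cos \<xi>" using c by (intro mult_mono) auto
      then have cc: "1/4 \<le> \<bar>cos \<xi> * cos \<xi>\<bar>" by simp
      have "\<bar>sin \<xi>\<bar> ^ (2 * n + 1) \<le> \<bar>x\<bar> ^ (2 * n + 1)"
        using abs_sin_x_le_abs_x [of \<xi>] that by (intro power_mono) auto
      then have "\<bar>1 - 2 * real n\<bar> * \<bar>a n\<bar> * \<bar>sin \<xi>\<bar> ^ (2 * n + 1) \<le> \<bar>1 - 2 * real n\<bar> * \<bar>a n\<bar> * \<bar>x\<bar> ^ (2 * n + 1)"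
        by (intro mult_left_mono) auto
      then have "\<bar>1 - 2 * real n\<bar> * \<bar>a n\<bar> * \<bar>sin \<xi>\<bar> ^ (2 * n + 1) / \<bar>cos \<xi> * cos \<xi>\<bar>
          \<le> \<bar>1 - 2 * real n\<bar> * \<bar>a n\<bar> * \<bar>x\<bar> ^ (2 * n + 1) / (1/4)"
        using cc by (intro frac_le) auto
      then show ?thesis by (simp add: C_def abs_mult power_abs mult_ac)
    qed
    have "\<exists>\<xi>. \<bar>\<xi>\<bar> \<le> \<bar>x\<bar> \<and> S x / cos x - S 0 / cos 0 = x * ((1 - 2 * real n) * a n * sin \<xi> ^ (2 * n + 1) / (cos \<xi> * cos \<xi>))"
    proof (cases x "0::real" rule: linorder_cases)
      case less
      have "\<exists>\<xi>>x. \<xi> < 0 \<and> S 0 / cos 0 - S x / cos x = (0 - x) * ((1 - 2 * real n) * a n * sin \<xi> ^ (2 * n + 1) / (cos \<xi> * cos \<xi>))"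
        by (rule MVT2 [OF less], rule D) (use x in auto)
      then obtain \<xi> where "x < \<xi>" "\<xi> < 0" "S 0 / cos 0 - S x / cos x = (0 - x) * ((1 - 2 * real n) * a n * sin \<xi> ^ (2 * n + 1) / (cos \<xi> * cos \<xi>))"
        by blast
      then show ?thesis by (intro exI [of _ \<xi>]) auto
    next
      case greater
      have "\<exists>\<xi>>0. \<xi> < x \<and> S x / cos x - S 0 / cos 0 = (x - 0) * ((1 - 2 * real n) * a n * sin \<xi> ^ (2 * n + 1) / (cos \<xi> * cos \<xi>))"
        by (rule MVT2 [OF greater], rule D) (use x in auto)
      then obtain \<xi> where "0 < \<xi>" "\<xi> < x" "S x / cos x - S 0 / cos 0 = (x - 0) * ((1 - 2 * real n) * a n * sin \<xi> ^ (2 * n + 1) / (cos \<xi> * cos \<xi>))"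
        by blast
      then show ?thesis by (intro exI [of _ \<xi>]) auto
    qed auto
    then obtain \<xi> where \<xi>: "\<bar>\<xi>\<bar> \<le> \<bar>x\<bar>" "S x / cos x - 1 = x * ((1 - 2 * real n) * a n * sin \<xi> ^ (2 * n + 1) / (cos \<xi> * cos \<xi>))"
      by (auto simp: S0)
    have "\<bar>S x / cos x - 1\<bar> \<le> \<bar>x\<bar> * (C * \<bar>x\<bar> ^ (2 * n + 1))"
      unfolding \<xi>(2) abs_mult [of x] by (intro mult_left_mono bound \<xi>(1)) simp
    then show ?thesis by (simp add: mult_ac)
  qed
  then show ?thesis unfolding S by (intro exI [of _ C]) (simp add: C_def)
qed

lemma poly_bounded_on:
  assumes "poly_bounded F" "T \<ge> 0"
  shows "\<exists>K\<ge>0. \<forall>e t. 0 < e \<longrightarrow> e \<le> 1 \<longrightarrow> \<bar>t\<bar> \<le> T \<longrightarrow> \<bar>F e t\<bar> \<le> K"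
proof -
  obtain K N where K: "K \<ge> 0" "\<And>e t. 0 < e \<Longrightarrow> e \<le> 1 \<Longrightarrow> \<bar>F e t\<bar> \<le> K * (1 + t\<^sup>2) ^ N"
    using assms(1) unfolding poly_bounded_def by blast
  show ?thesis
  proof (intro exI [of _ "K * (1 + T\<^sup>2) ^ N"] conjI allI impI)
    show "0 \<le> K * (1 + T\<^sup>2) ^ N" using K(1) by (simp add: zero_le_power add_nonneg_nonneg)
    fix e t :: real
    assume e: "0 < e" "e \<le> 1" and t: "\<bar>t\<bar> \<le> T"
    have "t\<^sup>2 \<le> T\<^sup>2" using t by (metis abs_ge_zero power2_abs power_mono)
    then have "K * (1 + t\<^sup>2) ^ N \<le> K * (1 + T\<^sup>2) ^ N"
      using K(1) by (intro mult_left_mono power_mono) (auto simp: add_nonneg_nonneg)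
    then show "\<bar>F e t\<bar> \<le> K * (1 + T\<^sup>2) ^ N" using K(2) [OF e, of t] by linarith
  qed
qed

text \<open>The defining convolution makes the product of Y and the truncated
  \<open>sqrt_deconv A\<close> agree with that of A up to O(h^(-n-1)), where Y is the truncated
  series of the cosine. The sequence A is general because both A_s and B_s are divided.\<close>

lemma sqrt_division:
  assumes "T \<ge> 0"
  shows "\<exists>K\<ge>0. \<forall>h s. h \<ge> 1 + T\<^sup>2 \<longrightarrow> \<bar>s\<bar> \<le> pi * sqrt h \<longrightarrow> \<bar>tvar h s\<bar> \<le> T \<longrightarrow>
    \<bar>truncation n A (1 / h) (tvar h s) / cos (s / (2 * sqrt h)) - truncation n (sqrt_deconv A) (1 / h) (tvar h s)\<bar> \<le> K / h ^ (n + 1)"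
proof -
  define Y :: "nat \<Rightarrow> real poly" where "Y j = smult ((1/2) gchoose j) ([:0, 0, -1/4:] ^ j)" for j
  let ?P = "sqrt_deconv A"
  have A: "(\<Sum>i\<le>s. Y i * ?P (s - i)) = A s" for s
    unfolding Y_def using sqrt_deconv_relation [of A s] by (simp add: atLeast0AtMost)
  have "expansion n (\<lambda>e t. truncation n Y e t * truncation n ?P e t) A"
    using expansion_mult [OF expansion_truncation [of n Y] expansion_truncation [of n ?P]] unfolding A .
  then obtain R where R: "poly_bounded R"
      "\<And>e t. truncation n Y e t * truncation n ?P e t = truncation n A e t + e ^ (n + 1) * R e t"
    by (rule expansionE) (rule that)
  obtain K1 where K1: "K1 \<ge> 0" "\<And>e t. 0 < e \<Longrightarrow> e \<le> 1 \<Longrightarrow> \<bar>t\<bar> \<le> T \<Longrightarrow> \<bar>R e t\<bar> \<le> K1"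
    using poly_bounded_on [OF R(1) assms] by blast
  obtain K2 where K2: "K2 \<ge> 0" "\<And>e t. 0 < e \<Longrightarrow> e \<le> 1 \<Longrightarrow> \<bar>t\<bar> \<le> T \<Longrightarrow> \<bar>truncation n ?P e t\<bar> \<le> K2"
    using poly_bounded_on [OF poly_bounded_truncation assms] by blast
  obtain C :: real where C: "C \<ge> 0" "\<And>x. \<bar>x\<bar> \<le> 1 \<Longrightarrow> \<bar>(\<Sum>j\<le>n. ((1/2) gchoose j) * (- ((sin x)\<^sup>2)) ^ j) / cos x - 1\<bar> \<le> C * \<bar>x\<bar> ^ (2 * n + 2)"
    using sqrt_partial_sum_bound [of n] by blast
  define K where "K = K2 * (C * T ^ (2 * n + 2)) + 2 * K1"
  have "K \<ge> 0" unfolding K_def using K1(1) K2(1) C(1) assms by (intro add_nonneg_nonneg mult_nonneg_nonneg zero_le_power) auto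
  moreover have "\<bar>truncation n A (1 / h) (tvar h s) / cos (s / (2 * sqrt h)) - truncation n ?P (1 / h) (tvar h s)\<bar> \<le> K / h ^ (n + 1)"
    if hh: "h \<ge> 1 + T\<^sup>2" and s: "\<bar>s\<bar> \<le> pi * sqrt h" and t: "\<bar>tvar h s\<bar> \<le> T" for h s
  proof -
    let ?t = "tvar h s" and ?e = "1 / h" and ?x = "s / (2 * sqrt h)"
    have h: "h \<ge> 1" using hh zero_le_power2 [of T] by linarith
    then have hp: "h > 0" and e: "0 < ?e" "?e \<le> 1" by auto
    have "\<bar>s\<bar> / 2 \<le> T" using abs_tvar_ge [OF hp s] t by linarith
    then have xT: "\<bar>?x\<bar> \<le> T / sqrt h" using hp by (simp add: field_simps)
    have "T\<^sup>2 \<le> h" using hh by simp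
    then have "T \<le> sqrt h" by (rule real_le_rsqrt)
    then have "T / sqrt h \<le> 1" using hp by (simp add: pos_divide_le_eq)
    then have x1: "\<bar>?x\<bar> \<le> 1" using xT by linarith
    have c: "1/2 \<le> cos ?x" by (rule cos_ge_half [OF x1])
    have Ysum: "truncation n Y ?e ?t = (\<Sum>j\<le>n. ((1/2) gchoose j) * (- ((sin ?x)\<^sup>2)) ^ j)"
    proof -
      have "?t * ?t = 4 * h * (sin ?x)\<^sup>2"
        using hp by (simp add: tvar_def power_mult_distrib flip: power2_eq_square)
      then have "?e * (- (?t * ?t / 4)) = - ((sin ?x)\<^sup>2)"
        using hp by simp
      then have "?e ^ j * (- (?t * ?t / 4)) ^ j = (- ((sin ?x)\<^sup>2)) ^ j" for j
        by (simp only: power_mult_distrib [symmetric])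
      moreover have "poly (Y j) ?t = ((1/2) gchoose j) * (- (?t * ?t / 4)) ^ j" for j
        by (simp add: Y_def poly_power)
      ultimately have "?e ^ j * poly (Y j) ?t = ((1/2) gchoose j) * (- ((sin ?x)\<^sup>2)) ^ j" for j
        by (metis mult.left_commute)
      then show ?thesis
        by (simp only: truncation_def)
    qed
    have "\<bar>truncation n Y ?e ?t / cos ?x - 1\<bar> \<le> C * \<bar>?x\<bar> ^ (2 * n + 2)"
      unfolding Ysum by (rule C(2) [OF x1])
    also have "\<dots> \<le> C * (T / sqrt h) ^ (2 * n + 2)"
      using xT C(1) by (intro mult_left_mono power_mono) auto
    also have "(T / sqrt h) ^ (2 * n + 2) = T ^ (2 * n + 2) / h ^ (n + 1)"
    proof -
      have "sqrt h ^ (2 * n + 2) = h ^ (n + 1)"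
        using power_mult [of "sqrt h" 2 "n + 1"] hp by simp
      then show ?thesis by (simp only: power_divide)
    qed
    finally have 1: "\<bar>truncation n Y ?e ?t / cos ?x - 1\<bar> \<le> C * (T ^ (2 * n + 2) / h ^ (n + 1))" .
    have "truncation n A ?e ?t / cos ?x - truncation n ?P ?e ?t
        = truncation n ?P ?e ?t * (truncation n Y ?e ?t / cos ?x - 1) - ?e ^ (n + 1) * R ?e ?t / cos ?x"
    proof -
      have "truncation n A ?e ?t = truncation n Y ?e ?t * truncation n ?P ?e ?t - ?e ^ (n + 1) * R ?e ?t"
        using R(2) [of ?e ?t] by simp
      moreover have "(y * p - r) / c - p = p * (y / c - 1) - r / c" for y p r c :: real
        by (simp add: diff_divide_distrib right_diff_distrib mult.commute)
      ultimately show ?thesis by (simp only:)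
    qed
    moreover have "\<bar>truncation n ?P ?e ?t * (truncation n Y ?e ?t / cos ?x - 1)\<bar> \<le> K2 * (C * (T ^ (2 * n + 2) / h ^ (n + 1)))"
      unfolding abs_mult using K2 1 e t by (intro mult_mono) auto
    moreover have "\<bar>?e ^ (n + 1) * R ?e ?t / cos ?x\<bar> \<le> (1 / h ^ (n + 1)) * K1 / (1/2)"
    proof -
      have "\<bar>?e ^ (n + 1) * R ?e ?t\<bar> \<le> (1 / h ^ (n + 1)) * K1"
        unfolding abs_mult using K1(2) [OF e t] hp by (intro mult_mono) (auto simp: power_divide)
      then show ?thesis unfolding abs_divide using c K1(1) hp by (intro frac_le) auto
    qed
    ultimately have "\<bar>truncation n A ?e ?t / cos ?x - truncation n ?P ?e ?t\<bar>
        \<le> K2 * (C * (T ^ (2 * n + 2) / h ^ (n + 1))) + (1 / h ^ (n + 1)) * K1 / (1/2)"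
      by linarith
    also have "\<dots> = K / h ^ (n + 1)" by (simp add: K_def add_divide_distrib)
    finally show ?thesis .
  qed
  ultimately show ?thesis by blast
qed

section \<open>Reduction of the eigenfunctions to modes\<close>

lemma solution_unique:
  fixes f f' V :: "real \<Rightarrow> real"
  assumes d: "\<And>s. (f has_real_derivative f' s) (at s)" "\<And>s. (f' has_real_derivative V s * f s) (at s)"
    and V: "\<And>s. \<bar>V s\<bar> \<le> M" and z: "f a = 0" "f' a = 0"
  shows "f s = 0"
proof (cases "a \<le> s")
  case True
  have "(f s)\<^sup>2 + (f' s)\<^sup>2 \<le> ((f a)\<^sup>2 + (f' a)\<^sup>2 + 0\<^sup>2 * (s - a)) * exp ((2 + M) * (s - a))"
    by (rule energy_growth [where V = V and r = "\<lambda>s. 0"]) (use d V True in auto)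
  then have "(f s)\<^sup>2 + (f' s)\<^sup>2 \<le> 0" by (simp add: z)
  then show ?thesis by (metis add_nonneg_eq_0_iff antisym add_nonneg_nonneg power_eq_0_iff zero_le_power2)
next
  case False
  have "(f s)\<^sup>2 + (f' s)\<^sup>2 \<le> ((f a)\<^sup>2 + (f' a)\<^sup>2) * exp ((2 + M) * (a - s))"
    by (rule energy_lower [where V = V]) (use d V False in auto)
  then have "(f s)\<^sup>2 + (f' s)\<^sup>2 \<le> 0" by (simp add: z)
  then show ?thesis by (metis add_nonneg_eq_0_iff antisym add_nonneg_nonneg power_eq_0_iff zero_le_power2)
qed

lemma mathieu_solution_DERIV:
  assumes "mathieu_solution h lam w"
  shows "(w has_real_derivative deriv w z) (at z)"
    "(deriv w has_real_derivative (2 * h\<^sup>2 * cos (2 * z) - lam) * w z) (at z)"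
proof -
  show "(w has_real_derivative deriv w z) (at z)"
    using assms unfolding mathieu_solution_def by (metis DERIV_imp_deriv real_differentiableE)
  have "(deriv w has_real_derivative deriv (deriv w) z) (at z)"
    using assms unfolding mathieu_solution_def by (metis DERIV_imp_deriv real_differentiableE)
  moreover have "deriv (deriv w) z = (2 * h\<^sup>2 * cos (2 * z) - lam) * w z"
    using assms unfolding mathieu_solution_def by (simp add: algebra_simps add_eq_0_iff)
  ultimately show "(deriv w has_real_derivative (2 * h\<^sup>2 * cos (2 * z) - lam) * w z) (at z)"
    by simp
qed

definition boundary_condition :: "(real \<Rightarrow> real) \<Rightarrow> bool" where
  "boundary_condition w \<longleftrightarrow> (deriv w 0 = 0 \<and> deriv w pi = 0) \<or> (w 0 = 0 \<and> w pi = 0)"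

text \<open>Parity is not part of the notion of eigenfunction. The reflected function F(-s) solves
  the same equation with the same homogeneous condition at b, so it is a multiple c F, and
  reflecting twice gives c^2 = 1.\<close>

lemma eigenfunction_mode:
  assumes sol: "mathieu_solution h lam w" and nz: "\<exists>z. w z \<noteq> 0" and bc: "boundary_condition w"
    and zeros: "exactly_zeros m w" and h: "h \<ge> 1" and wide: "2 * turn m + 4 \<le> pi * sqrt h"
  shows "\<exists>N>0. mathieu_mode m h ((lam + 2 * h\<^sup>2) / (4 * h))
     (\<lambda>s. w (pi / 2 - s / (2 * sqrt h)) / N) (\<lambda>s. - deriv w (pi / 2 - s / (2 * sqrt h)) / (2 * sqrt h) / N)"
proof -
  let ?k = "2 * sqrt h" and ?b = "pi * sqrt h" and ?\<Lambda> = "(lam + 2 * h\<^sup>2) / (4 * h)"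
  have hp: "h > 0" using h by simp
  have k: "?k > 0" using hp by simp
  define F F' where "F s = w (pi / 2 - s / ?k)" and "F' s = - deriv w (pi / 2 - s / ?k) / ?k" for s
  define V where "V s = (tvar h s)\<^sup>2 / 4 - ?\<Lambda>" for s
  have l: "((\<lambda>s. pi / 2 - s / ?k) has_real_derivative - (1 / ?k)) (at s)" for s
    by (rule DERIV_cong [OF DERIV_diff [OF DERIV_const DERIV_cdivide [OF DERIV_ident]]]) simp
  have dF: "(F has_real_derivative F' s) (at s)" for s
    unfolding F_def [abs_def] F'_def
    by (rule DERIV_cong [OF DERIV_chain2 [OF mathieu_solution_DERIV(1) [OF sol] l]]) simp
  have dF': "(F' has_real_derivative V s * F s) (at s)" for s
  proof -
    let ?z = "pi / 2 - s / ?k"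
    have "((\<lambda>s. - deriv w (pi / 2 - s / ?k) / ?k) has_real_derivative
        - ((2 * h\<^sup>2 * cos (2 * ?z) - lam) * w ?z * - (1 / ?k)) / ?k) (at s)"
      by (intro DERIV_cdivide DERIV_minus DERIV_chain2 [OF mathieu_solution_DERIV(2) [OF sol] l])
    moreover have "- ((2 * h\<^sup>2 * cos (2 * ?z) - lam) * w ?z * - (1 / ?k)) / ?k = V s * F s"
    proof -
      have "cos (2 * ?z) = 2 * (sin (s / ?k))\<^sup>2 - 1"
        by (simp only: cos_double_cos cos_diff) simp
      moreover have "?k * ?k = 4 * h" using hp by simp
      moreover have "(tvar h s)\<^sup>2 = 4 * h * (sin (s / ?k))\<^sup>2"
        using hp by (simp add: tvar_def power_mult_distrib)
      moreover have "- ((2 * h\<^sup>2 * C - lam) * W * - (1 / k)) / k = (q / 4 - ?\<Lambda>) * W"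
        if "C = 2 * S - 1" "k * k = 4 * h" "q = 4 * h * S" for C W S k q :: real
      proof -
        have "- ((2 * h\<^sup>2 * C - lam) * W * - (1 / k)) / k = (2 * h\<^sup>2 * C - lam) * W / (k * k)" by simp
        also have "\<dots> = (q / 4 - ?\<Lambda>) * W"
          unfolding that using hp by (simp add: field_simps power2_eq_square)
        finally show ?thesis .
      qed
      ultimately show ?thesis
        by (simp only: F_def V_def)
    qed
    ultimately show ?thesis unfolding F'_def [abs_def] by simp
  qed
  have V_bound: "\<bar>V s\<bar> \<le> h + \<bar>?\<Lambda>\<bar>" for s
  proof -
    have "(sin (s / ?k))\<^sup>2 \<le> 1" by (simp add: abs_square_le_1)
    then have "h * (sin (s / ?k))\<^sup>2 \<le> h" using hp by (simp add: mult_left_le)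
    moreover have "(tvar h s)\<^sup>2 / 4 = h * (sin (s / ?k))\<^sup>2"
      using hp by (simp add: tvar_def power_mult_distrib)
    moreover have "0 \<le> h * (sin (s / ?k))\<^sup>2" using hp by simp
    ultimately show ?thesis unfolding V_def by linarith
  qed
  have unique: "F s \<noteq> 0 \<or> F' s \<noteq> 0" for s
  proof (rule ccontr)
    assume "\<not> (F s \<noteq> 0 \<or> F' s \<noteq> 0)"
    then have "F x = 0" for x
      using solution_unique [OF dF dF' V_bound, of s x] by blast
    then have "w z = 0" for z
      using k unfolding F_def by (metis add_diff_cancel_left' diff_diff_eq2 nonzero_mult_div_cancel_left less_irrefl add.commute)
    with nz show False by blast
  qed
  have Vm: "V (- s) = V s" for s by (simp add: V_def tvar_minus)
  have dFm: "((\<lambda>s. F (- s)) has_real_derivative - F' (- s)) (at s)" for s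
    using DERIV_chain2 [where f = F and g = uminus, OF dF DERIV_minus [OF DERIV_ident]] by simp
  have dFm': "((\<lambda>s. - F' (- s)) has_real_derivative V s * F (- s)) (at s)" for s
    using DERIV_minus [OF DERIV_chain2 [where f = F' and g = uminus, OF dF' DERIV_minus [OF DERIV_ident]], of s] Vm by simp
  \<comment> \<open>A combination of F(-s) and F(s) with zero Cauchy data at b vanishes identically;
    the coefficients are later taken from the boundary data of F.\<close>
  have comb: "\<alpha> * F (- s) + \<beta> * F s = 0"
    if "\<alpha> * F (- ?b) + \<beta> * F ?b = 0" "\<alpha> * - F' (- ?b) + \<beta> * F' ?b = 0" for \<alpha> \<beta> s
  proof (rule solution_unique [where f = "\<lambda>s. \<alpha> * F (- s) + \<beta> * F s" and f' = "\<lambda>s. \<alpha> * - F' (- s) + \<beta> * F' s" and V = V, OF _ _ V_bound that])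
    show "((\<lambda>s. \<alpha> * F (- s) + \<beta> * F s) has_real_derivative \<alpha> * - F' (- s) + \<beta> * F' s) (at s)" for s
      by (intro DERIV_add DERIV_cmult dF dFm)
    show "((\<lambda>s. \<alpha> * - F' (- s) + \<beta> * F' s) has_real_derivative V s * (\<alpha> * F (- s) + \<beta> * F s)) (at s)" for s
      by (rule DERIV_cong [OF DERIV_add [OF DERIV_cmult [OF dFm'] DERIV_cmult [OF dF']]]) (simp add: algebra_simps)
  qed
  have ends: "pi / 2 - ?b / ?k = 0" "pi / 2 - - ?b / ?k = pi" using hp by (simp_all add: field_simps)
  have bcF: "(F' ?b = 0 \<and> F' (- ?b) = 0) \<or> (F ?b = 0 \<and> F (- ?b) = 0)"
    using bc unfolding boundary_condition_def F_def F'_def ends by auto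
  have parity: "(\<forall>s. F (- s) = F s) \<or> (\<forall>s. F (- s) = - F s)"
  proof -
    have "\<exists>\<alpha> \<beta>. \<alpha> \<noteq> 0 \<and> (\<forall>s. \<alpha> * F (- s) + \<beta> * F s = 0)"
      using bcF
    proof
      assume "F' ?b = 0 \<and> F' (- ?b) = 0"
      then show ?thesis
        using unique [of ?b] comb [of "F ?b" "- F (- ?b)"] by (intro exI [of _ "F ?b"] exI [of _ "- F (- ?b)"]) auto
    next
      assume "F ?b = 0 \<and> F (- ?b) = 0"
      then show ?thesis
        using unique [of ?b] comb [of "F' ?b" "F' (- ?b)"] by (intro exI [of _ "F' ?b"] exI [of _ "F' (- ?b)"]) auto
    qed
    then obtain \<alpha> \<beta> where ab: "\<alpha> \<noteq> 0" "\<And>s. \<alpha> * F (- s) + \<beta> * F s = 0" by blast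
    define c where "c = - \<beta> / \<alpha>"
    have c: "F (- s) = c * F s" for s
      using ab(1) ab(2) [of s] by (simp add: c_def field_simps add_eq_0_iff)
    obtain s where s: "F s \<noteq> 0"
    proof (rule ccontr)
      assume "\<not> thesis"
      then have *: "F = (\<lambda>s. 0)" using that by auto
      then have "F' 0 = 0" using dF [of 0] DERIV_unique DERIV_const by metis
      with * unique [of 0] show False by simp
    qed
    have "F s = c * (c * F s)" using c [of s] c [of "- s"] by simp
    then have "c * c = 1" using s by simp
    then have "c = 1 \<or> c = -1" by (metis square_eq_1_iff)
    then show ?thesis using c by auto
  qed
  define N where "N = sqrt ((F 0)\<^sup>2 + (F' 0)\<^sup>2)"
  have "(F 0)\<^sup>2 + (F' 0)\<^sup>2 > 0"
    using unique [of 0] by (auto simp: add_pos_nonneg add_nonneg_pos)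
  then have N: "N > 0" "N\<^sup>2 = (F 0)\<^sup>2 + (F' 0)\<^sup>2" by (simp_all add: N_def)
  have bij: "bij_betw (\<lambda>s. pi / 2 - s / ?k) {s. \<bar>s\<bar> < ?b \<and> F s / N = 0} {z \<in> {0<..<pi}. w z = 0}"
  proof (rule bij_betwI [where g = "\<lambda>z. ?k * (pi / 2 - z)"])
    show "(\<lambda>s. pi / 2 - s / ?k) \<in> {s. \<bar>s\<bar> < ?b \<and> F s / N = 0} \<rightarrow> {z \<in> {0<..<pi}. w z = 0}"
    proof
      fix s assume s: "s \<in> {s. \<bar>s\<bar> < ?b \<and> F s / N = 0}"
      then have "\<bar>s / ?k\<bar> < pi / 2" using hp by (simp add: abs_divide abs_mult field_simps)
      then have "- (pi / 2) < s / ?k \<and> s / ?k < pi / 2" by linarith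
      then show "pi / 2 - s / ?k \<in> {z \<in> {0<..<pi}. w z = 0}" using s N(1) by (auto simp: F_def)
    qed
    show "(\<lambda>z. ?k * (pi / 2 - z)) \<in> {z \<in> {0<..<pi}. w z = 0} \<rightarrow> {s. \<bar>s\<bar> < ?b \<and> F s / N = 0}"
    proof
      fix z assume z: "z \<in> {z \<in> {0<..<pi}. w z = 0}"
      then have "0 < z" "z < pi" by simp_all
      then have "\<bar>pi / 2 - z\<bar> < pi / 2" unfolding abs_less_iff by linarith
      then have "?k * \<bar>pi / 2 - z\<bar> < ?k * (pi / 2)" using k by (intro mult_strict_left_mono) auto
      then have "\<bar>?k * (pi / 2 - z)\<bar> < ?b" using hp by (simp add: abs_mult)
      then show "?k * (pi / 2 - z) \<in> {s. \<bar>s\<bar> < ?b \<and> F s / N = 0}" using z k by (simp add: F_def)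
    qed
  qed (use hp in auto)
  have "mathieu_mode m h ?\<Lambda> (\<lambda>s. F s / N) (\<lambda>s. F' s / N)"
  proof
    show "1 \<le> h" "2 * turn m + 4 \<le> pi * sqrt h" by (fact h wide)+
    show "((\<lambda>s. F s / N) has_real_derivative F' s / N) (at s)" for s
      by (rule DERIV_cdivide [OF dF])
    show "((\<lambda>s. F' s / N) has_real_derivative ((tvar h s)\<^sup>2 / 4 - ?\<Lambda>) * (F s / N)) (at s)" for s
      by (rule DERIV_cong [OF DERIV_cdivide [OF dF']]) (simp add: V_def)
    show "(\<forall>s. F (- s) / N = F s / N) \<or> (\<forall>s. F (- s) / N = - (F s / N))" using parity by auto
    show "F ?b / N * (F' ?b / N) = 0" using bcF by auto
    show "(F 0 / N)\<^sup>2 + (F' 0 / N)\<^sup>2 = 1"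
      using N unique [of 0] by (simp add: power_divide add_divide_distrib [symmetric])
    show "finite {s. \<bar>s\<bar> < ?b \<and> F s / N = 0}" "card {s. \<bar>s\<bar> < ?b \<and> F s / N = 0} = m"
      using zeros bij_betw_finite [OF bij] bij_betw_same_card [OF bij] by (simp_all add: exactly_zeros_def)
  qed
  then show ?thesis unfolding F_def F'_def using N(1) by blast
qed

section \<open>Normalised eigenfunctions\<close>

text \<open>He_m is monic, hence eventually at least 1.\<close>

lemma parabolic_D_eventually_ge: "\<exists>X. \<forall>t\<ge>X. exp (- t\<^sup>2 / 4) \<le> parabolic_D m t"
proof -
  have "lead_coeff (hermite_He m) = 1" by (simp only: degree_hermite_He lead_coeff_hermite_He)
  then have "lead_coeff (hermite_He m) > 0" by simp
  from poly_pinfty_gt_lc [OF this] obtain X where "\<And>t. t \<ge> X \<Longrightarrow> lead_coeff (hermite_He m) \<le> poly (hermite_He m) t"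
    by blast
  then have "\<And>t. t \<ge> X \<Longrightarrow> 1 \<le> poly (hermite_He m) t"
    by (simp only: degree_hermite_He lead_coeff_hermite_He)
  then have "\<And>t. t \<ge> X \<Longrightarrow> exp (- t\<^sup>2 / 4) * 1 \<le> exp (- t\<^sup>2 / 4) * poly (hermite_He m) t"
    by (intro mult_left_mono) auto
  then show ?thesis unfolding parabolic_D_def mult_1_right by blast
qed

text \<open>Supplies a fixed point T beyond the turning point where the approximate mode is positive
  uniformly in h; comparing there with f determines the sign of \<kappa>.\<close>

lemma amode_tail_pos:
  "\<exists>T d h0. T > 0 \<and> turn m \<le> T \<and> d > 0 \<and> 1 + T\<^sup>2 \<le> h0 \<and> (\<forall>h\<ge>h0. d \<le> amode m n h T)"
proof -
  obtain X where X: "\<And>t. t \<ge> X \<Longrightarrow> exp (- t\<^sup>2 / 4) \<le> parabolic_D m t"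
    using parabolic_D_eventually_ge by blast
  obtain K where K: "K \<ge> 0" "\<And>h t. h \<ge> 1 \<Longrightarrow> \<bar>approx m n (1 / h) t - parabolic_D m t\<bar> \<le> K / h"
    using approx_order_difference [of m n 0] by auto
  define T where "T = max (2 * \<bar>X\<bar>) (turn m)"
  define d where "d = exp (- T\<^sup>2 / 4) / 2"
  have d: "d > 0" by (simp add: d_def)
  have T: "T > 0" "turn m \<le> T" "X \<le> T / 2" using turn_pos(1) [of m] by (auto simp: T_def)
  define h0 where "h0 = 1 + T\<^sup>2 + K / d"
  have "d \<le> amode m n h T" if h0: "h \<ge> h0" for h
  proof -
    have h: "h \<ge> 1 + T\<^sup>2" "h \<ge> K / d"
      using h0 K(1) d zero_le_power2 [of T] unfolding h0_def by (smt (verit) divide_nonneg_pos)+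
    then have h1: "h \<ge> 1" using zero_le_power2 [of T] by linarith
    have "T \<le> sqrt h" using h(1) by (intro real_le_rsqrt) simp
    also have "\<dots> \<le> pi * sqrt h" using pi_gt3 h1 by simp
    finally have Tb: "T \<le> pi * sqrt h" .
    have t: "T / 2 \<le> tvar h T" using h1 T Tb by (intro tvar_ge) auto
    have "\<bar>tvar h T\<bar> \<le> \<bar>T\<bar>" using h1 by (intro abs_tvar_le) auto
    then have "(tvar h T)\<^sup>2 \<le> T\<^sup>2" by (simp only: abs_le_square_iff)
    then have "2 * d \<le> exp (- (tvar h T)\<^sup>2 / 4)" by (simp add: d_def)
    also have "\<dots> \<le> parabolic_D m (tvar h T)" using t T by (intro X) linarith
    finally have "2 * d \<le> parabolic_D m (tvar h T)" .
    moreover have "K / h \<le> d" using h(2) d h1 by (simp add: field_simps)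
    ultimately show ?thesis using K(2) [OF h1, of "tvar h T"] unfolding amode_def by linarith
  qed
  moreover have "1 + T\<^sup>2 \<le> h0" using K(1) d by (simp add: h0_def)
  ultimately show ?thesis using T d by blast
qed

lemma mode_integral:
  assumes h: "h > 0" and w: "continuous_on UNIV w"
  shows "integral {- (pi * sqrt h)..pi * sqrt h} (\<lambda>s. (w (pi / 2 - s / (2 * sqrt h)) / N)\<^sup>2)
    = 2 * sqrt h * integral {0..pi} (\<lambda>z. (w z)\<^sup>2) / N\<^sup>2"
proof -
  let ?k = "2 * sqrt h" and ?b = "pi * sqrt h" and ?F = "\<lambda>z. (w z)\<^sup>2"
  let ?g = "\<lambda>s. pi / 2 - s / (2 * sqrt h)"
  have g: "?g (- ?b) = pi" "?g ?b = 0" using h by (simp_all add: field_simps)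
  have "((\<lambda>s. (- (1 / ?k)) *\<^sub>R ?F (?g s)) has_integral integral {?g (- ?b)..?g ?b} ?F - integral {?g ?b..?g (- ?b)} ?F) {- ?b..?b}"
  proof (rule has_integral_substitution_general [where s = "{}" and c = 0 and d = pi])
    show "?g ` {- ?b..?b} \<subseteq> {0..pi}"
    proof (rule image_subsetI)
      fix s assume "s \<in> {- ?b..?b}"
      then have "- ?b / ?k \<le> s / ?k \<and> s / ?k \<le> ?b / ?k"
        using h by (intro conjI divide_right_mono) auto
      then show "?g s \<in> {0..pi}" using h by simp
    qed
    show "continuous_on {0..pi} ?F"
      by (intro continuous_intros continuous_on_subset [OF w]) auto
    show "continuous_on {- ?b..?b} ?g" using h by (intro continuous_intros) auto
    show "(?g has_real_derivative - (1 / ?k)) (at s within {- ?b..?b})" for s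
      by (rule DERIV_subset [where s = UNIV])
        (rule DERIV_cong [OF DERIV_diff [OF DERIV_const DERIV_cdivide [OF DERIV_ident]]], simp_all)
  qed (use h in auto)
  then have "((\<lambda>s. (- (1 / ?k)) *\<^sub>R ?F (?g s)) has_integral - integral {0..pi} ?F) {- ?b..?b}"
    unfolding g by (simp add: integral_spike_set)
  from has_integral_mult_right [OF this, of "- ?k / N\<^sup>2"]
  have "((\<lambda>s. (w (?g s) / N)\<^sup>2) has_integral ?k * integral {0..pi} ?F / N\<^sup>2) {- ?b..?b}"
    using h by (simp add: power_divide)
  then show ?thesis by (rule integral_unique)
qed

text \<open>What the two families have in common. Positivity just to the right of z = 0 stands in
  for the sign convention by continuity in h.\<close>

definition normalized_eigenfunction :: "nat \<Rightarrow> real \<Rightarrow> real \<Rightarrow> (real \<Rightarrow> real) \<Rightarrow> bool" where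
  "normalized_eigenfunction m h lam w \<longleftrightarrow>
     mathieu_solution h lam w \<and> (\<exists>z. w z \<noteq> 0) \<and> boundary_condition w \<and> exactly_zeros m w \<and>
     integral {0..pi} (\<lambda>z. (w z)\<^sup>2) = pi / 2 \<and> (\<exists>\<delta>>0. \<forall>z. 0 < z \<longrightarrow> z < \<delta> \<longrightarrow> w z > 0)"

text \<open>f has no zero from T up to b, so its sign near b, that is near z = 0, persists at
  T.\<close>

lemma (in mathieu_mode) tail_pos:
  assumes T: "turn m \<le> T" "T < b" and \<delta>: "\<delta> > 0" and pos: "\<And>s. b - \<delta> < s \<Longrightarrow> s < b \<Longrightarrow> f s > 0"
  shows "f T > 0"
proof -
  define r where "r = max T (b - \<delta> / 2)"
  have r: "T \<le> r" "r < b" "b - \<delta> < r" using T \<delta> by (auto simp: r_def)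
  have "f T * f r > 0"
  proof (rule nonzero_imp_same_sign [where a = T and b = r and f = f])
    show "continuous_on {T..r} f" by (rule continuous_on_DERIV [OF DERIV_f])
    show "f s \<noteq> 0" if "s \<in> {T..r}" for s using that T r by (intro tail_nonzero) auto
  qed (use r in auto)
  moreover have "f r > 0" using r by (intro pos)
  ultimately show ?thesis by (simp add: zero_less_mult_iff)
qed

text \<open>The square integral of w over s equals pi sqrt h, and it is c^2 times that of the
  approximate mode up to the error; this gives c to order n. The factor c still depends on
  n.\<close>

lemma normalized_expansion:
  assumes "T \<ge> 0"
  shows "\<exists>K h0. K \<ge> 0 \<and> h0 \<ge> 1 \<and> (\<forall>h lam w. h \<ge> h0 \<longrightarrow> normalized_eigenfunction m h lam w \<longrightarrow>
    (\<exists>c>0. (\<forall>s. \<bar>s\<bar> \<le> T \<longrightarrow> \<bar>w (pi / 2 - s / (2 * sqrt h)) - c * amode m n h s\<bar> \<le> c * (K / h ^ (n + 1))) \<and>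
      \<bar>pi * sqrt h / (c\<^sup>2 * (fact m * sqrt (2 * pi))) - (\<Sum>s\<le>n. coeff_eta m s / h ^ s)\<bar> \<le> K / h ^ (n + 1)))"
proof -
  obtain T1 d h1 where T1: "T1 > 0" "turn m \<le> T1" "d > 0" "1 + T1\<^sup>2 \<le> h1" "\<And>h. h \<ge> h1 \<Longrightarrow> d \<le> amode m n h T1"
    using amode_tail_pos [of m n] by blast
  define T' where "T' = max T T1"
  have T': "T' \<ge> 0" "T \<le> T'" "T1 \<le> T'" using assms by (auto simp: T'_def)
  obtain K1 h2 where K1: "K1 > 0" and exp: "\<And>h \<Lambda> f f'. mathieu_mode m h \<Lambda> f f' \<Longrightarrow> h \<ge> h2 \<Longrightarrow>
    \<exists>\<kappa>. 1 / K1 \<le> \<bar>\<kappa>\<bar> \<and> \<bar>\<kappa>\<bar> \<le> K1 \<and> (\<forall>s. \<bar>s\<bar> \<le> T' \<longrightarrow> \<bar>f s - \<kappa> * amode m n h s\<bar> \<le> K1 / h ^ (n + 1)) \<and>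
      \<bar>integral {- (pi * sqrt h)..pi * sqrt h} (\<lambda>s. (f s)\<^sup>2)
        - \<kappa>\<^sup>2 * integral {- (pi * sqrt h)..pi * sqrt h} (\<lambda>s. (amode m n h s)\<^sup>2)\<bar> \<le> K1 / h ^ (n + 1)"
    using mode_expansion [OF T'(1), of m n] by metis
  obtain K2 where K2: "K2 \<ge> 0" "\<And>h. h \<ge> 1 \<Longrightarrow> \<bar>integral {- (pi * sqrt h)..pi * sqrt h} (\<lambda>s. (amode m n h s)\<^sup>2)
     - fact m * sqrt (2 * pi) * (\<Sum>s\<le>n. coeff_eta m s / h ^ s)\<bar> \<le> K2 / h ^ (n + 1)"
    using amode_norm [of m n] by blast
  define g :: real where "g = fact m * sqrt (2 * pi)"
  have g: "g > 0" by (simp add: g_def)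
  define K where "K = K1\<^sup>2 + (K1 ^ 3 + K2) / g"
  \<comment> \<open>The squared entry yields \<open>wide\<close>; the last one makes K1/h smaller
    than d/K1, so that positivity of f at T1 excludes a negative \<kappa>.\<close>
  define h0 where "h0 = max (max h1 h2) (max ((2 * turn m + 4)\<^sup>2) (2 * K1\<^sup>2 / d + 1))"
  have K0: "K \<ge> 0" using K1 K2(1) g by (simp add: K_def)
  have "h1 \<ge> 1" using T1(4) zero_le_power2 [of T1] by linarith
  then have "h0 \<ge> 1" by (simp add: h0_def)
  moreover have "\<exists>c>0. (\<forall>s. \<bar>s\<bar> \<le> T \<longrightarrow> \<bar>w (pi / 2 - s / (2 * sqrt h)) - c * amode m n h s\<bar> \<le> c * (K / h ^ (n + 1))) \<and>
      \<bar>pi * sqrt h / (c\<^sup>2 * g) - (\<Sum>s\<le>n. coeff_eta m s / h ^ s)\<bar> \<le> K / h ^ (n + 1)"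
    if hh: "h \<ge> h0" and w: "normalized_eigenfunction m h lam w" for h lam w
  proof -
    let ?b = "pi * sqrt h" and ?k = "2 * sqrt h"
    have h: "h \<ge> h1" "h \<ge> h2" "(2 * turn m + 4)\<^sup>2 \<le> h" "2 * K1\<^sup>2 / d < h" "h \<ge> 1"
      using hh \<open>h0 \<ge> 1\<close> by (auto simp: h0_def)
    have hp: "h > 0" using h by simp
    have sq: "sqrt h \<le> ?b" using pi_gt3 hp by simp
    have "2 * turn m + 4 \<le> sqrt h" by (rule real_le_rsqrt [OF h(3)])
    then have wide: "2 * turn m + 4 \<le> ?b" using sq by linarith
    have "T1\<^sup>2 < h" using T1(4) h(1) by linarith
    then have "T1 < sqrt h" by (rule real_less_rsqrt)
    then have T1b: "T1 < ?b" using sq by linarith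
    have sol: "mathieu_solution h lam w" using w by (simp add: normalized_eigenfunction_def)
    obtain N where N: "N > 0" and mode: "mathieu_mode m h ((lam + 2 * h\<^sup>2) / (4 * h))
        (\<lambda>s. w (pi / 2 - s / ?k) / N) (\<lambda>s. - deriv w (pi / 2 - s / ?k) / ?k / N)"
      using eigenfunction_mode [of h lam w m] w h(5) wide unfolding normalized_eigenfunction_def by blast
    obtain \<kappa> where \<kappa>: "1 / K1 \<le> \<bar>\<kappa>\<bar>" "\<bar>\<kappa>\<bar> \<le> K1"
        "\<And>s. \<bar>s\<bar> \<le> T' \<Longrightarrow> \<bar>w (pi / 2 - s / ?k) / N - \<kappa> * amode m n h s\<bar> \<le> K1 / h ^ (n + 1)"
        "\<bar>integral {- ?b..?b} (\<lambda>s. (w (pi / 2 - s / ?k) / N)\<^sup>2)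
        - \<kappa>\<^sup>2 * integral {- ?b..?b} (\<lambda>s. (amode m n h s)\<^sup>2)\<bar> \<le> K1 / h ^ (n + 1)"
      using exp [OF mode h(2)] by blast
    obtain \<delta> where \<delta>: "\<delta> > 0" "\<And>z. 0 < z \<Longrightarrow> z < \<delta> \<Longrightarrow> w z > 0"
      using w unfolding normalized_eigenfunction_def by blast
    have fT: "w (pi / 2 - T1 / ?k) / N > 0"
    proof (rule mathieu_mode.tail_pos [OF mode T1(2) T1b, where \<delta> = "?k * \<delta>"])
      show "?k * \<delta> > 0" using hp \<delta> by simp
      fix s assume s: "?b - ?k * \<delta> < s" "s < ?b"
      have z: "pi / 2 - s / ?k = (?b - s) / ?k" using hp by (simp add: field_simps)
      have "0 < (?b - s) / ?k" "(?b - s) / ?k < \<delta>"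
        using s hp by (simp_all add: pos_divide_less_eq mult.commute)
      then show "w (pi / 2 - s / ?k) / N > 0" unfolding z using \<delta>(2) N by simp
    qed
    have hn: "1 / h ^ (n + 1) \<le> 1 / h"
      using h(5) power_increasing [of 1 "n + 1" h] by (simp add: frac_le)
    have \<kappa>pos: "\<kappa> > 0"
    proof (rule ccontr)
      assume "\<not> \<kappa> > 0"
      then have "\<kappa> \<le> - (1 / K1)" using \<kappa>(1) by linarith
      then have "\<kappa> * amode m n h T1 \<le> - (1 / K1) * d"
        using T1(3) T1(5) [OF h(1)] K1 by (smt (verit) mult_left_mono mult_minus_left mult_right_mono zero_less_divide_1_iff)
      moreover have "w (pi / 2 - T1 / ?k) / N - \<kappa> * amode m n h T1 \<le> K1 / h ^ (n + 1)"
        using \<kappa>(3) [of T1] T1(1) T'(3) by (simp add: abs_le_iff)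
      moreover have "K1 / h ^ (n + 1) \<le> K1 / h"
        using mult_left_mono [OF hn, of K1] K1 by simp
      ultimately have "d / K1 < K1 / h" using fT by simp
      then have "h * d < K1 * K1" using K1 hp by (simp add: field_simps)
      moreover have "2 * K1\<^sup>2 < h * d" using h(4) T1(3) by (simp add: pos_divide_less_eq)
      ultimately show False using zero_le_power2 [of K1] unfolding power2_eq_square by linarith
    qed
    define c where "c = N * \<kappa>"
    have c: "c > 0" using N \<kappa>pos by (simp add: c_def)
    have inv: "1 / \<kappa> \<le> K1" using \<kappa>(1) \<kappa>pos K1 by (simp add: field_simps)
    have "\<bar>w (pi / 2 - s / ?k) - c * amode m n h s\<bar> \<le> c * (K / h ^ (n + 1))" if s: "\<bar>s\<bar> \<le> T" for s
    proof -
      have "w (pi / 2 - s / ?k) - c * amode m n h s = N * (w (pi / 2 - s / ?k) / N - \<kappa> * amode m n h s)"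
        using N by (simp add: c_def right_diff_distrib)
      then have "\<bar>w (pi / 2 - s / ?k) - c * amode m n h s\<bar> = N * \<bar>w (pi / 2 - s / ?k) / N - \<kappa> * amode m n h s\<bar>"
        using N by (simp only: abs_mult abs_of_pos)
      also have "\<dots> \<le> N * (K1 / h ^ (n + 1))"
        using s T'(2) N by (intro mult_left_mono \<kappa>(3)) auto
      also have "\<dots> = c * ((1 / \<kappa>) * (K1 / h ^ (n + 1)))" using \<kappa>pos by (simp add: c_def)
      also have "\<dots> \<le> c * (K1 * (K1 / h ^ (n + 1)))"
        using inv c K1 hp by (intro mult_left_mono mult_right_mono) auto
      also have "\<dots> \<le> c * (K / h ^ (n + 1))"
      proof -
        have "K1 * K1 \<le> K" using K1 K2(1) g by (simp add: K_def power2_eq_square)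
        then have "K1 * K1 / h ^ (n + 1) \<le> K / h ^ (n + 1)" using hp by (intro divide_right_mono) auto
        then have "c * (K1 * K1 / h ^ (n + 1)) \<le> c * (K / h ^ (n + 1))" using c by (intro mult_left_mono) auto
        then show ?thesis by (simp only: times_divide_eq_right)
      qed
      finally show ?thesis .
    qed
    moreover have "\<bar>pi * sqrt h / (c\<^sup>2 * g) - (\<Sum>s\<le>n. coeff_eta m s / h ^ s)\<bar> \<le> K / h ^ (n + 1)"
    proof -
      define I where "I = integral {- ?b..?b} (\<lambda>s. (amode m n h s)\<^sup>2)"
      define S where "S = (\<Sum>s\<le>n. coeff_eta m s / h ^ s)"
      define y where "y = 1 / h ^ (n + 1)"
      have y: "y \<ge> 0" using hp by (simp add: y_def)
      have cw: "continuous_on UNIV w" by (rule continuous_on_DERIV [OF mathieu_solution_DERIV(1) [OF sol]])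
      have "integral {0..pi} (\<lambda>z. (w z)\<^sup>2) = pi / 2" using w by (simp only: normalized_eigenfunction_def)
      then have "integral {- ?b..?b} (\<lambda>s. (w (pi / 2 - s / ?k) / N)\<^sup>2) = ?b / N\<^sup>2"
        by (simp only: mode_integral [OF hp cw]) simp
      then have 1: "\<bar>?b / N\<^sup>2 - \<kappa>\<^sup>2 * I\<bar> \<le> K1 * y"
        using \<kappa>(4) by (simp add: I_def y_def)
      have 2: "\<bar>I - g * S\<bar> \<le> K2 * y" using K2(2) [OF h(5)] by (simp add: I_def S_def y_def g_def)
      have "?b / c\<^sup>2 - I = (1 / \<kappa>)\<^sup>2 * (?b / N\<^sup>2 - \<kappa>\<^sup>2 * I)"
        using \<kappa>pos N by (simp add: c_def field_simps)
      then have "\<bar>?b / c\<^sup>2 - I\<bar> = (1 / \<kappa>)\<^sup>2 * \<bar>?b / N\<^sup>2 - \<kappa>\<^sup>2 * I\<bar>"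
        by (simp only: abs_mult abs_power2)
      also have "\<dots> \<le> K1\<^sup>2 * (K1 * y)"
        using inv \<kappa>pos 1 K1 y by (intro mult_mono power_mono) auto
      also have "\<dots> = K1 ^ 3 * y" by (simp add: power2_eq_square power3_eq_cube)
      finally have "\<bar>?b / c\<^sup>2 - g * S\<bar> \<le> K1 ^ 3 * y + K2 * y" using 2 by linarith
      then have "\<bar>?b / c\<^sup>2 - g * S\<bar> / g \<le> (K1 ^ 3 * y + K2 * y) / g"
        using g by (intro divide_right_mono) auto
      moreover have "?b / (c\<^sup>2 * g) - S = (?b / c\<^sup>2 - g * S) / g" using g by (simp add: diff_divide_distrib)
      then have "\<bar>?b / (c\<^sup>2 * g) - S\<bar> = \<bar>?b / c\<^sup>2 - g * S\<bar> / g" using g by (simp only: abs_divide abs_of_pos)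
      moreover have "(K1 ^ 3 * y + K2 * y) / g \<le> K * y"
      proof -
        have "(K1 ^ 3 * y + K2 * y) / g = (K1 ^ 3 + K2) / g * y" by (simp add: distrib_right)
        also have "\<dots> \<le> K * y" using y by (intro mult_right_mono) (simp add: K_def)
        finally show ?thesis .
      qed
      ultimately show ?thesis by (simp add: S_def y_def)
    qed
    ultimately show ?thesis using c by blast
  qed
  ultimately show ?thesis using K0 unfolding g_def by blast
qed

section \<open>The normalising constant\<close>

lemma geometric_tail_bound:
  assumes "(h::real) \<ge> 2"
  shows "(\<Sum>j<L. 1 / h ^ (N + j)) \<le> 2 / h ^ N"
proof -
  have "(\<Sum>j<L. 1 / h ^ (N + j)) \<le> 2 / h ^ N - 2 / h ^ (N + L)"
  proof (induction L)
    case (Suc L)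
    have "2 / h ^ (N + Suc L) \<le> 1 / h ^ (N + L)" using assms by (simp add: field_simps)
    with Suc show ?case by simp
  qed simp
  also have "\<dots> \<le> 2 / h ^ N" using assms by simp
  finally show ?thesis .
qed

text \<open>The term of index s is switched on only for h \<ge> M s. As M s \<ge> |b s| it is then
  at most h^(1-s); M s > s keeps the sum finite, and h \<ge> 2 makes the tail geometric.\<close>

lemma borel_ritt:
  fixes b :: "nat \<Rightarrow> real"
  shows "\<exists>\<beta>. \<forall>N. \<exists>K h0. \<forall>h\<ge>h0. \<bar>\<beta> h - (\<Sum>s\<le>N. b s / h ^ s)\<bar> \<le> K / h ^ (N + 1)"
proof -
  define M where "M s = (\<Sum>i\<le>s. \<bar>b i\<bar>) + real s + 2" for s
  define \<beta> where "\<beta> h = (\<Sum>s | M s \<le> h. b s / h ^ s)" for h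
  have Mb: "\<bar>b s\<bar> \<le> M s" for s
    unfolding M_def using member_le_sum [of s "{..s}" "\<lambda>i. \<bar>b i\<bar>"] by simp
  have Ms: "real s < M s" for s
  proof -
    have "0 \<le> (\<Sum>i\<le>s. \<bar>b i\<bar>)" by (intro sum_nonneg) auto
    then show ?thesis unfolding M_def by linarith
  qed
  have mono: "M s \<le> M s'" if "s \<le> s'" for s s'
    unfolding M_def using that by (intro add_mono sum_mono2) auto
  have "\<bar>\<beta> h - (\<Sum>s\<le>N. b s / h ^ s)\<bar> \<le> (2 + \<bar>b (N + 1)\<bar>) / h ^ (N + 1)" if h: "h \<ge> M (N + 1)" for h N
  proof -
    define S where "S = {s. M s \<le> h}"
    define L where "L = nat \<lceil>h\<rceil> + 1"
    have "0 \<le> (\<Sum>i\<le>N + 1. \<bar>b i\<bar>)" by (intro sum_nonneg) auto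
    then have "2 \<le> M (N + 1)" unfolding M_def by linarith
    then have h2: "h \<ge> 2" using h by linarith
    have SL: "S \<subseteq> {..<L}"
    proof
      fix s assume "s \<in> S"
      then have "real s < h" using Ms [of s] by (simp add: S_def)
      then show "s \<in> {..<L}" unfolding L_def lessThan_iff by linarith
    qed
    then have fin: "finite S" by (rule finite_subset) simp
    have low: "{..N + 1} \<subseteq> S" using h mono by (fastforce simp: S_def)
    \<comment> \<open>The term of index N + 1 is split off, since the cut-off bounds it only by
      h^(-N); from N + 2 on the bound h^(1-s) suffices.\<close>
    let ?R = "\<Sum>s\<in>S - {..N + 1}. b s / h ^ s"
    have "\<bar>?R\<bar> \<le> (\<Sum>s\<in>S - {..N + 1}. 1 / h ^ (s - 1))"
    proof (rule order_trans [OF sum_abs], rule sum_mono)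
      fix s assume s: "s \<in> S - {..N + 1}"
      then have "\<bar>b s\<bar> \<le> h" using Mb [of s] by (simp add: S_def)
      moreover have "h ^ s = h * h ^ (s - 1)" using s by (simp add: power_eq_if)
      ultimately show "\<bar>b s / h ^ s\<bar> \<le> 1 / h ^ (s - 1)" using h2 by (simp add: abs_mult divide_simps)
    qed
    also have "\<dots> \<le> (\<Sum>s\<in>(\<lambda>j. N + 2 + j) ` {..<L}. 1 / h ^ (s - 1))"
    proof (rule sum_mono2)
      show "S - {..N + 1} \<subseteq> (\<lambda>j. N + 2 + j) ` {..<L}"
      proof
        fix s assume "s \<in> S - {..N + 1}"
        then have "s - (N + 2) \<in> {..<L}" "s = N + 2 + (s - (N + 2))" using SL by auto
        then show "s \<in> (\<lambda>j. N + 2 + j) ` {..<L}" by blast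
      qed
    qed (use h2 in auto)
    also have "\<dots> = (\<Sum>j<L. 1 / h ^ (N + 1 + j))"
      by (subst sum.reindex) (auto simp: inj_on_def)
    also have "\<dots> \<le> 2 / h ^ (N + 1)" by (rule geometric_tail_bound [OF h2])
    finally have R: "\<bar>?R\<bar> \<le> 2 / h ^ (N + 1)" .
    have "\<beta> h = ?R + (\<Sum>s\<le>N + 1. b s / h ^ s)"
      unfolding \<beta>_def S_def [symmetric] by (rule sum.subset_diff [OF low fin])
    then have "\<beta> h - (\<Sum>s\<le>N. b s / h ^ s) = ?R + b (N + 1) / h ^ (N + 1)" by simp
    moreover have "\<bar>b (N + 1) / h ^ (N + 1)\<bar> = \<bar>b (N + 1)\<bar> / h ^ (N + 1)" using h2 by simp
    moreover have "(2 + \<bar>b (N + 1)\<bar>) / h ^ (N + 1) = 2 / h ^ (N + 1) + \<bar>b (N + 1)\<bar> / h ^ (N + 1)"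
      by (rule add_divide_distrib)
    ultimately show ?thesis using R by linarith
  qed
  then show ?thesis by blast
qed

text \<open>One function that represents the asymptotic series to every order: the constants in the
  theorem must not depend on the order n of the expansion.\<close>

definition eta_sum :: "nat \<Rightarrow> real \<Rightarrow> real" where
  "eta_sum m = (SOME \<beta>. \<forall>N. \<exists>K h0. \<forall>h\<ge>h0. \<bar>\<beta> h - (\<Sum>s\<le>N. coeff_eta m s / h ^ s)\<bar> \<le> K / h ^ (N + 1))"

definition norm_const :: "nat \<Rightarrow> real \<Rightarrow> real" where
  "norm_const m h = (pi * h / (2 * (fact m)\<^sup>2)) powr (1/4) * eta_sum m h powr (- 1/2)"

lemma eta_sum_expansion:
  "\<exists>K h0. \<forall>h\<ge>h0. \<bar>eta_sum m h - (\<Sum>s\<le>N. coeff_eta m s / h ^ s)\<bar> \<le> K / h ^ (N + 1)"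
  using someI_ex [OF borel_ritt [of "coeff_eta m"]] unfolding eta_sum_def [symmetric] by (rule spec)

text \<open>Positivity is needed because the exponent -1/2 is applied through
  \<open>powr\<close>.\<close>

lemma eta_sum_ge_half: "\<exists>h0. \<forall>h\<ge>h0. 1/2 \<le> eta_sum m h"
proof -
  obtain K h0 where K: "\<And>h. h \<ge> h0 \<Longrightarrow> \<bar>eta_sum m h - 1\<bar> \<le> K / h"
    using eta_sum_expansion [of m 0] by (auto simp: coeff_eta_0)
  have "1/2 \<le> eta_sum m h" if h: "h \<ge> max h0 (max 1 (2 * K))" for h
  proof -
    have "K / h \<le> 1/2" using h by (simp add: pos_divide_le_eq)
    then show ?thesis using K [of h] h by linarith
  qed
  then show ?thesis by blast
qed

text \<open>E is taken to be the exact remainder of the cut-off series, so the formula is an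
  identity for every h and only the size of E is asymptotic.\<close>

lemma constant_expansion_norm_const: "constant_expansion m (norm_const m)"
  unfolding constant_expansion_def
proof
  fix N
  define E where "E h = eta_sum m h - (\<Sum>s\<le>N. coeff_eta m s / h ^ s)" for h
  obtain K h0 where K: "\<And>h. h \<ge> h0 \<Longrightarrow> \<bar>E h\<bar> \<le> K / h ^ (N + 1)"
    using eta_sum_expansion [of m N] unfolding E_def by blast
  have E: "E \<in> O[at_top](\<lambda>h. 1 / h ^ (N + 1))"
  proof (rule bigoI [where c = K])
    show "\<forall>\<^sub>F h in at_top. norm (E h) \<le> K * norm (1 / h ^ (N + 1))"
      using eventually_ge_at_top [of h0] eventually_ge_at_top [of 1]
    proof eventually_elim
      case (elim h)
      then show ?case using K [of h] by simp
    qed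
  qed
  have "1 + (\<Sum>s=1..N. coeff_eta m s / h ^ s) + E h = eta_sum m h" for h
  proof -
    have "(\<Sum>s\<le>N. coeff_eta m s / h ^ s) = 1 + (\<Sum>s=1..N. coeff_eta m s / h ^ s)"
      by (simp only: atMost_atLeast0 sum.atLeast_Suc_atMost [OF le0]) (simp add: coeff_eta_0)
    then show ?thesis by (simp add: E_def)
  qed
  then show "\<exists>E\<in>O[at_top](\<lambda>h. 1 / h ^ (N + 1)). \<forall>\<^sub>F h in at_top.
      norm_const m h = (pi * h / (2 * (fact m)\<^sup>2)) powr (1/4) * (1 + (\<Sum>s=1..N. coeff_eta m s / h ^ s) + E h) powr (- 1/2)"
    by (intro bexI [OF _ E] always_eventually allI) (simp only: norm_const_def)
qed

lemma norm_const_square: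
  assumes h: "h > 0" and e: "eta_sum m h > 0"
  shows "norm_const m h > 0" "pi * sqrt h / ((norm_const m h)\<^sup>2 * (fact m * sqrt (2 * pi))) = eta_sum m h"
proof -
  let ?x = "pi * h / (2 * (fact m)\<^sup>2)" and ?e = "eta_sum m h"
  have x: "?x > 0" using h by simp
  show "norm_const m h > 0" using x e by (metis mult_pos_pos norm_const_def powr_gt_zero less_irrefl)
  have "(?x powr (1/4))\<^sup>2 = sqrt ?x"
    using x by (simp add: power2_eq_square powr_half_sqrt [symmetric] flip: powr_add)
  moreover have "(?e powr (- 1/2))\<^sup>2 = 1 / ?e"
    using e by (simp add: power2_eq_square powr_minus_divide flip: powr_add)
  ultimately have sq: "(norm_const m h)\<^sup>2 = sqrt ?x / ?e" by (simp add: norm_const_def power_mult_distrib)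
  have "sqrt ?x * (fact m * sqrt (2 * pi)) = pi * sqrt h"
  proof -
    have f: "sqrt ((fact m)\<^sup>2) = (fact m :: real)" by simp
    have "sqrt ?x * (fact m * sqrt (2 * pi)) = sqrt (?x * ((fact m)\<^sup>2 * (2 * pi)))"
      by (simp only: real_sqrt_mult [of ?x] real_sqrt_mult [of "(fact m)\<^sup>2"] f)
    also have "?x * ((fact m)\<^sup>2 * (2 * pi)) = pi\<^sup>2 * h" by (simp add: power2_eq_square)
    also have "sqrt (pi\<^sup>2 * h) = pi * sqrt h" by (simp add: real_sqrt_mult)
    finally show ?thesis .
  qed
  then have "sqrt ?x / ?e * (fact m * sqrt (2 * pi)) = pi * sqrt h / ?e"
    by (simp only: times_divide_eq_left)
  moreover have "pi * sqrt h / (pi * sqrt h / ?e) = ?e" using h e by simp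
  ultimately show "pi * sqrt h / ((norm_const m h)\<^sup>2 * (fact m * sqrt (2 * pi))) = ?e"
    unfolding sq by (simp only:)
qed

lemma amode_bounded: "\<exists>K\<ge>0. \<forall>h s. h \<ge> 1 \<longrightarrow> \<bar>amode m n h s\<bar> \<le> K"
proof -
  obtain K where K: "K \<ge> 0" "\<And>h t. h \<ge> 1 \<Longrightarrow> \<bar>approx m n (1 / h) t\<bar> \<le> K"
    using approx_decay [of m n 0] by auto
  then show ?thesis unfolding amode_def by blast
qed

text \<open>The square of the n-dependent factor c and that of \<open>norm_const\<close> belong to
  the same series up to order n, so their quotient is 1 + O(h^(-n-1)). Exchanging them costs no more
  than the error already present.\<close>

lemma eigenfunction_expansion:
  assumes "T \<ge> 0"
  shows "\<exists>K h0. K \<ge> 0 \<and> (\<forall>h lam w s. h \<ge> h0 \<longrightarrow> normalized_eigenfunction m h lam w \<longrightarrow> \<bar>s\<bar> \<le> T \<longrightarrow>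
    norm_const m h > 0 \<and>
    \<bar>w (pi / 2 - s / (2 * sqrt h)) - norm_const m h * amode m n h s\<bar> \<le> norm_const m h * (K / h ^ (n + 1)))"
proof -
  obtain K1 h1 where *: "K1 \<ge> 0 \<and> h1 \<ge> 1 \<and> (\<forall>h lam w. h \<ge> h1 \<longrightarrow> normalized_eigenfunction m h lam w \<longrightarrow>
    (\<exists>c>0. (\<forall>s. \<bar>s\<bar> \<le> T \<longrightarrow> \<bar>w (pi / 2 - s / (2 * sqrt h)) - c * amode m n h s\<bar> \<le> c * (K1 / h ^ (n + 1))) \<and>
      \<bar>pi * sqrt h / (c\<^sup>2 * (fact m * sqrt (2 * pi))) - (\<Sum>s\<le>n. coeff_eta m s / h ^ s)\<bar> \<le> K1 / h ^ (n + 1)))"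
    using normalized_expansion [OF assms, of m n] by (elim exE)
  note K1 = conjunct1 [OF *] conjunct1 [OF conjunct2 [OF *]]
  note exp = * [THEN conjunct2, THEN conjunct2, rule_format]
  obtain K2 h2 where K2: "\<And>h. h \<ge> h2 \<Longrightarrow> \<bar>eta_sum m h - (\<Sum>s\<le>n. coeff_eta m s / h ^ s)\<bar> \<le> K2 / h ^ (n + 1)"
    using eta_sum_expansion [of m n] by blast
  obtain h3 where h3: "\<And>h. h \<ge> h3 \<Longrightarrow> 1/2 \<le> eta_sum m h" using eta_sum_ge_half by blast
  obtain K3 where K3: "K3 \<ge> 0" "\<And>h s. h \<ge> 1 \<Longrightarrow> \<bar>amode m n h s\<bar> \<le> K3"
    using amode_bounded [of m n] by blast
  define L where "L = 2 * (K1 + \<bar>K2\<bar>)"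
  have L0: "L \<ge> 0" using K1 by (simp add: L_def)
  define K where "K = 2 * (K1 + L * K3)"
  define h0 where "h0 = max (max h1 h2) (max h3 (2 * L))"
  have "norm_const m h > 0 \<and>
      \<bar>w (pi / 2 - s / (2 * sqrt h)) - norm_const m h * amode m n h s\<bar> \<le> norm_const m h * (K / h ^ (n + 1))"
    if hh: "h \<ge> h0" and w: "normalized_eigenfunction m h lam w" and s: "\<bar>s\<bar> \<le> T" for h lam w s
  proof -
    have h: "h \<ge> h1" "h \<ge> h2" "h \<ge> h3" "2 * L \<le> h" "h \<ge> 1" using hh K1(2) by (auto simp: h0_def)
    then have hp: "h > 0" by simp
    define C where "C = norm_const m h"
    define g :: real where "g = fact m * sqrt (2 * pi)"
    define y where "y = 1 / h ^ (n + 1)"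
    have y: "y \<ge> 0" using hp by (simp add: y_def)
    have e: "1/2 \<le> eta_sum m h" by (rule h3 [OF h(3)])
    have C: "C > 0" "pi * sqrt h / (C\<^sup>2 * g) = eta_sum m h"
      using norm_const_square [OF hp, of m] e by (simp_all add: C_def g_def)
    obtain c where c: "c > 0" "\<bar>w (pi / 2 - s / (2 * sqrt h)) - c * amode m n h s\<bar> \<le> c * (K1 * y)"
        "\<bar>pi * sqrt h / (c\<^sup>2 * g) - (\<Sum>s\<le>n. coeff_eta m s / h ^ s)\<bar> \<le> K1 * y"
    proof -
      obtain c where c: "c > 0 \<and> (\<forall>s. \<bar>s\<bar> \<le> T \<longrightarrow> \<bar>w (pi / 2 - s / (2 * sqrt h)) - c * amode m n h s\<bar> \<le> c * (K1 / h ^ (n + 1))) \<and>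
          \<bar>pi * sqrt h / (c\<^sup>2 * g) - (\<Sum>s\<le>n. coeff_eta m s / h ^ s)\<bar> \<le> K1 / h ^ (n + 1)"
        using exp [OF h(1) w] unfolding g_def by (rule exE)
      have y1: "K1 * y = K1 / h ^ (n + 1)" by (simp add: y_def)
      show ?thesis
      proof (rule that [of c])
        show "c > 0" by (rule conjunct1 [OF c])
        show "\<bar>w (pi / 2 - s / (2 * sqrt h)) - c * amode m n h s\<bar> \<le> c * (K1 * y)"
          unfolding y1 using conjunct1 [OF conjunct2 [OF c]] s by blast
        show "\<bar>pi * sqrt h / (c\<^sup>2 * g) - (\<Sum>s\<le>n. coeff_eta m s / h ^ s)\<bar> \<le> K1 * y"
          unfolding y1 by (rule conjunct2 [OF conjunct2 [OF c]])
      qed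
    qed
    \<comment> \<open>The normalisation gives \<open>eta_sum m h\<close> times |x^2 - 1| as
      O(h^(-n-1)). With \<open>eta_sum m h\<close> \<ge> 1/2 and x > 0 this bounds |x - 1|.\<close>
    define x where "x = C / c"
    have x: "x > 0" using C c by (simp add: x_def)
    have g0: "g > 0" by (simp add: g_def)
    have "pi * sqrt h / (c\<^sup>2 * g) = eta_sum m h * x\<^sup>2"
      unfolding C(2) [symmetric] x_def using C(1) c(1) g0 by (simp add: field_simps)
    moreover have "\<bar>eta_sum m h - (\<Sum>s\<le>n. coeff_eta m s / h ^ s)\<bar> \<le> K2 * y"
      using K2 [OF h(2)] by (simp add: y_def)
    ultimately have "\<bar>eta_sum m h * x\<^sup>2 - eta_sum m h\<bar> \<le> K1 * y + K2 * y"
      using c(3) by linarith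
    also have "K1 * y + K2 * y \<le> K1 * y + \<bar>K2\<bar> * y" using y by (intro add_left_mono mult_right_mono) auto
    also have "\<dots> = L * y / 2" by (simp add: L_def distrib_right)
    finally have le: "\<bar>eta_sum m h * x\<^sup>2 - eta_sum m h\<bar> \<le> L * y / 2" .
    have "eta_sum m h * \<bar>x\<^sup>2 - 1\<bar> \<le> L * y / 2"
    proof -
      have "eta_sum m h * x\<^sup>2 - eta_sum m h = eta_sum m h * (x\<^sup>2 - 1)" by (simp add: right_diff_distrib)
      then have "\<bar>eta_sum m h * x\<^sup>2 - eta_sum m h\<bar> = eta_sum m h * \<bar>x\<^sup>2 - 1\<bar>" using e by (simp add: abs_mult)
      with le show ?thesis by (simp only:)
    qed
    moreover have "1/2 * \<bar>x\<^sup>2 - 1\<bar> \<le> eta_sum m h * \<bar>x\<^sup>2 - 1\<bar>" using e by (intro mult_right_mono) auto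
    ultimately have "1/2 * \<bar>x\<^sup>2 - 1\<bar> \<le> L * y / 2" by (rule order_trans [rotated])
    then have x2: "\<bar>x\<^sup>2 - 1\<bar> \<le> L * y" by simp
    have "x\<^sup>2 - 1 = (x - 1) * (x + 1)" by (simp add: power2_eq_square algebra_simps)
    then have "\<bar>x\<^sup>2 - 1\<bar> = \<bar>x - 1\<bar> * (x + 1)" using x by (simp add: abs_mult)
    moreover have "\<bar>x - 1\<bar> * 1 \<le> \<bar>x - 1\<bar> * (x + 1)" using x by (intro mult_left_mono) auto
    ultimately have "\<bar>x - 1\<bar> * 1 \<le> L * y" using x2 by (simp only:)
    then have x1: "\<bar>x - 1\<bar> \<le> L * y" by simp
    have "y \<le> 1 / h" using h(5) power_increasing [of 1 "n + 1" h] by (simp add: y_def frac_le)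
    then have "L * y \<le> L * (1 / h)" using L0 by (rule mult_left_mono)
    also have "\<dots> \<le> 1/2" using h(4) hp by (simp add: pos_divide_le_eq)
    finally have "1/2 \<le> x" using x1 by linarith
    then have cC: "c \<le> 2 * C" using c by (simp add: x_def field_simps)
    have "\<bar>w (pi / 2 - s / (2 * sqrt h)) - C * amode m n h s\<bar>
        \<le> \<bar>w (pi / 2 - s / (2 * sqrt h)) - c * amode m n h s\<bar> + \<bar>c * (x - 1) * amode m n h s\<bar>"
    proof -
      have "C = c * x" using c by (simp add: x_def)
      then have "w (pi / 2 - s / (2 * sqrt h)) - C * amode m n h s
          = w (pi / 2 - s / (2 * sqrt h)) - c * amode m n h s - c * (x - 1) * amode m n h s"
        by (simp add: algebra_simps)
      then show ?thesis by linarith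
    qed
    also have "\<dots> \<le> c * (K1 * y) + c * (L * y) * K3"
    proof -
      have "\<bar>c * (x - 1) * amode m n h s\<bar> = c * \<bar>x - 1\<bar> * \<bar>amode m n h s\<bar>"
        using c(1) by (simp only: abs_mult abs_of_pos)
      also have "\<dots> \<le> c * (L * y) * K3"
        using c(1) x1 K3(2) [OF h(5), of s] L0 y by (intro mult_mono mult_nonneg_nonneg) auto
      finally show ?thesis using c(2) by linarith
    qed
    also have "\<dots> = c * ((K1 + L * K3) * y)" by (simp add: algebra_simps)
    also have "\<dots> \<le> (2 * C) * ((K1 + L * K3) * y)"
      using cC K1 L0 K3(1) y by (intro mult_right_mono) auto
    also have "\<dots> = C * (K / h ^ (n + 1))" by (simp add: K_def y_def)
    finally show ?thesis using C(1) by (simp add: C_def)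
  qed
  moreover have "K \<ge> 0" using K1 L0 K3(1) by (simp add: K_def)
  ultimately show ?thesis by blast
qed

section \<open>Signs near the left end point\<close>

lemma pos_near_of_pos:
  fixes w :: "real \<Rightarrow> real"
  assumes "isCont w 0" "w 0 > 0"
  shows "\<exists>\<delta>>0. \<forall>z. 0 < z \<longrightarrow> z < \<delta> \<longrightarrow> w z > 0"
proof -
  have "\<forall>\<^sub>F z in at 0. 0 < w z"
    by (rule order_tendstoD(1) [OF assms(1) [unfolded isCont_def] assms(2)])
  then obtain \<delta> where \<delta>: "\<delta> > 0" "\<forall>z\<in>UNIV. z \<noteq> 0 \<and> dist z 0 < \<delta> \<longrightarrow> 0 < w z"
    unfolding eventually_at by blast
  have "0 < w z" if "0 < z" "z < \<delta>" for z
    by (rule mp [OF bspec [OF \<delta>(2) UNIV_I]]) (use that in \<open>simp add: dist_real_def\<close>)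
  then show ?thesis using \<delta>(1) by blast
qed

lemma mathieu_potential_bound:
  fixes h z lam :: real
  shows "\<bar>2 * h\<^sup>2 * cos (2 * z) - lam\<bar> \<le> 2 * h\<^sup>2 + \<bar>lam\<bar>"
proof -
  have "2 * h\<^sup>2 * \<bar>cos (2 * z)\<bar> \<le> 2 * h\<^sup>2 * 1" by (intro mult_left_mono) auto
  then have "\<bar>2 * h\<^sup>2 * cos (2 * z)\<bar> \<le> 2 * h\<^sup>2" by (simp add: abs_mult)
  then show ?thesis by linarith
qed

lemma mathieu_unique:
  assumes sol: "mathieu_solution h lam w" and nz: "\<exists>z. w z \<noteq> 0"
  shows "w z \<noteq> 0 \<or> deriv w z \<noteq> 0"
proof (rule ccontr)
  assume "\<not> (w z \<noteq> 0 \<or> deriv w z \<noteq> 0)"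
  then have z: "w z = 0" "deriv w z = 0" by auto
  have "w x = 0" for x
    by (rule solution_unique [where f = w and V = "\<lambda>z. 2 * h\<^sup>2 * cos (2 * z) - lam",
          OF mathieu_solution_DERIV [OF sol] mathieu_potential_bound z])
  with nz show False by simp
qed

text \<open>The value at z = 0 cannot vanish because the derivative there already does; continuity
  in h then carries the sign over from h = 0.\<close>

lemma ce_pos_near_0:
  assumes ce: "is_ce m ce" and h: "h \<ge> 0"
  shows "\<exists>\<delta>>0. \<forall>z. 0 < z \<longrightarrow> z < \<delta> \<longrightarrow> ce h z > 0"
proof -
  note ce' = ce [unfolded is_ce_def]
  note ef = spec [OF conjunct1 [OF ce']]
  have nz: "ce h' 0 \<noteq> 0" for h'
  proof -
    obtain lam where "ce_eigenfunction m h' lam (ce h')" using ef [of h'] by (rule exE)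
    then have "mathieu_solution h' lam (ce h')" "\<exists>z. ce h' z \<noteq> 0" "deriv (ce h') 0 = 0"
      by (simp_all only: ce_eigenfunction_def)
    then show ?thesis using mathieu_unique [of h' lam "ce h'" 0] by simp
  qed
  have "continuous_on {0..h} (\<lambda>h. ce h 0)"
    by (rule continuous_on_subset [OF spec [OF conjunct1 [OF conjunct2 [OF conjunct2 [OF ce']]]] subset_UNIV])
  then have "ce 0 0 * ce h 0 > 0"
    by (rule nonzero_imp_same_sign [where f = "\<lambda>h. ce h 0" and a = 0 and b = h]) (use nz h in auto)
  moreover have "ce 0 0 > 0"
    by (subst spec [OF conjunct2 [OF conjunct2 [OF conjunct2 [OF ce']]]]) simp
  ultimately have "ce h 0 > 0" by (simp add: zero_less_mult_iff)
  moreover obtain lam where "ce_eigenfunction m h lam (ce h)" using ef [of h] by (rule exE)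
  then have "mathieu_solution h lam (ce h)" by (simp only: ce_eigenfunction_def)
  then have "isCont (ce h) 0"
    by (rule DERIV_isCont [OF mathieu_solution_DERIV(1)])
  ultimately show ?thesis by (intro pos_near_of_pos)
qed

text \<open>Comparison with sin(B z): since V \<ge> -B^2 and w \<ge> 0, the Wronskian is
  nondecreasing, so w' is nonnegative at the first zero \<zeta>. It is nonzero, hence positive, and
  w would be negative just before \<zeta>.\<close>

lemma no_early_zero:
  fixes w w' V :: "real \<Rightarrow> real"
  assumes d: "\<And>z. (w has_real_derivative w' z) (at z)" "\<And>z. (w' has_real_derivative V z * w z) (at z)"
    and V: "\<And>z. - B\<^sup>2 \<le> V z" "\<And>z. \<bar>V z\<bar> \<le> M" and B: "B > 0"
    and \<zeta>: "0 < \<zeta>" "\<zeta> < pi / B" "w 0 = 0" "w \<zeta> = 0" and pos: "\<And>z. 0 < z \<Longrightarrow> z < \<zeta> \<Longrightarrow> w z > 0"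
  shows False
proof -
  let ?W = "\<lambda>z. w' z * sin (B * z) - w z * (B * cos (B * z))"
  have s: "sin (B * z) \<ge> 0" if "0 \<le> z" "z \<le> \<zeta>" for z
  proof (rule sin_ge_zero)
    have "B * z \<le> B * \<zeta>" using that B by simp
    also have "\<dots> \<le> pi" using \<zeta>(2) B by (simp add: field_simps)
    finally show "B * z \<le> pi" .
  qed (use that B in simp)
  have dB: "((\<lambda>z. B * z) has_real_derivative B) (at z)" for z
    by (rule DERIV_cong [OF DERIV_cmult [OF DERIV_ident]]) simp
  have dW: "(?W has_real_derivative (V z + B\<^sup>2) * w z * sin (B * z)) (at z)" for z
    by (rule DERIV_cong [OF DERIV_diff [OF DERIV_mult [OF d(2) DERIV_chain2 [OF DERIV_sin dB]]
          DERIV_mult [OF d(1) DERIV_cmult [OF DERIV_chain2 [OF DERIV_cos dB]]]]])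
      (simp add: algebra_simps power2_eq_square)
  have "?W 0 \<le> ?W \<zeta>"
  proof (rule DERIV_nonneg_imp_nondecreasing [where f = ?W])
    fix z assume z: "0 \<le> z" "z \<le> \<zeta>"
    have "w z \<ge> 0" using pos [of z] z \<zeta>(3,4) by (cases "z = 0 \<or> z = \<zeta>") auto
    then have "(V z + B\<^sup>2) * w z * sin (B * z) \<ge> 0"
      using V(1) [of z] s [OF z] by (intro mult_nonneg_nonneg) auto
    then show "\<exists>y. (?W has_real_derivative y) (at z) \<and> 0 \<le> y" using dW by blast
  qed (use \<zeta> in simp)
  then have "0 \<le> w' \<zeta> * sin (B * \<zeta>)" using \<zeta>(3,4) by simp
  moreover have "sin (B * \<zeta>) > 0"
    using \<zeta>(1,2) B by (intro sin_gt_zero) (auto simp: field_simps)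
  ultimately have "w' \<zeta> \<ge> 0" by (simp add: zero_le_mult_iff)
  moreover have "w' \<zeta> \<noteq> 0"
  proof
    assume "w' \<zeta> = 0"
    then have "w (\<zeta> / 2) = 0"
      by (rule solution_unique [where f = w and V = V, OF d V(2) \<zeta>(4)])
    then show False using pos [of "\<zeta> / 2"] \<zeta>(1) by simp
  qed
  ultimately have "w' \<zeta> > 0" by simp
  from DERIV_pos_inc_left [OF d(1) this] obtain r where r: "r > 0" "\<And>x. 0 < x \<Longrightarrow> x < r \<Longrightarrow> w (\<zeta> - x) < w \<zeta>"
    by blast
  have "0 < min r \<zeta> / 2" "min r \<zeta> / 2 < r" "min r \<zeta> / 2 < \<zeta>" using r(1) \<zeta>(1) by auto
  then show False using r(2) [of "min r \<zeta> / 2"] pos [of "\<zeta> - min r \<zeta> / 2"] \<zeta>(4) by auto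
qed

text \<open>Otherwise Sturm comparison with N = 2m + 3 gives a zero in each interval
  [(2i+1) pi/N, (2i+2) pi/N] with i \<le> m. These are disjoint and inside (0, pi), one zero too
  many.\<close>

lemma se_eigenvalue_less:
  assumes se: "se_eigenfunction (m + 1) h lam w" and h: "h\<^sup>2 \<le> H\<^sup>2"
  shows "lam < (2 * real m + 3)\<^sup>2 + 2 * H\<^sup>2"
proof (rule ccontr)
  assume "\<not> lam < (2 * real m + 3)\<^sup>2 + 2 * H\<^sup>2"
  then have lam: "(2 * real m + 3)\<^sup>2 + 2 * H\<^sup>2 \<le> lam" by simp
  define N where "N = 2 * real m + 3"
  have N: "N > 0" by (simp add: N_def)
  have sol: "mathieu_solution h lam w" and zeros: "exactly_zeros m w"
    using se by (simp_all add: se_eigenfunction_def)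
  define a where "a i = (2 * real i + 1) * pi / N" for i
  have V: "2 * h\<^sup>2 * cos (2 * z) - lam \<le> - N\<^sup>2" for z
  proof -
    have "2 * h\<^sup>2 * cos (2 * z) \<le> 2 * h\<^sup>2 * 1" by (intro mult_left_mono) auto
    then show ?thesis using lam h unfolding N_def by linarith
  qed
  have "\<exists>z\<in>{a i..a i + pi / N}. w z = 0" for i
    by (rule sturm_zero [where f = w and f' = "deriv w" and V = "\<lambda>z. 2 * h\<^sup>2 * cos (2 * z) - lam"])
      (rule mathieu_solution_DERIV(1) [OF sol] mathieu_solution_DERIV(2) [OF sol] V N)+
  then have "\<forall>i. \<exists>z. z \<in> {a i..a i + pi / N} \<and> w z = 0" by blast
  from choice [OF this] obtain \<zeta> where \<zeta>: "\<And>i. \<zeta> i \<in> {a i..a i + pi / N}" "\<And>i. w (\<zeta> i) = 0" by blast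
  have step: "\<zeta> i < \<zeta> j" if "i < j" for i j
  proof -
    have "\<zeta> i \<le> a i + pi / N" using \<zeta>(1) [of i] by simp
    also have "\<dots> = (2 * real i + 2) * pi / N" by (simp add: a_def add_divide_distrib distrib_right)
    also have "\<dots> < (2 * real j + 1) * pi / N"
      using that N by (intro divide_strict_right_mono mult_strict_right_mono) auto
    also have "\<dots> \<le> \<zeta> j" using \<zeta>(1) [of j] by (simp add: a_def)
    finally show ?thesis .
  qed
  have inj: "inj_on \<zeta> {..m}"
    by (rule inj_onI) (metis step less_irrefl linorder_neqE_nat)
  have sub: "\<zeta> ` {..m} \<subseteq> {z \<in> {0<..<pi}. w z = 0}"
  proof (rule image_subsetI)
    fix i assume i: "i \<in> {..m}"
    have "0 < a i" using N by (simp add: a_def add_nonneg_pos)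
    then have "0 < \<zeta> i" using \<zeta>(1) [of i] by simp
    moreover have "\<zeta> i < pi"
    proof -
      have "\<zeta> i \<le> a i + pi / N" using \<zeta>(1) [of i] by simp
      also have "\<dots> = (2 * real i + 2) * pi / N" by (simp add: a_def add_divide_distrib distrib_right)
      also have "\<dots> < N * pi / N"
        using i N by (intro divide_strict_right_mono mult_strict_right_mono) (auto simp: N_def)
      finally show ?thesis using N by simp
    qed
    ultimately show "\<zeta> i \<in> {z \<in> {0<..<pi}. w z = 0}" using \<zeta>(2) by simp
  qed
  have "card (\<zeta> ` {..m}) \<le> m"
    using zeros card_mono [OF _ sub] by (simp add: exactly_zeros_def)
  then show False by (simp add: card_image [OF inj])
qed

text \<open>The bound on lam gives 2 h^2 cos 2z - lam > -2 H^2 - (2m+3)^2 - 2 H^2 = -B^2, so a zero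
  before pi/B is impossible. B depends on H only, not on the individual h.\<close>

lemma se_nonzero_near_0:
  assumes se: "se_eigenfunction (m + 1) h lam w" and h: "h\<^sup>2 \<le> H\<^sup>2"
    and B: "B\<^sup>2 = (2 * real m + 3)\<^sup>2 + 4 * H\<^sup>2" "B \<ge> 1" and z: "0 < z" "z < pi / B"
  shows "w z \<noteq> 0"
proof
  assume wz: "w z = 0"
  have sol: "mathieu_solution h lam w" and zeros: "exactly_zeros m w" and w0: "w 0 = 0"
    using se by (simp_all add: se_eigenfunction_def)
  let ?Z = "{z \<in> {0<..<pi}. w z = 0}"
  let ?V = "\<lambda>z. 2 * h\<^sup>2 * cos (2 * z) - lam"
  have "pi / B \<le> pi / 1" using B(2) by (intro divide_left_mono) auto
  then have zZ: "z \<in> ?Z" using z wz by simp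
  have fin: "finite ?Z" using zeros by (simp add: exactly_zeros_def)
  define \<zeta> where "\<zeta> = Min ?Z"
  have \<zeta>Z: "\<zeta> \<in> ?Z" unfolding \<zeta>_def using fin zZ by (intro Min_in) auto
  have "\<zeta> \<le> z" unfolding \<zeta>_def using fin zZ by (intro Min_le) auto
  then have \<zeta>: "0 < \<zeta>" "\<zeta> < pi / B" "w \<zeta> = 0" using \<zeta>Z z by auto
  have nz: "w x \<noteq> 0" if "0 < x" "x < \<zeta>" for x
  proof
    assume "w x = 0"
    then have "x \<in> ?Z" using that \<zeta>Z by simp
    then have "\<zeta> \<le> x" unfolding \<zeta>_def using fin by (intro Min_le) auto
    with that show False by simp
  qed
  let ?c = "w (\<zeta> / 2)"
  have pos: "?c * w x > 0" if "0 < x" "x < \<zeta>" for x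
  proof (rule nonzero_imp_same_sign [where a = "min (\<zeta> / 2) x" and b = "max (\<zeta> / 2) x" and f = w])
    show "continuous_on {min (\<zeta> / 2) x..max (\<zeta> / 2) x} w"
      by (rule continuous_on_DERIV [OF mathieu_solution_DERIV(1) [OF sol]])
    show "w y \<noteq> 0" if y: "y \<in> {min (\<zeta> / 2) x..max (\<zeta> / 2) x}" for y
      by (rule nz) (use y \<open>0 < x\<close> \<open>x < \<zeta>\<close> \<zeta>(1) in \<open>auto simp: min_def max_def split: if_splits\<close>)
  qed auto
  have V: "- B\<^sup>2 \<le> ?V x" for x
  proof -
    have "2 * h\<^sup>2 * - 1 \<le> 2 * h\<^sup>2 * cos (2 * x)" by (intro mult_left_mono) auto
    then show ?thesis using se_eigenvalue_less [OF se h] h unfolding B(1) by linarith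
  qed
  show False
  proof (rule no_early_zero [where w = "\<lambda>x. ?c * w x" and w' = "\<lambda>x. ?c * deriv w x" and V = ?V,
        OF _ _ V mathieu_potential_bound _ \<zeta>(1,2) _ _ pos])
    show "((\<lambda>x. ?c * w x) has_real_derivative ?c * deriv w x) (at x)" for x
      by (rule DERIV_cmult [OF mathieu_solution_DERIV(1) [OF sol]])
    show "((\<lambda>x. ?c * deriv w x) has_real_derivative ?V x * (?c * w x)) (at x)" for x
      by (rule DERIV_cong [OF DERIV_cmult [OF mathieu_solution_DERIV(2) [OF sol]]]) simp
  qed (use B w0 \<zeta> in auto)
qed

text \<open>At z = 0 the function vanishes, and continuity in h is given for values at fixed z, not
  for slopes. The sign is therefore followed at the fixed point pi/(2B), which is not a zero for any
  h between 0 and H.\<close>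

lemma se_pos_near_0:
  assumes se: "is_se (m + 1) se" and H: "H \<ge> 0"
  shows "\<exists>\<delta>>0. \<forall>z. 0 < z \<longrightarrow> z < \<delta> \<longrightarrow> se H z > 0"
proof -
  note se' = conjunct2 [OF se [unfolded is_se_def]]
  note ef = spec [OF conjunct1 [OF se']]
  define B where "B = sqrt ((2 * real m + 3)\<^sup>2 + 4 * H\<^sup>2)"
  have B2: "B\<^sup>2 = (2 * real m + 3)\<^sup>2 + 4 * H\<^sup>2" by (simp add: B_def)
  have Bm: "2 * real m + 3 \<le> B" unfolding B_def by (rule real_le_rsqrt) simp
  then have B1: "B \<ge> 1" by simp
  have nz: "se h z \<noteq> 0" if "0 \<le> h" "h \<le> H" "0 < z" "z < pi / B" for h z
  proof -
    obtain lam where "se_eigenfunction (m + 1) h lam (se h)" using ef [of h] by (rule exE)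
    moreover have "h\<^sup>2 \<le> H\<^sup>2" using that by (intro power_mono)
    ultimately show ?thesis by (rule se_nonzero_near_0 [OF _ _ B2 B1 that(3,4)])
  qed
  let ?z = "pi / B / 2"
  have z: "0 < ?z" "?z < pi / B" using B1 by (auto simp: field_simps)
  have "continuous_on {0..H} (\<lambda>h. se h ?z)"
    by (rule continuous_on_subset [OF spec [OF conjunct1 [OF conjunct2 [OF conjunct2 [OF se']]]] subset_UNIV])
  then have "se 0 ?z * se H ?z > 0"
    by (rule nonzero_imp_same_sign [where f = "\<lambda>h. se h ?z" and a = 0 and b = H]) (use nz [OF _ _ z] H in auto)
  moreover have "se 0 ?z > 0"
  proof -
    have "real (m + 1) * ?z > 0" using z(1) by (intro mult_pos_pos) auto
    moreover have "real (m + 1) * ?z < pi"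
    proof -
      have "real (m + 1) < B" using Bm by simp
      then have "real (m + 1) * ?z < B * ?z" using z(1) by (intro mult_strict_right_mono)
      also have "B * ?z = pi / 2" using B1 by simp
      finally show ?thesis using pi_gt_zero by linarith
    qed
    ultimately have "sin (real (m + 1) * ?z) > 0" by (rule sin_gt_zero)
    then show ?thesis by (subst spec [OF conjunct2 [OF conjunct2 [OF conjunct2 [OF se']]]])
  qed
  ultimately have p: "se H ?z > 0" by (simp add: zero_less_mult_iff)
  obtain lam where lam: "se_eigenfunction (m + 1) H lam (se H)" using ef [of H] by (rule exE)
  then have sol: "mathieu_solution H lam (se H)" by (simp only: se_eigenfunction_def)
  have "se H x > 0" if x: "0 < x" "x < pi / B" for x
  proof -
    have "se H ?z * se H x > 0"
    proof (rule nonzero_imp_same_sign [where a = "min ?z x" and b = "max ?z x" and f = "se H"])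
      show "continuous_on {min ?z x..max ?z x} (se H)"
        by (rule continuous_on_DERIV [OF mathieu_solution_DERIV(1) [OF sol]])
      show "se H y \<noteq> 0" if y: "y \<in> {min ?z x..max ?z x}" for y
      proof (rule nz)
        have "min ?z x > 0" "max ?z x < pi / B" using x z by auto
        then show "0 < y" "y < pi / B" using y by (meson atLeastAtMost_iff less_le_trans le_less_trans)+
      qed (use H in auto)
    qed auto
    then show ?thesis using p by (simp add: zero_less_mult_iff)
  qed
  moreover have "pi / B > 0" using B1 by simp
  ultimately show ?thesis by blast
qed

lemma normalized_eigenfunction_ce:
  assumes "is_ce m ce" "h \<ge> 0"
  shows "\<exists>lam. normalized_eigenfunction m h lam (ce h)"
proof -
  note ce' = assms(1) [unfolded is_ce_def]
  obtain lam where lam: "ce_eigenfunction m h lam (ce h)" using spec [OF conjunct1 [OF ce'], of h] by (rule exE)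
  note I = spec [OF conjunct1 [OF conjunct2 [OF ce']], of h]
  note ef = lam [unfolded ce_eigenfunction_def]
  show ?thesis
    unfolding normalized_eigenfunction_def boundary_condition_def
    by (rule exI [of _ lam]) (simp only: ef I ce_pos_near_0 [OF assms] simp_thms)
qed

lemma normalized_eigenfunction_se:
  assumes "is_se (m + 1) se" "h \<ge> 0"
  shows "\<exists>lam. normalized_eigenfunction m h lam (se h)"
proof -
  note se' = conjunct2 [OF assms(1) [unfolded is_se_def]]
  obtain lam where lam: "se_eigenfunction (m + 1) h lam (se h)" using spec [OF conjunct1 [OF se'], of h] by (rule exE)
  note I = spec [OF conjunct1 [OF conjunct2 [OF se']], of h]
  \<comment> \<open>For index m + 1 the number of interior zeros is (m + 1) - 1 = m, the same as for
    \<open>ce\<close>.\<close>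
  note ef = lam [unfolded se_eigenfunction_def add_diff_cancel_right']
  show ?thesis
    unfolding normalized_eigenfunction_def boundary_condition_def
    by (rule exI [of _ lam]) (simp only: ef I se_pos_near_0 [OF assms] simp_thms)
qed

section \<open>The expansions\<close>

lemma sum_inverse_powers: "(\<Sum>s=0..n. poly (U s) t / h ^ s) = truncation n U (1 / h) t"
  by (simp add: truncation_def atLeast0AtMost power_divide)

lemma tvar_of_angle: "h > 0 \<Longrightarrow> tvar h (2 * sqrt h * (pi / 2 - z)) = 2 * sqrt h * cos z"
  by (simp add: tvar_def sin_diff)

text \<open>The expression 2 sqrt h (pi/2 - z) is s. By \<open>abs_tvar_ge\<close> a bound T on |t|
  becomes 2T on |s|, which is why the expansions are invoked with 2T.\<close>

lemma angle_bounds: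
  assumes h: "h > 0" and z: "z \<in> {0<..<pi}" and t: "\<bar>2 * sqrt h * cos z\<bar> \<le> T"
  shows "\<bar>2 * sqrt h * (pi / 2 - z)\<bar> \<le> pi * sqrt h" "\<bar>2 * sqrt h * (pi / 2 - z)\<bar> \<le> 2 * T"
    "pi / 2 - (2 * sqrt h * (pi / 2 - z)) / (2 * sqrt h) = z"
proof -
  have "0 < z" "z < pi" using z by auto
  then have "\<bar>pi / 2 - z\<bar> \<le> pi / 2" unfolding abs_le_iff by linarith
  then have "2 * sqrt h * \<bar>pi / 2 - z\<bar> \<le> 2 * sqrt h * (pi / 2)" using h by (intro mult_left_mono) auto
  then show b: "\<bar>2 * sqrt h * (pi / 2 - z)\<bar> \<le> pi * sqrt h" using h by (simp add: abs_mult mult.commute)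
  show "\<bar>2 * sqrt h * (pi / 2 - z)\<bar> \<le> 2 * T"
    using abs_tvar_ge [OF h b] t unfolding tvar_of_angle [OF h] by linarith
  show "pi / 2 - (2 * sqrt h * (pi / 2 - z)) / (2 * sqrt h) = z" using h by simp
qed

lemma amode_truncation:
  "amode m n h s = parabolic_D m (tvar h s) * truncation n (coeff_A m) (1 / h) (tvar h s)
     + deriv (parabolic_D m) (tvar h s) * truncation n (coeff_B m) (1 / h) (tvar h s)"
  by (simp add: amode_def approx_parabolic truncation_def)

lemma uniform_expansion_AB:
  assumes w: "\<And>h. h \<ge> 0 \<Longrightarrow> \<exists>lam. normalized_eigenfunction m h lam (w h)"
  shows "uniform_expansion m w (norm_const m) (coeff_A m) (coeff_B m) n"
  unfolding uniform_expansion_def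
proof (intro allI impI)
  fix T :: real
  assume T: "T > 0"
  then have "2 * T \<ge> 0" by simp
  from eigenfunction_expansion [OF this, of m n] obtain K h0 where K: "K \<ge> 0 \<and> (\<forall>h lam w s. h \<ge> h0 \<longrightarrow>
    normalized_eigenfunction m h lam w \<longrightarrow> \<bar>s\<bar> \<le> 2 * T \<longrightarrow> norm_const m h > 0 \<and>
    \<bar>w (pi / 2 - s / (2 * sqrt h)) - norm_const m h * amode m n h s\<bar> \<le> norm_const m h * (K / h ^ (n + 1)))"
    by (elim exE)
  note exp = K [THEN conjunct2, rule_format]
  show "\<exists>K. \<forall>\<^sub>F h in at_top. \<forall>z\<in>{0<..<pi}. let t = 2 * sqrt h * cos z in \<bar>t\<bar> \<le> T \<longrightarrow>
          (\<exists>R. \<bar>R\<bar> \<le> K / h ^ (n + 1) \<and>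
             w h z = norm_const m h * (parabolic_D m t * (\<Sum>s=0..n. poly (coeff_A m s) t / h ^ s)
                          + deriv (parabolic_D m) t * (\<Sum>s=0..n. poly (coeff_B m s) t / h ^ s) + R))"
  proof (rule exI [of _ K], rule eventually_at_top_linorderI [of "max h0 1"], intro ballI, unfold Let_def, intro impI)
    fix h z :: real
    assume hh: "max h0 1 \<le> h" and z: "z \<in> {0<..<pi}" and t: "\<bar>2 * sqrt h * cos z\<bar> \<le> T"
    let ?s = "2 * sqrt h * (pi / 2 - z)" and ?C = "norm_const m h"
    have hp: "h > 0" "h \<ge> h0" using hh by auto
    note a = angle_bounds [OF hp(1) z t]
    obtain lam where lam: "normalized_eigenfunction m h lam (w h)" using w [of h] hp by auto
    note e = exp [OF hp(2) lam a(2), unfolded a(3)]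
    have C: "?C > 0" by (rule conjunct1 [OF e])
    define R where "R = w h z / ?C - amode m n h ?s"
    have "R = (w h z - ?C * amode m n h ?s) / ?C" using C by (simp add: R_def diff_divide_distrib)
    then have "\<bar>R\<bar> = \<bar>w h z - ?C * amode m n h ?s\<bar> / ?C" using C by (simp only: abs_divide abs_of_pos)
    also have "\<dots> \<le> ?C * (K / h ^ (n + 1)) / ?C" using conjunct2 [OF e] C by (intro divide_right_mono) auto
    also have "\<dots> = K / h ^ (n + 1)" using C by simp
    finally have "\<bar>R\<bar> \<le> K / h ^ (n + 1)" .
    moreover have "w h z = ?C * (amode m n h ?s + R)" using C by (simp add: R_def)
    ultimately show "\<exists>R. \<bar>R\<bar> \<le> K / h ^ (n + 1) \<and>
             w h z = ?C * (parabolic_D m (2 * sqrt h * cos z) * (\<Sum>s=0..n. poly (coeff_A m s) (2 * sqrt h * cos z) / h ^ s)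
                + deriv (parabolic_D m) (2 * sqrt h * cos z) * (\<Sum>s=0..n. poly (coeff_B m s) (2 * sqrt h * cos z) / h ^ s) + R)"
      unfolding sum_inverse_powers amode_truncation tvar_of_angle [OF hp(1)] by (intro exI [of _ R] conjI)
  qed
qed

lemma parabolic_D_bounded: "\<exists>K\<ge>0. \<forall>t. \<bar>parabolic_D m t\<bar> \<le> K \<and> \<bar>deriv (parabolic_D m) t\<bar> \<le> K"
proof -
  obtain K1 where K1: "K1 \<ge> 0" "\<And>t. \<bar>approx m 0 (1 / 1) t\<bar> \<le> K1" "\<And>t. \<bar>dapprox m 0 (1 / 1) t\<bar> \<le> K1"
    using approx_decay [of m 0 0] by auto
  obtain K2 where K2: "K2 \<ge> 0" "\<And>t. \<bar>approx m 0 (1 / 1) t - parabolic_D m t\<bar> \<le> K2"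
      "\<And>t. \<bar>dapprox m 0 (1 / 1) t - deriv (parabolic_D m) t\<bar> \<le> K2"
    using approx_order_difference [of m 0 0] by auto
  have "\<bar>parabolic_D m t\<bar> \<le> K1 + K2 \<and> \<bar>deriv (parabolic_D m) t\<bar> \<le> K1 + K2" for t
    using K1(2,3) [of t] K2(2,3) [of t] by linarith
  then show ?thesis using K1(1) K2(1) by (intro exI [of _ "K1 + K2"]) auto
qed

lemma uniform_expansion_PQ:
  assumes w: "\<And>h. h \<ge> 0 \<Longrightarrow> \<exists>lam. normalized_eigenfunction m h lam (w h)"
  shows "uniform_expansion m (\<lambda>h z. w h z / sin z) (norm_const m) (coeff_P m) (coeff_Q m) n"
  unfolding uniform_expansion_def
proof (intro allI impI)
  fix T :: real
  assume T: "T > 0"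
  then have T0: "T \<ge> 0" and "2 * T \<ge> 0" by simp_all
  from eigenfunction_expansion [OF this(2), of m n] obtain K1 h0 where K1: "K1 \<ge> 0 \<and> (\<forall>h lam w s. h \<ge> h0 \<longrightarrow>
    normalized_eigenfunction m h lam w \<longrightarrow> \<bar>s\<bar> \<le> 2 * T \<longrightarrow> norm_const m h > 0 \<and>
    \<bar>w (pi / 2 - s / (2 * sqrt h)) - norm_const m h * amode m n h s\<bar> \<le> norm_const m h * (K1 / h ^ (n + 1)))"
    by (elim exE)
  note exp = K1 [THEN conjunct2, rule_format]
  obtain K2 where K2: "K2 \<ge> 0 \<and> (\<forall>h s. h \<ge> 1 + T\<^sup>2 \<longrightarrow> \<bar>s\<bar> \<le> pi * sqrt h \<longrightarrow> \<bar>tvar h s\<bar> \<le> T \<longrightarrow>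
    \<bar>truncation n (coeff_A m) (1 / h) (tvar h s) / cos (s / (2 * sqrt h)) - truncation n (coeff_P m) (1 / h) (tvar h s)\<bar> \<le> K2 / h ^ (n + 1))"
    using sqrt_division [OF T0, of n "coeff_A m"] unfolding coeff_P_def by (elim exE)
  obtain K3 where K3: "K3 \<ge> 0 \<and> (\<forall>h s. h \<ge> 1 + T\<^sup>2 \<longrightarrow> \<bar>s\<bar> \<le> pi * sqrt h \<longrightarrow> \<bar>tvar h s\<bar> \<le> T \<longrightarrow>
    \<bar>truncation n (coeff_B m) (1 / h) (tvar h s) / cos (s / (2 * sqrt h)) - truncation n (coeff_Q m) (1 / h) (tvar h s)\<bar> \<le> K3 / h ^ (n + 1))"
    using sqrt_division [OF T0, of n "coeff_B m"] unfolding coeff_Q_def by (elim exE)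
  note A = K2 [THEN conjunct2, rule_format] and B = K3 [THEN conjunct2, rule_format]
  obtain D where D: "D \<ge> 0" "\<And>t. \<bar>parabolic_D m t\<bar> \<le> D" "\<And>t. \<bar>deriv (parabolic_D m) t\<bar> \<le> D"
    using parabolic_D_bounded [of m] by blast
  define K where "K = 2 * K1 + D * K2 + D * K3"
  show "\<exists>K. \<forall>\<^sub>F h in at_top. \<forall>z\<in>{0<..<pi}. let t = 2 * sqrt h * cos z in \<bar>t\<bar> \<le> T \<longrightarrow>
          (\<exists>R. \<bar>R\<bar> \<le> K / h ^ (n + 1) \<and>
             w h z / sin z = norm_const m h * (parabolic_D m t * (\<Sum>s=0..n. poly (coeff_P m s) t / h ^ s)
                          + deriv (parabolic_D m) t * (\<Sum>s=0..n. poly (coeff_Q m s) t / h ^ s) + R))"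
  proof (rule exI [of _ K], rule eventually_at_top_linorderI [of "max h0 (1 + T\<^sup>2)"], intro ballI, unfold Let_def, intro impI)
    fix h z :: real
    assume hh: "max h0 (1 + T\<^sup>2) \<le> h" and z: "z \<in> {0<..<pi}" and t: "\<bar>2 * sqrt h * cos z\<bar> \<le> T"
    define s where "s = 2 * sqrt h * (pi / 2 - z)"
    define \<tau> where "\<tau> = 2 * sqrt h * cos z"
    define y where "y = 1 / h ^ (n + 1)"
    let ?C = "norm_const m h" and ?e = "1 / h"
    have hT: "h \<ge> 1 + T\<^sup>2" "h \<ge> h0" using hh by auto
    then have h1: "h \<ge> 1" using zero_le_power2 [of T] by linarith
    then have hp: "h > 0" by simp
    have y: "y \<ge> 0" using hp by (simp add: y_def)
    note a = angle_bounds [OF hp z t, folded s_def]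
    have ts: "tvar h s = \<tau>" using tvar_of_angle [OF hp, of z] by (simp only: s_def \<tau>_def)
    have cs: "cos (s / (2 * sqrt h)) = sin z" using hp by (simp add: s_def cos_diff)
    obtain lam where lam: "normalized_eigenfunction m h lam (w h)" using w [of h] hp by auto
    note e = exp [OF hT(2) lam a(2), unfolded a(3)]
    have C: "?C > 0" by (rule conjunct1 [OF e])
    \<comment> \<open>h \<ge> 1 + T^2 keeps |s|/(2 sqrt h) \<le> 1, so sin z \<ge> 1/2 and the
      division at most doubles the error of w.\<close>
    have "T \<le> sqrt h" using hT(1) by (intro real_le_rsqrt) simp
    then have "\<bar>s\<bar> \<le> 2 * sqrt h" using a(2) by linarith
    then have "\<bar>s / (2 * sqrt h)\<bar> \<le> 1" using hp by (simp add: abs_divide pos_divide_le_eq)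
    then have sin: "1/2 \<le> sin z" using cos_ge_half unfolding cs [symmetric] by blast
    have tT: "\<bar>tvar h s\<bar> \<le> T" unfolding ts \<tau>_def by (rule t)
    let ?A = "truncation n (coeff_A m) ?e \<tau>" and ?B = "truncation n (coeff_B m) ?e \<tau>"
      and ?P = "truncation n (coeff_P m) ?e \<tau>" and ?Q = "truncation n (coeff_Q m) ?e \<tau>"
      and ?D = "parabolic_D m \<tau>" and ?D' = "deriv (parabolic_D m) \<tau>"
    have rA: "\<bar>?A / sin z - ?P\<bar> \<le> K2 * y" and rB: "\<bar>?B / sin z - ?Q\<bar> \<le> K3 * y"
      using A [OF hT(1) a(1) tT] B [OF hT(1) a(1) tT] by (simp_all add: ts cs y_def)
    have am: "amode m n h s = ?D * ?A + ?D' * ?B" by (simp only: amode_truncation ts)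
    have r: "\<bar>w h z - ?C * amode m n h s\<bar> / (?C * sin z) \<le> 2 * (K1 * y)"
    proof -
      have "\<bar>w h z - ?C * amode m n h s\<bar> \<le> ?C * (K1 * y)" using conjunct2 [OF e] by (simp add: y_def)
      moreover have "?C * (1/2) \<le> ?C * sin z" using sin C by (intro mult_left_mono) auto
      moreover have "0 \<le> ?C * (K1 * y)" using C K1 y by simp
      ultimately have "\<bar>w h z - ?C * amode m n h s\<bar> / (?C * sin z) \<le> ?C * (K1 * y) / (?C * (1/2))"
        using C by (intro frac_le) auto
      also have "\<dots> = 2 * (K1 * y)" using C by simp
      finally show ?thesis .
    qed
    define R where "R = w h z / sin z / ?C - (?D * ?P + ?D' * ?Q)"
    have "R = (w h z - ?C * amode m n h s) / (?C * sin z) + ?D * (?A / sin z - ?P) + ?D' * (?B / sin z - ?Q)"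
    proof -
      have "w h z / sin z / ?C = (w h z - ?C * amode m n h s) / (?C * sin z) + amode m n h s / sin z"
        using C sin by (simp add: field_simps)
      then show ?thesis unfolding R_def am by (simp add: add_divide_distrib right_diff_distrib)
    qed
    moreover have "\<bar>(w h z - ?C * amode m n h s) / (?C * sin z)\<bar> \<le> 2 * (K1 * y)"
    proof -
      have "?C * sin z > 0" using C sin by simp
      then show ?thesis using r by (simp only: abs_divide abs_of_pos)
    qed
    moreover have "\<bar>?D * (?A / sin z - ?P)\<bar> \<le> D * (K2 * y)"
      unfolding abs_mult using D rA by (intro mult_mono) auto
    moreover have "\<bar>?D' * (?B / sin z - ?Q)\<bar> \<le> D * (K3 * y)"
      unfolding abs_mult using D rB by (intro mult_mono) auto
    ultimately have "\<bar>R\<bar> \<le> 2 * (K1 * y) + D * (K2 * y) + D * (K3 * y)" by linarith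
    also have "\<dots> = K / h ^ (n + 1)" by (simp add: K_def y_def add_divide_distrib)
    finally have "\<bar>R\<bar> \<le> K / h ^ (n + 1)" .
    moreover have "w h z / sin z = ?C * (?D * ?P + ?D' * ?Q + R)" using C by (simp add: R_def)
    ultimately show "\<exists>R. \<bar>R\<bar> \<le> K / h ^ (n + 1) \<and>
             w h z / sin z = ?C * (parabolic_D m (2 * sqrt h * cos z) * (\<Sum>s=0..n. poly (coeff_P m s) (2 * sqrt h * cos z) / h ^ s)
                + deriv (parabolic_D m) (2 * sqrt h * cos z) * (\<Sum>s=0..n. poly (coeff_Q m s) (2 * sqrt h * cos z) / h ^ s) + R)"
      unfolding sum_inverse_powers \<tau>_def by (intro exI [of _ R] conjI)
  qed
qed

theorem mainTheorem6:
  fixes m :: nat and ce se :: "real \<Rightarrow> real \<Rightarrow> real"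
  assumes "is_ce m ce" and "is_se (m + 1) se"
  shows "(\<exists>C S :: real \<Rightarrow> real.
           (\<forall>n\<ge>1. uniform_expansion m ce C (coeff_A m) (coeff_B m) n) \<and>
           (\<forall>n\<ge>1. uniform_expansion m (\<lambda>h z. se h z / sin z) S (coeff_P m) (coeff_Q m) n) \<and>
           constant_expansion m C \<and> constant_expansion m S) \<and>
         (\<forall>s. even_poly (coeff_A m s)) \<and>
         (\<forall>s. odd_poly (coeff_B m s)) \<and>
         (\<forall>s. even_poly (coeff_P m s)) \<and>
         (\<forall>s. odd_poly (coeff_Q m s)) \<and>
         coeff_A m 0 = 1 \<and>
         coeff_P m 0 = 1 \<and>
         coeff_B m 0 = 0 \<and>
         coeff_Q m 0 = 0 \<and>
         (\<forall>t. poly (coeff_A m 1) t = t^2 / 2^6) \<and>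
         (\<forall>t. poly (coeff_P m 1) t = 9 * t^2 / 2^6) \<and>
         (\<forall>t. poly (coeff_B m 1) t = t^3 / 2^5 - (1 + 2 * real m) * t / 2^5) \<and>
         (\<forall>t. poly (coeff_Q m 1) t = t^3 / 2^5 - (1 + 2 * real m) * t / 2^5) \<and>
         coeff_eta m 1 = (6 * real m + 3) / 32 \<and>
         (\<forall>t. poly (coeff_A m 2) t = t^8 / 2^13 - (1 + 2 * real m) * t^6 / 2^11
           + (9 + 10 * real m + 10 * real m ^ 2) * t^4 / 2^12
           + (5 + 6 * real m - 12 * real m ^ 2 - 8 * real m ^ 3) * t^2 / 2^12) \<and>
         (\<forall>t. poly (coeff_B m 2) t = t^5 / 2^8 - (1 + 2 * real m) * (5 * t^3) / 2^11
           - (11 + 20 * real m + 20 * real m ^ 2) * t / 2^11) \<and>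
         (\<forall>t. poly (coeff_P m 2) t = t^8 / 2^13 - (1 + 2 * real m) * t^6 / 2^11
           + (113 + 10 * real m + 10 * real m ^ 2) * t^4 / 2^12
           + (5 + 6 * real m - 12 * real m ^ 2 - 8 * real m ^ 3) * t^2 / 2^12) \<and>
         (\<forall>t. poly (coeff_Q m 2) t = t^5 / 2^7 - (1 + 2 * real m) * (13 * t^3) / 2^11
           - (11 + 20 * real m + 20 * real m ^ 2) * t / 2^11)"
proof -
  have expansions: "\<exists>C S :: real \<Rightarrow> real.
      (\<forall>n\<ge>1. uniform_expansion m ce C (coeff_A m) (coeff_B m) n) \<and>
      (\<forall>n\<ge>1. uniform_expansion m (\<lambda>h z. se h z / sin z) S (coeff_P m) (coeff_Q m) n) \<and>
      constant_expansion m C \<and> constant_expansion m S"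
  proof (rule exI [of _ "norm_const m"], rule exI [of _ "norm_const m"], intro conjI allI impI)
    fix n :: nat
    show "uniform_expansion m ce (norm_const m) (coeff_A m) (coeff_B m) n"
      by (rule uniform_expansion_AB [OF normalized_eigenfunction_ce [OF assms(1)]])
    show "uniform_expansion m (\<lambda>h z. se h z / sin z) (norm_const m) (coeff_P m) (coeff_Q m) n"
      by (rule uniform_expansion_PQ [where w = se, OF normalized_eigenfunction_se [OF assms(2)]])
  qed (rule constant_expansion_norm_const)+
  have parity: "\<forall>s. even_poly (coeff_A m s)" "\<forall>s. odd_poly (coeff_B m s)"
      "\<forall>s. even_poly (coeff_P m s)" "\<forall>s. odd_poly (coeff_Q m s)"
    unfolding coeff_P_def coeff_Q_def by (intro allI parity_sqrt_deconv even_coeff_A odd_coeff_B)+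
  have A1: "\<forall>t. poly (coeff_A m 1) t = t^2 / 2^6"
    unfolding coeff_level_1 by (simp add: power2_eq_square)
  have P1: "\<forall>t. poly (coeff_P m 1) t = 9 * t^2 / 2^6"
    by (intro allI coeff_PQ_levels)
  have B1: "\<forall>t. poly (coeff_B m 1) t = t^3 / 2^5 - (1 + 2 * real m) * t / 2^5"
    unfolding coeff_level_1 by (simp add: power3_eq_cube algebra_simps add_divide_distrib diff_divide_distrib)
  have Q1: "\<forall>t. poly (coeff_Q m 1) t = t^3 / 2^5 - (1 + 2 * real m) * t / 2^5"
    unfolding coeff_PQ_levels(4) by (rule B1)
  have A2: "\<forall>t. poly (coeff_A m 2) t = t^8 / 2^13 - (1 + 2 * real m) * t^6 / 2^11
           + (9 + 10 * real m + 10 * real m ^ 2) * t^4 / 2^12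
           + (5 + 6 * real m - 12 * real m ^ 2 - 8 * real m ^ 3) * t^2 / 2^12"
    unfolding coeff_level_2 poly_pCons poly_0
    by (simp add: power2_eq_square power3_eq_cube eval_nat_numeral algebra_simps add_divide_distrib diff_divide_distrib)
  have B2: "\<forall>t. poly (coeff_B m 2) t = t^5 / 2^8 - (1 + 2 * real m) * (5 * t^3) / 2^11
           - (11 + 20 * real m + 20 * real m ^ 2) * t / 2^11"
    unfolding coeff_level_2 poly_pCons poly_0
    by (simp add: power2_eq_square power3_eq_cube eval_nat_numeral algebra_simps add_divide_distrib diff_divide_distrib)
  have P2: "\<forall>t. poly (coeff_P m 2) t = t^8 / 2^13 - (1 + 2 * real m) * t^6 / 2^11
           + (113 + 10 * real m + 10 * real m ^ 2) * t^4 / 2^12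
           + (5 + 6 * real m - 12 * real m ^ 2 - 8 * real m ^ 3) * t^2 / 2^12"
    by (intro allI coeff_PQ_levels)
  have Q2: "\<forall>t. poly (coeff_Q m 2) t = t^5 / 2^7 - (1 + 2 * real m) * (13 * t^3) / 2^11
           - (11 + 20 * real m + 20 * real m ^ 2) * t / 2^11"
    by (intro allI coeff_PQ_levels)
  show ?thesis
    by (intro conjI) (fact expansions parity coeff_A_0 coeff_B_0 coeff_PQ_levels(1) coeff_PQ_levels(2)
      A1 P1 B1 Q1 coeff_eta_1 A2 B2 P2 Q2)+
qed

end
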